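(* Let $n\ge0$ and $d>1$ be integers. The map $\Delta_{1,n}(d)\to\Delta^{\mathrm{vir}}_{1,n}(d)$, $((\mathbf{G},\rho),\ell)\mapsto(\mathbf{G},\hat\ell)$, is a homeomorphism onto the subspace $Z\subset\Delta^{\mathrm{vir}}_{1,n}(d)$. The deformation retraction $H:\Delta^{\mathrm{vir}}_{1,n}(d)\times[0,1]\to\Delta^{\mathrm{vir}}_{1,n}(d)$ onto a point described in the context preserves $Z$, i.e. $H(Z\times[0,1])\subset Z$. In particular, $\Delta_{1,n}(d)$ is contractible.
   Context: **Graphs.** A $(1,n,d)$-graph is $\mathbf{G}=(G,w,\delta,m)$ with $G$ a connected graph, $w,\delta:V(\mathbf{G})\to\mathbb{Z}_{\ge0}$ (genus and degree), $m:\{1,\dots,n\}\to V(\mathbf{G})$ (marking), $\dim H_1(G,\mathbb{Q})+\sum_v w(v)=1$, $\sum_v\delta(v)=d$. It is stable if $2w(v)-2+\mathrm{val}(v)+|m^{-1}(v)|>0$ whenever $\delta(v)=0$. Isomorphisms respect $w,\delta,m$. Contracting a non-loop edge merges its endpoints, adding $w$ and $\delta$ and uniting markings; contracting a loop increases $w$ of its vertex by $1$. $\Gamma_{1,n}(d)$ is the category of stable $(1,n,d)$-graphs with morphisms the compositions of isomorphisms and edge contractions. **Virtual dual complex.** For stable $\mathbf{G}$ let $\kappa_{\mathbf{G}}=\{\ell:E(\mathbf{G})\to\mathbb{R}_{\ge0}\mid\sum_e\ell(e)=1\}$. A morphism $\mathbf{G}\to\mathbf{G}'$ induces an inclusion $\kappa_{\mathbf{G}'}\to\kappa_{\mathbf{G}}$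 (extension by $0$ on contracted edges). $\Delta^{\mathrm{vir}}_{1,n}(d)$ is the colimit of the resulting functor $\Gamma_{1,n}(d)^{\mathrm{op}}\to\mathsf{Spaces}$. Every point is represented by some $(\mathbf{G},\ell)$ with all edge lengths positive, unique up to isomorphism. **Deformation retraction $H$.** A $1$-end of $\mathbf{G}$ is an edge separating $\mathbf{G}$ into two components, one of which is a single vertex $v$ (a $1$-end vertex) with $w(v)=0$, no markings and $\delta(v)=1$. The sprouting $\mathbf{G}^{\mathrm{sp}}$ is obtained from $\mathbf{G}$ as follows: for every vertex $v$ that is not a $1$-end vertex, attach to $v$, by one edge each, $\delta(v)$ new genus $0$, unmarked vertices of degree $1$, and replace $\delta(v)$ by $0$. Then $H((\mathbf{G},\ell),t)=(\mathbf{G}^{\mathrm{sp}},\ell_t)$, where $\ell$ is extended by $0$ to the new edges, $\ell_t(e)=(1-t)\ell(e)+t/d$ if $e$ is a $1$-end of $\mathbf{G}^{\mathrm{sp}}$, and $\ell_t(e)=(1-t)\ell(e)$ otherwise. At $t=1$ it is constant with value the sprouting of the one-vertex graph with all $d$ edges of length $1/d$. **Radial alignments.** The core of $\mathbf{G}$ is its minimal subgraph of genus $1$; $C(\mathbf{G})$ is the set of its edges, $V^{\mathrm{core}}(\mathbf{G})$ the set of its vertices. Contracting the core gives a rooted tree, directed away from the root, so non-core edges are directed; write $v<w$ if $v,w$ are non-core and there is a directed path from $v$ to $w$, or if $v$ is core and $w$ is not. A radial alignment of length $k\ge0$ is a surjection $\rho:V(\mathbf{G})\to\{0,\dots,k\}$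 with $\rho^{-1}(0)=V^{\mathrm{core}}(\mathbf{G})$ and $v<w\Rightarrow\rho(v)<\rho(w)$. The radial merge along $i\in\{1,\dots,k\}$ post-composes $\rho$ with the surjection $\{0,\dots,k\}\to\{0,\dots,k-1\}$ fixing $j<i$ and decreasing $j\ge i$ by $1$, and contracts every edge between $\rho^{-1}(i-1)$ and $\rho^{-1}(i)$. Put $\mathrm{rad}(\mathbf{G},\rho)=\min\{j:\sum_{v\in\rho^{-1}(j)}\delta(v)\neq0\}$ and $d_{\min}(\mathbf{G},\rho)=\sum_{v\in\rho^{-1}(\mathrm{rad}(\mathbf{G},\rho))}\delta(v)$. $\tilde\Gamma^{\mathrm{rad}}_{1,n}(d)$ is the category of stable radially-aligned $(1,n,d)$-graphs $(\mathbf{G},\rho)$ with $d_{\min}>1$, with morphisms compositions of isomorphisms (compatible with $\rho$), core edge contractions and radial merges. **$\Delta_{1,n}(d)$** (as a topological space) is the colimit over $\tilde\Gamma^{\mathrm{rad}}_{1,n}(d)^{\mathrm{op}}$ of the cells $\sigma_{(\mathbf{G},\rho)}=\{\ell:C(\mathbf{G})\sqcup\{1,\dots,k\}\to\mathbb{R}_{\ge0}\mid\sum\ell=1\}$ ($k$ the length of $\rho$), with inclusions $\sigma_{(\mathbf{G}',\rho')}\to\sigma_{(\mathbf{G},\rho)}$ extending by $0$ on contracted core edges and merged levels. It is the dual complex of the normal crossings compactification $\mathcal{M}_{1,n}(\mathbb{P}^r,d)\subset\widetilde{\mathcal{M}}_{1,n}(\mathbb{P}^r,d)$ of Ranganathan–Santos-Parker–Wise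 ($r\ge1$). **The map and $Z$.** For $((\mathbf{G},\rho),\ell)$, let $m_i$ be the number of non-core edges directed from $v$ to $w$ with $\rho(v)<i\le\rho(w)$. Then $\hat\ell(e)=\ell(e)$ for core edges, and $\hat\ell(e)=\sum_{i=\rho(v)+1}^{\rho(w)}\ell(i)/m_i$ for a non-core edge $e$ directed from $v$ to $w$. For a point $(\mathbf{G},\ell)\in\Delta^{\mathrm{vir}}_{1,n}(d)$ with all lengths positive, the canonical radial alignment $\rho_\ell$ orders the non-core vertices by their distance to the core (equal distances giving equal values, core vertices having value $0$). Set $Z=\{(\mathbf{G},\ell)\mid d_{\min}(\mathbf{G},\rho_\ell)>1\}$. *)

theory Defs
  imports
    "HOL-Analysis.Analysis"
    "HOL-Library.Function_Algebras"
    "HOL-Library.Nat_Bijection"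
begin

section \<open>Colimits of topological spaces\<close>

definition quotient_topology :: "'a topology \<Rightarrow> ('a \<Rightarrow> 'b) \<Rightarrow> 'b topology" where
  "quotient_topology T f =
     topology (\<lambda>U. U \<subseteq> f ` topspace T \<and> openin T {x \<in> topspace T. f x \<in> U})"

lemma openin_quotient_topology:
  "openin (quotient_topology T f) U \<longleftrightarrow>
     U \<subseteq> f ` topspace T \<and> openin T {x \<in> topspace T. f x \<in> U}"
proof -
  have "istopology (\<lambda>U. U \<subseteq> f ` topspace T \<and> openin T {x \<in> topspace T. f x \<in> U})"
    unfolding istopology_def
  proof (intro conjI allI impI)
    fix A B
    assume "A \<subseteq> f ` topspace T \<and> openin T {x \<in> topspace T. f x \<in> A}"
      and "B \<subseteq> f ` topspace T \<and> openin T {x \<in> topspace T. f x \<in> B}"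
    moreover have "{x \<in> topspace T. f x \<in> A \<inter> B} =
        {x \<in> topspace T. f x \<in> A} \<inter> {x \<in> topspace T. f x \<in> B}"
      by auto
    ultimately show "A \<inter> B \<subseteq> f ` topspace T" "openin T {x \<in> topspace T. f x \<in> A \<inter> B}"
      by auto
  next
    fix K
    assume K: "\<forall>A\<in>K. A \<subseteq> f ` topspace T \<and> openin T {x \<in> topspace T. f x \<in> A}"
    then show "\<Union>K \<subseteq> f ` topspace T" by blast
    have "{x \<in> topspace T. f x \<in> \<Union>K} = (\<Union>A\<in>K. {x \<in> topspace T. f x \<in> A})"
      by auto
    with K show "openin T {x \<in> topspace T. f x \<in> \<Union>K}" by auto
  qed
  then show ?thesis
    by (simp add: quotient_topology_def topology_inverse')
qed

lemma topspace_quotient_topology: "topspace (quotient_topology T f) = f ` topspace T"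
proof
  show "topspace (quotient_topology T f) \<subseteq> f ` topspace T"
    using openin_quotient_topology[of T f "topspace (quotient_topology T f)"] by simp
  have "{x \<in> topspace T. f x \<in> f ` topspace T} = topspace T" by auto
  then have "openin (quotient_topology T f) (f ` topspace T)"
    by (simp add: openin_quotient_topology)
  then show "f ` topspace T \<subseteq> topspace (quotient_topology T f)"
    by (rule openin_subset)
qed

lemma quotient_map_quotient_topology: "quotient_map T (quotient_topology T f) f"
  by (auto simp: quotient_map_def topspace_quotient_topology openin_quotient_topology)

text \<open>
  The colimit of a contravariant functor from a category to topological spaces: an object
  \<open>G \<in> Ob\<close> is sent to the space \<open>X G\<close>, and a morphism \<open>mor G f G'\<close> to the map
  \<open>act G f G'\<close> from \<open>X G'\<close> to \<open>X G\<close>. Its points are the classes of the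
  equivalence relation on the disjoint union generated by identifying \<open>x\<close> with
  \<open>act G f G' x\<close>.
\<close>

definition colim_equiv ::
  "'o set \<Rightarrow> ('o \<Rightarrow> 'x topology) \<Rightarrow> ('o \<Rightarrow> 'm \<Rightarrow> 'o \<Rightarrow> bool) \<Rightarrow> ('o \<Rightarrow> 'm \<Rightarrow> 'o \<Rightarrow> 'x \<Rightarrow> 'x)
     \<Rightarrow> ('o \<times> 'x) rel" where
  "colim_equiv Ob X mor act =
     (let S = topspace (sum_topology X Ob);
          R = {((G', x), (G, act G f G' x)) | G f G' x. mor G f G' \<and> x \<in> topspace (X G')}
      in (R \<union> R\<inverse>)\<^sup>* \<inter> S \<times> S)"

definition colim_class ::
  "'o set \<Rightarrow> ('o \<Rightarrow> 'x topology) \<Rightarrow> ('o \<Rightarrow> 'm \<Rightarrow> 'o \<Rightarrow> bool) \<Rightarrow> ('o \<Rightarrow> 'm \<Rightarrow> 'o \<Rightarrow> 'x \<Rightarrow> 'x)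
     \<Rightarrow> 'o \<times> 'x \<Rightarrow> ('o \<times> 'x) set" where
  "colim_class Ob X mor act p = colim_equiv Ob X mor act `` {p}"

definition colimit ::
  "'o set \<Rightarrow> ('o \<Rightarrow> 'x topology) \<Rightarrow> ('o \<Rightarrow> 'm \<Rightarrow> 'o \<Rightarrow> bool) \<Rightarrow> ('o \<Rightarrow> 'm \<Rightarrow> 'o \<Rightarrow> 'x \<Rightarrow> 'x)
     \<Rightarrow> ('o \<times> 'x) set topology" where
  "colimit Ob X mor act =
     quotient_topology (sum_topology X Ob) (colim_class Ob X mor act)"

text \<open>
  The function on equivalence classes induced by a function on representatives. Its value
  at \<open>p\<close> is meaningful only if \<open>f\<close> is constant on \<open>p\<close>.
\<close>

definition descend :: "('a \<Rightarrow> 'b) \<Rightarrow> 'a set \<Rightarrow> 'b" where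
  "descend f p = the_elem (f ` p)"

definition length_simplex :: "'s set \<Rightarrow> ('s \<Rightarrow> real) topology" where
  "length_simplex S = subtopology (powertop_real S) {l. (\<forall>s\<in>S. 0 \<le> l s) \<and> (\<Sum>s\<in>S. l s) = 1}"

text \<open>Transport along an injection \<open>j\<close> from \<open>S'\<close> to \<open>S\<close>, extending by zero.\<close>

definition extend_zero :: "('s \<Rightarrow> 's) \<Rightarrow> 's set \<Rightarrow> 's set \<Rightarrow> ('s \<Rightarrow> real) \<Rightarrow> 's \<Rightarrow> real" where
  "extend_zero j S' S l =
     (\<lambda>s\<in>S. if s \<in> j ` S' then l (the_inv_into S' j s) else 0)"

definition deformation_retraction_to_point ::
  "'a topology \<Rightarrow> ('a \<Rightarrow> real \<Rightarrow> 'a) \<Rightarrow> 'a \<Rightarrow> bool" where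
  "deformation_retraction_to_point X h p \<longleftrightarrow>
     p \<in> topspace X \<and>
     continuous_map (prod_topology X (top_of_set {0..1})) X (\<lambda>(x, t). h x t) \<and>
     (\<forall>x\<in>topspace X. h x 0 = x \<and> h x 1 = p) \<and>
     (\<forall>t\<in>{0..1}. h p t = p)"


section \<open>Graphs\<close>

text \<open>
  Graphs may have loops and parallel edges. An edge has one end if it is a loop and two
  otherwise. Vertices and edges are labelled by natural numbers; every finite graph is
  isomorphic to such a graph, so restricting to these does not change the colimits below.
  The values of the fields outside \<open>verts\<close>, \<open>edges\<close> and \<open>{1..n}\<close>
  are irrelevant.
\<close>

record wgraph =
  verts :: "nat set"
  edges :: "nat set"
  ends :: "nat \<Rightarrow> nat set"
  weight :: "nat \<Rightarrow> nat"
  deg :: "nat \<Rightarrow> nat"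
  mark :: "nat \<Rightarrow> nat"

definition wf_wgraph :: "nat \<Rightarrow> wgraph \<Rightarrow> bool" where
  "wf_wgraph n G \<longleftrightarrow>
     finite (verts G) \<and> finite (edges G) \<and>
     (\<forall>e\<in>edges G. ends G e \<subseteq> verts G \<and> card (ends G e) \<in> {1, 2}) \<and>
     mark G ` {1..n} \<subseteq> verts G"

definition adj :: "wgraph \<Rightarrow> nat set \<Rightarrow> nat rel" where
  "adj G F = {(u, v). \<exists>e\<in>F. ends G e = {u, v}}"

definition connected_wgraph :: "wgraph \<Rightarrow> bool" where
  "connected_wgraph G \<longleftrightarrow>
     verts G \<noteq> {} \<and> (\<forall>u\<in>verts G. \<forall>v\<in>verts G. (u, v) \<in> (adj G (edges G))\<^sup>*)"

text \<open>
  Rational cellular chains, each edge being oriented from its smaller to its larger end.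
  The first homology of a graph is the kernel of the boundary map.
\<close>

interpretation rat_chains: vector_space "\<lambda>(q::rat) (c::nat \<Rightarrow> rat) e. q * c e"
  by unfold_locales (auto simp: fun_eq_iff algebra_simps)

definition boundary :: "wgraph \<Rightarrow> nat set \<Rightarrow> (nat \<Rightarrow> rat) \<Rightarrow> nat \<Rightarrow> rat" where
  "boundary G F c v =
     (\<Sum>e\<in>F. c e * (of_bool (v = Max (ends G e)) - of_bool (v = Min (ends G e))))"

definition H1 :: "wgraph \<Rightarrow> nat set \<Rightarrow> (nat \<Rightarrow> rat) set" where
  "H1 G F = {c. (\<forall>e. e \<notin> F \<longrightarrow> c e = 0) \<and> (\<forall>v. boundary G F c v = 0)}"

definition subgraph_genus :: "wgraph \<Rightarrow> nat set \<Rightarrow> nat set \<Rightarrow> nat" where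
  "subgraph_genus G W F = rat_chains.dim (H1 G F) + (\<Sum>v\<in>W. weight G v)"

text \<open>The number of half-edges at a vertex.\<close>

definition valence :: "wgraph \<Rightarrow> nat \<Rightarrow> nat" where
  "valence G v = card {e\<in>edges G. v \<in> ends G e} + card {e\<in>edges G. ends G e = {v}}"

definition genus_one_graph :: "nat \<Rightarrow> nat \<Rightarrow> wgraph \<Rightarrow> bool" where
  "genus_one_graph n d G \<longleftrightarrow>
     wf_wgraph n G \<and> connected_wgraph G \<and>
     subgraph_genus G (verts G) (edges G) = 1 \<and> (\<Sum>v\<in>verts G. deg G v) = d"

definition stable :: "nat \<Rightarrow> wgraph \<Rightarrow> bool" where
  "stable n G \<longleftrightarrow>
     (\<forall>v\<in>verts G. deg G v = 0 \<longrightarrow>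
        2 * int (weight G v) - 2 + int (valence G v) + int (card {i\<in>{1..n}. mark G i = v}) > 0)"

definition stable_graphs :: "nat \<Rightarrow> nat \<Rightarrow> wgraph set" where
  "stable_graphs n d = {G. genus_one_graph n d G \<and> stable n G}"

text \<open>
  A morphism from \<open>G\<close> to \<open>G'\<close> is given by a map \<open>fv\<close> from the vertices
  of \<open>G\<close> to those of \<open>G'\<close> and an injection \<open>fe\<close> from the edges of
  \<open>G'\<close> to those of \<open>G\<close> whose image consists of the edges that are not contracted.
\<close>

definition graph_iso :: "nat \<Rightarrow> wgraph \<Rightarrow> (nat \<Rightarrow> nat) \<Rightarrow> (nat \<Rightarrow> nat) \<Rightarrow> wgraph \<Rightarrow> bool" where
  "graph_iso n G fv fe G' \<longleftrightarrow>
     bij_betw fv (verts G) (verts G') \<and> bij_betw fe (edges G') (edges G) \<and>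
     (\<forall>e\<in>edges G'. ends G' e = fv ` ends G (fe e)) \<and>
     (\<forall>v\<in>verts G. weight G' (fv v) = weight G v \<and> deg G' (fv v) = deg G v) \<and>
     (\<forall>i\<in>{1..n}. mark G' i = fv (mark G i))"

text \<open>
  The vertex resulting from a contraction keeps the smaller label of the two merged ones,
  and the remaining edges keep their labels.
\<close>

definition contract_vert :: "wgraph \<Rightarrow> nat \<Rightarrow> nat \<Rightarrow> nat" where
  "contract_vert G e v = (if v \<in> ends G e then Min (ends G e) else v)"

definition contract_edge :: "wgraph \<Rightarrow> nat \<Rightarrow> wgraph" where
  "contract_edge G e =
     \<lparr>verts = contract_vert G e ` verts G,
      edges = edges G - {e},
      ends = (\<lambda>f. contract_vert G e ` ends G f),
      weight = (\<lambda>v. (\<Sum>u | u \<in> verts G \<and> contract_vert G e u = v. weight G u)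
                  + (if ends G e = {v} then 1 else 0)),
      deg = (\<lambda>v. \<Sum>u | u \<in> verts G \<and> contract_vert G e u = v. deg G u),
      mark = (\<lambda>i. contract_vert G e (mark G i))\<rparr>"

primrec contract_list :: "wgraph \<Rightarrow> nat list \<Rightarrow> wgraph" where
  "contract_list G [] = G"
| "contract_list G (e # es) = contract_list (contract_edge G e) es"

primrec contract_list_vert :: "wgraph \<Rightarrow> nat list \<Rightarrow> nat \<Rightarrow> nat" where
  "contract_list_vert G [] = id"
| "contract_list_vert G (e # es) = contract_list_vert (contract_edge G e) es \<circ> contract_vert G e"

inductive graph_mor ::
  "nat \<Rightarrow> nat \<Rightarrow> wgraph \<Rightarrow> (nat \<Rightarrow> nat) \<times> (nat \<Rightarrow> nat) \<Rightarrow> wgraph \<Rightarrow> bool"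
  for n d where
  iso: "\<lbrakk>G \<in> stable_graphs n d; G' \<in> stable_graphs n d; graph_iso n G fv fe G'\<rbrakk>
    \<Longrightarrow> graph_mor n d G (fv, fe) G'"
| contract: "\<lbrakk>G \<in> stable_graphs n d; contract_edge G e \<in> stable_graphs n d; e \<in> edges G\<rbrakk>
    \<Longrightarrow> graph_mor n d G (contract_vert G e, id) (contract_edge G e)"
| comp: "\<lbrakk>graph_mor n d G (fv, fe) G'; graph_mor n d G' (gv, ge) G''\<rbrakk>
    \<Longrightarrow> graph_mor n d G (gv \<circ> fv, fe \<circ> ge) G''"


section \<open>The virtual dual complex\<close>

definition kappa :: "wgraph \<Rightarrow> (nat \<Rightarrow> real) topology" where
  "kappa G = length_simplex (edges G)"

definition kappa_incl ::
  "wgraph \<Rightarrow> (nat \<Rightarrow> nat) \<times> (nat \<Rightarrow> nat) \<Rightarrow> wgraph \<Rightarrow> (nat \<Rightarrow> real) \<Rightarrow> nat \<Rightarrow> real" where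
  "kappa_incl G f G' = extend_zero (snd f) (edges G') (edges G)"

definition vir_class ::
  "nat \<Rightarrow> nat \<Rightarrow> wgraph \<times> (nat \<Rightarrow> real) \<Rightarrow> (wgraph \<times> (nat \<Rightarrow> real)) set" where
  "vir_class n d = colim_class (stable_graphs n d) kappa (graph_mor n d) kappa_incl"

definition Delta_vir :: "nat \<Rightarrow> nat \<Rightarrow> (wgraph \<times> (nat \<Rightarrow> real)) set topology" where
  "Delta_vir n d = colimit (stable_graphs n d) kappa (graph_mor n d) kappa_incl"


section \<open>Sprouting and the deformation retraction\<close>

text \<open>
  As \<open>G\<close> is connected, removing \<open>e\<close> leaves the single vertex \<open>v\<close> as one of
  two components precisely if \<open>e\<close> is not a loop and is the only edge at \<open>v\<close>.
\<close>

definition one_end :: "nat \<Rightarrow> wgraph \<Rightarrow> nat \<Rightarrow> nat \<Rightarrow> bool" where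
  "one_end n G e v \<longleftrightarrow>
     e \<in> edges G \<and> card (ends G e) = 2 \<and> v \<in> ends G e \<and> (\<forall>f\<in>edges G. v \<in> ends G f \<longrightarrow> f = e) \<and>
     weight G v = 0 \<and> (\<forall>i\<in>{1..n}. mark G i \<noteq> v) \<and> deg G v = 1"

definition one_end_edge :: "nat \<Rightarrow> wgraph \<Rightarrow> nat \<Rightarrow> bool" where
  "one_end_edge n G e \<longleftrightarrow> (\<exists>v. one_end n G e v)"

definition one_end_vert :: "nat \<Rightarrow> wgraph \<Rightarrow> nat \<Rightarrow> bool" where
  "one_end_vert n G v \<longleftrightarrow> (\<exists>e. one_end n G e v)"

text \<open>
  The \<open>j\<close>-th vertex attached to \<open>v\<close> and the edge joining it to \<open>v\<close> both get
  the label \<open>sprout_base G + prod_encode (v, j)\<close>, which is not used in \<open>G\<close>.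
\<close>

definition sprout_base :: "wgraph \<Rightarrow> nat" where
  "sprout_base G = Suc (Max (verts G \<union> edges G))"

definition sprout_labels :: "nat \<Rightarrow> wgraph \<Rightarrow> nat set" where
  "sprout_labels n G =
     {sprout_base G + prod_encode (v, j) | v j.
        v \<in> verts G \<and> \<not> one_end_vert n G v \<and> j < deg G v}"

definition sprout :: "nat \<Rightarrow> wgraph \<Rightarrow> wgraph" where
  "sprout n G =
     \<lparr>verts = verts G \<union> sprout_labels n G,
      edges = edges G \<union> sprout_labels n G,
      ends = (\<lambda>e. if e \<in> sprout_labels n G then {fst (prod_decode (e - sprout_base G)), e}
                  else ends G e),
      weight = (\<lambda>v. if v \<in> sprout_labels n G then 0 else weight G v),
      deg = (\<lambda>v. if v \<in> sprout_labels n G then 1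
                 else if one_end_vert n G v then deg G v else 0),
      mark = mark G\<rparr>"

definition retract_lengths ::
  "nat \<Rightarrow> nat \<Rightarrow> wgraph \<Rightarrow> (nat \<Rightarrow> real) \<Rightarrow> real \<Rightarrow> nat \<Rightarrow> real" where
  "retract_lengths n d G l t =
     (\<lambda>e\<in>edges (sprout n G).
        (1 - t) * (if e \<in> edges G then l e else 0)
        + (if one_end_edge n (sprout n G) e then t / real d else 0))"

definition retraction_H ::
  "nat \<Rightarrow> nat \<Rightarrow> (wgraph \<times> (nat \<Rightarrow> real)) set \<Rightarrow> real \<Rightarrow> (wgraph \<times> (nat \<Rightarrow> real)) set" where
  "retraction_H n d p t = descend (\<lambda>(G, l). vir_class n d (sprout n G, retract_lengths n d G l t)) p"

definition one_vertex_graph :: "nat \<Rightarrow> wgraph" where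
  "one_vertex_graph d =
     \<lparr>verts = {0}, edges = {}, ends = (\<lambda>_. {}), weight = (\<lambda>_. 1), deg = (\<lambda>_. d),
      mark = (\<lambda>_. 0)\<rparr>"

definition H_end :: "nat \<Rightarrow> nat \<Rightarrow> (wgraph \<times> (nat \<Rightarrow> real)) set" where
  "H_end n d =
     (let S = sprout n (one_vertex_graph d) in vir_class n d (S, \<lambda>e\<in>edges S. 1 / real d))"


section \<open>Radial alignments\<close>

definition subgraph :: "wgraph \<Rightarrow> nat set \<Rightarrow> nat set \<Rightarrow> bool" where
  "subgraph G W F \<longleftrightarrow> W \<subseteq> verts G \<and> F \<subseteq> edges G \<and> (\<forall>e\<in>F. ends G e \<subseteq> W)"

definition is_core :: "wgraph \<Rightarrow> nat set \<Rightarrow> nat set \<Rightarrow> bool" where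
  "is_core G W F \<longleftrightarrow>
     subgraph G W F \<and> subgraph_genus G W F = 1 \<and>
     (\<forall>W' F'. subgraph G W' F' \<and> subgraph_genus G W' F' = 1 \<and> W' \<subseteq> W \<and> F' \<subseteq> F
        \<longrightarrow> W' = W \<and> F' = F)"

definition core :: "wgraph \<Rightarrow> nat set \<times> nat set" where
  "core G = (THE (W, F). is_core G W F)"

definition core_verts :: "wgraph \<Rightarrow> nat set" where
  "core_verts G = fst (core G)"

definition core_edges :: "wgraph \<Rightarrow> nat set" where
  "core_edges G = snd (core G)"

text \<open>
  The non-core edge \<open>e\<close> is directed from \<open>v\<close> to \<open>w\<close>, away from the core:
  removing \<open>e\<close> disconnects \<open>w\<close>, but not \<open>v\<close>, from the core.
\<close>

definition directed :: "wgraph \<Rightarrow> nat \<Rightarrow> nat \<Rightarrow> nat \<Rightarrow> bool" where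
  "directed G e v w \<longleftrightarrow>
     e \<in> edges G - core_edges G \<and> ends G e = {v, w} \<and>
     v \<in> (adj G (edges G - {e}))\<^sup>* `` core_verts G \<and>
     w \<notin> (adj G (edges G - {e}))\<^sup>* `` core_verts G"

definition tree_less :: "wgraph \<Rightarrow> nat \<Rightarrow> nat \<Rightarrow> bool" where
  "tree_less G v w \<longleftrightarrow>
     v \<in> verts G \<and> w \<in> verts G - core_verts G \<and>
     (v \<in> core_verts G \<or> (v, w) \<in> {(a, b). \<exists>e. directed G e a b}\<^sup>+)"

definition radial_alignment :: "wgraph \<Rightarrow> nat \<Rightarrow> (nat \<Rightarrow> nat) \<Rightarrow> bool" where
  "radial_alignment G k \<rho> \<longleftrightarrow>
     \<rho> ` verts G = {0..k} \<and> {v\<in>verts G. \<rho> v = 0} = core_verts G \<and>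
     (\<forall>v w. tree_less G v w \<longrightarrow> \<rho> v < \<rho> w)"

definition level_deg :: "wgraph \<Rightarrow> (nat \<Rightarrow> nat) \<Rightarrow> nat \<Rightarrow> nat" where
  "level_deg G \<rho> j = (\<Sum>v | v \<in> verts G \<and> \<rho> v = j. deg G v)"

definition rad :: "wgraph \<Rightarrow> (nat \<Rightarrow> nat) \<Rightarrow> nat" where
  "rad G \<rho> = (LEAST j. level_deg G \<rho> j \<noteq> 0)"

definition d_min :: "wgraph \<Rightarrow> (nat \<Rightarrow> nat) \<Rightarrow> nat" where
  "d_min G \<rho> = level_deg G \<rho> (rad G \<rho>)"

text \<open>A graph \<open>G\<close> with a radial alignment \<open>\<rho>\<close> of length \<open>k\<close>.\<close>

type_synonym aligned = "wgraph \<times> nat \<times> (nat \<Rightarrow> nat)"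

definition aligned_graphs :: "nat \<Rightarrow> nat \<Rightarrow> aligned set" where
  "aligned_graphs n d =
     {(G, k, \<rho>). G \<in> stable_graphs n d \<and> radial_alignment G k \<rho> \<and> d_min G \<rho> > 1}"

definition merge_level :: "nat \<Rightarrow> nat \<Rightarrow> nat" where
  "merge_level i j = (if j < i then j else j - 1)"

text \<open>The increasing injection whose image omits \<open>i\<close>.\<close>

definition skip_level :: "nat \<Rightarrow> nat \<Rightarrow> nat" where
  "skip_level i j = (if j < i then j else j + 1)"

definition merge_edges :: "wgraph \<Rightarrow> (nat \<Rightarrow> nat) \<Rightarrow> nat \<Rightarrow> nat list" where
  "merge_edges G \<rho> i = sorted_list_of_set {e\<in>edges G. \<rho> ` ends G e = {i - 1, i}}"

text \<open>
  Contractions retain a representative of each class of merged vertices, so that an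
  alignment that is constant on these classes descends to the contracted graph as the same
  function. The parameter \<open>l(i)\<close> of a cell is the distance between the levels
  \<open>i - 1\<close> and \<open>i\<close>, so the third component of a morphism, an injection from
  \<open>{1..k'}\<close> to \<open>{1..k}\<close>, omits \<open>i\<close> for the merge along \<open>i\<close>.
\<close>

inductive aligned_mor ::
  "nat \<Rightarrow> nat \<Rightarrow> aligned \<Rightarrow> (nat \<Rightarrow> nat) \<times> (nat \<Rightarrow> nat) \<times> (nat \<Rightarrow> nat) \<Rightarrow> aligned \<Rightarrow> bool"
  for n d where
  iso: "\<lbrakk>(G, k, \<rho>) \<in> aligned_graphs n d; (G', k, \<rho>') \<in> aligned_graphs n d;
      graph_iso n G fv fe G'; \<forall>v\<in>verts G. \<rho>' (fv v) = \<rho> v\<rbrakk>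
    \<Longrightarrow> aligned_mor n d (G, k, \<rho>) (fv, fe, id) (G', k, \<rho>')"
| core_contract: "\<lbrakk>(G, k, \<rho>) \<in> aligned_graphs n d; (contract_edge G e, k, \<rho>) \<in> aligned_graphs n d;
      e \<in> core_edges G\<rbrakk>
    \<Longrightarrow> aligned_mor n d (G, k, \<rho>) (contract_vert G e, id, id) (contract_edge G e, k, \<rho>)"
| merge: "\<lbrakk>(G, k, \<rho>) \<in> aligned_graphs n d; i \<in> {1..k}; es = merge_edges G \<rho> i;
      (contract_list G es, k - 1, merge_level i \<circ> \<rho>) \<in> aligned_graphs n d\<rbrakk>
    \<Longrightarrow> aligned_mor n d (G, k, \<rho>) (contract_list_vert G es, id, skip_level i)
          (contract_list G es, k - 1, merge_level i \<circ> \<rho>)"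
| comp: "\<lbrakk>aligned_mor n d A (fv, fe, fl) A'; aligned_mor n d A' (gv, ge, gl) A''\<rbrakk>
    \<Longrightarrow> aligned_mor n d A (gv \<circ> fv, fe \<circ> ge, fl \<circ> gl) A''"

fun sigma_index :: "aligned \<Rightarrow> (nat + nat) set" where
  "sigma_index (G, k, \<rho>) = core_edges G <+> {1..k}"

definition sigma :: "aligned \<Rightarrow> (nat + nat \<Rightarrow> real) topology" where
  "sigma A = length_simplex (sigma_index A)"

definition sigma_incl ::
  "aligned \<Rightarrow> (nat \<Rightarrow> nat) \<times> (nat \<Rightarrow> nat) \<times> (nat \<Rightarrow> nat) \<Rightarrow> aligned
     \<Rightarrow> (nat + nat \<Rightarrow> real) \<Rightarrow> nat + nat \<Rightarrow> real" where
  "sigma_incl A f A' =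
     extend_zero (map_sum (fst (snd f)) (snd (snd f))) (sigma_index A') (sigma_index A)"

definition Delta :: "nat \<Rightarrow> nat \<Rightarrow> (aligned \<times> (nat + nat \<Rightarrow> real)) set topology" where
  "Delta n d = colimit (aligned_graphs n d) sigma (aligned_mor n d) sigma_incl"


section \<open>The comparison map and its image\<close>

definition crosses :: "wgraph \<Rightarrow> (nat \<Rightarrow> nat) \<Rightarrow> nat \<Rightarrow> nat \<Rightarrow> bool" where
  "crosses G \<rho> e i \<longleftrightarrow> (\<exists>v w. directed G e v w \<and> \<rho> v < i \<and> i \<le> \<rho> w)"

definition mult :: "wgraph \<Rightarrow> (nat \<Rightarrow> nat) \<Rightarrow> nat \<Rightarrow> nat" where
  "mult G \<rho> i = card {e. crosses G \<rho> e i}"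

definition hat :: "wgraph \<Rightarrow> (nat \<Rightarrow> nat) \<Rightarrow> (nat + nat \<Rightarrow> real) \<Rightarrow> nat \<Rightarrow> real" where
  "hat G \<rho> l =
     (\<lambda>e\<in>edges G. if e \<in> core_edges G then l (Inl e)
        else (\<Sum>i | crosses G \<rho> e i. l (Inr i) / real (mult G \<rho> i)))"

definition comparison ::
  "nat \<Rightarrow> nat \<Rightarrow> (aligned \<times> (nat + nat \<Rightarrow> real)) set \<Rightarrow> (wgraph \<times> (nat \<Rightarrow> real)) set" where
  "comparison n d = descend (\<lambda>((G, k, \<rho>), l). vir_class n d (G, hat G \<rho> l))"

inductive walk :: "wgraph \<Rightarrow> nat \<Rightarrow> nat list \<Rightarrow> nat \<Rightarrow> bool" for G where
  Nil: "v \<in> verts G \<Longrightarrow> walk G v [] v"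
| Cons: "\<lbrakk>e \<in> edges G; ends G e = {u, v}; walk G v es w\<rbrakk> \<Longrightarrow> walk G u (e # es) w"

definition dist_core :: "wgraph \<Rightarrow> (nat \<Rightarrow> real) \<Rightarrow> nat \<Rightarrow> real" where
  "dist_core G l v = Inf {sum_list (map l es) | u es. u \<in> core_verts G \<and> walk G u es v}"

text \<open>The number of distinct distances to the core smaller than that of \<open>v\<close>.\<close>

definition canonical_alignment :: "wgraph \<Rightarrow> (nat \<Rightarrow> real) \<Rightarrow> nat \<Rightarrow> nat" where
  "canonical_alignment G l v = card (dist_core G l ` verts G \<inter> {..<dist_core G l v})"

definition Z_locus :: "nat \<Rightarrow> nat \<Rightarrow> (wgraph \<times> (nat \<Rightarrow> real)) set set" where
  "Z_locus n d =
     {vir_class n d (G, l) | G l.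
        G \<in> stable_graphs n d \<and> l \<in> topspace (kappa G) \<and> (\<forall>e\<in>edges G. l e > 0) \<and>
        d_min G (canonical_alignment G l) > 1}"

end

theory Submission
  imports Defs
begin

text \<open>
  A point of either complex is a metric graph in which edges of length zero may be contracted. All
  arguments use contractions of several edges at once, described by their fibres instead of an order
  of the edges. Lemma \<open>contraction_comp_iff\<close> treats composition and cancellation together, and
  it yields the positive form of a point, unique up to isomorphism (\<open>positive_unique\<close>).

  Everything about \<open>Z\<close> is a statement on distances to the core. Edges outside the core are
  bridges directed away from it, so the distance is the only function that vanishes on the core and
  increases by the length along each directed edge (\<open>dist_core_unique\<close>). Hence it is not
  affected by contracting edges of length zero, and a point lies in \<open>Z\<close> if, on any of its
  representatives, the smallest distance at which there is degree carries degree more than one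
  (\<open>vir_class_in_Z_locus\<close>).

  The comparison map is a change of coordinates: up to the factors \<open>m_i\<close>, the lengths of the
  levels are the gaps between consecutive distances to the core. If they are positive, the alignment
  can be recovered from the distances, and so can the lengths, which gives injectivity
  (\<open>comparison_injective_positive\<close>). Taking the gaps of the distances in a given graph
  as level lengths gives surjectivity onto \<open>Z\<close> (\<open>canonical_lift\<close>). The same
  construction covers the part of \<open>Z\<close> in a cell of the virtual complex by finitely many compact
  images of cells, so the map is closed (\<open>closed_comparison\<close>).

  The deformation \<open>H\<close> is compatible with contractions because sprouting is functorial: over each
  vertex there are as many leaves as its degree, and degrees add up under contraction, so the leaves
  can be matched (\<open>sprout_contraction\<close>). It is continuous since the product with the interval
  preserves quotients. It moves a leaf at distance \<open>r\<close> to distance \<open>(1 - t) * r + t / d\<close>,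
  a monotone function of \<open>r\<close>, so that degree tied for the minimal distance stays tied
  (\<open>tied_sprout\<close>). Thus \<open>H\<close> contracts \<open>Z\<close>, and with it the source of the comparison map.
\<close>

section \<open>Connectivity and the cycle rank\<close>

abbreviation reach :: "wgraph \<Rightarrow> nat set \<Rightarrow> nat \<Rightarrow> nat \<Rightarrow> bool" where
  "reach G F u v \<equiv> (u, v) \<in> (adj G F)\<^sup>*"

lemma reach_sym: "reach G F u v \<Longrightarrow> reach G F v u"
proof -
  have "sym (adj G F)" by (auto simp: sym_def adj_def insert_commute)
  then show "reach G F u v \<Longrightarrow> reach G F v u" using sym_rtrancl symD by metis
qed

lemma reach_mono: "reach G F u v \<Longrightarrow> F \<subseteq> F' \<Longrightarrow> reach G F' u v"
  using rtrancl_mono[of "adj G F" "adj G F'"] by (auto simp: adj_def)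

lemma reach_edge: "e \<in> F \<Longrightarrow> ends G e = {u, v} \<Longrightarrow> reach G F u v"
  by (rule r_into_rtrancl) (auto simp: adj_def)

lemma reach_map:
  assumes "reach G F u v"
    and "\<And>e a b. e \<in> F \<Longrightarrow> ends G e = {a, b} \<Longrightarrow> reach G' F' (p a) (p b)"
  shows "reach G' F' (p u) (p v)"
  using assms(1)
proof (induction rule: rtrancl_induct)
  case (step y z)
  then obtain e where "e \<in> F" "ends G e = {y, z}" by (auto simp: adj_def)
  from assms(2)[OF this] step.IH show ?case by (meson rtrancl_trans)
qed simp

lemma reach_closed:
  assumes "reach G F u v" "u \<in> X"
    and "\<And>e a b. e \<in> F \<Longrightarrow> ends G e = {a, b} \<Longrightarrow> a \<in> X \<Longrightarrow> b \<in> X"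
  shows "v \<in> X"
  using assms(1,2)
proof (induction rule: rtrancl_induct)
  case (step y z)
  then show ?case using assms(3) by (auto simp: adj_def)
qed simp

lemma reach_same: "reach G F a b \<Longrightarrow> reach G F u a \<longleftrightarrow> reach G F u b"
  using reach_sym rtrancl_trans by metis

lemma reach_insert:
  assumes "ends G e = {a, b}"
  shows "reach G (insert e F) u v \<longleftrightarrow>
    reach G F u v \<or> (reach G F u a \<and> reach G F b v) \<or> (reach G F u b \<and> reach G F a v)"
    (is "?L \<longleftrightarrow> ?R v")
proof
  assume ?L
  then show "?R v"
  proof (induction rule: rtrancl_induct)
    case (step y z)
    then obtain f where f: "f \<in> insert e F" "ends G f = {y, z}" by (auto simp: adj_def)
    show ?case
    proof (cases "f \<in> F")
      case True
      then have "reach G F y z" using f reach_edge by blast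
      then show ?thesis using step.IH by (meson rtrancl_trans)
    next
      case False
      then have "(y = a \<and> z = b) \<or> (y = b \<and> z = a)" using f assms by (auto simp: doubleton_eq_iff)
      then show ?thesis using step.IH by auto
    qed
  qed simp
next
  assume R: "?R v"
  have m: "reach G F x y \<Longrightarrow> reach G (insert e F) x y" for x y
    by (rule reach_mono) auto
  have "reach G (insert e F) a b" using assms reach_edge by blast
  then have ab: "reach G (insert e F) a b" "reach G (insert e F) b a" using reach_sym by auto
  from R show ?L
  proof (elim disjE conjE)
    assume "reach G F u v"
    then show ?L using m by blast
  next
    assume "reach G F u a" "reach G F b v"
    then show ?L using m ab(1) by (meson rtrancl_trans)
  next
    assume "reach G F u b" "reach G F a v"
    then show ?L using m ab(2) by (meson rtrancl_trans)
  qed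
qed

lemma ends_Min_Max:
  assumes "card (ends G e) \<in> {1, 2}"
  shows "ends G e = {Min (ends G e), Max (ends G e)}"
proof -
  have "card (ends G e) = 1 \<or> card (ends G e) = 2" using assms by simp
  then show ?thesis
  proof
    assume "card (ends G e) = 1"
    then obtain x where "ends G e = {x}" by (rule card_1_singletonE)
    then show ?thesis by simp
  next
    assume "card (ends G e) = 2"
    then obtain x y where "ends G e = {x, y}" by (auto simp: card_2_iff)
    then show ?thesis by (cases "x \<le> y") (auto simp: min_def max_def)
  qed
qed

lemma ends_obtain:
  assumes "card (ends G e) \<in> {1, 2}"
  obtains a b where "ends G e = {a, b}"
  using ends_Min_Max[OF assms] by blast

lemma boundary_insert:
  assumes "finite F" "e \<notin> F"
  shows "boundary G (insert e F) c v =
    c e * (of_bool (v = Max (ends G e)) - of_bool (v = Min (ends G e))) + boundary G F c v"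
  using assms by (simp add: boundary_def)

lemma boundary_add: "boundary G F (\<lambda>e. x e + y e) v = boundary G F x v + boundary G F y v"
  by (simp add: boundary_def sum.distrib[symmetric] distrib_right)

lemma boundary_scale: "boundary G F (\<lambda>e. q * x e) v = q * boundary G F x v"
  by (simp add: boundary_def sum_distrib_left algebra_simps)

lemma boundary_cong: "(\<And>e. e \<in> F \<Longrightarrow> x e = y e) \<Longrightarrow> boundary G F x v = boundary G F y v"
  unfolding boundary_def by (rule sum.cong) auto

lemma subspace_H1: "rat_chains.subspace (H1 G F)"
  unfolding rat_chains.subspace_def
proof (intro conjI ballI allI)
  show "0 \<in> H1 G F" by (auto simp: H1_def boundary_def)
next
  fix x y assume "x \<in> H1 G F" "y \<in> H1 G F"
  then show "x + y \<in> H1 G F"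
    using boundary_add[of G F x y] by (auto simp: H1_def plus_fun_def)
next
  fix q x assume "x \<in> H1 G F"
  then show "(\<lambda>e. q * x e) \<in> H1 G F"
    using boundary_scale[of G F q x] by (auto simp: H1_def)
qed

lemma path_chain:
  assumes "reach G F a b" "finite F" "\<forall>e\<in>F. card (ends G e) \<in> {1, 2}"
  shows "\<exists>p. (\<forall>e. e \<notin> F \<longrightarrow> p e = 0) \<and> (\<forall>v. boundary G F p v = of_bool (v = b) - of_bool (v = a))"
  using assms(1)
proof (induction rule: rtrancl_induct)
  case base
  show ?case by (rule exI[of _ "\<lambda>_. 0"]) (simp add: boundary_def)
next
  case (step y z)
  then obtain p where p: "\<forall>e. e \<notin> F \<longrightarrow> p e = 0"
    "\<forall>v. boundary G F p v = of_bool (v = y) - of_bool (v = a)" by blast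
  from step obtain f where f: "f \<in> F" "ends G f = {y, z}" by (auto simp: adj_def)
  define s :: rat where "s = (if z = Max (ends G f) then 1 else - 1)"
  have mm: "ends G f = {Min (ends G f), Max (ends G f)}"
    using assms(3) f ends_Min_Max by blast
  have unit: "boundary G F (\<lambda>e. s * of_bool (e = f)) v = of_bool (v = z) - of_bool (v = y)" for v
  proof -
    have "boundary G F (\<lambda>e. s * of_bool (e = f)) v
      = (\<Sum>e\<in>F. if e = f then s * (of_bool (v = Max (ends G f)) - of_bool (v = Min (ends G f))) else 0)"
      unfolding boundary_def by (rule sum.cong) auto
    also have "\<dots> = s * (of_bool (v = Max (ends G f)) - of_bool (v = Min (ends G f)))"
      using f assms(2) by simp
    also have "\<dots> = of_bool (v = z) - of_bool (v = y)"
      using mm f(2) unfolding s_def by (auto simp: doubleton_eq_iff)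
    finally show ?thesis .
  qed
  show ?case
    by (rule exI[of _ "\<lambda>e. p e + s * of_bool (e = f)"]) (use p f unit boundary_add in auto)
qed

lemma weighted_boundary:
  assumes "finite F" "finite U" "\<forall>e\<in>F. ends G e \<subseteq> U \<and> card (ends G e) \<in> {1, 2}"
  shows "(\<Sum>v\<in>U. \<phi> v * boundary G F c v) = (\<Sum>e\<in>F. c e * (\<phi> (Max (ends G e)) - \<phi> (Min (ends G e))))"
proof -
  have "(\<Sum>v\<in>U. \<phi> v * boundary G F c v)
    = (\<Sum>e\<in>F. \<Sum>v\<in>U. \<phi> v * (c e * (of_bool (v = Max (ends G e)) - of_bool (v = Min (ends G e)))))"
    unfolding boundary_def sum_distrib_left by (rule sum.swap)
  also have "\<dots> = (\<Sum>e\<in>F. c e * (\<phi> (Max (ends G e)) - \<phi> (Min (ends G e))))"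
  proof (rule sum.cong)
    fix e assume e: "e \<in> F"
    have mM: "Min (ends G e) \<in> U" "Max (ends G e) \<in> U"
      using assms(3) e ends_Min_Max[of G e] by auto
    have "(\<Sum>v\<in>U. \<phi> v * (c e * (of_bool (v = Max (ends G e)) - of_bool (v = Min (ends G e)))))
       = (\<Sum>v\<in>U. (if v = Max (ends G e) then c e * \<phi> v else 0)) - (\<Sum>v\<in>U. (if v = Min (ends G e) then c e * \<phi> v else 0))"
      unfolding sum_subtractf[symmetric] by (rule sum.cong) (auto simp: algebra_simps)
    also have "\<dots> = c e * (\<phi> (Max (ends G e)) - \<phi> (Min (ends G e)))"
      using assms(2) mM by (simp add: algebra_simps)
    finally show "(\<Sum>v\<in>U. \<phi> v * (c e * (of_bool (v = Max (ends G e)) - of_bool (v = Min (ends G e)))))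
       = c e * (\<phi> (Max (ends G e)) - \<phi> (Min (ends G e)))" .
  qed simp
  finally show ?thesis .
qed

text \<open>
  A cycle cannot use an edge whose ends are not otherwise connected: summing the boundary over
  the component of one end leaves only the coefficient of that edge.
\<close>

lemma H1_insert_bridge:
  assumes F: "finite F" "e \<notin> F" "\<forall>f\<in>insert e F. card (ends G f) \<in> {1, 2}"
    and e: "ends G e = {a, b}" "\<not> reach G F a b"
  shows "H1 G (insert e F) = H1 G F"
proof -
  define U where "U = (\<Union>f\<in>insert e F. ends G f)"
  have fin: "finite (ends G f)" if "f \<in> insert e F" for f
    using F(3) that by (metis card.infinite insert_iff singletonD zero_neq_numeral zero_neq_one)
  then have U: "finite U" "\<forall>f\<in>insert e F. ends G f \<subseteq> U \<and> card (ends G f) \<in> {1, 2}"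
    using F unfolding U_def by auto
  define \<phi> where "\<phi> v = (of_bool (reach G F a v) :: rat)" for v
  have zero: "x e = 0" if x: "x \<in> H1 G (insert e F)" for x
  proof -
    have "0 = (\<Sum>v\<in>U. \<phi> v * boundary G (insert e F) x v)" using x by (simp add: H1_def)
    also have "\<dots> = (\<Sum>f\<in>insert e F. x f * (\<phi> (Max (ends G f)) - \<phi> (Min (ends G f))))"
      using F(1) U by (intro weighted_boundary) auto
    also have "\<dots> = x e * (\<phi> (Max (ends G e)) - \<phi> (Min (ends G e)))
        + (\<Sum>f\<in>F. x f * (\<phi> (Max (ends G f)) - \<phi> (Min (ends G f))))"
      using F(1,2) by simp
    also have "(\<Sum>f\<in>F. x f * (\<phi> (Max (ends G f)) - \<phi> (Min (ends G f)))) = 0"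
    proof (rule sum.neutral, rule ballI)
      fix f assume f: "f \<in> F"
      have "ends G f = {Min (ends G f), Max (ends G f)}" using F(3) f ends_Min_Max by blast
      then have r: "reach G F (Min (ends G f)) (Max (ends G f))" using f reach_edge by blast
      have "reach G F a (Min (ends G f)) = reach G F a (Max (ends G f))"
        using r reach_sym by (meson rtrancl_trans)
      then show "x f * (\<phi> (Max (ends G f)) - \<phi> (Min (ends G f))) = 0" by (simp add: \<phi>_def)
    qed
    finally have *: "x e * (\<phi> (Max (ends G e)) - \<phi> (Min (ends G e))) = 0" by simp
    have "{Min (ends G e), Max (ends G e)} = {a, b}" using F(3) e ends_Min_Max[of G e] by auto
    then have "\<phi> (Max (ends G e)) \<noteq> \<phi> (Min (ends G e))"
      using e(2) by (auto simp: \<phi>_def doubleton_eq_iff)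
    then show ?thesis using * by simp
  qed
  show ?thesis
  proof (intro set_eqI iffI)
    fix x assume x: "x \<in> H1 G (insert e F)"
    then show "x \<in> H1 G F"
      using zero[OF x] F(1,2) by (auto simp: H1_def boundary_insert)
  next
    fix x assume x: "x \<in> H1 G F"
    then have "x e = 0" using F(2) by (auto simp: H1_def)
    then show "x \<in> H1 G (insert e F)" using x F(1,2) by (auto simp: H1_def boundary_insert)
  qed
qed

lemma H1_insert_zero:
  assumes "finite F" "e \<notin> F" "y \<in> H1 G (insert e F)" "y e = 0"
  shows "y \<in> H1 G F"
proof -
  have "y f = 0" if "f \<notin> F" for f using assms(3,4) that by (cases "f = e") (auto simp: H1_def)
  then show ?thesis using assms by (auto simp: H1_def boundary_insert)
qed

text \<open>
  A path joining the ends of \<open>e\<close> closes up to a cycle through \<open>e\<close> with coefficient one.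
  Subtracting a multiple of it from any other cycle removes \<open>e\<close> from that cycle.
\<close>

lemma H1_basis_insert_cycle:
  assumes F: "finite F" "e \<notin> F" "\<forall>f\<in>insert e F. card (ends G f) \<in> {1, 2}"
    and e: "ends G e = {a, b}" "reach G F a b"
    and B: "finite B" "rat_chains.independent B" "rat_chains.span B = H1 G F"
  shows "\<exists>c. c \<notin> B \<and> rat_chains.independent (insert c B) \<and> rat_chains.span (insert c B) = H1 G (insert e F)"
proof -
  let ?m = "Min (ends G e)" and ?M = "Max (ends G e)"
  have "{?m, ?M} = {a, b}" using F(3) e ends_Min_Max[of G e] by auto
  then have "reach G F ?M ?m" using e reach_sym by (metis doubleton_eq_iff)
  then obtain p where p: "\<forall>f. f \<notin> F \<longrightarrow> p f = 0"
      "\<forall>v. boundary G F p v = of_bool (v = ?m) - of_bool (v = ?M)"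
    using path_chain[of ?M ?m G F] F by auto
  define c where "c = p(e := 1)"
  have bc: "boundary G F c v = boundary G F p v" for v
    by (rule boundary_cong) (use F(2) in \<open>auto simp: c_def\<close>)
  have c: "c \<in> H1 G (insert e F)"
    using p F(1,2) by (auto simp: H1_def boundary_insert bc) (auto simp: c_def)
  have sub: "H1 G F \<subseteq> H1 G (insert e F)"
    using F(1,2) by (auto simp: H1_def boundary_insert)
  have ce: "c \<notin> rat_chains.span B"
    using B(3) F(2) by (auto simp: H1_def c_def)
  have ind: "rat_chains.independent (insert c B)"
    using rat_chains.independent_insertI[OF ce B(2)] .
  have span: "rat_chains.span (insert c B) = H1 G (insert e F)"
  proof
    have "insert c B \<subseteq> H1 G (insert e F)"
      using c sub B(3) rat_chains.span_superset by blast
    then show "rat_chains.span (insert c B) \<subseteq> H1 G (insert e F)"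
      using rat_chains.span_minimal subspace_H1 by blast
    show "H1 G (insert e F) \<subseteq> rat_chains.span (insert c B)"
    proof
      fix x assume x: "x \<in> H1 G (insert e F)"
      let ?y = "x - (\<lambda>f. x e * c f)"
      have "?y \<in> H1 G (insert e F)"
        using rat_chains.subspace_diff[OF subspace_H1 x rat_chains.subspace_scale[OF subspace_H1 c]] .
      moreover have "?y e = 0" by (simp add: c_def)
      ultimately have "?y \<in> H1 G F" using H1_insert_zero[OF F(1,2)] by blast
      then have "?y \<in> rat_chains.span B" using B(3) by simp
      then show "x \<in> rat_chains.span (insert c B)"
        unfolding rat_chains.span_insert by auto
    qed
  qed
  show ?thesis using ce ind span rat_chains.span_base by blast
qed

lemma H1_finite_basis:
  assumes "finite F" "\<forall>f\<in>F. card (ends G f) \<in> {1, 2}"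
  shows "\<exists>B. finite B \<and> rat_chains.independent B \<and> rat_chains.span B = H1 G F"
  using assms
proof (induction F rule: finite_induct)
  case empty
  have "H1 G {} = {0}" by (auto simp: H1_def boundary_def)
  then show ?case by (intro exI[of _ "{}"]) (auto simp: rat_chains.independent_empty)
next
  case (insert e F)
  then obtain B where B: "finite B" "rat_chains.independent B" "rat_chains.span B = H1 G F" by auto
  obtain a b where e: "ends G e = {a, b}" using insert.prems ends_obtain by blast
  show ?case
  proof (cases "reach G F a b")
    case True
    then show ?thesis
      using H1_basis_insert_cycle[OF insert.hyps(1,2) insert.prems e _ B] B(1) by blast
  next
    case False
    then show ?thesis using H1_insert_bridge[OF insert.hyps(1,2) insert.prems e] B by auto
  qed
qed

definition cycle_rank :: "wgraph \<Rightarrow> nat set \<Rightarrow> nat" where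
  "cycle_rank G F = rat_chains.dim (H1 G F)"

lemma cycle_rank_empty [simp]: "cycle_rank G {} = 0"
proof -
  have "H1 G {} = rat_chains.span {}" by (auto simp: H1_def boundary_def)
  then show ?thesis
    unfolding cycle_rank_def using rat_chains.dim_span_eq_card_independent[of "{}"]
    by (simp add: rat_chains.independent_empty)
qed

lemma cycle_rank_insert:
  assumes F: "finite F" "e \<notin> F" "\<forall>f\<in>insert e F. card (ends G f) \<in> {1, 2}"
    and e: "ends G e = {a, b}"
  shows "cycle_rank G (insert e F) = cycle_rank G F + (if reach G F a b then 1 else 0)"
proof -
  obtain B where B: "finite B" "rat_chains.independent B" "rat_chains.span B = H1 G F"
    using H1_finite_basis[of F G] F by auto
  have r: "cycle_rank G F = card B"
    unfolding cycle_rank_def using B rat_chains.dim_span_eq_card_independent[of B] by simp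
  show ?thesis
  proof (cases "reach G F a b")
    case True
    then obtain c where c: "c \<notin> B" "rat_chains.independent (insert c B)"
        "rat_chains.span (insert c B) = H1 G (insert e F)"
      using H1_basis_insert_cycle[OF F e _ B] by blast
    then have "cycle_rank G (insert e F) = card (insert c B)"
      unfolding cycle_rank_def using rat_chains.dim_span_eq_card_independent[of "insert c B"] by simp
    then show ?thesis using True c B r by simp
  next
    case False
    then show ?thesis using H1_insert_bridge[OF F e] by (simp add: cycle_rank_def)
  qed
qed

lemma cycle_rank_remove:
  assumes "finite F" "e \<in> F" "\<forall>f\<in>F. card (ends G f) \<in> {1, 2}" "ends G e = {a, b}"
  shows "cycle_rank G F = cycle_rank G (F - {e}) + (if reach G (F - {e}) a b then 1 else 0)"
  using cycle_rank_insert[of "F - {e}" e G a b] assms by (simp add: insert_absorb)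

lemma cycle_rank_mono:
  assumes "finite F'" "F \<subseteq> F'" "\<forall>f\<in>F'. card (ends G f) \<in> {1, 2}"
  shows "cycle_rank G F \<le> cycle_rank G F'"
proof -
  have "finite X \<Longrightarrow> X \<subseteq> F' - F \<Longrightarrow> cycle_rank G F \<le> cycle_rank G (F \<union> X)" for X
  proof (induction X rule: finite_induct)
    case (insert e X)
    obtain a b where "ends G e = {a, b}" using assms(3) insert.prems ends_obtain by blast
    then have "cycle_rank G (F \<union> X) \<le> cycle_rank G (insert e (F \<union> X))"
      using assms insert finite_subset[OF assms(2,1)]
      by (subst cycle_rank_insert[of "F \<union> X" e G a b]) auto
    moreover have "cycle_rank G F \<le> cycle_rank G (F \<union> X)" using insert by blast
    ultimately show ?case by simp
  qed simp
  from this[of "F' - F"] assms show ?thesis by (simp add: Un_absorb1)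
qed

definition components :: "wgraph \<Rightarrow> nat set \<Rightarrow> nat set \<Rightarrow> nat set set" where
  "components G V F = (\<lambda>v. {w\<in>V. reach G F v w}) ` V"

lemma card_components_insert:
  assumes V: "finite V" and e: "ends G e = {a, b}" "a \<in> V" "b \<in> V" "\<not> reach G F a b"
  shows "card (components G V F) = card (components G V (insert e F)) + 1"
proof -
  define K where "K F v = {w\<in>V. reach G F v w}" for F v
  have K: "K F v = K F w \<longleftrightarrow> reach G F v w" if "v \<in> V" "w \<in> V" for v w F
  proof
    assume eq: "K F v = K F w"
    have "w \<in> K F w" using that by (simp add: K_def)
    then have "w \<in> K F v" unfolding eq .
    then show "reach G F v w" by (simp add: K_def)
  next
    assume r: "reach G F v w"
    have "reach G F v x \<longleftrightarrow> reach G F w x" for x using r by (meson reach_sym rtrancl_trans)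
    then show "K F v = K F w" by (simp add: K_def)
  qed
  have c: "components G V F = K F ` V" "components G V (insert e F) = K (insert e F) ` V"
    by (auto simp: components_def K_def)
  let ?R = "K F ` V - {K F a, K F b}"
  let ?AB = "K F a \<union> K F b"
  have new: "K (insert e F) v = (if reach G F v a \<or> reach G F v b then ?AB else K F v)" for v
  proof (cases "reach G F v a \<or> reach G F v b")
    case True
    have "reach G (insert e F) v x \<longleftrightarrow> reach G F a x \<or> reach G F b x" for x
    proof (cases "reach G F v a")
      case True
      then have "reach G F v x \<longleftrightarrow> reach G F a x" by (meson reach_sym rtrancl_trans)
      then show ?thesis unfolding reach_insert[OF e(1)] using True by blast
    next
      case False
      then have vb: "reach G F v b" using \<open>reach G F v a \<or> reach G F v b\<close> by blast
      then have "reach G F v x \<longleftrightarrow> reach G F b x" by (meson reach_sym rtrancl_trans)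
      then show ?thesis unfolding reach_insert[OF e(1)] using False vb by blast
    qed
    then show ?thesis using True by (auto simp: K_def)
  next
    case False
    then show ?thesis unfolding K_def reach_insert[OF e(1)] by simp
  qed
  have "K (insert e F) ` V = insert ?AB ?R"
  proof (intro set_eqI iffI)
    fix X assume "X \<in> K (insert e F) ` V"
    then obtain v where v: "v \<in> V" "X = K (insert e F) v" by auto
    then show "X \<in> insert ?AB ?R" using new[of v] K e(2,3) by auto
  next
    fix X assume X: "X \<in> insert ?AB ?R"
    show "X \<in> K (insert e F) ` V"
    proof (cases "X = ?AB")
      case True
      then show ?thesis using new[of a] e(2) by auto
    next
      case False
      then obtain v where v: "v \<in> V" "X = K F v" "X \<noteq> K F a" "X \<noteq> K F b" using X by auto
      then show ?thesis using new[of v] K e(2,3) by auto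
    qed
  qed
  moreover have "?AB \<notin> ?R"
  proof
    assume "?AB \<in> ?R"
    then obtain v where v: "v \<in> V" "?AB = K F v" by auto
    have "a \<in> ?AB" "b \<in> ?AB" using e by (auto simp: K_def)
    then have "reach G F v a" "reach G F v b" using v by (auto simp: K_def)
    then show False using e(4) by (meson reach_sym rtrancl_trans)
  qed
  moreover have "card (K F ` V) = card ?R + 2"
  proof -
    have "K F a \<noteq> K F b" using K e by auto
    then have "card {K F a, K F b} = 2" by simp
    moreover have "{K F a, K F b} \<subseteq> K F ` V" using e by auto
    ultimately show ?thesis using V card_Diff_subset[of "{K F a, K F b}" "K F ` V"]
        card_mono[of "K F ` V" "{K F a, K F b}"] by simp
  qed
  ultimately show ?thesis using c V by simp
qed

text \<open>
  Adding an edge either raises the cycle rank or joins two components.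
\<close>

lemma euler_formula:
  assumes "finite V" "finite F" "\<forall>e\<in>F. ends G e \<subseteq> V \<and> card (ends G e) \<in> {1, 2}"
  shows "cycle_rank G F + card V = card F + card (components G V F)"
  using assms(2,3)
proof (induction F rule: finite_induct)
  case empty
  have "adj G {} = {}" by (auto simp: adj_def)
  then have "components G V {} = (\<lambda>v. {v}) ` V" by (auto simp: components_def)
  then show ?case by (simp add: card_image)
next
  case (insert e F)
  obtain a b where e: "ends G e = {a, b}" using insert.prems ends_obtain by blast
  have r: "cycle_rank G (insert e F) = cycle_rank G F + (if reach G F a b then 1 else 0)"
    using cycle_rank_insert[of F e G a b] insert e by auto
  show ?case
  proof (cases "reach G F a b")
    case True
    have "reach G (insert e F) u v = reach G F u v" for u v
      unfolding reach_insert[OF e] using True by (meson reach_sym rtrancl_trans)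
    then have "components G V (insert e F) = components G V F" by (simp add: components_def)
    then show ?thesis using r True insert by simp
  next
    case False
    then have "card (components G V F) = card (components G V (insert e F)) + 1"
      using card_components_insert[of V G e a b F] assms(1) e insert.prems by auto
    then show ?thesis using r False insert by simp
  qed
qed

lemma wf_edge:
  assumes "wf_wgraph n G" "e \<in> edges G"
  shows "ends G e \<subseteq> verts G" "card (ends G e) \<in> {1, 2}"
  using assms by (auto simp: wf_wgraph_def)

lemma wf_edge_obtain:
  assumes "wf_wgraph n G" "e \<in> edges G"
  obtains a b where "ends G e = {a, b}" "a \<in> verts G" "b \<in> verts G"
proof -
  obtain a b where "ends G e = {a, b}" using wf_edge[OF assms] ends_obtain by blast
  then show ?thesis using that wf_edge[OF assms] by auto
qed

text \<open>
  Counting replaces homology here, and both sides of the count change by the same amount when an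
  edge is contracted.
\<close>

lemma genus_one_graph_iff:
  "genus_one_graph n d G \<longleftrightarrow>
     wf_wgraph n G \<and> connected_wgraph G \<and>
     card (edges G) + (\<Sum>v\<in>verts G. weight G v) = card (verts G) \<and> (\<Sum>v\<in>verts G. deg G v) = d"
proof -
  have "subgraph_genus G (verts G) (edges G) = 1 \<longleftrightarrow>
      card (edges G) + (\<Sum>v\<in>verts G. weight G v) = card (verts G)"
    if wf: "wf_wgraph n G" and con: "connected_wgraph G"
  proof -
    have "components G (verts G) (edges G) = {verts G}"
      using con by (auto simp: components_def connected_wgraph_def)
    then have "cycle_rank G (edges G) + card (verts G) = card (edges G) + 1"
      using euler_formula[of "verts G" "edges G" G] wf by (auto simp: wf_wgraph_def)
    then show ?thesis by (auto simp: subgraph_genus_def cycle_rank_def)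
  qed
  then show ?thesis by (auto simp: genus_one_graph_def)
qed

section \<open>The core\<close>

text \<open>
  A loop always qualifies: its two ends coincide.
\<close>

definition cycle_edges :: "wgraph \<Rightarrow> nat set" where
  "cycle_edges G = {e\<in>edges G. \<exists>a b. ends G e = {a, b} \<and> reach G (edges G - {e}) a b}"

lemma subgraph_genus_eq: "subgraph_genus G W F = cycle_rank G F + (\<Sum>v\<in>W. weight G v)"
  by (simp add: subgraph_genus_def cycle_rank_def)

lemma cycle_edges_rank:
  assumes "wf_wgraph n G" "e \<in> cycle_edges G"
  shows "cycle_rank G (edges G) = cycle_rank G (edges G - {e}) + 1"
  using assms cycle_rank_remove[of "edges G" e G] by (auto simp: cycle_edges_def wf_wgraph_def)

text \<open>
  By minimality each edge of a core contributes to its cycle rank and each vertex that is not an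
  end of such an edge contributes weight. Conversely, if the graph has a cycle, then removing any
  cycle edge from it leaves rank zero, so a subgraph of genus one contains all of them.
\<close>

lemma is_core_unique:
  assumes G: "genus_one_graph n d G" and c: "is_core G W F"
  shows "W = {v\<in>verts G. weight G v > 0} \<union> \<Union> (ends G ` cycle_edges G) \<and> F = cycle_edges G"
proof -
  let ?r = "cycle_rank G"
  have wf: "wf_wgraph n G" using G by (simp add: genus_one_graph_def)
  have fin: "finite (verts G)" "finite (edges G)" using wf by (auto simp: wf_wgraph_def)
  have tot: "?r (edges G) + (\<Sum>v\<in>verts G. weight G v) = 1"
    using G by (simp add: genus_one_graph_def subgraph_genus_eq)
  have sub: "W \<subseteq> verts G" "F \<subseteq> edges G" "\<forall>e\<in>F. ends G e \<subseteq> W"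
    and g: "?r F + (\<Sum>v\<in>W. weight G v) = 1"
    using c by (simp_all add: is_core_def subgraph_def subgraph_genus_eq)
  have least: "subgraph G W' F' \<Longrightarrow> subgraph_genus G W' F' = 1 \<Longrightarrow> W' \<subseteq> W \<Longrightarrow> F' \<subseteq> F \<Longrightarrow> W' = W \<and> F' = F"
    for W' F' using c by (simp add: is_core_def)
  have card: "\<forall>f\<in>edges G. card (ends G f) \<in> {1, 2}" using wf_edge[OF wf] by blast
  have cardF: "\<forall>f\<in>F. card (ends G f) \<in> {1, 2}" using card sub(2) by blast
  have finF: "finite F" "finite W" using sub fin finite_subset by blast+
  have FC: "F \<subseteq> cycle_edges G"
  proof
    fix e assume e: "e \<in> F"
    then obtain a b where ab: "ends G e = {a, b}" using sub card ends_obtain by blast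
    have "reach G (F - {e}) a b"
    proof (rule ccontr)
      assume "\<not> reach G (F - {e}) a b"
      then have "?r F = ?r (F - {e})" using cycle_rank_remove[OF finF(1) e cardF ab] by simp
      then have "F - {e} = F"
        using least[of W "F - {e}"] sub g by (auto simp: subgraph_def subgraph_genus_eq)
      then show False using e by blast
    qed
    then have "reach G (edges G - {e}) a b" using sub by (auto intro: reach_mono)
    then show "e \<in> cycle_edges G" using e ab sub by (auto simp: cycle_edges_def)
  qed
  have CF: "cycle_edges G \<subseteq> F"
  proof
    fix e assume e: "e \<in> cycle_edges G"
    then have "?r (edges G) = ?r (edges G - {e}) + 1" using cycle_edges_rank wf by blast
    then have r0: "?r (edges G - {e}) = 0" and w0: "(\<Sum>v\<in>verts G. weight G v) = 0" using tot by auto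
    have "(\<Sum>v\<in>W. weight G v) = 0" using w0 sub fin by (auto simp: subset_iff)
    then have "?r F = 1" using g by simp
    show "e \<in> F"
    proof (rule ccontr)
      assume "e \<notin> F"
      then have "?r F \<le> ?r (edges G - {e})"
        using sub card fin by (intro cycle_rank_mono) auto
      then show False using r0 \<open>?r F = 1\<close> by simp
    qed
  qed
  have W1: "W \<subseteq> {v\<in>verts G. weight G v > 0} \<union> \<Union> (ends G ` F)"
  proof
    fix v assume v: "v \<in> W"
    show "v \<in> {v\<in>verts G. weight G v > 0} \<union> \<Union> (ends G ` F)"
    proof (rule ccontr)
      assume n: "\<not> ?thesis"
      then have "weight G v = 0" using v sub by auto
      then have "(\<Sum>v\<in>W - {v}. weight G v) = (\<Sum>v\<in>W. weight G v)"
        using finF v by (simp add: sum_diff1_nat)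
      moreover have "W - {v} \<subseteq> verts G" "\<forall>e\<in>F. ends G e \<subseteq> W - {v}" using sub n by auto
      ultimately have "W - {v} = W"
        using least[of "W - {v}" F] sub g by (simp add: subgraph_def subgraph_genus_eq)
      then show False using v by blast
    qed
  qed
  have W2: "v \<in> W" if v: "v \<in> verts G" "weight G v > 0" for v
  proof (rule ccontr)
    assume n: "v \<notin> W"
    have "(\<Sum>v\<in>insert v W. weight G v) \<le> (\<Sum>v\<in>verts G. weight G v)"
      using fin sub v by (intro sum_mono2) auto
    then have le: "weight G v + (\<Sum>v\<in>W. weight G v) \<le> (\<Sum>v\<in>verts G. weight G v)" using n finF by simp
    then have "?r (edges G) = 0" using tot v by linarith
    then have "?r F = 0" using cycle_rank_mono[of "edges G" F G] fin sub card by simp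
    then show False using g le tot v by linarith
  qed
  have FCe: "F = cycle_edges G" using FC CF by (rule subset_antisym)
  have "\<Union> (ends G ` F) \<subseteq> W" using sub(3) by blast
  then have "{v\<in>verts G. weight G v > 0} \<union> \<Union> (ends G ` F) \<subseteq> W" using W2 by blast
  then show ?thesis using W1 FCe by (metis subset_antisym)
qed

lemma is_core_exists:
  assumes G: "genus_one_graph n d G"
  shows "\<exists>W F. is_core G W F"
proof -
  have wf: "wf_wgraph n G" using G by (simp add: genus_one_graph_def)
  have fin: "finite (verts G)" "finite (edges G)" using wf by (auto simp: wf_wgraph_def)
  define P where "P = (\<lambda>(W, F). subgraph G W F \<and> subgraph_genus G W F = 1)"
  define m where "m = (\<lambda>(W::nat set, F::nat set). card W + card F)"
  have "P (verts G, edges G)"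
    using G wf_edge[OF wf] by (auto simp: P_def subgraph_def genus_one_graph_def)
  then obtain p where p: "P p" "\<And>q. P q \<Longrightarrow> m p \<le> m q"
    using ex_has_least_nat[of P _ m] by blast
  obtain W F where WF: "p = (W, F)" by force
  have f: "finite W" "finite F"
    using p(1) fin by (auto simp: WF P_def subgraph_def intro: finite_subset)
  have "W' = W \<and> F' = F"
    if "subgraph G W' F'" "subgraph_genus G W' F' = 1" "W' \<subseteq> W" "F' \<subseteq> F" for W' F'
  proof -
    have "card W + card F \<le> card W' + card F'" using p(2)[of "(W', F')"] that by (auto simp: P_def m_def WF)
    moreover have "card W' \<le> card W" "card F' \<le> card F" using that f by (auto intro: card_mono)
    ultimately have "card W' = card W" "card F' = card F" by linarith+
    then show ?thesis using that f card_subset_eq by blast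
  qed
  then have "is_core G W F" using p(1) by (auto simp: WF P_def is_core_def)
  then show ?thesis by blast
qed

lemma core_eq:
  assumes G: "genus_one_graph n d G"
  shows "core_edges G = cycle_edges G"
    and "core_verts G = {v\<in>verts G. weight G v > 0} \<union> \<Union> (ends G ` cycle_edges G)"
    and "is_core G (core_verts G) (core_edges G)"
proof -
  obtain W F where c: "is_core G W F" using is_core_exists[OF G] by blast
  have "core G = (W, F)"
    unfolding core_def
  proof (rule the_equality)
    show "case (W, F) of (W, F) \<Rightarrow> is_core G W F" using c by simp
  next
    fix p assume "case p of (W, F) \<Rightarrow> is_core G W F"
    then have p: "is_core G (fst p) (snd p)" by (simp add: case_prod_beta)
    show "p = (W, F)" using is_core_unique[OF G p] is_core_unique[OF G c] by (simp add: prod_eq_iff)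
  qed
  then have *: "core_verts G = W" "core_edges G = F" by (auto simp: core_verts_def core_edges_def)
  show "core_edges G = cycle_edges G"
    and "core_verts G = {v\<in>verts G. weight G v > 0} \<union> \<Union> (ends G ` cycle_edges G)"
    and "is_core G (core_verts G) (core_edges G)"
    unfolding * using is_core_unique[OF G c] c by auto
qed

lemma genus_one_wf: "genus_one_graph n d G \<Longrightarrow> wf_wgraph n G"
  by (simp add: genus_one_graph_def)

lemma core_subset:
  assumes "genus_one_graph n d G"
  shows "core_edges G \<subseteq> edges G" "core_verts G \<subseteq> verts G"
    "e \<in> core_edges G \<Longrightarrow> ends G e \<subseteq> core_verts G"
  using core_eq(3)[OF assms] by (auto simp: is_core_def subgraph_def)

lemma core_verts_nonempty:
  assumes "genus_one_graph n d G"
  shows "core_verts G \<noteq> {}"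
proof
  assume e: "core_verts G = {}"
  have "core_edges G = {}"
  proof (rule ccontr)
    assume "core_edges G \<noteq> {}"
    then obtain e where "e \<in> core_edges G" by blast
    then have "ends G e = {}" "e \<in> edges G" using core_subset[OF assms] e by auto
    then show False using wf_edge(2)[OF genus_one_wf[OF assms]] by fastforce
  qed
  then show False using core_eq(3)[OF assms] e by (simp add: is_core_def subgraph_genus_eq)
qed

text \<open>
  Two disjoint cycles, or a cycle and a vertex of positive genus, would exceed genus one, so
  the core stays on one side of each bridge. Given cycle edges on both sides of \<open>e\<close>,
  collapsing the near side to the far end of \<open>e\<close> shows that the far one lies on a cycle
  avoiding the near one, and removing both lowers the cycle rank by two.
\<close>

lemma core_connected:
  assumes G: "genus_one_graph n d G" and e: "e \<in> edges G - core_edges G"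
    and u: "u1 \<in> core_verts G" "u2 \<in> core_verts G"
  shows "reach G (edges G - {e}) u1 u2"
proof (cases "cycle_edges G = {}")
  case True
  have fin: "finite (verts G)" using genus_one_wf[OF G] by (auto simp: wf_wgraph_def)
  have u': "u1 \<in> verts G" "u2 \<in> verts G" "weight G u1 > 0" "weight G u2 > 0"
    using u core_eq(2)[OF G] True by auto
  have "u1 = u2"
  proof (rule ccontr)
    assume "u1 \<noteq> u2"
    then have "weight G u1 + weight G u2 = (\<Sum>v\<in>{u1, u2}. weight G v)" by simp
    also have "\<dots> \<le> (\<Sum>v\<in>verts G. weight G v)" using u' fin by (intro sum_mono2) auto
    also have "\<dots> \<le> 1" using G by (simp add: genus_one_graph_def subgraph_genus_eq)
    finally show False using u' by simp
  qed
  then show ?thesis by simp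
next
  case False
  have wf: "wf_wgraph n G" using genus_one_wf[OF G] .
  have fin: "finite (verts G)" "finite (edges G)" using wf by (auto simp: wf_wgraph_def)
  have tot: "cycle_rank G (edges G) + (\<Sum>v\<in>verts G. weight G v) = 1"
    using G by (simp add: genus_one_graph_def subgraph_genus_eq)
  obtain e0 where "e0 \<in> cycle_edges G" using False by blast
  then have r1: "cycle_rank G (edges G) = 1" and "(\<Sum>v\<in>verts G. weight G v) = 0"
    using cycle_edges_rank[OF wf, of e0] tot by auto
  then have "core_verts G = \<Union> (ends G ` cycle_edges G)" using core_eq(2)[OF G] fin by auto
  then obtain e1 e2 where e12: "e1 \<in> cycle_edges G" "u1 \<in> ends G e1" "e2 \<in> cycle_edges G" "u2 \<in> ends G e2"
    using u by auto
  have sub: "cycle_edges G \<subseteq> edges G" by (auto simp: cycle_edges_def)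
  have ec: "e \<notin> cycle_edges G" "e \<in> edges G" using e core_eq(1)[OF G] by auto
  obtain x1 where x1: "ends G e1 = {u1, x1}"
    using wf_edge_obtain[OF wf, of e1] e12 sub by (metis insert_commute insert_iff singletonD subsetD)
  obtain x2 where x2: "ends G e2 = {u2, x2}" "reach G (edges G - {e2}) u2 x2"
  proof -
    from e12(3) obtain p q where pq: "ends G e2 = {p, q}" "reach G (edges G - {e2}) p q"
      by (auto simp: cycle_edges_def)
    show ?thesis
    proof (cases "u2 = p")
      case True
      then show ?thesis using that pq by blast
    next
      case False
      then have "u2 = q" using pq e12 by auto
      then show ?thesis using that[of p] pq reach_sym by (auto simp: insert_commute)
    qed
  qed
  define E' where "E' = edges G - {e}"
  define X where "X = {x. reach G E' u1 x}"
  show ?thesis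
  proof (rule ccontr)
    assume n: "\<not> ?thesis"
    then have u2X: "u2 \<notin> X" by (simp add: X_def E'_def)
    obtain p q where pq: "ends G e = {p, q}" using wf_edge_obtain[OF wf] ec by blast
    have "reach G (insert e E') u1 u2"
      using G u core_subset[OF G] ec
      by (simp add: E'_def insert_absorb genus_one_graph_def connected_wgraph_def subset_iff)
    then have "(reach G E' u1 p \<and> reach G E' q u2) \<or> (reach G E' u1 q \<and> reach G E' p u2)"
      using reach_insert[OF pq] n unfolding E'_def by blast
    then obtain a b where ab: "ends G e = {a, b}" "a \<in> X" "reach G E' b u2"
      unfolding X_def using pq by (auto simp: insert_commute)
    have bX: "b \<notin> X" using u2X reach_same[OF ab(3)] by (simp add: X_def)
    have step: "x \<in> X \<longleftrightarrow> y \<in> X" if "f \<in> E'" "ends G f = {x, y}" for f x y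
      using reach_same[OF reach_edge[OF that]] by (simp add: X_def)
    have e1E: "e1 \<in> E'" "e2 \<in> E'" using e12 ec sub by (auto simp: E'_def)
    have x1X: "u1 \<in> X" "x1 \<in> X" using step[OF e1E(1) x1] by (auto simp: X_def)
    have x2X: "x2 \<notin> X" using step[OF e1E(2) x2(1)] u2X by simp
    define \<pi> where "\<pi> x = (if x \<in> X then b else x)" for x
    have "reach G (edges G - {e1} - {e2}) (\<pi> u2) (\<pi> x2)"
    proof (rule reach_map[OF x2(2)])
      fix f x y assume f: "f \<in> edges G - {e2}" "ends G f = {x, y}"
      show "reach G (edges G - {e1} - {e2}) (\<pi> x) (\<pi> y)"
      proof (cases "f = e")
        case True
        then have "{x, y} = {a, b}" using f ab by simp
        then have "\<pi> x = b" "\<pi> y = b" using ab bX by (auto simp: \<pi>_def doubleton_eq_iff)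
        then show ?thesis by simp
      next
        case False
        then have fE: "f \<in> E'" using f by (auto simp: E'_def)
        show ?thesis
        proof (cases "x \<in> X")
          case True
          then show ?thesis using step[OF fE f(2)] by (simp add: \<pi>_def)
        next
          case F: False
          then have "f \<noteq> e1" using f(2) x1 x1X step[OF fE f(2)] by (auto simp: doubleton_eq_iff)
          then have "reach G (edges G - {e1} - {e2}) x y" using f by (intro reach_edge) auto
          then show ?thesis using F step[OF fE f(2)] by (simp add: \<pi>_def)
        qed
      qed
    qed
    then have r: "reach G (edges G - {e1} - {e2}) u2 x2" using u2X x2X by (simp add: \<pi>_def)
    have ne: "e1 \<noteq> e2" using x1 x1X u2X e12 by auto
    have "cycle_rank G (edges G - {e1}) = cycle_rank G (edges G - {e1} - {e2}) + 1"
      using cycle_rank_remove[of "edges G - {e1}" e2 G u2 x2] r x2 fin e1E ne wf_edge[OF wf]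
      by (auto simp: E'_def)
    then show False using cycle_edges_rank[OF wf e12(1)] r1 by simp
  qed
qed

lemma connected_reach:
  "genus_one_graph n d G \<Longrightarrow> u \<in> verts G \<Longrightarrow> v \<in> verts G \<Longrightarrow> reach G (edges G) u v"
  by (simp add: genus_one_graph_def connected_wgraph_def)

lemma directedD:
  assumes "directed G e v w"
  shows "e \<in> edges G" "e \<notin> core_edges G" "ends G e = {v, w}"
    "\<exists>u\<in>core_verts G. reach G (edges G - {e}) u v"
    "u \<in> core_verts G \<Longrightarrow> \<not> reach G (edges G - {e}) u w"
  using assms by (auto simp: directed_def)

lemma directed_asym: "directed G e v w \<Longrightarrow> \<not> directed G e w v"
  by (auto simp: directed_def)

lemma directed_head_not_core: "directed G e v w \<Longrightarrow> w \<notin> core_verts G"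
  by (auto simp: directed_def)

lemma directed_verts:
  "wf_wgraph n G \<Longrightarrow> directed G e v w \<Longrightarrow> v \<in> verts G \<and> w \<in> verts G"
  using wf_edge(1) directedD(1,3) by blast

text \<open>
  A path from the core to an end of \<open>e\<close> shows that one end can be reached without
  \<open>e\<close>; if both could, then \<open>e\<close> would lie on a cycle, as the core is on one side.
\<close>

lemma noncore_directed:
  assumes G: "genus_one_graph n d G" and e: "e \<in> edges G - core_edges G" "ends G e = {a, b}"
  shows "directed G e a b \<or> directed G e b a"
proof -
  let ?E = "edges G - {e}"
  obtain u where u: "u \<in> core_verts G" using core_verts_nonempty[OF G] by blast
  have ab: "a \<in> verts G" "b \<in> verts G" using e wf_edge[OF genus_one_wf[OF G], of e] by auto
  have "reach G (insert e ?E) u a"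
    using connected_reach[OF G] u ab core_subset[OF G] e by (simp add: insert_absorb subset_iff)
  then have one: "reach G ?E u a \<or> reach G ?E u b" using reach_insert[OF e(2)] by blast
  have "\<not> reach G ?E a b" using e core_eq(1)[OF G] by (auto simp: cycle_edges_def)
  then have notboth: "\<not> (reach G ?E u1 a \<and> reach G ?E u2 b)"
    if "u1 \<in> core_verts G" "u2 \<in> core_verts G" for u1 u2
    using core_connected[OF G e(1) that] by (meson reach_sym rtrancl_trans)
  from one show ?thesis
  proof
    assume r: "reach G ?E u a"
    then show ?thesis unfolding directed_def using e u notboth by blast
  next
    assume r: "reach G ?E u b"
    then show ?thesis unfolding directed_def using e u notboth by (auto simp: insert_commute)
  qed
qed

lemma reach_first_hit:
  assumes "reach G F u w" "u \<noteq> w"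
  shows "\<exists>f y. f \<in> F \<and> ends G f = {y, w} \<and> reach G {f\<in>F. w \<notin> ends G f} u y"
proof -
  let ?F = "{f\<in>F. w \<notin> ends G f}"
  have "(reach G ?F u x \<and> x \<noteq> w) \<or> (\<exists>f y. f \<in> F \<and> ends G f = {y, w} \<and> reach G ?F u y)"
    if "reach G F u x" for x
    using that
  proof (induction rule: rtrancl_induct)
    case base
    then show ?case using assms(2) by simp
  next
    case (step y z)
    show ?case
    proof (cases "reach G ?F u y \<and> y \<noteq> w")
      case True
      obtain f where f: "f \<in> F" "ends G f = {y, z}" using step by (auto simp: adj_def)
      show ?thesis
      proof (cases "z = w")
        case True
        then show ?thesis using f \<open>reach G ?F u y \<and> y \<noteq> w\<close> by blast
      next
        case False
        then have "reach G ?F y z" using f True by (intro reach_edge) auto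
        then show ?thesis using True False by (meson rtrancl_trans)
      qed
    qed (use step.IH in blast)
  qed
  from this[OF assms(1)] show ?thesis by blast
qed

text \<open>
  Stop a path from the core at its first arrival at \<open>w\<close>. The part before the last edge does
  not use that edge, which is therefore directed towards \<open>w\<close>.
\<close>

lemma noncore_parent:
  assumes G: "genus_one_graph n d G" and w: "w \<in> verts G" "w \<notin> core_verts G"
  shows "\<exists>e v. directed G e v w"
proof -
  obtain u where u: "u \<in> core_verts G" using core_verts_nonempty[OF G] by blast
  have "reach G (edges G) u w" using connected_reach[OF G] u w core_subset[OF G] by auto
  then obtain f y where f: "f \<in> edges G" "ends G f = {y, w}"
      "reach G {f\<in>edges G. w \<notin> ends G f} u y"
    using reach_first_hit u w by metis
  have "f \<notin> core_edges G" using core_subset(3)[OF G, of f] f w by auto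
  then have "directed G f y w \<or> directed G f w y" using noncore_directed[OF G] f by blast
  moreover have "reach G (edges G - {f}) u y" using f by (auto intro: reach_mono)
  ultimately show ?thesis using directedD(5) u by blast
qed

section \<open>Contractions of several edges\<close>

text \<open>
  The composites of isomorphisms and edge contractions, described without choosing an order of
  the contracted edges. The new weight is the genus of the fibre, computed by Euler's formula
  for a connected graph and written without subtraction.
\<close>

definition contraction ::
  "nat \<Rightarrow> wgraph \<Rightarrow> (nat \<Rightarrow> nat) \<Rightarrow> (nat \<Rightarrow> nat) \<Rightarrow> wgraph \<Rightarrow> bool" where
  "contraction n G fv fe G' \<longleftrightarrow>
     fv ` verts G = verts G' \<and> inj_on fe (edges G') \<and> fe ` edges G' \<subseteq> edges G \<and>
     (\<forall>e\<in>edges G'. ends G' e = fv ` ends G (fe e)) \<and>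
     (\<forall>u\<in>verts G. \<forall>v\<in>verts G. fv u = fv v \<longleftrightarrow> reach G (edges G - fe ` edges G') u v) \<and>
     (\<forall>v\<in>verts G'. weight G' v + card {u\<in>verts G. fv u = v} =
        (\<Sum>u | u \<in> verts G \<and> fv u = v. weight G u)
        + card {e \<in> edges G - fe ` edges G'. fv ` ends G e = {v}} + 1) \<and>
     (\<forall>v\<in>verts G'. deg G' v = (\<Sum>u | u \<in> verts G \<and> fv u = v. deg G u)) \<and>
     (\<forall>i\<in>{1..n}. mark G' i = fv (mark G i))"

lemma wf_ends:
  assumes "wf_wgraph n G" "e \<in> edges G"
  shows "\<exists>a b. ends G e = {a, b} \<and> a \<in> verts G \<and> b \<in> verts G"
  using wf_edge_obtain[OF assms] by metis

lemma wf_mark: "wf_wgraph n G \<Longrightarrow> i \<in> {1..n} \<Longrightarrow> mark G i \<in> verts G"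
  by (auto simp: wf_wgraph_def)

lemma contractionD:
  assumes "contraction n G fv fe G'"
  shows "fv ` verts G = verts G'" "inj_on fe (edges G')" "fe ` edges G' \<subseteq> edges G"
    "e \<in> edges G' \<Longrightarrow> ends G' e = fv ` ends G (fe e)"
    "u \<in> verts G \<Longrightarrow> v \<in> verts G \<Longrightarrow> fv u = fv v \<longleftrightarrow> reach G (edges G - fe ` edges G') u v"
    "v' \<in> verts G' \<Longrightarrow> weight G' v' + card {u\<in>verts G. fv u = v'} =
        (\<Sum>u | u \<in> verts G \<and> fv u = v'. weight G u)
        + card {e \<in> edges G - fe ` edges G'. fv ` ends G e = {v'}} + 1"
    "v' \<in> verts G' \<Longrightarrow> deg G' v' = (\<Sum>u | u \<in> verts G \<and> fv u = v'. deg G u)"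
    "i \<in> {1..n} \<Longrightarrow> mark G' i = fv (mark G i)"
  using assms unfolding contraction_def by blast+

lemma Collect_bex_eq_UN:
  "(\<And>e. e \<in> F \<Longrightarrow> P e \<longleftrightarrow> (\<exists>v\<in>A. Q v e)) \<Longrightarrow> {e\<in>F. P e} = (\<Union>v\<in>A. {e\<in>F. Q v e})"
  by blast

lemma sum_fibres:
  assumes "finite A" "finite B"
  shows "(\<Sum>a | a \<in> A \<and> f a \<in> B. h a) = (\<Sum>b\<in>B. \<Sum>a | a \<in> A \<and> f a = b. (h a :: 'a :: comm_monoid_add))"
proof -
  have "{a \<in> A. f a \<in> B} = (\<Union>b\<in>B. {a\<in>A. f a = b})" by auto
  then show ?thesis using assms by (auto intro!: sum.UNION_disjoint)
qed

lemma card_fibres: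
  assumes "finite A" "finite B"
  shows "card {a\<in>A. f a \<in> B} = (\<Sum>b\<in>B. card {a\<in>A. f a = b})"
  using sum_fibres[OF assms, where f = f and h = "\<lambda>_. 1 :: nat"] by simp

lemma wf_finite: "wf_wgraph n G \<Longrightarrow> finite (verts G)" "wf_wgraph n G \<Longrightarrow> finite (edges G)"
  by (auto simp: wf_wgraph_def)

lemma contraction_wf:
  assumes wf: "wf_wgraph n G" and C: "contraction n G fv fe G'"
  shows "wf_wgraph n G'"
  unfolding wf_wgraph_def
proof (intro conjI ballI)
  show "finite (verts G')" using contractionD(1)[OF C] wf_finite[OF wf] by (metis finite_imageI)
  show "finite (edges G')"
    using contractionD(2,3)[OF C] wf_finite(2)[OF wf] by (metis finite_imageD finite_subset)
  show "mark G' ` {1..n} \<subseteq> verts G'"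
  proof
    fix x assume "x \<in> mark G' ` {1..n}"
    then obtain i where i: "i \<in> {1..n}" "x = mark G' i" by blast
    then have "mark G i \<in> verts G" using wf by (auto simp: wf_wgraph_def)
    then show "x \<in> verts G'" using i contractionD(1,8)[OF C] by blast
  qed
next
  fix e assume e: "e \<in> edges G'"
  then have "fe e \<in> edges G" using contractionD(3)[OF C] by blast
  then obtain a b where ab: "ends G (fe e) = {a, b}" "a \<in> verts G" "b \<in> verts G"
    using wf_ends[OF wf] by blast
  then have ee: "ends G' e = {fv a, fv b}" using contractionD(4)[OF C e] by simp
  then show "ends G' e \<subseteq> verts G'" using ab contractionD(1)[OF C] by auto
  show "card (ends G' e) \<in> {1, 2}" unfolding ee by (cases "fv a = fv b") auto
qed

text \<open>A path in the contracted graph lifts, as the fibres are connected by contracted edges.\<close>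

lemma contraction_reach:
  assumes wf: "wf_wgraph n G" and C: "contraction n G fv fe G'"
    and S: "S \<subseteq> edges G'" and u: "u \<in> verts G" "v \<in> verts G"
  shows "reach G' S (fv u) (fv v) \<longleftrightarrow> reach G ((edges G - fe ` edges G') \<union> fe ` S) u v"
proof
  let ?F = "edges G - fe ` edges G'"
  have lift: "\<forall>v\<in>verts G. fv v = x \<longrightarrow> reach G (?F \<union> fe ` S) u v" if "reach G' S (fv u) x" for x
    using that
  proof (induction rule: rtrancl_induct)
    case base
    then show ?case using contractionD(5)[OF C u(1)] by (metis reach_mono Un_upper1)
  next
    case (step y z)
    then obtain e where e: "e \<in> S" "ends G' e = {y, z}" by (auto simp: adj_def)
    have eE: "e \<in> edges G'" "fe e \<in> edges G" using e S contractionD(3)[OF C] by auto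
    obtain p q where pq: "ends G (fe e) = {p, q}" "p \<in> verts G" "q \<in> verts G"
      using wf_edge_obtain[OF wf eE(2)] .
    have "{fv p, fv q} = {y, z}" using contractionD(4)[OF C eE(1)] e pq by auto
    then obtain a b where ab: "ends G (fe e) = {a, b}" "a \<in> verts G" "b \<in> verts G" "fv a = y" "fv b = z"
      using pq by (metis doubleton_eq_iff insert_commute)
    have r: "reach G (?F \<union> fe ` S) u b"
    proof -
      have "reach G (?F \<union> fe ` S) u a" using step.IH ab by blast
      moreover have "reach G (?F \<union> fe ` S) a b" using e ab by (intro reach_edge) auto
      ultimately show ?thesis by (rule rtrancl_trans)
    qed
    show ?case
    proof (intro ballI impI)
      fix v assume v: "v \<in> verts G" "fv v = z"
      then have "reach G ?F b v" using contractionD(5)[OF C ab(3) v(1)] ab by simp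
      then have "reach G (?F \<union> fe ` S) b v" by (rule reach_mono) auto
      with r show "reach G (?F \<union> fe ` S) u v" by (rule rtrancl_trans)
    qed
  qed
  then show "reach G' S (fv u) (fv v) \<Longrightarrow> reach G (?F \<union> fe ` S) u v" using u by blast
  assume "reach G (?F \<union> fe ` S) u v"
  then show "reach G' S (fv u) (fv v)"
  proof (rule reach_map)
    fix e a b assume e: "e \<in> ?F \<union> fe ` S" "ends G e = {a, b}"
    have eE: "e \<in> edges G" using e S contractionD(3)[OF C] by auto
    show "reach G' S (fv a) (fv b)"
    proof (cases "e \<in> ?F")
      case True
      have "a \<in> verts G" "b \<in> verts G" using wf_edge(1)[OF wf eE] e by auto
      then have "fv a = fv b" using contractionD(5)[OF C] reach_edge[OF True e(2)] by blast
      then show ?thesis by simp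
    next
      case False
      then obtain s where s: "s \<in> S" "e = fe s" using e by auto
      then have "ends G' s = {fv a, fv b}" using contractionD(4)[OF C, of s] e S by auto
      then show ?thesis using s by (intro reach_edge)
    qed
  qed
qed

lemma contracted_edge_const:
  assumes wf: "wf_wgraph n G" and C: "contraction n G fv fe G'"
    and e: "e \<in> edges G - fe ` edges G'" "ends G e = {a, b}"
  shows "fv a = fv b"
proof -
  have "a \<in> verts G" "b \<in> verts G" using wf_edge(1)[OF wf, of e] e by auto
  then show ?thesis using contractionD(5)[OF C] reach_edge[OF e] by blast
qed

lemma contraction_cong:
  assumes wf: "wf_wgraph n G" and C: "contraction n G fv fe G'"
    and "\<And>v. v \<in> verts G \<Longrightarrow> gv v = fv v" "\<And>e. e \<in> edges G' \<Longrightarrow> ge e = fe e"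
  shows "contraction n G gv ge G'"
proof -
  have i: "gv ` verts G = fv ` verts G" "ge ` edges G' = fe ` edges G'"
    "inj_on ge (edges G') = inj_on fe (edges G')"
    using assms(3,4) by (auto cong: inj_on_cong)
  have "gv ` ends G e = fv ` ends G e" if "e \<in> edges G" for e
    using wf_edge(1)[OF wf that] assms(3) by (auto intro!: image_cong)
  note gf = this
  have k: "{e \<in> edges G - fe ` edges G'. gv ` ends G e = {v}} = {e \<in> edges G - fe ` edges G'. fv ` ends G e = {v}}" for v
    by (rule Collect_cong) (metis gf DiffD1)
  have k': "gv ` ends G (fe e) = fv ` ends G (fe e)" if "e \<in> edges G'" for e
    using contractionD(3)[OF C] that by (intro gf) auto
  have f: "{u\<in>verts G. gv u = v} = {u\<in>verts G. fv u = v}" for v using assms(3) by auto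
  have m: "gv (mark G i) = fv (mark G i)" if "i \<in> {1..n}" for i
    using assms(3) wf_mark[OF wf that] by blast
  show ?thesis
    using C unfolding contraction_def i k f by (simp add: assms(3,4) k' m)
qed

lemma contraction_weight_sum:
  assumes wf: "wf_wgraph n G" and C: "contraction n G fv fe G'" and A: "A \<subseteq> verts G'"
  shows "(\<Sum>v\<in>A. weight G' v) + card {u\<in>verts G. fv u \<in> A} =
    (\<Sum>u | u \<in> verts G \<and> fv u \<in> A. weight G u)
    + card {e \<in> edges G - fe ` edges G'. fv ` ends G e \<subseteq> A} + card A"
proof -
  let ?F = "edges G - fe ` edges G'"
  have fA: "finite A" using A wf_finite[OF contraction_wf[OF wf C]] finite_subset by blast
  have K: "card {e\<in>?F. fv ` ends G e \<subseteq> A} = (\<Sum>v\<in>A. card {e\<in>?F. fv ` ends G e = {v}})"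
  proof -
    have "fv ` ends G e \<subseteq> A \<longleftrightarrow> (\<exists>v\<in>A. fv ` ends G e = {v})" if e: "e \<in> ?F" for e
    proof -
      obtain a b where ab: "ends G e = {a, b}" using wf_ends[OF wf, of e] e by blast
      then have "fv ` ends G e = {fv a}" using contracted_edge_const[OF wf C e] by auto
      then show ?thesis by simp
    qed
    then have "{e\<in>?F. fv ` ends G e \<subseteq> A} = (\<Union>v\<in>A. {e\<in>?F. fv ` ends G e = {v}})"
      by (rule Collect_bex_eq_UN)
    also have "card \<dots> = (\<Sum>v\<in>A. card {e\<in>?F. fv ` ends G e = {v}})"
      using fA wf_finite(2)[OF wf] by (intro card_UN_disjoint) auto
    finally show ?thesis .
  qed
  have "(\<Sum>v\<in>A. weight G' v + card {u\<in>verts G. fv u = v}) =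
     (\<Sum>v\<in>A. (\<Sum>u | u \<in> verts G \<and> fv u = v. weight G u) + card {e\<in>?F. fv ` ends G e = {v}} + 1)"
    using contractionD(6)[OF C] A by (intro sum.cong) auto
  then show ?thesis
    unfolding sum.distrib K sum_fibres[OF wf_finite(1)[OF wf] fA] card_fibres[OF wf_finite(1)[OF wf] fA]
    by simp
qed

text \<open>
  Composition and cancellation in one statement: once \<open>G'\<close> is a contraction of
  \<open>G\<close>, the contractions of \<open>G'\<close> are the contractions of \<open>G\<close> that factor.
\<close>

lemma contraction_comp_iff:
  assumes wf: "wf_wgraph n G" and C: "contraction n G fv fe G'" and sub: "ge ` edges G'' \<subseteq> edges G'"
  shows "contraction n G' gv ge G'' \<longleftrightarrow> contraction n G (gv \<circ> fv) (fe \<circ> ge) G''"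
proof -
  let ?F1 = "edges G - fe ` edges G'" and ?F2 = "edges G' - ge ` edges G''"
  let ?F = "edges G - (fe \<circ> ge) ` edges G''"
  have inj: "inj_on fe (edges G')" and feE: "fe ` edges G' \<subseteq> edges G" using contractionD[OF C] by auto
  have wf': "wf_wgraph n G'" using contraction_wf[OF wf C] .
  have V': "verts G' = fv ` verts G" using contractionD(1)[OF C] by simp
  have F: "?F = ?F1 \<union> fe ` ?F2"
    using inj feE sub by (auto simp: inj_on_def)
  have c2: "inj_on ge (edges G'') \<longleftrightarrow> inj_on (fe \<circ> ge) (edges G'')"
    using inj sub comp_inj_on[of ge "edges G''" fe] inj_on_imageI2[of fe ge "edges G''"]
    by (meson inj_on_subset)
  have c3: "(fe \<circ> ge) ` edges G'' \<subseteq> edges G" using sub feE by auto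
  have c4: "gv ` ends G' (ge e) = (gv \<circ> fv) ` ends G ((fe \<circ> ge) e)" if "e \<in> edges G''" for e
  proof -
    have "ends G' (ge e) = fv ` ends G (fe (ge e))" using contractionD(4)[OF C, of "ge e"] that sub by blast
    then show ?thesis by (simp add: image_comp)
  qed
  have c5: "(\<forall>u\<in>verts G'. \<forall>v\<in>verts G'. gv u = gv v \<longleftrightarrow> reach G' ?F2 u v) \<longleftrightarrow>
      (\<forall>u\<in>verts G. \<forall>v\<in>verts G. (gv \<circ> fv) u = (gv \<circ> fv) v \<longleftrightarrow> reach G ?F u v)"
    using contraction_reach[OF wf C, of ?F2] unfolding F V' by auto
  have fib: "{u\<in>verts G. (gv \<circ> fv) u = z} = {u\<in>verts G. fv u \<in> {v\<in>verts G'. gv v = z}}" for z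
    using V' by auto
  have edge: "card {e\<in>?F. (gv \<circ> fv) ` ends G e = {z}} =
      card {e\<in>?F1. fv ` ends G e \<subseteq> {v\<in>verts G'. gv v = z}} + card {e\<in>?F2. gv ` ends G' e = {z}}" for z
  proof -
    have "{e\<in>?F. (gv \<circ> fv) ` ends G e = {z}} =
      {e\<in>?F1. fv ` ends G e \<subseteq> {v\<in>verts G'. gv v = z}} \<union> fe ` {e\<in>?F2. gv ` ends G' e = {z}}"
      (is "_ = ?A \<union> ?B")
    proof -
      have P1: "(gv \<circ> fv) ` ends G e = {z} \<longleftrightarrow> fv ` ends G e \<subseteq> {v\<in>verts G'. gv v = z}" if e: "e \<in> ?F1" for e
      proof -
        obtain a b where "ends G e = {a, b}" "a \<in> verts G" "b \<in> verts G"
          using wf_ends[OF wf, of e] e by blast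
        then show ?thesis using V' by auto
      qed
      have P2: "(gv \<circ> fv) ` ends G (fe e) = gv ` ends G' e" if "e \<in> ?F2" for e
      proof -
        have "ends G' e = fv ` ends G (fe e)" using contractionD(4)[OF C, of e] that by blast
        then show ?thesis by (simp add: image_comp)
      qed
      have "{e\<in>?F1. (gv \<circ> fv) ` ends G e = {z}} = ?A"
        by (rule Collect_cong) (use P1 in blast)
      moreover have "{e\<in>fe ` ?F2. (gv \<circ> fv) ` ends G e = {z}} = ?B"
      proof (intro set_eqI iffI)
        fix x assume "x \<in> {e\<in>fe ` ?F2. (gv \<circ> fv) ` ends G e = {z}}"
        then obtain e where "e \<in> ?F2" "x = fe e" "(gv \<circ> fv) ` ends G (fe e) = {z}" by blast
        then show "x \<in> ?B" using P2 by blast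
      next
        fix x assume "x \<in> ?B"
        then obtain e where "e \<in> ?F2" "x = fe e" "gv ` ends G' e = {z}" by blast
        then show "x \<in> {e\<in>fe ` ?F2. (gv \<circ> fv) ` ends G e = {z}}" using P2 by blast
      qed
      moreover have "{e\<in>?F. (gv \<circ> fv) ` ends G e = {z}} =
        {e\<in>?F1. (gv \<circ> fv) ` ends G e = {z}} \<union> {e\<in>fe ` ?F2. (gv \<circ> fv) ` ends G e = {z}}"
        unfolding F by blast
      ultimately show ?thesis by simp
    qed
    moreover have "card (?A \<union> ?B) = card ?A + card ?B"
      using wf_finite[OF wf] wf_finite[OF wf'] by (intro card_Un_disjoint) auto
    moreover have "card ?B = card {e\<in>?F2. gv ` ends G' e = {z}}"
      using inj by (intro card_image) (auto simp: inj_on_def)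
    ultimately show ?thesis by simp
  qed
  have c6: "weight G'' z + card {u\<in>verts G'. gv u = z} =
        (\<Sum>u | u \<in> verts G' \<and> gv u = z. weight G' u) + card {e\<in>?F2. gv ` ends G' e = {z}} + 1
    \<longleftrightarrow> weight G'' z + card {u\<in>verts G. (gv \<circ> fv) u = z} =
        (\<Sum>u | u \<in> verts G \<and> (gv \<circ> fv) u = z. weight G u) + card {e\<in>?F. (gv \<circ> fv) ` ends G e = {z}} + 1" for z
    unfolding edge fib using contraction_weight_sum[OF wf C, of "{v\<in>verts G'. gv v = z}"] by auto
  have c7: "(\<Sum>u | u \<in> verts G' \<and> gv u = z. deg G' u) = (\<Sum>u | u \<in> verts G \<and> (gv \<circ> fv) u = z. deg G u)" for z
  proof -
    have "(\<Sum>u | u \<in> verts G' \<and> gv u = z. deg G' u) =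
        (\<Sum>v\<in>{v\<in>verts G'. gv v = z}. \<Sum>u | u \<in> verts G \<and> fv u = v. deg G u)"
      using contractionD(7)[OF C] by (intro sum.cong) auto
    also have "\<dots> = (\<Sum>u | u \<in> verts G \<and> fv u \<in> {v\<in>verts G'. gv v = z}. deg G u)"
      using wf_finite(1)[OF wf] wf_finite(1)[OF wf'] by (intro sum_fibres[symmetric]) auto
    finally show ?thesis unfolding fib .
  qed
  have c8: "gv (mark G' i) = (gv \<circ> fv) (mark G i)" if "i \<in> {1..n}" for i
    using contractionD(8)[OF C that] by simp
  have c1: "gv ` verts G' = (gv \<circ> fv) ` verts G" unfolding V' by (simp add: image_comp)
  show ?thesis
    unfolding contraction_def c1 c2 c5 c6 c7 using c3 sub c4 c8 by auto
qed

lemma contraction_comp: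
  assumes "wf_wgraph n G" "contraction n G fv fe G'" "contraction n G' gv ge G''"
  shows "contraction n G (gv \<circ> fv) (fe \<circ> ge) G''"
  using contraction_comp_iff[OF assms(1,2) contractionD(3)[OF assms(3)]] assms(3) by blast

text \<open>
  The fibres of the first contraction are contained in those of the second, so the maps exist, and
  the composition lemma, read backwards, shows that they form a contraction.
\<close>

lemma contraction_factor:
  assumes wf: "wf_wgraph n G" and C: "contraction n G fv fe G'" and D: "contraction n G hv he N"
    and sub: "he ` edges N \<subseteq> fe ` edges G'"
  obtains gv ge where "contraction n G' gv ge N" "\<And>v. v \<in> verts G \<Longrightarrow> gv (fv v) = hv v"
    "\<And>e. e \<in> edges N \<Longrightarrow> fe (ge e) = he e"
proof -
  define gv where "gv = hv \<circ> inv_into (verts G) fv"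
  define ge where "ge = inv_into (edges G') fe \<circ> he"
  have gv: "gv (fv v) = hv v" if v: "v \<in> verts G" for v
  proof -
    let ?u = "inv_into (verts G) fv (fv v)"
    have u: "?u \<in> verts G" "fv ?u = fv v" using v by (auto intro: inv_into_into f_inv_into_f)
    then have "reach G (edges G - fe ` edges G') ?u v" using contractionD(5)[OF C u(1) v] by simp
    then have "reach G (edges G - he ` edges N) ?u v" using sub by (auto intro: reach_mono)
    then show ?thesis using contractionD(5)[OF D u(1) v] by (simp add: gv_def)
  qed
  have ge: "fe (ge e) = he e" "ge e \<in> edges G'" if "e \<in> edges N" for e
    using sub that by (auto simp: ge_def intro!: f_inv_into_f inv_into_into)
  have "contraction n G (gv \<circ> fv) (fe \<circ> ge) N"
    by (rule contraction_cong[OF wf D]) (use gv ge in auto)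
  then have "contraction n G' gv ge N"
    using contraction_comp_iff[OF wf C, of ge N gv] ge by blast
  then show ?thesis using that gv ge by blast
qed

lemma reach_empty [simp]: "reach G {} u v \<longleftrightarrow> u = v"
  by (auto simp: adj_def)

lemma graph_iso_contraction:
  assumes wf: "wf_wgraph n G" and I: "graph_iso n G fv fe G'"
  shows "contraction n G fv fe G'"
proof -
  have b: "bij_betw fv (verts G) (verts G')" "bij_betw fe (edges G') (edges G)"
    using I by (auto simp: graph_iso_def)
  then have F: "edges G - fe ` edges G' = {}" by (auto simp: bij_betw_def)
  have fib: "{u\<in>verts G. fv u = fv v} = {v}" if "v \<in> verts G" for v
    using b(1) that by (auto simp: bij_betw_def inj_on_def)
  have V: "verts G' = fv ` verts G" using b by (auto simp: bij_betw_def)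
  have c6: "weight G' v + card {u\<in>verts G. fv u = v} =
      (\<Sum>u | u \<in> verts G \<and> fv u = v. weight G u) + card {e\<in>{}. fv ` ends G e = {v}} + 1"
    and c7: "deg G' v = (\<Sum>u | u \<in> verts G \<and> fv u = v. deg G u)" if v: "v \<in> verts G'" for v
  proof -
    obtain u where u: "u \<in> verts G" "v = fv u" using v V by blast
    show "weight G' v + card {u\<in>verts G. fv u = v} =
      (\<Sum>u | u \<in> verts G \<and> fv u = v. weight G u) + card {e\<in>{}. fv ` ends G e = {v}} + 1"
      and "deg G' v = (\<Sum>u | u \<in> verts G \<and> fv u = v. deg G u)"
      unfolding u(2) fib[OF u(1)] using I u(1) by (simp_all add: graph_iso_def)
  qed
  have c5: "\<forall>u\<in>verts G. \<forall>v\<in>verts G. fv u = fv v \<longleftrightarrow> reach G {} u v"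
    using b(1) by (auto simp: bij_betw_def inj_on_def)
  show ?thesis
    unfolding contraction_def F using I b c5 c6 c7
    by (simp add: graph_iso_def bij_betw_def)
qed

lemma contraction_graph_iso:
  assumes wf: "wf_wgraph n G" and C: "contraction n G fv fe G'" and e: "edges G \<subseteq> fe ` edges G'"
  shows "graph_iso n G fv fe G'"
proof -
  have F: "edges G - fe ` edges G' = {}" using e by auto
  have inj: "inj_on fv (verts G)" using contractionD(5)[OF C] unfolding F by (auto simp: inj_on_def)
  have fib: "{u\<in>verts G. fv u = fv v} = {v}" if "v \<in> verts G" for v
    using inj that by (auto simp: inj_on_def)
  have "weight G' (fv v) = weight G v \<and> deg G' (fv v) = deg G v" if v: "v \<in> verts G" for v
  proof -
    have v': "fv v \<in> verts G'" using v contractionD(1)[OF C] by auto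
    show ?thesis using contractionD(6,7)[OF C v'] unfolding F fib[OF v] by simp
  qed
  then show ?thesis
    using contractionD[OF C] inj e unfolding graph_iso_def bij_betw_def by auto
qed

lemma contract_edge_contraction:
  assumes wf: "wf_wgraph n G" and e: "e \<in> edges G"
  shows "contraction n G (contract_vert G e) id (contract_edge G e)"
proof -
  obtain a b where ab: "ends G e = {a, b}" "a \<in> verts G" "b \<in> verts G"
    using wf_edge_obtain[OF wf e] .
  define m where "m = Min (ends G e)"
  have m: "m = a \<or> m = b" unfolding m_def ab(1) by (auto simp: min_def)
  let ?c = "contract_vert G e" and ?G = "contract_edge G e"
  have c: "?c v = (if v = a \<or> v = b then m else v)" for v by (simp add: contract_vert_def ab(1) m_def)
  have F: "edges G - id ` edges ?G = {e}" using e by (auto simp: contract_edge_def)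
  have r: "reach G {e} u v \<longleftrightarrow> u = v \<or> (u = a \<and> v = b) \<or> (u = b \<and> v = a)" for u v
    using reach_insert[OF ab(1), where F = "{}"] by auto
  have w: "weight ?G v + card {u\<in>verts G. ?c u = v} =
        (\<Sum>u | u \<in> verts G \<and> ?c u = v. weight G u) + card {f \<in> {e}. ?c ` ends G f = {v}} + 1"
    if v: "v \<in> verts ?G" for v
  proof (cases "v = m")
    case True
    have "{u\<in>verts G. ?c u = v} = {a, b}" using True m ab by (auto simp: c)
    moreover have "{f \<in> {e}. ?c ` ends G f = {v}} = {e}" using True ab by (auto simp: c)
    moreover have "(ends G e = {v}) = (a = b)" using True m ab by auto
    ultimately show ?thesis by (cases "a = b") (simp_all add: contract_edge_def)
  next
    case False
    then have "{u\<in>verts G. ?c u = v} = {v}" using v by (auto simp: c contract_edge_def split: if_splits)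
    moreover have "{f \<in> {e}. ?c ` ends G f = {v}} = {}" using False ab by (auto simp: c)
    moreover have "ends G e \<noteq> {v}" using False m ab by auto
    ultimately show ?thesis by (simp add: contract_edge_def)
  qed
  have c5: "\<forall>u\<in>verts G. \<forall>v\<in>verts G. ?c u = ?c v \<longleftrightarrow> u = v \<or> (u = a \<and> v = b) \<or> (u = b \<and> v = a)"
    using m by (auto simp: c)
  show ?thesis
    unfolding contraction_def F r using w c5
    by (simp add: contract_edge_def)
qed

lemma contraction_genus_one:
  assumes wf: "wf_wgraph n G" and C: "contraction n G fv fe G'"
  shows "genus_one_graph n d G' \<longleftrightarrow> genus_one_graph n d G"
proof -
  let ?F = "edges G - fe ` edges G'"
  have wf': "wf_wgraph n G'" using contraction_wf[OF wf C] .
  have V': "verts G' = fv ` verts G" using contractionD(1)[OF C] by simp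
  have full: "?F \<union> fe ` edges G' = edges G" using contractionD(3)[OF C] by auto
  have con: "connected_wgraph G' \<longleftrightarrow> connected_wgraph G"
    unfolding connected_wgraph_def V' using contraction_reach[OF wf C, of "edges G'"] full by auto
  have cE: "card (edges G) = card ?F + card (edges G')"
  proof -
    have "card (?F \<union> fe ` edges G') = card ?F + card (fe ` edges G')"
      using wf_finite[OF wf] wf_finite[OF wf'] by (intro card_Un_disjoint) auto
    then show ?thesis using full card_image[OF contractionD(2)[OF C]] by simp
  qed
  have "{e\<in>?F. fv ` ends G e \<subseteq> verts G'} = ?F" using wf_edge(1)[OF wf] V' by fastforce
  moreover have "{u\<in>verts G. fv u \<in> verts G'} = verts G" using V' by auto
  ultimately have W: "(\<Sum>v\<in>verts G'. weight G' v) + card (verts G) =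
      (\<Sum>u\<in>verts G. weight G u) + card ?F + card (verts G')"
    using contraction_weight_sum[OF wf C, of "verts G'"] by simp
  have D: "(\<Sum>v\<in>verts G'. deg G' v) = (\<Sum>u\<in>verts G. deg G u)"
  proof -
    have "(\<Sum>v\<in>verts G'. deg G' v) = (\<Sum>v\<in>verts G'. \<Sum>u | u \<in> verts G \<and> fv u = v. deg G u)"
      using contractionD(7)[OF C] by (intro sum.cong) auto
    also have "\<dots> = (\<Sum>u\<in>verts G. deg G u)"
      using wf_finite[OF wf] wf_finite[OF wf'] V' by (intro sum.group) auto
    finally show ?thesis .
  qed
  show ?thesis unfolding genus_one_graph_iff using wf wf' con cE W D by auto
qed

definition half_edges :: "wgraph \<Rightarrow> nat \<Rightarrow> nat \<Rightarrow> nat" where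
  "half_edges G e v = of_bool (v \<in> ends G e) + of_bool (ends G e = {v})"

lemma half_edges_eq: "ends G e = {a, b} \<Longrightarrow> half_edges G e v = of_bool (v = a) + of_bool (v = b)"
  by (auto simp: half_edges_def)

lemma valence_eq: "finite (edges G) \<Longrightarrow> valence G v = (\<Sum>e\<in>edges G. half_edges G e v)"
  by (simp add: valence_def half_edges_def sum.distrib Int_def conj_commute flip: of_nat_id)

text \<open>
  Each half-edge is counted at the image of its vertex; a contracted edge contributes two half-edges
  to one fibre.
\<close>

lemma contraction_valence:
  assumes wf: "wf_wgraph n G" and C: "contraction n G fv fe G'"
  shows "(\<Sum>u | u \<in> verts G \<and> fv u = v'. valence G u) =
    valence G' v' + 2 * card {e \<in> edges G - fe ` edges G'. fv ` ends G e = {v'}}"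
proof -
  let ?F = "edges G - fe ` edges G'"
  have fin: "finite (verts G)" "finite (edges G)" "finite (edges G')"
    using wf_finite[OF wf] wf_finite[OF contraction_wf[OF wf C]] by auto
  have half: "(\<Sum>u | u \<in> verts G \<and> fv u = v'. half_edges G e u) = of_bool (fv a = v') + of_bool (fv b = v')"
    if e: "e \<in> edges G" "ends G e = {a, b}" for e a b
  proof -
    have "a \<in> verts G" "b \<in> verts G" using wf_edge(1)[OF wf e(1)] e by auto
    then show ?thesis using fin by (simp add: half_edges_eq[OF e(2)] sum.distrib of_bool_def)
  qed
  have "(\<Sum>u | u \<in> verts G \<and> fv u = v'. valence G u)
      = (\<Sum>e\<in>edges G. \<Sum>u | u \<in> verts G \<and> fv u = v'. half_edges G e u)"
    unfolding valence_eq[OF fin(2)] by (rule sum.swap)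
  also have "\<dots> = (\<Sum>e\<in>?F. \<Sum>u | u \<in> verts G \<and> fv u = v'. half_edges G e u)
      + (\<Sum>e\<in>fe ` edges G'. \<Sum>u | u \<in> verts G \<and> fv u = v'. half_edges G e u)"
    using fin contractionD(3)[OF C] by (simp add: sum.subset_diff add.commute)
  also have "(\<Sum>e\<in>?F. \<Sum>u | u \<in> verts G \<and> fv u = v'. half_edges G e u)
      = (\<Sum>e\<in>?F. 2 * of_bool (fv ` ends G e = {v'}))"
  proof (rule sum.cong)
    fix e assume e: "e \<in> ?F"
    obtain a b where ab: "ends G e = {a, b}" using wf_ends[OF wf, of e] e by blast
    show "(\<Sum>u | u \<in> verts G \<and> fv u = v'. half_edges G e u) = 2 * of_bool (fv ` ends G e = {v'})"
      using half[of e a b] contracted_edge_const[OF wf C e ab] ab e by auto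
  qed simp
  also have "\<dots> = 2 * card {e \<in> ?F. fv ` ends G e = {v'}}"
    using fin by (simp add: sum_distrib_left[symmetric] Int_def conj_commute)
  also have "(\<Sum>e\<in>fe ` edges G'. \<Sum>u | u \<in> verts G \<and> fv u = v'. half_edges G e u)
      = (\<Sum>e\<in>edges G'. half_edges G' e v')"
    unfolding sum.reindex[OF contractionD(2)[OF C]]
  proof (rule sum.cong)
    fix e assume e: "e \<in> edges G'"
    then have fe: "fe e \<in> edges G" using contractionD(3)[OF C] by auto
    obtain a b where ab: "ends G (fe e) = {a, b}" using wf_ends[OF wf fe] by blast
    then have "ends G' e = {fv a, fv b}" using contractionD(4)[OF C e] by simp
    then show "((\<lambda>e. \<Sum>u | u \<in> verts G \<and> fv u = v'. half_edges G e u) \<circ> fe) e = half_edges G' e v'"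
      using half[OF fe ab] by (auto simp: half_edges_eq)
  qed simp
  also have "\<dots> = valence G' v'" using valence_eq[OF fin(3)] by simp
  finally show ?thesis by simp
qed

text \<open>The quantity that stability requires to be positive is additive over fibres.\<close>

definition vertex_excess :: "nat \<Rightarrow> wgraph \<Rightarrow> nat \<Rightarrow> int" where
  "vertex_excess n G v =
     2 * int (weight G v) - 2 + int (valence G v) + int (card {i\<in>{1..n}. mark G i = v})"

lemma contraction_excess:
  assumes wf: "wf_wgraph n G" and C: "contraction n G fv fe G'" and v: "v' \<in> verts G'"
  shows "vertex_excess n G' v' = (\<Sum>u | u \<in> verts G \<and> fv u = v'. vertex_excess n G u)"
proof -
  let ?A = "{u\<in>verts G. fv u = v'}"
  have fin: "finite ?A" using wf_finite[OF wf] by simp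
  have "{i\<in>{1..n}. mark G' i = v'} = {i\<in>{1..n}. mark G i \<in> ?A}"
    using contractionD(8)[OF C] wf by (auto simp: wf_wgraph_def)
  then have m: "card {i\<in>{1..n}. mark G' i = v'} = (\<Sum>u\<in>?A. card {i\<in>{1..n}. mark G i = u})"
    using card_fibres[OF _ fin, of "{1..n}" "mark G"] by simp
  have s: "(\<Sum>u\<in>?A. vertex_excess n G u) = 2 * int (\<Sum>u\<in>?A. weight G u) - 2 * int (card ?A)
      + int (\<Sum>u\<in>?A. valence G u) + int (\<Sum>u\<in>?A. card {i\<in>{1..n}. mark G i = u})"
    unfolding vertex_excess_def by (simp add: sum.distrib sum_subtractf sum_distrib_left)
  show ?thesis
    unfolding s unfolding contraction_valence[OF wf C] m[symmetric] unfolding vertex_excess_def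
    using arg_cong[OF contractionD(6)[OF C v], of int] by simp
qed

lemma stable_iff: "stable n G \<longleftrightarrow> (\<forall>v\<in>verts G. deg G v = 0 \<longrightarrow> vertex_excess n G v > 0)"
  by (simp add: stable_def vertex_excess_def)

lemma contraction_stable:
  assumes wf: "wf_wgraph n G" and C: "contraction n G fv fe G'" and s: "stable n G"
  shows "stable n G'"
  unfolding stable_iff
proof (intro ballI impI)
  fix v' assume v: "v' \<in> verts G'" "deg G' v' = 0"
  have fin: "finite {u\<in>verts G. fv u = v'}" using wf_finite[OF wf] by simp
  have "\<forall>u\<in>{u\<in>verts G. fv u = v'}. deg G u = 0" using contractionD(7)[OF C v(1)] v(2) fin by simp
  then have pos: "\<forall>u\<in>{u\<in>verts G. fv u = v'}. vertex_excess n G u > 0" using s by (auto simp: stable_iff)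
  have "{u\<in>verts G. fv u = v'} \<noteq> {}" using v(1) unfolding contractionD(1)[OF C, symmetric] by blast
  then show "vertex_excess n G' v' > 0"
    unfolding contraction_excess[OF wf C v(1)] using pos fin by (intro sum_pos) auto
qed

lemma stable_graphs_wf: "G \<in> stable_graphs n d \<Longrightarrow> wf_wgraph n G"
  by (auto simp: stable_graphs_def genus_one_graph_def)

lemma stable_graphs_genus: "G \<in> stable_graphs n d \<Longrightarrow> genus_one_graph n d G"
  by (auto simp: stable_graphs_def)

lemma contraction_stable_graphs:
  assumes "G \<in> stable_graphs n d" "contraction n G fv fe G'"
  shows "G' \<in> stable_graphs n d"
  using assms contraction_stable contraction_genus_one stable_graphs_wf
  unfolding stable_graphs_def by blast

lemma graph_mor_contraction:
  assumes "graph_mor n d G f G'"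
  shows "G \<in> stable_graphs n d \<and> G' \<in> stable_graphs n d \<and> contraction n G (fst f) (snd f) G'"
  using assms
proof (induction rule: graph_mor.induct)
  case (iso G G' fv fe)
  then show ?case using graph_iso_contraction stable_graphs_wf by auto
next
  case (contract G e)
  then show ?case unfolding fst_conv snd_conv using contract_edge_contraction stable_graphs_wf by blast
next
  case (comp G fv fe G' gv ge G'')
  then show ?case unfolding fst_conv snd_conv using contraction_comp stable_graphs_wf by blast
qed

lemma contract_edges_exists:
  assumes "G \<in> stable_graphs n d" "F \<subseteq> edges G"
  shows "\<exists>fv N. graph_mor n d G (fv, id) N \<and> edges N = edges G - F"
proof -
  have "finite F" using assms wf_finite stable_graphs_wf finite_subset by metis
  then show ?thesis using assms
  proof (induction F arbitrary: G rule: finite_induct)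
    case empty
    have "graph_iso n G id id G" by (simp add: graph_iso_def)
    then show ?case using empty graph_mor.iso by fastforce
  next
    case (insert e F)
    let ?G = "contract_edge G e"
    have wf: "wf_wgraph n G" using insert stable_graphs_wf by blast
    have e: "e \<in> edges G" using insert by blast
    have st: "?G \<in> stable_graphs n d"
      using contraction_stable_graphs[OF _ contract_edge_contraction[OF wf e]] insert by blast
    have E: "edges ?G = edges G - {e}" by (simp add: contract_edge_def)
    then obtain fv N where N: "graph_mor n d ?G (fv, id) N" "edges N = edges ?G - F"
      using insert.IH[OF st] insert by blast
    have "graph_mor n d G (fv \<circ> contract_vert G e, id \<circ> id) N"
      using graph_mor.comp[OF graph_mor.contract N(1)] insert st e by blast
    moreover have "edges N = edges G - insert e F" using N E by auto
    ultimately show ?case by (metis id_comp)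
  qed
qed

text \<open>
  Contract the same edges one at a time. The given contraction factors through the result, and the
  second factor contracts nothing, so it is an isomorphism.
\<close>

lemma contraction_graph_mor:
  assumes G: "G \<in> stable_graphs n d" and C: "contraction n G fv fe G'"
  obtains gv ge where "graph_mor n d G (gv, ge) G'" "\<And>v. v \<in> verts G \<Longrightarrow> gv v = fv v"
    "\<And>e. e \<in> edges G' \<Longrightarrow> ge e = fe e"
proof -
  have wf: "wf_wgraph n G" using stable_graphs_wf[OF G] .
  obtain hv N where N: "graph_mor n d G (hv, id) N" "edges N = edges G - (edges G - fe ` edges G')"
    using contract_edges_exists[OF G, of "edges G - fe ` edges G'"] by blast
  then have EN: "edges N = fe ` edges G'" using contractionD(3)[OF C] by auto
  have CN: "contraction n G hv id N" and stN: "N \<in> stable_graphs n d" using graph_mor_contraction[OF N(1)] by auto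
  obtain gv ge where g: "contraction n N gv ge G'" "\<And>v. v \<in> verts G \<Longrightarrow> gv (hv v) = fv v"
      "\<And>e. e \<in> edges G' \<Longrightarrow> id (ge e) = fe e"
    using contraction_factor[OF wf CN C] EN by auto
  have "edges N \<subseteq> ge ` edges G'" using g(3) EN by auto
  then have "graph_iso n N gv ge G'" using contraction_graph_iso[OF stable_graphs_wf[OF stN] g(1)] by blast
  then have "graph_mor n d N (gv, ge) G'"
    using graph_mor.iso stN contraction_stable_graphs[OF G C] by blast
  then have "graph_mor n d G (gv \<circ> hv, id \<circ> ge) G'" using graph_mor.comp N(1) by blast
  then show ?thesis using that g by auto
qed

section \<open>The core and distances under contraction\<close>

lemma cycle_edges_iff:
  assumes "ends G e = {a, b}"
  shows "e \<in> cycle_edges G \<longleftrightarrow> e \<in> edges G \<and> reach G (edges G - {e}) a b"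
proof
  assume "e \<in> cycle_edges G"
  then obtain p q where pq: "e \<in> edges G" "ends G e = {p, q}" "reach G (edges G - {e}) p q"
    by (auto simp: cycle_edges_def)
  then have "(p = a \<and> q = b) \<or> (p = b \<and> q = a)" using assms by (auto simp: doubleton_eq_iff)
  then show "e \<in> edges G \<and> reach G (edges G - {e}) a b" using pq reach_sym by auto
qed (use assms in \<open>auto simp: cycle_edges_def\<close>)

lemma contraction_remove_edge:
  assumes C: "contraction n G fv fe G'" and e: "e \<in> edges G'"
  shows "(edges G - fe ` edges G') \<union> fe ` (edges G' - {e}) = edges G - {fe e}"
  using contractionD(2,3)[OF C] e by (auto simp: inj_on_def)

lemma cycle_edges_contraction:
  assumes wf: "wf_wgraph n G" and C: "contraction n G fv fe G'" and e: "e \<in> edges G'"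
  shows "e \<in> cycle_edges G' \<longleftrightarrow> fe e \<in> cycle_edges G"
proof -
  have fe: "fe e \<in> edges G" using contractionD(3)[OF C] e by blast
  obtain a b where ab: "ends G (fe e) = {a, b}" "a \<in> verts G" "b \<in> verts G" using wf_ends[OF wf fe] by blast
  have "ends G' e = {fv a, fv b}" using contractionD(4)[OF C e] ab by simp
  then have "e \<in> cycle_edges G' \<longleftrightarrow> reach G' (edges G' - {e}) (fv a) (fv b)"
    using cycle_edges_iff e by simp
  also have "\<dots> \<longleftrightarrow> reach G (edges G - {fe e}) a b"
    using contraction_reach[OF wf C _ ab(2,3), of "edges G' - {e}"] contraction_remove_edge[OF C e] by simp
  finally show ?thesis using cycle_edges_iff[OF ab(1)] fe by simp
qed

lemma core_edges_contraction:
  assumes G: "genus_one_graph n d G" and C: "contraction n G fv fe G'" and e: "e \<in> edges G'"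
  shows "e \<in> core_edges G' \<longleftrightarrow> fe e \<in> core_edges G"
proof -
  have wf: "wf_wgraph n G" using genus_one_wf[OF G] .
  have G': "genus_one_graph n d G'" using contraction_genus_one[OF wf C] G by simp
  show ?thesis using cycle_edges_contraction[OF wf C e] core_eq(1)[OF G] core_eq(1)[OF G'] by simp
qed

text \<open>
  The second edge is the one by which a path from \<open>b\<close> that avoids \<open>e\<close> first arrives at
  \<open>a\<close>.
\<close>

lemma cycle_edges_next:
  assumes e: "e \<in> cycle_edges G" "ends G e = {a, b}" "a \<noteq> b"
  shows "\<exists>g\<in>cycle_edges G. g \<noteq> e \<and> a \<in> ends G g"
proof -
  have r: "reach G (edges G - {e}) b a" using cycle_edges_iff[OF e(2)] e(1) reach_sym by blast
  have "b \<noteq> a" using e(3) by simp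
  from reach_first_hit[OF r this] obtain f y where f: "f \<in> edges G - {e}" "ends G f = {y, a}"
      "reach G {h \<in> edges G - {e}. a \<notin> ends G h} b y"
    by blast
  have "e \<in> edges G" using e(1) by (simp add: cycle_edges_def)
  then have ab: "reach G (edges G - {f}) b a"
    using f e(2) by (intro reach_edge[of e]) (auto simp: insert_commute)
  have "reach G (edges G - {f}) b y" using f(2,3) by (auto intro: reach_mono)
  then have "reach G (edges G - {f}) y a" using ab reach_sym rtrancl_trans by metis
  then have "f \<in> cycle_edges G" using cycle_edges_iff[OF f(2)] f(1) by simp
  then show ?thesis using f by (intro bexI[of _ f]) auto
qed

lemma sum_pos_obtain:
  assumes "(\<Sum>x\<in>A. f x) > (0 :: nat)"
  obtains x where "x \<in> A" "f x > 0"
  using assms by (metis neq0_conv sum.neutral)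

text \<open>
  The vertex onto which a cycle edge is contracted stays in the core: if the edge is a loop, the
  vertex acquires weight, and otherwise the cycle passes through it along the next edge.
\<close>

lemma core_verts_contract_edge:
  assumes G: "genus_one_graph n d G" and e: "e \<in> edges G"
  shows "core_verts (contract_edge G e) = contract_vert G e ` core_verts G"
proof -
  let ?H = "contract_edge G e" and ?c = "contract_vert G e"
  have wf: "wf_wgraph n G" using genus_one_wf[OF G] .
  have C: "contraction n G ?c id ?H" using contract_edge_contraction[OF wf e] .
  have H: "genus_one_graph n d ?H" using contraction_genus_one[OF wf C] G by simp
  have V: "verts ?H = ?c ` verts G" and E: "edges ?H = edges G - {e}"
    and ends: "\<And>f. ends ?H f = ?c ` ends G f" by (simp_all add: contract_edge_def)
  have cyc: "f \<in> cycle_edges ?H \<longleftrightarrow> f \<in> cycle_edges G" if "f \<in> edges G" "f \<noteq> e" for f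
    using cycle_edges_contraction[OF wf C, of f] E that by simp
  have fin: "finite (verts G)" using wf_finite[OF wf] by blast
  obtain a b where ab: "ends G e = {a, b}" "a \<in> verts G" "b \<in> verts G" using wf_ends[OF wf e] by blast
  have cab: "?c a = ?c b" using ab by (simp add: contract_vert_def)
  note core = core_eq(2)[OF G] and coreH = core_eq(2)[OF H]
  show ?thesis
  proof (intro set_eqI iffI)
    fix x assume "x \<in> ?c ` core_verts G"
    then obtain v where v: "x = ?c v" "v \<in> core_verts G" by blast
    then have vV: "v \<in> verts G" using core_subset(2)[OF G] by blast
    then have xV: "x \<in> verts ?H" using v V by blast
    consider "weight G v > 0" | f where "f \<in> cycle_edges G" "v \<in> ends G f" "f \<noteq> e"
      | "e \<in> cycle_edges G" "v \<in> ends G e"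
    proof -
      have "weight G v > 0 \<or> (\<exists>f\<in>cycle_edges G. v \<in> ends G f)" using v(2) unfolding core by blast
      then show ?thesis using that by blast
    qed
    then show "x \<in> core_verts ?H"
    proof cases
      case 1
      have "weight G v \<le> (\<Sum>u | u \<in> verts G \<and> ?c u = x. weight G u)"
        using fin vV v by (intro member_le_sum) auto
      then have "weight ?H x > 0" using 1 by (simp add: contract_edge_def)
      then show ?thesis using coreH xV by simp
    next
      case 2
      then have "f \<in> cycle_edges ?H" using cyc by (simp add: cycle_edges_def)
      moreover have "x \<in> ends ?H f" using 2 v ends by blast
      ultimately show ?thesis using coreH by blast
    next
      case 3
      show ?thesis
      proof (cases "a = b")
        case True
        then have "x = a" using 3 v ab by (simp add: contract_vert_def)
        then have "weight ?H x > 0" using True ab by (simp add: contract_edge_def)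
        then show ?thesis using coreH xV by simp
      next
        case False
        then obtain g where g: "g \<in> cycle_edges G" "g \<noteq> e" "a \<in> ends G g"
          using cycle_edges_next[OF 3(1) ab(1)] by blast
        have "x = ?c a" using 3(2) v ab cab by auto
        then have "x \<in> ends ?H g" using g ends by blast
        moreover have "g \<in> cycle_edges ?H" using g cyc by (simp add: cycle_edges_def)
        ultimately show ?thesis using coreH by blast
      qed
    qed
  next
    fix x assume x: "x \<in> core_verts ?H"
    then have xV: "x \<in> verts ?H" using core_subset(2)[OF H] by blast
    consider "weight ?H x > 0" | f where "f \<in> cycle_edges ?H" "x \<in> ends ?H f" 
    proof -
      have "weight ?H x > 0 \<or> (\<exists>f\<in>cycle_edges ?H. x \<in> ends ?H f)" using x unfolding coreH by blast
      then show ?thesis using that by blast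
    qed
    then show "x \<in> ?c ` core_verts G"
    proof cases
      case 1
      show ?thesis
      proof (cases "ends G e = {x}")
        case True
        then have "a = x" "b = x" using ab(1) by auto
        then have "e \<in> cycle_edges G" using cycle_edges_iff[OF ab(1)] e by simp
        then have "x \<in> core_verts G" using core True by blast
        moreover have "?c x = x" using True by (simp add: contract_vert_def)
        ultimately show ?thesis by (metis imageI)
      next
        case False
        then have "(\<Sum>u | u \<in> verts G \<and> ?c u = x. weight G u) > 0" using 1 by (simp add: contract_edge_def)
        then obtain u where "u \<in> {u\<in>verts G. ?c u = x}" "weight G u > 0" by (rule sum_pos_obtain)
        then show ?thesis using core by blast
      qed
    next
      case 2
      then have fE: "f \<in> edges G" "f \<noteq> e" using E by (auto simp: cycle_edges_def)
      then have "f \<in> cycle_edges G" using cyc 2 by blast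
      moreover obtain y where "x = ?c y" "y \<in> ends G f" using 2(2) ends by blast
      ultimately show ?thesis using core by blast
    qed
  qed
qed

lemma core_verts_graph_iso:
  assumes G: "genus_one_graph n d G" and I: "graph_iso n G fv fe G'"
  shows "core_verts G' = fv ` core_verts G"
proof -
  have wf: "wf_wgraph n G" using genus_one_wf[OF G] .
  have C: "contraction n G fv fe G'" using graph_iso_contraction[OF wf I] .
  have G': "genus_one_graph n d G'" using contraction_genus_one[OF wf C] G by simp
  have V: "verts G' = fv ` verts G" and E: "edges G = fe ` edges G'"
    using I by (auto simp: graph_iso_def bij_betw_def)
  have w: "weight G' (fv v) = weight G v" if "v \<in> verts G" for v using I that by (simp add: graph_iso_def)
  have "{v\<in>verts G'. weight G' v > 0} = fv ` {v\<in>verts G. weight G v > 0}"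
    unfolding V using w by auto
  moreover have "\<Union> (ends G' ` cycle_edges G') = fv ` \<Union> (ends G ` cycle_edges G)"
  proof -
    have sub: "cycle_edges G' \<subseteq> edges G'" by (auto simp: cycle_edges_def)
    have "cycle_edges G = fe ` cycle_edges G'"
    proof (intro set_eqI iffI)
      fix x assume x: "x \<in> cycle_edges G"
      then have "x \<in> fe ` edges G'" unfolding E[symmetric] by (simp add: cycle_edges_def)
      then show "x \<in> fe ` cycle_edges G'" using cycle_edges_contraction[OF wf C] x by blast
    next
      fix x assume "x \<in> fe ` cycle_edges G'"
      then show "x \<in> cycle_edges G" using cycle_edges_contraction[OF wf C] sub by blast
    qed
    then have "\<Union> (ends G ` cycle_edges G) = (\<Union>e\<in>cycle_edges G'. ends G (fe e))" by simp
    then have "fv ` \<Union> (ends G ` cycle_edges G) = (\<Union>e\<in>cycle_edges G'. fv ` ends G (fe e))"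
      by (simp add: image_UN)
    also have "\<dots> = (\<Union>e\<in>cycle_edges G'. ends G' e)"
      using contractionD(4)[OF C] sub by (intro SUP_cong) auto
    finally show ?thesis by simp
  qed
  ultimately show ?thesis unfolding core_eq(2)[OF G] core_eq(2)[OF G'] by (simp add: image_Un)
qed

lemma core_verts_graph_mor:
  assumes "graph_mor n d G f G'"
  shows "core_verts G' = fst f ` core_verts G"
  using assms
proof (induction rule: graph_mor.induct)
  case (iso G G' fv fe)
  then show ?case using core_verts_graph_iso[OF stable_graphs_genus[OF iso(1)] iso(3)] by simp
next
  case (contract G e)
  then show ?case using core_verts_contract_edge[OF stable_graphs_genus[OF contract(1)] contract(3)] by simp
next
  case (comp G fv fe G' gv ge G'')
  then show ?case by (simp add: image_comp)
qed

text \<open>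
  Reduced to a single edge, where it is easy to see which vertices remain on the cycle.
\<close>

lemma core_verts_contraction:
  assumes G: "G \<in> stable_graphs n d" and C: "contraction n G fv fe G'"
  shows "core_verts G' = fv ` core_verts G"
proof -
  obtain gv ge where g: "graph_mor n d G (gv, ge) G'" "\<And>v. v \<in> verts G \<Longrightarrow> gv v = fv v"
    using contraction_graph_mor[OF G C] by metis
  then show ?thesis
    using core_verts_graph_mor[OF g(1)] core_subset(2)[OF stable_graphs_genus[OF G]] by (auto simp: subset_iff)
qed

text \<open>
  The direction of an edge says which of its ends is still connected to the core after its removal,
  and paths avoiding the edge can be pushed forward and lifted.
\<close>

lemma directed_contraction:
  assumes G: "G \<in> stable_graphs n d" and C: "contraction n G fv fe G'"
    and e: "e \<in> edges G'" "ends G (fe e) = {v, w}"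
  shows "directed G' e (fv v) (fv w) \<longleftrightarrow> directed G (fe e) v w"
proof -
  have wf: "wf_wgraph n G" using stable_graphs_wf[OF G] .
  have fe: "fe e \<in> edges G" using contractionD(3)[OF C] e by blast
  have side: "fv x \<in> (adj G' (edges G' - {e}))\<^sup>* `` core_verts G' \<longleftrightarrow>
      x \<in> (adj G (edges G - {fe e}))\<^sup>* `` core_verts G" if x: "x \<in> verts G" for x
  proof -
    have "reach G' (edges G' - {e}) (fv u) (fv x) \<longleftrightarrow> reach G (edges G - {fe e}) u x"
      if "u \<in> core_verts G" for u
      using contraction_reach[OF wf C, of "edges G' - {e}" u x] contraction_remove_edge[OF C e(1)]
        core_subset(2)[OF stable_graphs_genus[OF G]] x that by auto
    then show ?thesis unfolding core_verts_contraction[OF G C] by auto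
  qed
  have vw: "v \<in> verts G" "w \<in> verts G" using wf_edge(1)[OF wf fe] e by auto
  have "ends G' e = {fv v, fv w}" using contractionD(4)[OF C e(1)] e(2) by simp
  then show ?thesis
    unfolding directed_def side[OF vw(1)] side[OF vw(2)]
    using core_edges_contraction[OF stable_graphs_genus[OF G] C e(1)] e fe by simp
qed

lemma directed_lift:
  assumes G: "G \<in> stable_graphs n d" and C: "contraction n G fv fe G'" and e: "directed G' e v' w'"
  obtains v w where "directed G (fe e) v w" "fv v = v'" "fv w = w'"
proof -
  have eE: "e \<in> edges G'" using directedD(1)[OF e] .
  then have fe: "fe e \<in> edges G" using contractionD(3)[OF C] by blast
  obtain a b where ab: "ends G (fe e) = {a, b}" using wf_ends[OF stable_graphs_wf[OF G] fe] by blast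
  have "{fv a, fv b} = {v', w'}" using contractionD(4)[OF C eE] ab directedD(3)[OF e] by simp
  then consider "fv a = v'" "fv b = w'" | "fv b = v'" "fv a = w'" by (auto simp: doubleton_eq_iff)
  then show ?thesis
  proof cases
    case 1
    then show ?thesis using that directed_contraction[OF G C eE ab] e by blast
  next
    case 2
    moreover have "ends G (fe e) = {b, a}" using ab by (simp add: insert_commute)
    ultimately show ?thesis using that directed_contraction[OF G C eE, of b a] e by blast
  qed
qed

lemma walk_append: "walk G u es v \<Longrightarrow> walk G v fs w \<Longrightarrow> walk G u (es @ fs) w"
  by (induction rule: walk.induct) (auto intro: walk.intros)

lemma walk_edges: "walk G u es v \<Longrightarrow> set es \<subseteq> edges G"
  by (induction rule: walk.induct) auto

lemma reach_walk:
  assumes wf: "wf_wgraph n G" and r: "reach G (edges G) u v" and v: "v \<in> verts G"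
  shows "\<exists>es. walk G u es v"
  using r
proof (induction rule: converse_rtrancl_induct)
  case base
  then show ?case using v walk.Nil by blast
next
  case (step y z)
  then show ?case by (auto simp: adj_def intro: walk.Cons)
qed

text \<open>
  The first step from the side of the core to the other side uses \<open>e\<close>, and it starts at
  \<open>v\<close>.
\<close>

lemma walk_through_bridge:
  assumes "walk G u es x" "directed G e v w"
    and "\<exists>c\<in>core_verts G. reach G (edges G - {e}) c u" "\<not> (\<exists>c\<in>core_verts G. reach G (edges G - {e}) c x)"
    and "v \<in> verts G"
  shows "\<exists>es1 es2. es = es1 @ e # es2 \<and> walk G u es1 v"
  using assms(1,3,4)
proof (induction rule: walk.induct)
  case (Nil v)
  then show ?case by blast
next
  case (Cons f p q es x)
  show ?case
  proof (cases "f = e")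
    case True
    then have "{p, q} = {v, w}" using Cons directedD(3)[OF assms(2)] by simp
    moreover have "p \<noteq> w" using Cons(5) directedD(5)[OF assms(2)] by blast
    ultimately have "p = v" by (auto simp: doubleton_eq_iff)
    then have "f # es = [] @ e # es \<and> walk G p [] v" using True walk.Nil assms(5) by auto
    then show ?thesis by blast
  next
    case False
    then have "reach G (edges G - {e}) p q" using Cons by (intro reach_edge) auto
    then have "\<exists>c\<in>core_verts G. reach G (edges G - {e}) c q" using Cons(5) rtrancl_trans by metis
    then obtain es1 es2 where "es = es1 @ e # es2" "walk G q es1 v" using Cons.IH Cons.prems by blast
    then have "f # es = (f # es1) @ e # es2 \<and> walk G p (f # es1) v" using Cons walk.Cons by auto
    then show ?thesis by blast
  qed
qed

lemma walk_length_nonneg: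
  assumes "\<forall>e\<in>edges G. 0 \<le> (l e :: real)" "walk G u es v"
  shows "0 \<le> sum_list (map l es)"
  using walk_edges[OF assms(2)] assms(1) by (intro sum_list_nonneg) auto

lemma dist_core_le:
  assumes "\<forall>e\<in>edges G. 0 \<le> l e" "u \<in> core_verts G" "walk G u es v"
  shows "dist_core G l v \<le> sum_list (map l es)"
  unfolding dist_core_def
proof (rule cInf_lower)
  show "bdd_below {sum_list (map l es) | u es. u \<in> core_verts G \<and> walk G u es v}"
    using walk_length_nonneg[OF assms(1)] by (intro bdd_belowI[of _ 0]) auto
qed (use assms in blast)

lemma dist_core_ge:
  assumes G: "genus_one_graph n d G" and v: "v \<in> verts G"
    and x: "\<And>u es. u \<in> core_verts G \<Longrightarrow> walk G u es v \<Longrightarrow> x \<le> sum_list (map l es)"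
  shows "x \<le> dist_core G l v"
  unfolding dist_core_def
proof (rule cInf_greatest)
  obtain u where u: "u \<in> core_verts G" using core_verts_nonempty[OF G] by blast
  then have "reach G (edges G) u v" using connected_reach[OF G] v core_subset(2)[OF G] by blast
  then obtain es where "walk G u es v" using reach_walk[OF genus_one_wf[OF G]] v by blast
  then show "{sum_list (map l es) | u es. u \<in> core_verts G \<and> walk G u es v} \<noteq> {}" using u by blast
qed (use x in blast)

lemma dist_core_core:
  assumes G: "genus_one_graph n d G" and l: "\<forall>e\<in>edges G. 0 \<le> l e" and v: "v \<in> core_verts G"
  shows "dist_core G l v = 0"
proof (rule antisym)
  have vV: "v \<in> verts G" using v core_subset(2)[OF G] by blast
  show "dist_core G l v \<le> 0" using dist_core_le[OF l v walk.Nil[OF vV]] by simp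
  show "0 \<le> dist_core G l v" using dist_core_ge[OF G vV] walk_length_nonneg[OF l] by blast
qed

lemma dist_core_directed:
  assumes G: "genus_one_graph n d G" and l: "\<forall>e\<in>edges G. 0 \<le> l e" and e: "directed G e v w"
  shows "dist_core G l w = dist_core G l v + l e"
proof (rule antisym)
  have vw: "v \<in> verts G" "w \<in> verts G" using directed_verts[OF genus_one_wf[OF G] e] by auto
  have we: "walk G v [e] w" using walk.Cons[OF directedD(1,3)[OF e] walk.Nil[OF vw(2)]] .
  have "dist_core G l w - l e \<le> dist_core G l v"
  proof (rule dist_core_ge[OF G vw(1)])
    fix u es assume "u \<in> core_verts G" "walk G u es v"
    then show "dist_core G l w - l e \<le> sum_list (map l es)"
      using dist_core_le[OF l, of u "es @ [e]" w] walk_append[OF _ we] by fastforce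
  qed
  then show "dist_core G l w \<le> dist_core G l v + l e" by simp
  show "dist_core G l v + l e \<le> dist_core G l w"
  proof (rule dist_core_ge[OF G vw(2)])
    fix u es assume u: "u \<in> core_verts G" "walk G u es w"
    then obtain es1 es2 where es: "es = es1 @ e # es2" "walk G u es1 v"
      using walk_through_bridge[OF u(2) e] directedD(5)[OF e] vw by blast
    have "0 \<le> sum_list (map l es2)"
      using walk_edges[OF u(2)] es l by (intro sum_list_nonneg) auto
    then show "dist_core G l v + l e \<le> sum_list (map l es)"
      using dist_core_le[OF l u(1) es(2)] es by simp
  qed
qed

text \<open>
  Distances from the core are determined by their increments along the directed edges, so any
  function with these increments that vanishes on the core computes them.
\<close>

lemma dist_core_unique:
  assumes G: "genus_one_graph n d G" and l: "\<forall>e\<in>edges G. 0 \<le> l e"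
    and core: "\<And>v. v \<in> core_verts G \<Longrightarrow> g v = 0"
    and step: "\<And>e v w. directed G e v w \<Longrightarrow> g w = g v + l e"
    and v: "v \<in> verts G"
  shows "dist_core G l v = g v"
proof -
  obtain u where u: "u \<in> core_verts G" using core_verts_nonempty[OF G] by blast
  then have "reach G (edges G) u v" using connected_reach[OF G] v core_subset(2)[OF G] by blast
  then show ?thesis
  proof (induction rule: rtrancl_induct)
    case base
    then show ?case using dist_core_core[OF G l u] core[OF u] by simp
  next
    case (step y z)
    then obtain f where f: "f \<in> edges G" "ends G f = {y, z}" by (auto simp: adj_def)
    show ?case
    proof (cases "f \<in> core_edges G")
      case True
      then have "z \<in> core_verts G" using core_subset(3)[OF G True] f by auto
      then show ?thesis using dist_core_core[OF G l] core by simp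
    next
      case False
      then have "directed G f y z \<or> directed G f z y" using noncore_directed[OF G] f by blast
      then show ?thesis using dist_core_directed[OF G l] assms(4) step.IH by force
    qed
  qed
qed

text \<open>
  The distance in \<open>G'\<close>, pulled back to \<open>G\<close>, has the increments required in \<open>G\<close>:
  contracted edges have length zero and their ends have the same image.
\<close>

lemma dist_core_contraction:
  assumes G: "G \<in> stable_graphs n d" and C: "contraction n G fv fe G'"
    and l': "\<forall>e\<in>edges G'. 0 \<le> l' e" and eq: "\<And>e. e \<in> edges G' \<Longrightarrow> l (fe e) = l' e"
    and zero: "\<And>e. e \<in> edges G - fe ` edges G' \<Longrightarrow> l e = 0" and v: "v \<in> verts G"
  shows "dist_core G l v = dist_core G' l' (fv v)"
proof (rule dist_core_unique[OF stable_graphs_genus[OF G] _ _ _ v, where g = "\<lambda>v. dist_core G' l' (fv v)"])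
  have G': "genus_one_graph n d G'"
    using contraction_genus_one[OF stable_graphs_wf[OF G] C] stable_graphs_genus[OF G] by simp
  show "\<forall>e\<in>edges G. 0 \<le> l e"
  proof
    fix e assume "e \<in> edges G"
    then show "0 \<le> l e" using zero[of e] eq l' by (cases "e \<in> fe ` edges G'") auto
  qed
  show "dist_core G' l' (fv v) = 0" if "v \<in> core_verts G" for v
    using dist_core_core[OF G' l'] core_verts_contraction[OF G C] that by blast
  show "dist_core G' l' (fv w) = dist_core G' l' (fv v) + l e" if e: "directed G e v w" for e v w
  proof (cases "e \<in> fe ` edges G'")
    case True
    then obtain f where f: "f \<in> edges G'" "e = fe f" by blast
    then have "directed G' f (fv v) (fv w)"
      using directed_contraction[OF G C f(1)] directedD(3)[OF e] e by blast
    then show ?thesis using dist_core_directed[OF G' l'] eq f by simp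
  next
    case False
    then have "e \<in> edges G - fe ` edges G'" using directedD(1)[OF e] by blast
    then show ?thesis
      using contracted_edge_const[OF stable_graphs_wf[OF G] C _ directedD(3)[OF e]] zero by simp
  qed
qed

section \<open>Ties at the minimal distance\<close>

text \<open>
  The condition that the total degree at the smallest level carrying any degree exceeds one,
  for an arbitrary level function. It is inherited along monotone reparametrisations.
\<close>

definition tied :: "wgraph \<Rightarrow> (nat \<Rightarrow> 'a :: linorder) \<Rightarrow> bool" where
  "tied G g \<longleftrightarrow> (\<exists>m. (\<forall>v\<in>verts G. deg G v > 0 \<longrightarrow> m \<le> g v) \<and>
     1 < (\<Sum>v | v \<in> verts G \<and> g v = m. deg G v))"

lemma tied_mono:
  fixes g :: "nat \<Rightarrow> 'a :: linorder" and h :: "nat \<Rightarrow> 'b :: linorder"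
  assumes fin: "finite (verts G)" and t: "tied G g"
    and mono: "\<And>u v. \<lbrakk>u \<in> verts G; v \<in> verts G; deg G u > 0; deg G v > 0; g u \<le> g v\<rbrakk> \<Longrightarrow> h u \<le> h v"
  shows "tied G h"
proof -
  from t obtain m where m: "\<forall>v\<in>verts G. deg G v > 0 \<longrightarrow> m \<le> g v"
      "1 < (\<Sum>v | v \<in> verts G \<and> g v = m. deg G v)" by (auto simp: tied_def)
  let ?A = "{v \<in> verts G. g v = m \<and> deg G v > 0}"
  have s: "(\<Sum>v | v \<in> verts G \<and> g v = m. deg G v) = (\<Sum>v\<in>?A. deg G v)"
    using fin by (intro sum.mono_neutral_right) auto
  have "?A \<noteq> {}"
  proof
    assume "?A = {}"
    then show False using m(2) unfolding s by simp
  qed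
  then obtain v0 where v0: "v0 \<in> verts G" "g v0 = m" "deg G v0 > 0" by blast
  have "?A \<subseteq> {v \<in> verts G. h v = h v0}"
  proof
    fix v assume v: "v \<in> ?A"
    then have "h v \<le> h v0" "h v0 \<le> h v" using v0 by (auto intro!: mono)
    then show "v \<in> {v \<in> verts G. h v = h v0}" using v by auto
  qed
  then have "(\<Sum>v\<in>?A. deg G v) \<le> (\<Sum>v | v \<in> verts G \<and> h v = h v0. deg G v)"
    using fin by (intro sum_mono2) auto
  moreover have "\<forall>v\<in>verts G. deg G v > 0 \<longrightarrow> h v0 \<le> h v" using m(1) v0 by (auto intro!: mono)
  ultimately have "(\<forall>v\<in>verts G. deg G v > 0 \<longrightarrow> h v0 \<le> h v) \<and>
      1 < (\<Sum>v | v \<in> verts G \<and> h v = h v0. deg G v)" using m(2) s by linarith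
  then show ?thesis unfolding tied_def by (rule exI)
qed

lemma tied_contraction:
  assumes wf: "wf_wgraph n G" and C: "contraction n G fv fe G'"
  shows "tied G (\<lambda>v. g (fv v)) \<longleftrightarrow> tied G' g"
proof -
  have fin: "finite (verts G)" "finite (verts G')"
    using wf_finite[OF wf] wf_finite[OF contraction_wf[OF wf C]] by auto
  have V: "verts G' = fv ` verts G" using contractionD(1)[OF C] by simp
  have "(\<Sum>v | v \<in> verts G \<and> g (fv v) = m. deg G v) = (\<Sum>v | v \<in> verts G' \<and> g v = m. deg G' v)" for m
  proof -
    have "{v\<in>verts G. g (fv v) = m} = {v\<in>verts G. fv v \<in> {w\<in>verts G'. g w = m}}" using V by auto
    then have "(\<Sum>v | v \<in> verts G \<and> g (fv v) = m. deg G v) =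
        (\<Sum>v | v \<in> verts G \<and> fv v \<in> {w\<in>verts G'. g w = m}. deg G v)" by simp
    also have "\<dots> = (\<Sum>w\<in>{w\<in>verts G'. g w = m}. \<Sum>u | u \<in> verts G \<and> fv u = w. deg G u)"
      using fin by (intro sum_fibres) auto
    also have "\<dots> = (\<Sum>w\<in>{w\<in>verts G'. g w = m}. deg G' w)"
      using contractionD(7)[OF C] by (intro sum.cong) auto
    finally show ?thesis .
  qed
  moreover have "(\<forall>v\<in>verts G. deg G v > 0 \<longrightarrow> m \<le> g (fv v)) \<longleftrightarrow> (\<forall>v\<in>verts G'. deg G' v > 0 \<longrightarrow> m \<le> g v)" for m
  proof -
    have 1: "deg G' (fv v) > 0 \<longleftrightarrow> (\<exists>u\<in>verts G. fv u = fv v \<and> deg G u > 0)" if "v \<in> verts G" for v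
    proof -
      have "deg G' (fv v) = (\<Sum>u | u \<in> verts G \<and> fv u = fv v. deg G u)"
        using contractionD(7)[OF C, of "fv v"] V that by blast
      then have "deg G' (fv v) = 0 \<longleftrightarrow> (\<forall>u\<in>{u\<in>verts G. fv u = fv v}. deg G u = 0)"
        using fin by simp
      then show ?thesis by auto
    qed
    show ?thesis
    proof
      assume L: "\<forall>v\<in>verts G. deg G v > 0 \<longrightarrow> m \<le> g (fv v)"
      show "\<forall>v\<in>verts G'. deg G' v > 0 \<longrightarrow> m \<le> g v"
      proof (intro ballI impI)
        fix v' assume v': "v' \<in> verts G'" "deg G' v' > 0"
        then obtain v where v: "v \<in> verts G" "v' = fv v" using V by blast
        then obtain u where "u \<in> verts G" "fv u = v'" "deg G u > 0" using 1[OF v(1)] v' by auto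
        then show "m \<le> g v'" using L by auto
      qed
    next
      assume R: "\<forall>v\<in>verts G'. deg G' v > 0 \<longrightarrow> m \<le> g v"
      show "\<forall>v\<in>verts G. deg G v > 0 \<longrightarrow> m \<le> g (fv v)"
      proof (intro ballI impI)
        fix v assume v: "v \<in> verts G" "deg G v > 0"
        then have "deg G' (fv v) > 0" using 1 by blast
        then show "m \<le> g (fv v)" using R V v by blast
      qed
    qed
  qed
  ultimately show ?thesis unfolding tied_def by simp
qed

lemma d_min_tied:
  assumes fin: "finite (verts G)" and deg: "(\<Sum>v\<in>verts G. deg G v) > 0"
  shows "d_min G \<rho> > 1 \<longleftrightarrow> tied G \<rho>"
proof
  obtain v0 where v0: "v0 \<in> verts G" "deg G v0 > 0" using deg by (rule sum_pos_obtain)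
  have pos: "level_deg G \<rho> (\<rho> v) \<noteq> 0" if "v \<in> verts G" "deg G v > 0" for v
    using that fin by (auto simp: level_deg_def)
  have "level_deg G \<rho> (rad G \<rho>) \<noteq> 0" unfolding rad_def by (rule LeastI, rule pos[OF v0])
  have low: "rad G \<rho> \<le> \<rho> v" if "v \<in> verts G" "deg G v > 0" for v
    unfolding rad_def using pos[OF that] by (rule Least_le)
  show "tied G \<rho>" if "d_min G \<rho> > 1"
    using that low unfolding tied_def d_min_def level_deg_def by blast
  assume "tied G \<rho>"
  then obtain m where m: "\<forall>v\<in>verts G. deg G v > 0 \<longrightarrow> m \<le> \<rho> v" "1 < level_deg G \<rho> m"
    by (auto simp: tied_def level_deg_def)
  have "rad G \<rho> \<le> m" unfolding rad_def using m(2) by (intro Least_le) simp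
  moreover have "m \<le> rad G \<rho>"
  proof -
    have "(\<Sum>v | v \<in> verts G \<and> \<rho> v = rad G \<rho>. deg G v) > 0"
      using \<open>level_deg G \<rho> (rad G \<rho>) \<noteq> 0\<close> by (simp add: level_deg_def)
    then obtain v where v: "v \<in> {v\<in>verts G. \<rho> v = rad G \<rho>}" "deg G v > 0" by (rule sum_pos_obtain)
    then have "m \<le> \<rho> v" using m(1) by blast
    then show ?thesis using v by simp
  qed
  ultimately show "d_min G \<rho> > 1" using m(2) by (simp add: d_min_def)
qed

lemma canonical_alignment_less:
  assumes fin: "finite (verts G)" and uv: "u \<in> verts G" "v \<in> verts G"
  shows "canonical_alignment G l u < canonical_alignment G l v \<longleftrightarrow> dist_core G l u < dist_core G l v"
proof -
  let ?D = "dist_core G l ` verts G"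
  have lt: "card (?D \<inter> {..<dist_core G l u}) < card (?D \<inter> {..<dist_core G l v})"
    if "u \<in> verts G" "dist_core G l u < dist_core G l v" for u v
    using fin that by (intro psubset_card_mono) auto
  show ?thesis
  proof
    assume c: "canonical_alignment G l u < canonical_alignment G l v"
    show "dist_core G l u < dist_core G l v"
    proof (rule ccontr)
      assume "\<not> ?thesis"
      then have "{..<dist_core G l v} \<subseteq> {..<dist_core G l u}" by auto
      then have "card (?D \<inter> {..<dist_core G l v}) \<le> card (?D \<inter> {..<dist_core G l u})"
        using fin by (intro card_mono) auto
      then show False using c by (simp add: canonical_alignment_def)
    qed
  qed (use lt uv in \<open>simp add: canonical_alignment_def\<close>)
qed

lemma canonical_alignment_le:
  assumes "finite (verts G)" "u \<in> verts G" "v \<in> verts G"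
  shows "canonical_alignment G l u \<le> canonical_alignment G l v \<longleftrightarrow> dist_core G l u \<le> dist_core G l v"
  using canonical_alignment_less[OF assms(1,3,2), of l] by (simp add: not_less[symmetric])

lemma tied_canonical_alignment:
  assumes fin: "finite (verts G)"
  shows "tied G (canonical_alignment G l) \<longleftrightarrow> tied G (dist_core G l)"
proof
  assume t: "tied G (canonical_alignment G l)"
  show "tied G (dist_core G l)"
    by (rule tied_mono[OF fin t]) (simp add: canonical_alignment_le[OF fin])
next
  assume t: "tied G (dist_core G l)"
  show "tied G (canonical_alignment G l)"
    by (rule tied_mono[OF fin t]) (simp add: canonical_alignment_le[OF fin])
qed

section \<open>Colimits and simplices\<close>

lemma topspace_length_simplex:
  "topspace (length_simplex S) = {l \<in> extensional S. (\<forall>s\<in>S. 0 \<le> l s) \<and> (\<Sum>s\<in>S. l s) = 1}"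
  by (auto simp: length_simplex_def PiE_def)

lemma continuous_map_length_simplex:
  "continuous_map X (length_simplex S) f \<longleftrightarrow>
     f \<in> topspace X \<rightarrow> topspace (length_simplex S) \<and> (\<forall>s\<in>S. continuous_map X euclideanreal (\<lambda>x. f x s))"
proof -
  have t: "topspace (length_simplex S) = extensional S \<inter> {l. (\<forall>s\<in>S. 0 \<le> l s) \<and> (\<Sum>s\<in>S. l s) = 1}"
    by (auto simp: topspace_length_simplex)
  show ?thesis
    unfolding t unfolding length_simplex_def continuous_map_in_subtopology continuous_map_componentwise
      image_subset_iff Pi_iff Int_iff by blast
qed

lemma Hausdorff_length_simplex: "Hausdorff_space (length_simplex S)"
  by (simp add: length_simplex_def Hausdorff_space_subtopology Hausdorff_space_product_topology)

lemma compact_length_simplex: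
  assumes "finite S"
  shows "compact_space (length_simplex S)"
proof -
  let ?P = "powertop_real S"
  have c: "compactin ?P (PiE S (\<lambda>_. {0..1}))"
    by (simp add: compactin_PiE compactin_euclidean_iff)
  have "continuous_map ?P euclideanreal (\<lambda>l. \<Sum>s\<in>S. l s)"
    using assms by (intro continuous_map_sum continuous_map_product_projection) auto
  then have "closedin ?P {l \<in> topspace ?P. (\<Sum>s\<in>S. l s) \<in> {1}}"
    by (rule closedin_continuous_map_preimage) simp
  from closed_Int_compactin[OF this c]
  have "compactin ?P ({l \<in> topspace ?P. (\<Sum>s\<in>S. l s) \<in> {1}} \<inter> PiE S (\<lambda>_. {0..1}))" .
  also have "{l \<in> topspace ?P. (\<Sum>s\<in>S. l s) \<in> {1}} \<inter> PiE S (\<lambda>_. {0..1}) = topspace (length_simplex S)"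
  proof -
    have "l s \<le> 1" if "\<forall>s\<in>S. 0 \<le> l s" "(\<Sum>s\<in>S. l s) = 1" "s \<in> S" for l :: "'a \<Rightarrow> real" and s
      using member_le_sum[of s S l] that assms by auto
    then show ?thesis unfolding topspace_length_simplex by (auto simp: PiE_def Pi_def)
  qed
  finally show ?thesis
    unfolding compact_space_def by (simp add: length_simplex_def compactin_subtopology)
qed

lemma extend_zero_image:
  assumes "inj_on j S'" "s \<in> S'" "j s \<in> S"
  shows "extend_zero j S' S l (j s) = l s"
  using assms by (simp add: extend_zero_def the_inv_into_f_f)

lemma extend_zero_other: "s \<in> S \<Longrightarrow> s \<notin> j ` S' \<Longrightarrow> extend_zero j S' S l s = 0"
  by (simp add: extend_zero_def)

lemma extend_zero_extensional: "extend_zero j S' S l \<in> extensional S"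
  by (simp add: extend_zero_def)

lemma extend_zero_eqI:
  assumes "inj_on j S'" "j ` S' \<subseteq> S" "m \<in> extensional S"
    "\<And>s. s \<in> S' \<Longrightarrow> m (j s) = l s" "\<And>s. s \<in> S \<Longrightarrow> s \<notin> j ` S' \<Longrightarrow> m s = 0"
  shows "m = extend_zero j S' S l"
proof (rule extensionalityI[OF assms(3) extend_zero_extensional])
  fix s assume s: "s \<in> S"
  show "m s = extend_zero j S' S l s"
  proof (cases "s \<in> j ` S'")
    case True
    then obtain s' where "s' \<in> S'" "s = j s'" by blast
    then show ?thesis using extend_zero_image[OF assms(1)] assms(4) s by metis
  next
    case False
    then show ?thesis using extend_zero_other[OF s False] assms(5)[OF s False] by simp
  qed
qed

lemma extend_zero_sum:
  assumes "inj_on j S'" "j ` S' \<subseteq> S" "finite S"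
    "\<And>s. s \<in> S' \<Longrightarrow> m (j s) = l s" "\<And>s. s \<in> S \<Longrightarrow> s \<notin> j ` S' \<Longrightarrow> m s = 0"
  shows "(\<Sum>s\<in>S. m s) = (\<Sum>s\<in>S'. l s :: real)"
proof -
  have "(\<Sum>s\<in>S. m s) = (\<Sum>s\<in>j ` S'. m s)" using assms by (intro sum.mono_neutral_right) auto
  also have "\<dots> = (\<Sum>s\<in>S'. l s)" using assms by (simp add: sum.reindex)
  finally show ?thesis .
qed

lemma extend_zero_simplex:
  assumes j: "inj_on j S'" "j ` S' \<subseteq> S" "finite S" and l: "l \<in> topspace (length_simplex S')"
  shows "extend_zero j S' S l \<in> topspace (length_simplex S)"
proof -
  have im: "extend_zero j S' S l (j s) = l s" if "s \<in> S'" for s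
    using extend_zero_image[OF j(1) that] j(2) that by blast
  have "0 \<le> extend_zero j S' S l s" if "s \<in> S" for s
    using im extend_zero_other[OF that, of j S' l] l that
    by (cases "s \<in> j ` S'") (auto simp: topspace_length_simplex)
  moreover have "(\<Sum>s\<in>S. extend_zero j S' S l s) = (\<Sum>s\<in>S'. l s)"
    using im extend_zero_other by (intro extend_zero_sum[OF j]) auto
  ultimately show ?thesis
    using l extend_zero_extensional by (auto simp: topspace_length_simplex)
qed

lemma continuous_map_extend_zero:
  assumes j: "inj_on j S'" "j ` S' \<subseteq> S" "finite S"
  shows "continuous_map (length_simplex S') (length_simplex S) (extend_zero j S' S)"
  unfolding continuous_map_length_simplex
proof (intro conjI ballI)
  show "extend_zero j S' S \<in> topspace (length_simplex S') \<rightarrow> topspace (length_simplex S)"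
    using extend_zero_simplex[OF j] by blast
  fix s assume s: "s \<in> S"
  show "continuous_map (length_simplex S') euclideanreal (\<lambda>l. extend_zero j S' S l s)"
  proof (cases "s \<in> j ` S'")
    case True
    then obtain s' where s': "s' \<in> S'" "s = j s'" by blast
    then have "(\<lambda>l. extend_zero j S' S l s) = (\<lambda>l. l s')"
      using extend_zero_image[OF j(1) s'(1)] s by auto
    moreover have "continuous_map (length_simplex S') euclideanreal (\<lambda>l. l s')"
      unfolding length_simplex_def
      by (intro continuous_map_from_subtopology continuous_map_product_projection s'(1))
    ultimately show ?thesis by simp
  next
    case False
    then show ?thesis using extend_zero_other[OF s] by simp
  qed
qed

lemma continuous_map_length_simplex_coordinate:
  "s \<in> S \<Longrightarrow> continuous_map (length_simplex S) euclideanreal (\<lambda>l. l s)"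
  unfolding length_simplex_def by (intro continuous_map_from_subtopology continuous_map_product_projection)

text \<open>
  Under these assumptions every generator of the equivalence relation joins two points of the
  disjoint union, so that a function respecting the generators descends to the colimit.
\<close>

locale space_diagram =
  fixes Ob :: "'o set" and X :: "'o \<Rightarrow> 'x topology"
    and mor :: "'o \<Rightarrow> 'm \<Rightarrow> 'o \<Rightarrow> bool" and act :: "'o \<Rightarrow> 'm \<Rightarrow> 'o \<Rightarrow> 'x \<Rightarrow> 'x"
  assumes mor_dom: "mor G f G' \<Longrightarrow> G \<in> Ob" and mor_cod: "mor G f G' \<Longrightarrow> G' \<in> Ob"
    and act_in: "mor G f G' \<Longrightarrow> x \<in> topspace (X G') \<Longrightarrow> act G f G' x \<in> topspace (X G)"
begin

abbreviation points :: "('o \<times> 'x) set" where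
  "points \<equiv> topspace (sum_topology X Ob)"

abbreviation rel :: "('o \<times> 'x) rel" where
  "rel \<equiv> {((G', x), (G, act G f G' x)) | G f G' x. mor G f G' \<and> x \<in> topspace (X G')}"

abbreviation cls :: "'o \<times> 'x \<Rightarrow> ('o \<times> 'x) set" where
  "cls \<equiv> colim_class Ob X mor act"

lemma colim_equiv_eq: "colim_equiv Ob X mor act = (rel \<union> rel\<inverse>)\<^sup>* \<inter> points \<times> points"
  by (simp add: colim_equiv_def Let_def)

lemma equiv_colim_equiv: "equiv points (colim_equiv Ob X mor act)"
proof (rule equivI)
  show "colim_equiv Ob X mor act \<subseteq> points \<times> points" unfolding colim_equiv_eq by blast
  show "refl_on points (colim_equiv Ob X mor act)"
    unfolding colim_equiv_eq refl_on_def by blast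
  have "sym ((rel \<union> rel\<inverse>)\<^sup>*)" by (intro sym_rtrancl sym_Un_converse)
  then show "sym (colim_equiv Ob X mor act)" unfolding colim_equiv_eq sym_def by blast
  show "trans (colim_equiv Ob X mor act)"
    unfolding colim_equiv_eq trans_def by (blast intro: rtrancl_trans)
qed

lemma cls_eq_iff:
  "p \<in> points \<Longrightarrow> q \<in> points \<Longrightarrow> cls p = cls q \<longleftrightarrow> (p, q) \<in> colim_equiv Ob X mor act"
  unfolding colim_class_def using eq_equiv_class_iff[OF equiv_colim_equiv] by blast

lemma cls_act:
  assumes "mor G f G'" "x \<in> topspace (X G')"
  shows "cls (G', x) = cls (G, act G f G' x)"
proof -
  have "(G', x) \<in> points" "(G, act G f G' x) \<in> points"
    using mor_dom mor_cod act_in assms by auto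
  moreover have "((G', x), (G, act G f G' x)) \<in> rel" using assms by blast
  ultimately show ?thesis unfolding cls_eq_iff[OF \<open>(G', x) \<in> points\<close> \<open>(G, act G f G' x) \<in> points\<close>] colim_equiv_eq
    by (blast intro: r_into_rtrancl)
qed

lemma cls_invariant:
  assumes inv: "\<And>G f G' x. mor G f G' \<Longrightarrow> x \<in> topspace (X G') \<Longrightarrow> h (G', x) = h (G, act G f G' x)"
    and "p \<in> points" "q \<in> points" "cls p = cls q"
  shows "h p = h q"
proof -
  have "(p, q) \<in> (rel \<union> rel\<inverse>)\<^sup>*" using assms(2-4) unfolding cls_eq_iff[OF assms(2,3)] colim_equiv_eq by blast
  then show ?thesis
  proof (induction rule: rtrancl_induct)
    case (step y z)
    then have "h y = h z" using inv by fastforce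
    then show ?case using step.IH by simp
  qed simp
qed

lemma descend_cls:
  assumes inv: "\<And>G f G' x. mor G f G' \<Longrightarrow> x \<in> topspace (X G') \<Longrightarrow> h (G', x) = h (G, act G f G' x)"
    and p: "p \<in> points"
  shows "descend h (cls p) = h p"
proof -
  have "h q = h p" if "q \<in> cls p" for q
  proof -
    have q: "q \<in> points" "(p, q) \<in> colim_equiv Ob X mor act"
      using that unfolding colim_class_def colim_equiv_eq by auto
    then show ?thesis using cls_invariant[where h = h, OF inv p q(1)] cls_eq_iff[OF p q(1)] by simp
  qed
  moreover have "p \<in> cls p" unfolding colim_class_def using equiv_class_self[OF equiv_colim_equiv p] .
  ultimately have "h ` cls p = {h p}" by blast
  then show ?thesis by (simp add: descend_def)
qed

lemma topspace_colimit: "topspace (colimit Ob X mor act) = cls ` points"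
  by (simp add: colimit_def topspace_quotient_topology)

lemma quotient_map_cls: "quotient_map (sum_topology X Ob) (colimit Ob X mor act) cls"
  unfolding colimit_def by (rule quotient_map_quotient_topology)

lemma closedin_colimit:
  assumes "K \<subseteq> topspace (colimit Ob X mor act)"
    and "\<And>G. G \<in> Ob \<Longrightarrow> closedin (X G) {x \<in> topspace (X G). cls (G, x) \<in> K}"
  shows "closedin (colimit Ob X mor act) K"
proof -
  have "closedin (sum_topology X Ob) {p \<in> points. cls p \<in> K}"
    unfolding closedin_sum_topology
  proof (intro conjI ballI)
    fix G assume G: "G \<in> Ob"
    have "{x. (G, x) \<in> {p \<in> points. cls p \<in> K}} = {x \<in> topspace (X G). cls (G, x) \<in> K}"
      using G by auto
    then show "closedin (X G) {x. (G, x) \<in> {p \<in> points. cls p \<in> K}}" using assms(2)[OF G] by simp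
  qed auto
  then show ?thesis using quotient_map_cls assms(1) unfolding quotient_map_closedin by blast
qed

lemma continuous_map_cls:
  assumes "G \<in> Ob"
  shows "continuous_map (X G) (colimit Ob X mor act) (\<lambda>x. cls (G, x))"
  using continuous_map_compose[OF continuous_map_component_injection[OF assms]
      quotient_imp_continuous_map[OF quotient_map_cls]] by (simp add: comp_def)

lemma continuous_map_sum_topology:
  assumes "\<And>G. G \<in> Ob \<Longrightarrow> continuous_map (X G) Y (\<lambda>x. h (G, x))"
  shows "continuous_map (sum_topology X Ob) Y h"
proof -
  have h: "h \<in> points \<rightarrow> topspace Y" using assms continuous_map_funspace by fastforce
  show ?thesis
    unfolding continuous_map_def
  proof (intro conjI allI impI h)
    fix U assume U: "openin Y U"
    show "openin (sum_topology X Ob) {p \<in> points. h p \<in> U}"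
      unfolding openin_sum_topology
    proof (intro conjI ballI)
      fix G assume G: "G \<in> Ob"
      have "{x. (G, x) \<in> {p \<in> points. h p \<in> U}} = {x \<in> topspace (X G). h (G, x) \<in> U}"
        using G by auto
      then show "openin (X G) {x. (G, x) \<in> {p \<in> points. h p \<in> U}}"
        using openin_continuous_map_preimage[OF assms[OF G] U] by simp
    qed auto
  qed
qed

lemma continuous_map_colimit:
  assumes cont: "\<And>G. G \<in> Ob \<Longrightarrow> continuous_map (X G) Y (\<lambda>x. h (G, x))"
    and inv: "\<And>G f G' x. mor G f G' \<Longrightarrow> x \<in> topspace (X G') \<Longrightarrow> h (G', x) = h (G, act G f G' x)"
  shows "continuous_map (colimit Ob X mor act) Y (descend h)"
proof (rule continuous_compose_quotient_map[OF quotient_map_cls])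
  show "continuous_map (sum_topology X Ob) Y (descend h \<circ> cls)"
    by (rule continuous_map_eq[OF continuous_map_sum_topology[OF cont]]) (simp_all add: descend_cls[where h = h, OF inv])
qed

text \<open>Taking the product with a locally compact Hausdorff space preserves the quotient.\<close>

lemma continuous_map_colimit_prod:
  assumes T: "locally_compact_space T" "Hausdorff_space T"
    and cont: "\<And>G. G \<in> Ob \<Longrightarrow> continuous_map (prod_topology (X G) T) Y (\<lambda>(x, t). h t (G, x))"
    and inv: "\<And>G f G' x t. \<lbrakk>mor G f G'; x \<in> topspace (X G'); t \<in> topspace T\<rbrakk> \<Longrightarrow> h t (G', x) = h t (G, act G f G' x)"
  shows "continuous_map (prod_topology (colimit Ob X mor act) T) Y (\<lambda>(p, t). descend (h t) p)"
proof -
  let ?S = "sum_topology X Ob"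
  let ?P = "prod_topology ?S T"
  have q: "quotient_map ?P (prod_topology (colimit Ob X mor act) T) (\<lambda>(p, t). (cls p, t))"
    using quotient_map_prod_left[OF T(1) _ quotient_map_cls] T(2) by blast
  have c: "continuous_map ?P Y (\<lambda>(p, t). h t p)"
  proof (rule pasting_lemma[where I = Ob and T = "\<lambda>G. ({G} \<times> topspace (X G)) \<times> topspace T"
        and f = "\<lambda>G (p, t). h t (G, snd p)"])
    fix G assume G: "G \<in> Ob"
    have open_piece: "openin ?S ({G} \<times> U)" if "openin (X G) U" for U
    proof -
      have "{G} \<times> U = Pair G ` U" by auto
      then show ?thesis
        using open_map_component_injection[OF G, of X] that by (simp add: open_map_def)
    qed
    then have o: "openin ?S ({G} \<times> topspace (X G))" by simp
    then show "openin ?P (({G} \<times> topspace (X G)) \<times> topspace T)" by (simp add: openin_prod_Times_iff)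
    have s: "continuous_map (subtopology ?S ({G} \<times> topspace (X G))) (X G) snd"
      unfolding continuous_map_def
    proof (intro conjI allI impI)
      fix U assume U: "openin (X G) U"
      have "{x \<in> topspace (subtopology ?S ({G} \<times> topspace (X G))). snd x \<in> U} = {G} \<times> U"
        using G openin_subset[OF U] by auto
      moreover have "openin ?S ({G} \<times> U)"
        using open_piece[OF U] .
      ultimately show "openin (subtopology ?S ({G} \<times> topspace (X G)))
          {x \<in> topspace (subtopology ?S ({G} \<times> topspace (X G))). snd x \<in> U}"
        using openin_subset[OF U] by (auto simp: openin_subtopology)
    qed auto
    have sub: "subtopology ?P (({G} \<times> topspace (X G)) \<times> topspace T)
        = prod_topology (subtopology ?S ({G} \<times> topspace (X G))) T"
      by (simp add: subtopology_Times)
    have "continuous_map (prod_topology (subtopology ?S ({G} \<times> topspace (X G))) T) (prod_topology (X G) T)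
        (\<lambda>(p, t). (snd p, t))"
      using s by (simp add: continuous_map_prod_top)
    from continuous_map_compose[OF this cont[OF G]]
    show "continuous_map (subtopology ?P (({G} \<times> topspace (X G)) \<times> topspace T)) Y (\<lambda>(p, t). h t (G, snd p))"
      unfolding sub by (simp add: comp_def case_prod_unfold)
  next
    fix G G' p assume "p \<in> topspace ?P \<inter> ({G} \<times> topspace (X G)) \<times> topspace T \<inter> ({G'} \<times> topspace (X G')) \<times> topspace T"
    then show "(\<lambda>(p, t). h t (G, snd p)) p = (\<lambda>(p, t). h t (G', snd p)) p" by auto
  next
    fix p assume "p \<in> topspace ?P"
    then show "\<exists>G. G \<in> Ob \<and> p \<in> ({G} \<times> topspace (X G)) \<times> topspace T \<and>
        (\<lambda>(p, t). h t p) p = (\<lambda>(p, t). h t (G, snd p)) p" by auto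
  qed
  show ?thesis
  proof (rule continuous_compose_quotient_map[OF q], rule continuous_map_eq[OF c])
    fix p assume p: "p \<in> topspace ?P"
    then have "descend (h (snd p)) (cls (fst p)) = h (snd p) (fst p)"
      by (intro descend_cls inv) (auto simp: topspace_prod_topology)
    then show "(\<lambda>(p, t). h t p) p = ((\<lambda>(p, t). descend (h t) p) \<circ> (\<lambda>(p, t). (cls p, t))) p"
      by (simp add: case_prod_beta)
  qed
qed

end

section \<open>Points of the virtual dual complex\<close>

lemma topspace_kappa:
  "topspace (kappa G) = {l \<in> extensional (edges G). (\<forall>e\<in>edges G. 0 \<le> l e) \<and> (\<Sum>e\<in>edges G. l e) = 1}"
  by (simp add: kappa_def topspace_length_simplex)

lemma graph_mor_inj:
  assumes "graph_mor n d G f G'"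
  shows "G \<in> stable_graphs n d" "G' \<in> stable_graphs n d" "inj_on (snd f) (edges G')"
    "snd f ` edges G' \<subseteq> edges G" "finite (edges G)"
proof -
  have m: "G \<in> stable_graphs n d" "G' \<in> stable_graphs n d" "contraction n G (fst f) (snd f) G'"
    using graph_mor_contraction[OF assms] by auto
  show "G \<in> stable_graphs n d" "G' \<in> stable_graphs n d" by fact+
  show "inj_on (snd f) (edges G')" "snd f ` edges G' \<subseteq> edges G" using contractionD(2,3)[OF m(3)] by auto
  show "finite (edges G)" using wf_finite(2)[OF stable_graphs_wf[OF m(1)]] .
qed

interpretation vir: space_diagram "stable_graphs n d" kappa "graph_mor n d" kappa_incl for n d
proof
  fix G f G' assume m: "graph_mor n d G f G'"
  show "G \<in> stable_graphs n d" "G' \<in> stable_graphs n d" using graph_mor_inj[OF m] by auto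
  show "x \<in> topspace (kappa G') \<Longrightarrow> kappa_incl G f G' x \<in> topspace (kappa G)" for x
    unfolding kappa_def kappa_incl_def using graph_mor_inj[OF m] by (intro extend_zero_simplex) auto
qed

lemma vir_points: "(G, l) \<in> topspace (sum_topology kappa (stable_graphs n d)) \<longleftrightarrow>
    G \<in> stable_graphs n d \<and> l \<in> topspace (kappa G)"
  by auto

lemma vir_class_contraction:
  assumes G: "G \<in> stable_graphs n d" and C: "contraction n G fv fe G'"
    and l': "l' \<in> topspace (kappa G')" and l: "l \<in> extensional (edges G)"
    and eq: "\<And>e. e \<in> edges G' \<Longrightarrow> l (fe e) = l' e"
    and zero: "\<And>e. e \<in> edges G - fe ` edges G' \<Longrightarrow> l e = 0"
  shows "vir_class n d (G, l) = vir_class n d (G', l')"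
proof -
  obtain gv ge where g: "graph_mor n d G (gv, ge) G'" "\<And>e. e \<in> edges G' \<Longrightarrow> ge e = fe e"
    using contraction_graph_mor[OF G C] by metis
  have "ge ` edges G' = fe ` edges G'" using g(2) by auto
  then have "l = kappa_incl G (gv, ge) G' l'"
    unfolding kappa_incl_def using graph_mor_inj[OF g(1)] l eq zero g(2) by (intro extend_zero_eqI) auto
  then show ?thesis using vir.cls_act[OF g(1) l'] by (simp add: vir_class_def)
qed

text \<open>
  The positive forms of a point: the metric graphs with positive lengths obtained by
  contracting its edges of length zero.
\<close>

definition positive_forms :: "nat \<Rightarrow> wgraph \<times> (nat \<Rightarrow> real) \<Rightarrow> (wgraph \<times> (nat \<Rightarrow> real)) set" where
  "positive_forms n = (\<lambda>(G, l). {(N, l0). (\<forall>e\<in>edges N. 0 < l0 e) \<and>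
     (\<exists>fv fe. contraction n G fv fe N \<and> (\<forall>e\<in>edges N. l (fe e) = l0 e) \<and>
       (\<forall>e\<in>edges G - fe ` edges N. l e = 0))})"

lemma positive_forms_iff:
  "(N, l0) \<in> positive_forms n (G, l) \<longleftrightarrow> (\<forall>e\<in>edges N. 0 < l0 e) \<and>
     (\<exists>fv fe. contraction n G fv fe N \<and> (\<forall>e\<in>edges N. l (fe e) = l0 e) \<and>
       (\<forall>e\<in>edges G - fe ` edges N. l e = 0))"
  by (simp add: positive_forms_def)

text \<open>
  Positive forms of \<open>G'\<close> are positive forms of \<open>G\<close> by composition. In the other
  direction, an edge that survives in a positive form has positive length, hence comes from
  \<open>G'\<close>, and the contraction factors.
\<close>

lemma positive_forms_graph_mor:
  assumes m: "graph_mor n d G f G'" and x: "x \<in> topspace (kappa G')"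
  shows "positive_forms n (G', x) = positive_forms n (G, kappa_incl G f G' x)"
proof -
  obtain fv fe where f: "f = (fv, fe)" by force
  have C: "contraction n G fv fe G'" and wf: "wf_wgraph n G"
    using graph_mor_contraction[OF m] stable_graphs_wf f by auto
  define l where "l = kappa_incl G f G' x"
  have leq: "l (fe e) = x e" if "e \<in> edges G'" for e
    unfolding l_def kappa_incl_def f snd_conv
    using contractionD(2,3)[OF C] that by (intro extend_zero_image) auto
  have lzero: "l e = 0" if "e \<in> edges G - fe ` edges G'" for e
    unfolding l_def kappa_incl_def f snd_conv using that by (intro extend_zero_other) auto
  have "(N, l0) \<in> positive_forms n (G', x) \<longleftrightarrow> (N, l0) \<in> positive_forms n (G, l)" for N l0
  proof
    assume "(N, l0) \<in> positive_forms n (G', x)"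
    then obtain gv ge where g: "\<forall>e\<in>edges N. 0 < l0 e" "contraction n G' gv ge N"
        "\<forall>e\<in>edges N. x (ge e) = l0 e" "\<forall>e\<in>edges G' - ge ` edges N. x e = 0"
      by (auto simp: positive_forms_def)
    have "contraction n G (gv \<circ> fv) (fe \<circ> ge) N" using contraction_comp[OF wf C g(2)] .
    moreover have "\<forall>e\<in>edges N. l ((fe \<circ> ge) e) = l0 e"
      using leq g(3) contractionD(3)[OF g(2)] by auto
    moreover have "\<forall>e\<in>edges G - (fe \<circ> ge) ` edges N. l e = 0"
    proof
      fix e assume e: "e \<in> edges G - (fe \<circ> ge) ` edges N"
      show "l e = 0"
      proof (cases "e \<in> fe ` edges G'")
        case True
        then obtain e' where e': "e' \<in> edges G'" "e = fe e'" by blast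
        then have "e' \<notin> ge ` edges N" using e by auto
        then show ?thesis using leq g(4) e' by simp
      next
        case False
        then show ?thesis using lzero e by blast
      qed
    qed
    ultimately show "(N, l0) \<in> positive_forms n (G, l)" unfolding positive_forms_iff using g(1) by blast
  next
    assume "(N, l0) \<in> positive_forms n (G, l)"
    then obtain hv he where h: "\<forall>e\<in>edges N. 0 < l0 e" "contraction n G hv he N"
        "\<forall>e\<in>edges N. l (he e) = l0 e" "\<forall>e\<in>edges G - he ` edges N. l e = 0"
      by (auto simp: positive_forms_def)
    have sub: "he ` edges N \<subseteq> fe ` edges G'"
    proof
      fix y assume "y \<in> he ` edges N"
      then obtain e where e: "e \<in> edges N" "y = he e" by blast
      then have "l y > 0" "y \<in> edges G" using h(1,3) contractionD(3)[OF h(2)] by auto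
      then show "y \<in> fe ` edges G'" using lzero[of y] by fastforce
    qed
    obtain gv ge where g: "contraction n G' gv ge N" "\<And>e. e \<in> edges N \<Longrightarrow> fe (ge e) = he e"
      using contraction_factor[OF wf C h(2) sub] by metis
    have ge: "ge e \<in> edges G'" if "e \<in> edges N" for e using contractionD(3)[OF g(1)] that by blast
    have "\<forall>e\<in>edges N. x (ge e) = l0 e" using leq ge g(2) h(3) by metis
    moreover have "\<forall>e\<in>edges G' - ge ` edges N. x e = 0"
    proof
      fix e assume e: "e \<in> edges G' - ge ` edges N"
      have "fe e \<notin> he ` edges N"
      proof
        assume "fe e \<in> he ` edges N"
        then obtain e1 where "e1 \<in> edges N" "fe e = fe (ge e1)" using g(2) by auto
        then show False using contractionD(2)[OF C] ge e by (auto simp: inj_on_def)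
      qed
      moreover have "fe e \<in> edges G" using e contractionD(3)[OF C] by blast
      ultimately have "l (fe e) = 0" using h(4) by blast
      then show "x e = 0" using leq[of e] e by simp
    qed
    ultimately show "(N, l0) \<in> positive_forms n (G', x)" unfolding positive_forms_iff using h(1) g(1) by blast
  qed
  then have "positive_forms n (G', x) = positive_forms n (G, l)" by (simp add: set_eq_iff split_paired_all)
  then show ?thesis unfolding l_def .
qed

lemma contraction_refl: "wf_wgraph n G \<Longrightarrow> contraction n G id id G"
  by (rule graph_iso_contraction) (auto simp: graph_iso_def)

text \<open>
  A positive metric graph is one of its own positive forms. By invariance it is also a positive form
  of the other one, where no edge of length zero can be contracted.
\<close>

lemma positive_unique:
  assumes "G \<in> stable_graphs n d" "l \<in> topspace (kappa G)" "\<forall>e\<in>edges G. 0 < l e"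
    and "G' \<in> stable_graphs n d" "l' \<in> topspace (kappa G')" "\<forall>e\<in>edges G'. 0 < l' e"
    and "vir_class n d (G, l) = vir_class n d (G', l')"
  obtains fv fe where "graph_iso n G fv fe G'" "\<And>e. e \<in> edges G' \<Longrightarrow> l (fe e) = l' e"
proof -
  have wf: "wf_wgraph n G" "wf_wgraph n G'" using stable_graphs_wf assms by auto
  have "positive_forms n (G, l) = positive_forms n (G', l')"
    by (rule vir.cls_invariant[where h = "positive_forms n" and n = n and d = d, OF positive_forms_graph_mor])
      (use assms in \<open>auto simp: vir_class_def\<close>)
  moreover have "(G', l') \<in> positive_forms n (G', l')"
    using assms(6) contraction_refl[OF wf(2)] unfolding positive_forms_def by fastforce
  ultimately have "(G', l') \<in> positive_forms n (G, l)" by simp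
  then obtain fv fe where f: "contraction n G fv fe G'" "\<forall>e\<in>edges G'. l (fe e) = l' e"
      "\<forall>e\<in>edges G - fe ` edges G'. l e = 0"
    unfolding positive_forms_iff by blast
  have "edges G \<subseteq> fe ` edges G'" using f(3) assms(3) by (metis DiffI less_irrefl subsetI)
  then show ?thesis using that contraction_graph_iso[OF wf(1) f(1)] f(2) by blast
qed

lemma positive_exists:
  assumes G: "G \<in> stable_graphs n d" and l: "l \<in> topspace (kappa G)"
    and fv: "graph_mor n d G (fv, id) N" and N: "edges N = {e\<in>edges G. l e > 0}"
  shows "N \<in> stable_graphs n d" "contraction n G fv id N" "restrict l (edges N) \<in> topspace (kappa N)"
    "\<forall>e\<in>edges N. 0 < restrict l (edges N) e" "vir_class n d (G, l) = vir_class n d (N, restrict l (edges N))"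
proof -
  show st: "N \<in> stable_graphs n d" and C: "contraction n G fv id N" using graph_mor_contraction[OF fv] by auto
  have z: "l e = 0" if "e \<in> edges G - edges N" for e
    using l that N by (auto simp: topspace_kappa not_less intro: antisym)
  have fin: "finite (edges G)" using wf_finite(2)[OF stable_graphs_wf[OF G]] .
  have "(\<Sum>e\<in>edges N. l e) = (\<Sum>e\<in>edges G. l e)"
    using z N fin by (intro sum.mono_neutral_left) auto
  then show k: "restrict l (edges N) \<in> topspace (kappa N)" using l N by (auto simp: topspace_kappa)
  show "\<forall>e\<in>edges N. 0 < restrict l (edges N) e" using N by auto
  show "vir_class n d (G, l) = vir_class n d (N, restrict l (edges N))"
    by (rule vir_class_contraction[OF G C k]) (use l z in \<open>auto simp: topspace_kappa\<close>)
qed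

lemma tied_cong:
  assumes "finite (verts G)" "\<And>v. v \<in> verts G \<Longrightarrow> deg G v > 0 \<Longrightarrow> g v = h v"
  shows "tied G g \<longleftrightarrow> tied G h"
  using tied_mono[OF assms(1), of g h] tied_mono[OF assms(1), of h g] assms(2) by fastforce

lemma tied_dist_contraction:
  assumes G: "G \<in> stable_graphs n d" and C: "contraction n G fv fe G'"
    and l': "\<forall>e\<in>edges G'. 0 \<le> l' e" and eq: "\<And>e. e \<in> edges G' \<Longrightarrow> l (fe e) = l' e"
    and zero: "\<And>e. e \<in> edges G - fe ` edges G' \<Longrightarrow> l e = 0"
  shows "tied G (dist_core G l) \<longleftrightarrow> tied G' (dist_core G' l')"
proof -
  have wf: "wf_wgraph n G" using stable_graphs_wf[OF G] .
  have "tied G (dist_core G l) \<longleftrightarrow> tied G (\<lambda>v. dist_core G' l' (fv v))"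
    using dist_core_contraction[OF G C l', of l] eq zero wf_finite[OF wf] by (intro tied_cong) auto
  then show ?thesis using tied_contraction[OF wf C] by simp
qed

lemma stable_graphs_deg: "G \<in> stable_graphs n d \<Longrightarrow> (\<Sum>v\<in>verts G. deg G v) = d"
  by (simp add: stable_graphs_def genus_one_graph_def)

lemma stable_graphs_finite: "G \<in> stable_graphs n d \<Longrightarrow> finite (verts G) \<and> finite (edges G)"
  using stable_graphs_wf wf_finite by blast

lemma canonical_d_min:
  assumes "G \<in> stable_graphs n d" "d > 0"
  shows "d_min G (canonical_alignment G l) > 1 \<longleftrightarrow> tied G (dist_core G l)"
  using d_min_tied[of G "canonical_alignment G l"] tied_canonical_alignment stable_graphs_deg[OF assms(1)]
    stable_graphs_finite[OF assms(1)] assms(2) by metis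

text \<open>
  Membership in \<open>Z\<close> can be tested on any representative, edges of length zero included,
  because distances to the core and total degrees are preserved when such edges are contracted.
\<close>

lemma vir_class_in_Z_locus:
  assumes G: "G \<in> stable_graphs n d" and l: "l \<in> topspace (kappa G)" and d: "d > 0"
  shows "vir_class n d (G, l) \<in> Z_locus n d \<longleftrightarrow> tied G (dist_core G l)"
proof -
  have "{e\<in>edges G. \<not> l e > 0} \<subseteq> edges G" by blast
  then obtain fv N where "graph_mor n d G (fv, id) N" "edges N = edges G - {e\<in>edges G. \<not> l e > 0}"
    using contract_edges_exists[OF G] by blast
  then have m: "graph_mor n d G (fv, id) N" "edges N = {e\<in>edges G. l e > 0}" by auto
  note N = positive_exists[OF G l m]
  let ?l = "restrict l (edges N)"
  have "l e = 0" if "e \<in> edges G - id ` edges N" for e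
    using l that m(2) by (auto simp: topspace_kappa not_less intro: antisym)
  then have t: "tied G (dist_core G l) \<longleftrightarrow> tied N (dist_core N ?l)"
    using N(4) by (intro tied_dist_contraction[OF G N(2)]) (auto intro: less_imp_le)
  show ?thesis
  proof
    assume "tied G (dist_core G l)"
    then have "d_min N (canonical_alignment N ?l) > 1" using t canonical_d_min[OF N(1) d] by simp
    then show "vir_class n d (G, l) \<in> Z_locus n d" unfolding Z_locus_def using N by blast
  next
    assume "vir_class n d (G, l) \<in> Z_locus n d"
    then obtain G' l' where G': "vir_class n d (G, l) = vir_class n d (G', l')" "G' \<in> stable_graphs n d"
        "l' \<in> topspace (kappa G')" "\<forall>e\<in>edges G'. l' e > 0" "d_min G' (canonical_alignment G' l') > 1"
      unfolding Z_locus_def by blast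
    have "vir_class n d (N, ?l) = vir_class n d (G', l')" using G'(1) N(5) by simp
    then obtain gv ge where g: "graph_iso n N gv ge G'" "\<And>e. e \<in> edges G' \<Longrightarrow> ?l (ge e) = l' e"
      using positive_unique[OF N(1,3,4) G'(2-4)] by metis
    have C: "contraction n N gv ge G'" using graph_iso_contraction[OF stable_graphs_wf[OF N(1)] g(1)] .
    have "ge ` edges G' = edges N" using g(1) by (auto simp: graph_iso_def bij_betw_def)
    then have "tied N (dist_core N ?l) \<longleftrightarrow> tied G' (dist_core G' l')"
      using g(2) G'(4) by (intro tied_dist_contraction[OF N(1) C]) (auto intro: less_imp_le)
    then show "tied G (dist_core G l)" using t canonical_d_min[OF G'(2) d] G'(5) by simp
  qed
qed

section \<open>Sprouting\<close>

lemma fibres_bij: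
  assumes "finite A" "finite B" "\<And>y. card {a\<in>A. f a = y} = card {b\<in>B. g b = y}"
  shows "\<exists>\<gamma>. bij_betw \<gamma> A B \<and> (\<forall>a\<in>A. g (\<gamma> a) = f a)"
  using assms
proof (induction A arbitrary: B rule: finite_induct)
  case empty
  have "B = {}"
  proof (rule ccontr)
    assume "B \<noteq> {}"
    then obtain b where "b \<in> B" by blast
    then have "card {c\<in>B. g c = g b} > 0" using empty(1) by (auto simp: card_gt_0_iff)
    then show False using empty(2)[of "g b"] by simp
  qed
  then show ?case by (auto simp: bij_betw_def)
next
  case (insert a A)
  have "card {c\<in>insert a A. f c = f a} > 0" using insert(1) by (auto simp: card_gt_0_iff)
  then have "{b\<in>B. g b = f a} \<noteq> {}" using insert.prems(2)[of "f a"] by (metis card.empty less_numeral_extra(3))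
  then obtain b where b: "b \<in> B" "g b = f a" by blast
  have "card {c\<in>A. f c = y} = card {c\<in>B - {b}. g c = y}" for y
  proof (cases "y = f a")
    case True
    have "{c\<in>insert a A. f c = y} = insert a {c\<in>A. f c = y}" "{c\<in>B. g c = y} = insert b {c\<in>B - {b}. g c = y}"
      using True b by auto
    then show ?thesis using insert.prems(2)[of y] insert(1,2) insert.prems(1) by simp
  next
    case False
    have "{c\<in>insert a A. f c = y} = {c\<in>A. f c = y}" "{c\<in>B. g c = y} = {c\<in>B - {b}. g c = y}"
      using False b by auto
    then show ?thesis using insert.prems(2)[of y] by simp
  qed
  then obtain \<gamma> where g: "bij_betw \<gamma> A (B - {b})" "\<forall>c\<in>A. g (\<gamma> c) = f c"
    using insert.IH[of "B - {b}"] insert.prems(1) by auto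
  define \<gamma>' where "\<gamma>' = \<gamma>(a := b)"
  have "bij_betw \<gamma>' A (B - {b})" using g(1) insert(2) by (subst bij_betw_cong[of A \<gamma>' \<gamma>]) (auto simp: \<gamma>'_def)
  then have "bij_betw \<gamma>' (insert a A) (insert (\<gamma>' a) (B - {b}))"
    using insert(2) by (intro notIn_Un_bij_betw[where b = a, simplified]) (auto simp: \<gamma>'_def)
  then have "bij_betw \<gamma>' (insert a A) B" using b by (simp add: \<gamma>'_def insert_absorb)
  moreover have "\<forall>c\<in>insert a A. g (\<gamma>' c) = f c" using g(2) b insert(2) by (auto simp: \<gamma>'_def)
  ultimately show ?case by blast
qed

definition sprout_anchor :: "wgraph \<Rightarrow> nat \<Rightarrow> nat" where
  "sprout_anchor G x = fst (prod_decode (x - sprout_base G))"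

definition sprout_proj :: "nat \<Rightarrow> wgraph \<Rightarrow> nat \<Rightarrow> nat" where
  "sprout_proj n G x = (if x \<in> sprout_labels n G then sprout_anchor G x else x)"

lemma sprout_label_obtain:
  assumes "x \<in> sprout_labels n G"
  obtains v j where "x = sprout_base G + prod_encode (v, j)" "v \<in> verts G" "\<not> one_end_vert n G v" "j < deg G v"
  using assms by (auto simp: sprout_labels_def)

lemma sprout_anchor_encode: "sprout_anchor G (sprout_base G + prod_encode (v, j)) = v"
  by (simp add: sprout_anchor_def)

lemma sprout_anchor:
  assumes "x \<in> sprout_labels n G"
  shows "sprout_anchor G x \<in> verts G" "\<not> one_end_vert n G (sprout_anchor G x)"
  using assms by (auto simp: sprout_anchor_encode elim!: sprout_label_obtain)

lemma sprout_labels_fresh: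
  assumes "wf_wgraph n G" "x \<in> sprout_labels n G"
  shows "x \<notin> verts G" "x \<notin> edges G"
proof -
  have "finite (verts G \<union> edges G)" using wf_finite[OF assms(1)] by simp
  then have "y < sprout_base G" if "y \<in> verts G \<union> edges G" for y
    using that by (simp add: sprout_base_def less_Suc_eq_le)
  moreover have "sprout_base G \<le> x" using assms(2) by (auto elim!: sprout_label_obtain)
  ultimately show "x \<notin> verts G" "x \<notin> edges G" by fastforce+
qed

lemma sprout_labels_fibre:
  assumes "v \<in> verts G" "\<not> one_end_vert n G v"
  shows "{x \<in> sprout_labels n G. sprout_anchor G x = v} = (\<lambda>j. sprout_base G + prod_encode (v, j)) ` {..<deg G v}"
  using assms by (auto simp: sprout_anchor_encode sprout_labels_def)

lemma card_sprout_labels_fibre: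
  assumes "v \<in> verts G" "\<not> one_end_vert n G v"
  shows "card {x \<in> sprout_labels n G. sprout_anchor G x = v} = deg G v"
proof -
  have "inj_on (\<lambda>j. sprout_base G + prod_encode (v, j)) {..<deg G v}" by (auto simp: inj_on_def)
  then show ?thesis unfolding sprout_labels_fibre[OF assms] by (simp add: card_image)
qed

lemma finite_sprout_labels:
  assumes "wf_wgraph n G"
  shows "finite (sprout_labels n G)"
proof -
  have "sprout_labels n G \<subseteq> (\<Union>v\<in>verts G. (\<lambda>j. sprout_base G + prod_encode (v, j)) ` {..<deg G v})"
    by (auto simp: sprout_labels_def)
  then show ?thesis using wf_finite(1)[OF assms] by (auto intro: finite_subset)
qed

lemma sprout_simps:
  "verts (sprout n G) = verts G \<union> sprout_labels n G"
  "edges (sprout n G) = edges G \<union> sprout_labels n G"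
  "mark (sprout n G) = mark G"
  "x \<in> sprout_labels n G \<Longrightarrow> ends (sprout n G) x = {sprout_anchor G x, x}"
  "x \<notin> sprout_labels n G \<Longrightarrow> ends (sprout n G) x = ends G x"
  "x \<in> sprout_labels n G \<Longrightarrow> weight (sprout n G) x = 0"
  "x \<notin> sprout_labels n G \<Longrightarrow> weight (sprout n G) x = weight G x"
  by (auto simp: sprout_def sprout_anchor_def)

lemma sprout_edge_old:
  assumes "wf_wgraph n G" "e \<in> edges G"
  shows "ends (sprout n G) e = ends G e"
  using sprout_labels_fresh(2)[OF assms(1)] assms(2) sprout_simps(5) by blast

lemma sprout_weight_old:
  assumes "wf_wgraph n G" "v \<in> verts G"
  shows "weight (sprout n G) v = weight G v"
  using sprout_labels_fresh(1)[OF assms(1)] assms(2) sprout_simps(7) by blast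

lemma one_endD:
  assumes "one_end n G e v"
  shows "e \<in> edges G" "card (ends G e) = 2" "v \<in> ends G e" "\<And>f. f \<in> edges G \<Longrightarrow> v \<in> ends G f \<Longrightarrow> f = e"
    "weight G v = 0" "\<And>i. i \<in> {1..n} \<Longrightarrow> mark G i \<noteq> v" "deg G v = 1"
  using assms by (auto simp: one_end_def)

lemma one_end_verts: "wf_wgraph n G \<Longrightarrow> one_end n G e v \<Longrightarrow> v \<in> verts G"
  using wf_edge(1) one_endD(1,3) by blast

lemma one_end_obtain:
  assumes "wf_wgraph n G" "one_end n G e v"
  obtains q where "ends G e = {v, q}" "q \<noteq> v" "q \<in> verts G"
proof -
  have "card (ends G e) = 2" "v \<in> ends G e" using one_endD(2,3)[OF assms(2)] by auto
  then obtain x y where xy: "ends G e = {x, y}" "x \<noteq> y" "v = x \<or> v = y" by (auto simp: card_2_iff)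
  define q where "q = (if v = x then y else x)"
  have "ends G e = {v, q}" "q \<noteq> v" using xy by (auto simp: q_def)
  then show ?thesis using that wf_edge(1)[OF assms(1) one_endD(1)[OF assms(2)]] by auto
qed

lemma sprout_deg:
  assumes "wf_wgraph n G"
  shows "deg (sprout n G) x = of_bool (x \<in> sprout_labels n G \<or> one_end_vert n G x)"
proof -
  have "deg G x = 1" if "one_end_vert n G x" using that one_endD(7) unfolding one_end_vert_def by blast
  then show ?thesis by (simp add: sprout_def)
qed

lemma wf_sprout:
  assumes wf: "wf_wgraph n G"
  shows "wf_wgraph n (sprout n G)"
  unfolding wf_wgraph_def sprout_simps(1-3)
proof (intro conjI ballI)
  show "finite (verts G \<union> sprout_labels n G)" "finite (edges G \<union> sprout_labels n G)"
    using wf_finite[OF wf] finite_sprout_labels[OF wf] by auto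
  show "mark G ` {1..n} \<subseteq> verts G \<union> sprout_labels n G" using wf_mark[OF wf] by blast
next
  fix e assume e: "e \<in> edges G \<union> sprout_labels n G"
  show "ends (sprout n G) e \<subseteq> verts G \<union> sprout_labels n G"
    using e wf_edge(1)[OF wf, of e] sprout_edge_old[OF wf, of e] sprout_simps(4)[of e n G] sprout_anchor(1)[of e n G]
    by auto
  show "card (ends (sprout n G) e) \<in> {1, 2}"
  proof (cases "e \<in> sprout_labels n G")
    case True
    then have "sprout_anchor G e \<noteq> e" using sprout_anchor(1) sprout_labels_fresh(1)[OF wf] by metis
    then show ?thesis using sprout_simps(4)[OF True] by simp
  next
    case False
    then show ?thesis using wf_edge(2)[OF wf, of e] e sprout_simps(5)[OF False] by simp
  qed
qed

text \<open>
  The fibre over \<open>v\<close> is the star of the sprouts at \<open>v\<close>, which has genus zero and carries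
  the degree of \<open>v\<close>.
\<close>

lemma sprout_proj_contraction:
  assumes wf: "wf_wgraph n G"
  shows "contraction n (sprout n G) (sprout_proj n G) id G"
proof -
  let ?S = "sprout n G" and ?L = "sprout_labels n G" and ?p = "sprout_proj n G"
  have fresh: "x \<notin> ?L" if "x \<in> verts G \<or> x \<in> edges G" for x using sprout_labels_fresh[OF wf] that by blast
  have pV: "?p v = v" if "v \<in> verts G" for v using fresh that by (simp add: sprout_proj_def)
  have pL: "?p x = sprout_anchor G x" if "x \<in> ?L" for x using that by (simp add: sprout_proj_def)
  have F: "edges ?S - id ` edges G = ?L" using fresh by (auto simp: sprout_simps)
  have c1: "?p ` verts ?S = verts G"
  proof (intro set_eqI iffI)
    fix y assume "y \<in> ?p ` verts ?S"
    then obtain x where "x \<in> verts G \<or> x \<in> ?L" "y = ?p x" by (auto simp: sprout_simps(1))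
    then show "y \<in> verts G" using pV pL sprout_anchor(1) by metis
  next
    fix y assume "y \<in> verts G"
    then show "y \<in> ?p ` verts ?S" using pV by (intro image_eqI[of _ _ y]) (auto simp: sprout_simps(1))
  qed
  have c4: "ends G e = ?p ` ends ?S (id e)" if e: "e \<in> edges G" for e
  proof -
    have "?p ` ends G e = id ` ends G e" using wf_edge(1)[OF wf e] pV by (intro image_cong) auto
    then show ?thesis using sprout_edge_old[OF wf e] by simp
  qed
  have r: "reach ?S ?L x (?p x)" for x
  proof (cases "x \<in> ?L")
    case True
    then have "ends ?S x = {x, ?p x}" using sprout_simps(4)[OF True] pL[OF True] by (simp add: insert_commute)
    then show ?thesis using True reach_edge by blast
  qed (simp add: sprout_proj_def)
  have c5: "?p u = ?p v \<longleftrightarrow> reach ?S ?L u v" for u v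
  proof
    assume "?p u = ?p v"
    then show "reach ?S ?L u v" using r[of u] r[of v] reach_sym rtrancl_trans by metis
  next
    assume "reach ?S ?L u v"
    then have "v \<in> {z. ?p u = ?p z}"
    proof (rule reach_closed)
      fix e a b assume e: "e \<in> ?L" "ends ?S e = {a, b}" "a \<in> {z. ?p u = ?p z}"
      have "{a, b} = {sprout_anchor G e, e}" using e sprout_simps(4) by metis
      moreover have "?p (sprout_anchor G e) = ?p e" using pV pL e sprout_anchor(1) by metis
      ultimately have "?p a = ?p b" by (auto simp: doubleton_eq_iff)
      then show "b \<in> {z. ?p u = ?p z}" using e(3) by simp
    qed simp
    then show "?p u = ?p v" by simp
  qed
  have fib: "{u\<in>verts ?S. ?p u = v} = insert v {x\<in>?L. sprout_anchor G x = v}" if "v \<in> verts G" for v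
    using pV pL that by (auto simp: sprout_simps)
  have finL: "finite {x\<in>?L. sprout_anchor G x = v}" for v using finite_sprout_labels[OF wf] by simp
  have vL: "v \<notin> {x\<in>?L. sprout_anchor G x = v}" if "v \<in> verts G" for v using fresh that by blast
  have c6: "weight G v + card {u\<in>verts ?S. ?p u = v} =
      (\<Sum>u | u \<in> verts ?S \<and> ?p u = v. weight ?S u) + card {e\<in>?L. ?p ` ends ?S e = {v}} + 1"
    if v: "v \<in> verts G" for v
  proof -
    have "?p ` ends ?S e = {sprout_anchor G e}" if "e \<in> ?L" for e
      using sprout_simps(4)[OF that] pL[OF that] pV[OF sprout_anchor(1)[OF that]] by simp
    then have "{e\<in>?L. ?p ` ends ?S e = {v}} = {x\<in>?L. sprout_anchor G x = v}" by auto
    moreover have "(\<Sum>u\<in>{x\<in>?L. sprout_anchor G x = v}. weight ?S u) = 0" using sprout_simps(6) by (intro sum.neutral) blast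
    ultimately show ?thesis
      unfolding fib[OF v] using finL vL[OF v] sprout_weight_old[OF wf v] by simp
  qed
  have c7: "deg G v = (\<Sum>u | u \<in> verts ?S \<and> ?p u = v. deg ?S u)" if v: "v \<in> verts G" for v
  proof -
    have "(\<Sum>u\<in>{x\<in>?L. sprout_anchor G x = v}. deg ?S u) = card {x\<in>?L. sprout_anchor G x = v}"
      by (simp add: sprout_deg[OF wf])
    then have s: "(\<Sum>u | u \<in> verts ?S \<and> ?p u = v. deg ?S u) = of_bool (one_end_vert n G v) + card {x\<in>?L. sprout_anchor G x = v}"
      unfolding fib[OF v] using finL vL[OF v] fresh v by (simp add: sprout_deg[OF wf])
    show ?thesis
    proof (cases "one_end_vert n G v")
      case True
      then have e: "{x\<in>?L. sprout_anchor G x = v} = {}" using sprout_anchor(2) by blast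
      obtain e where "one_end n G e v" using True by (auto simp: one_end_vert_def)
      then show ?thesis using s True one_endD(7) unfolding e by simp
    next
      case False
      then show ?thesis using s card_sprout_labels_fibre[OF v False] by simp
    qed
  qed
  show ?thesis
    unfolding contraction_def F using c1 c4 c5 c6 c7 pV wf_mark[OF wf] by (simp add: sprout_simps)
qed

lemma valence_pos:
  assumes "finite (edges G)" "e \<in> edges G" "v \<in> ends G e"
  shows "valence G v \<ge> 1"
proof -
  have "card {e\<in>edges G. v \<in> ends G e} > 0" using assms by (auto simp: card_gt_0_iff)
  then show ?thesis by (simp add: valence_def)
qed

text \<open>
  A vertex that violates stability once its degree is moved to sprouts has genus zero, one
  half-edge, no markings and degree one: exactly the vertices that are not sprouted.
\<close>

lemma stable_sprout:
  assumes G: "G \<in> stable_graphs n d"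
  shows "sprout n G \<in> stable_graphs n d"
proof -
  let ?S = "sprout n G" and ?L = "sprout_labels n G"
  have wf: "wf_wgraph n G" using stable_graphs_wf[OF G] .
  have wfS: "wf_wgraph n ?S" using wf_sprout[OF wf] .
  have g: "genus_one_graph n d G" using stable_graphs_genus[OF G] .
  have gS: "genus_one_graph n d ?S"
    using contraction_genus_one[OF wfS sprout_proj_contraction[OF wf]] g by simp
  have fin: "finite (edges G)" "finite (verts G)" "finite ?L"
    using wf_finite[OF wf] finite_sprout_labels[OF wf] by auto
  have "vertex_excess n ?S v > 0" if v: "v \<in> verts ?S" "deg ?S v = 0" for v
  proof -
    have vV: "v \<in> verts G" and ne: "\<not> one_end_vert n G v"
      using v by (auto simp: sprout_deg[OF wf] sprout_simps split: if_splits)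
    have old: "half_edges ?S e v = half_edges G e v" if "e \<in> edges G" for e
      using sprout_edge_old[OF wf that] by (simp add: half_edges_def)
    have new: "half_edges ?S x v = of_bool (sprout_anchor G x = v)" if "x \<in> ?L" for x
      using half_edges_eq[OF sprout_simps(4)[OF that], of v] sprout_labels_fresh(1)[OF wf that] vV by auto
    have val: "valence ?S v = valence G v + deg G v"
    proof -
      have "valence ?S v = (\<Sum>e\<in>edges G. half_edges ?S e v) + (\<Sum>e\<in>?L. half_edges ?S e v)"
        using fin sprout_labels_fresh(2)[OF wf] wf_finite(2)[OF wfS]
        by (subst valence_eq) (auto simp: sprout_simps intro!: sum.union_disjoint)
      also have "(\<Sum>e\<in>edges G. half_edges ?S e v) = valence G v"
        unfolding valence_eq[OF fin(1)] using old by (intro sum.cong) auto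
      also have "(\<Sum>e\<in>?L. half_edges ?S e v) = (\<Sum>e\<in>?L. of_bool (sprout_anchor G e = v))"
        using new by (intro sum.cong) auto
      also have "\<dots> = card {x\<in>?L. sprout_anchor G x = v}" using fin by (simp add: Int_def conj_commute)
      also have "\<dots> = deg G v" using card_sprout_labels_fibre[OF vV ne] .
      finally show ?thesis .
    qed
    have ex: "vertex_excess n ?S v = vertex_excess n G v + int (deg G v)"
      using val sprout_weight_old[OF wf vV] by (simp add: vertex_excess_def sprout_simps)
    show ?thesis
    proof (cases "deg G v = 0")
      case True
      then show ?thesis using ex G vV by (auto simp: stable_graphs_def stable_iff)
    next
      case False
      show ?thesis
      proof (rule ccontr)
        assume "\<not> ?thesis"
        then have le: "2 * int (weight G v) + int (valence G v) + int (card {i\<in>{1..n}. mark G i = v}) + int (deg G v) \<le> 2"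
          using ex by (simp add: vertex_excess_def)
        then have w0: "weight G v = 0" using False by linarith
        have "valence G v \<ge> 1"
        proof (rule ccontr)
          assume "\<not> ?thesis"
          then have noedge: "v \<notin> ends G e" if "e \<in> edges G" for e using valence_pos[OF fin(1) that] by blast
          have "verts G = {v}"
          proof -
            have "u = v" if u: "u \<in> verts G" for u
            proof -
              have "reach G (edges G) v u" using connected_reach[OF g vV u] .
              then have "u \<in> {v}" by (rule reach_closed) (use noedge in auto)
              then show ?thesis by simp
            qed
            then show ?thesis using vV by blast
          qed
          moreover have "edges G = {}"
          proof (rule ccontr)
            assume "edges G \<noteq> {}"
            then obtain e where e: "e \<in> edges G" by blast
            then obtain a b where "ends G e = {a, b}" "a \<in> verts G" using wf_ends[OF wf] by blast
            then show False using noedge[OF e] \<open>verts G = {v}\<close> by auto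
          qed
          ultimately show False using g w0 unfolding genus_one_graph_iff by simp
        qed
        then have v1: "valence G v = 1" and d1: "deg G v = 1" and m0: "card {i\<in>{1..n}. mark G i = v} = 0"
          using le False by linarith+
        have "card {e\<in>edges G. v \<in> ends G e} = 1"
        proof -
          have "card {e\<in>edges G. ends G e = {v}} \<le> card {e\<in>edges G. v \<in> ends G e}"
            using fin by (intro card_mono) auto
          then show ?thesis using v1 unfolding valence_def by linarith
        qed
        then have noloop: "{e\<in>edges G. ends G e = {v}} = {}" and "\<exists>e. {e\<in>edges G. v \<in> ends G e} = {e}"
          using v1 fin unfolding valence_def by (auto simp: card_1_singleton_iff)
        then obtain e where e: "{e\<in>edges G. v \<in> ends G e} = {e}" by blast
        have eE: "e \<in> edges G" "v \<in> ends G e" using e by blast+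
        obtain a b where ab: "ends G e = {a, b}" using wf_ends[OF wf eE(1)] by blast
        have "ends G e \<noteq> {v}" using noloop eE by blast
        then have "card (ends G e) = 2" using ab eE(2) by auto
        moreover have "\<forall>i\<in>{1..n}. mark G i \<noteq> v" using m0 by auto
        ultimately have "one_end n G e v" unfolding one_end_def using e eE w0 d1 by blast
        then show False using ne by (auto simp: one_end_vert_def)
      qed
    qed
  qed
  then show ?thesis unfolding stable_graphs_def stable_iff using gS by simp
qed

text \<open>
  If both ends of an edge were 1-end vertices, the graph would be a single segment of genus
  zero.
\<close>

lemma one_end_unique:
  assumes g: "genus_one_graph n d G" and v: "one_end n G e v" "one_end n G e v'"
  shows "v = v'"
proof (rule ccontr)
  assume ne: "v \<noteq> v'"
  have wf: "wf_wgraph n G" using genus_one_wf[OF g] .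
  have e: "e \<in> edges G" using one_endD(1)[OF v(1)] .
  obtain a b where ab: "ends G e = {a, b}" using wf_ends[OF wf e] by blast
  have ends: "ends G e = {v, v'}" using ab one_endD(3)[OF v(1)] one_endD(3)[OF v(2)] ne by auto
  have vV: "v \<in> verts G" "v' \<in> verts G" using one_end_verts[OF wf] v by auto
  have V: "verts G = {v, v'}"
  proof -
    have "u \<in> {v, v'}" if u: "u \<in> verts G" for u
      using connected_reach[OF g vV(1) u]
    proof (rule reach_closed)
      fix f a b assume f: "f \<in> edges G" "ends G f = {a, b}" "a \<in> {v, v'}"
      then have "f = e" using one_endD(4)[OF v(1), of f] one_endD(4)[OF v(2), of f] by auto
      then show "b \<in> {v, v'}" using f(2) ends by auto
    qed simp
    then show ?thesis using vV by blast
  qed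
  have "edges G = {e}"
  proof -
    have "f = e" if f: "f \<in> edges G" for f
    proof -
      obtain a b where "ends G f = {a, b}" "a \<in> verts G" using wf_ends[OF wf f] by blast
      then show ?thesis using V one_endD(4)[OF v(1) f] one_endD(4)[OF v(2) f] by auto
    qed
    then show ?thesis using e by blast
  qed
  then show False
    using g V ne one_endD(5)[OF v(1)] one_endD(5)[OF v(2)] unfolding genus_one_graph_iff by simp
qed

lemma one_end_sprout:
  assumes wf: "wf_wgraph n G"
  shows "one_end n (sprout n G) e x \<longleftrightarrow> (x \<in> sprout_labels n G \<and> e = x) \<or> one_end n G e x"
proof
  let ?S = "sprout n G" and ?L = "sprout_labels n G"
  assume o: "one_end n ?S e x"
  have x: "x \<in> verts G \<union> ?L" using one_end_verts[OF wf_sprout[OF wf] o] by (simp add: sprout_simps)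
  show "(x \<in> ?L \<and> e = x) \<or> one_end n G e x"
  proof (cases "x \<in> ?L")
    case True
    then show ?thesis using one_endD(4)[OF o, of x] sprout_simps(4)[OF True] by (auto simp: sprout_simps(2))
  next
    case False
    then have xV: "x \<in> verts G" using x by blast
    have "one_end_vert n G x" using one_endD(7)[OF o] False by (cases "one_end_vert n G x") (simp_all add: sprout_deg[OF wf])
    then obtain e' where e': "one_end n G e' x" by (auto simp: one_end_vert_def)
    have "e' \<in> edges ?S" "x \<in> ends ?S e'"
      using one_endD(1,3)[OF e'] sprout_edge_old[OF wf] by (auto simp: sprout_simps(2))
    then show ?thesis using one_endD(4)[OF o] e' by blast
  qed
next
  let ?S = "sprout n G" and ?L = "sprout_labels n G"
  assume "(x \<in> ?L \<and> e = x) \<or> one_end n G e x"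
  then show "one_end n ?S e x"
  proof (elim disjE conjE)
    assume x: "x \<in> ?L" and e: "e = x"
    have "sprout_anchor G x \<noteq> x" using sprout_anchor(1)[OF x] sprout_labels_fresh(1)[OF wf x] by metis
    moreover have "f = x" if f: "f \<in> edges ?S" "x \<in> ends ?S f" for f
    proof (cases "f \<in> ?L")
      case True
      then show ?thesis
        using f(2) sprout_simps(4)[OF True] sprout_anchor(1)[OF True] sprout_labels_fresh(1)[OF wf x] by auto
    next
      case False
      then have "f \<in> edges G" using f(1) by (simp add: sprout_simps(2))
      then show ?thesis
        using f(2) sprout_simps(5)[OF False] wf_edge(1)[OF wf] sprout_labels_fresh(1)[OF wf x] by blast
    qed
    moreover have "mark ?S i \<noteq> x" if "i \<in> {1..n}" for i
      using wf_mark[OF wf that] sprout_labels_fresh(1)[OF wf x] by (auto simp: sprout_simps(3))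
    ultimately show ?thesis
      unfolding one_end_def e using x sprout_simps(4)[OF x] by (simp add: sprout_simps(2,6) sprout_deg[OF wf])
  next
    assume o: "one_end n G e x"
    have xV: "x \<in> verts G" using one_end_verts[OF wf o] .
    have "f = e" if f: "f \<in> edges ?S" "x \<in> ends ?S f" for f
    proof (cases "f \<in> ?L")
      case True
      have "x \<noteq> f" using xV sprout_labels_fresh(1)[OF wf True] by metis
      then have "x = sprout_anchor G f" using f(2) sprout_simps(4)[OF True] by simp
      then show ?thesis using sprout_anchor(2)[OF True] o by (auto simp: one_end_vert_def)
    next
      case False
      then show ?thesis using f sprout_simps(5)[OF False] one_endD(4)[OF o] by (simp add: sprout_simps(2))
    qed
    moreover have "deg ?S x = 1" using o by (auto simp: sprout_deg[OF wf] one_end_vert_def)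
    moreover have "ends ?S e = ends G e" using sprout_edge_old[OF wf one_endD(1)[OF o]] .
    moreover have "weight ?S x = 0" using sprout_weight_old[OF wf xV] one_endD(5)[OF o] by simp
    moreover have "\<forall>i\<in>{1..n}. mark ?S i \<noteq> x" using one_endD(6)[OF o] unfolding sprout_simps(3) by blast
    moreover have "e \<in> edges ?S" using one_endD(1)[OF o] by (simp add: sprout_simps(2))
    ultimately show ?thesis unfolding one_end_def using one_endD(2,3)[OF o] by metis
  qed
qed

text \<open>
  The leaves among which the degree is distributed after sprouting: the new vertices and the
  1-end vertices that were present before.
\<close>

definition tips :: "nat \<Rightarrow> wgraph \<Rightarrow> nat set" where
  "tips n G = sprout_labels n G \<union> {v\<in>verts G. one_end_vert n G v}"

definition tip_edge :: "nat \<Rightarrow> wgraph \<Rightarrow> nat \<Rightarrow> nat" where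
  "tip_edge n G x = (THE e. one_end n (sprout n G) e x)"

lemma tip_edge_eq:
  assumes "one_end n (sprout n G) e x"
  shows "tip_edge n G x = e"
  unfolding tip_edge_def using assms
proof (rule the_equality)
  fix e' assume "one_end n (sprout n G) e' x"
  then show "e' = e" using one_endD(4)[OF assms one_endD(1,3)] by blast
qed

lemma tip_edge_one_end:
  assumes wf: "wf_wgraph n G" and x: "x \<in> tips n G"
  shows "one_end n (sprout n G) (tip_edge n G x) x"
proof -
  obtain e where "one_end n (sprout n G) e x"
    using x unfolding tips_def one_end_vert_def one_end_sprout[OF wf] by blast
  then show ?thesis using tip_edge_eq by metis
qed

lemma tip_edge_label:
  "wf_wgraph n G \<Longrightarrow> x \<in> sprout_labels n G \<Longrightarrow> tip_edge n G x = x"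
  by (rule tip_edge_eq) (simp add: one_end_sprout)

lemma tip_edge_old:
  "wf_wgraph n G \<Longrightarrow> one_end n G e x \<Longrightarrow> tip_edge n G x = e"
  by (rule tip_edge_eq) (simp add: one_end_sprout)

lemma inj_on_tip_edge:
  assumes "G \<in> stable_graphs n d"
  shows "inj_on (tip_edge n G) (tips n G)"
proof (rule inj_onI)
  fix x y assume "x \<in> tips n G" "y \<in> tips n G" "tip_edge n G x = tip_edge n G y"
  then have "one_end n (sprout n G) (tip_edge n G x) x" "one_end n (sprout n G) (tip_edge n G x) y"
    using tip_edge_one_end[OF stable_graphs_wf[OF assms]] by metis+
  then show "x = y" using one_end_unique[OF stable_graphs_genus[OF stable_sprout[OF assms]]] by blast
qed

lemma one_end_edge_sprout:
  assumes wf: "wf_wgraph n G"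
  shows "one_end_edge n (sprout n G) e \<longleftrightarrow> e \<in> tip_edge n G ` tips n G"
proof
  assume "one_end_edge n (sprout n G) e"
  then obtain x where x: "one_end n (sprout n G) e x" by (auto simp: one_end_edge_def)
  then have "x \<in> tips n G"
    using one_end_verts[OF wf] unfolding one_end_sprout[OF wf] tips_def one_end_vert_def by blast
  then show "e \<in> tip_edge n G ` tips n G" using tip_edge_eq[OF x] by blast
next
  assume "e \<in> tip_edge n G ` tips n G"
  then show "one_end_edge n (sprout n G) e" using tip_edge_one_end[OF wf] unfolding one_end_edge_def by blast
qed

lemma one_end_edge_sprout_old:
  assumes wf: "wf_wgraph n G" and e: "e \<in> edges G"
  shows "one_end_edge n (sprout n G) e \<longleftrightarrow> one_end_edge n G e"
  unfolding one_end_edge_def one_end_sprout[OF wf] using sprout_labels_fresh(2)[OF wf] e by blast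

lemma sprout_deg_tips:
  assumes "wf_wgraph n G" "x \<in> verts (sprout n G)"
  shows "deg (sprout n G) x = of_bool (x \<in> tips n G)"
proof -
  have "one_end_vert n G x \<Longrightarrow> x \<in> verts G" using one_end_verts[OF assms(1)] by (auto simp: one_end_vert_def)
  then show ?thesis unfolding sprout_deg[OF assms(1)] tips_def by auto
qed

lemma tips_subset: "tips n G \<subseteq> verts (sprout n G)"
  by (auto simp: tips_def sprout_simps)

lemma finite_tips: "wf_wgraph n G \<Longrightarrow> finite (tips n G)"
  using tips_subset wf_finite(1)[OF wf_sprout] finite_subset by metis

lemma card_tips:
  assumes G: "G \<in> stable_graphs n d"
  shows "card (tips n G) = d"
proof -
  have wf: "wf_wgraph n G" using stable_graphs_wf[OF G] .
  have fin: "finite (verts (sprout n G))" using wf_finite(1)[OF wf_sprout[OF wf]] .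
  have "d = (\<Sum>v\<in>verts (sprout n G). deg (sprout n G) v)" using stable_graphs_deg[OF stable_sprout[OF G]] by simp
  also have "\<dots> = (\<Sum>v\<in>verts (sprout n G). of_bool (v \<in> tips n G))"
    using sprout_deg_tips[OF wf] by (intro sum.cong) auto
  also have "\<dots> = card (tips n G)" using fin tips_subset[of n G] by (simp add: Int_absorb1)
  finally show ?thesis by simp
qed

lemma sprout_proj_tips:
  assumes wf: "wf_wgraph n G" and v: "v \<in> verts G"
  shows "card {x\<in>tips n G. sprout_proj n G x = v} = deg G v"
proof -
  have "deg G v = (\<Sum>u | u \<in> verts (sprout n G) \<and> sprout_proj n G u = v. deg (sprout n G) u)"
    using contractionD(7)[OF sprout_proj_contraction[OF wf] v] .
  also have "\<dots> = (\<Sum>u | u \<in> verts (sprout n G) \<and> sprout_proj n G u = v. of_bool (u \<in> tips n G))"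
    using sprout_deg_tips[OF wf] by (intro sum.cong) auto
  also have "\<dots> = card ({u \<in> verts (sprout n G). sprout_proj n G u = v} \<inter> tips n G)"
    using wf_finite(1)[OF wf_sprout[OF wf]] by simp
  also have "{u \<in> verts (sprout n G). sprout_proj n G u = v} \<inter> tips n G = {x\<in>tips n G. sprout_proj n G x = v}"
    using tips_subset by blast
  finally show ?thesis by simp
qed

text \<open>
  The only edge at the 1-end vertex is kept, so no contracted edge meets the vertex and its fibre is
  a single point.
\<close>

lemma one_end_contraction:
  assumes G: "G \<in> stable_graphs n d" and C: "contraction n G fv fe G'"
    and e: "e \<in> edges G'" and y: "one_end n G (fe e) y"
  shows "one_end n G' e (fv y)"
proof -
  let ?F = "edges G - fe ` edges G'"
  have wf: "wf_wgraph n G" using stable_graphs_wf[OF G] .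
  have yV: "y \<in> verts G" using one_end_verts[OF wf y] .
  obtain q where q: "ends G (fe e) = {y, q}" "q \<noteq> y" "q \<in> verts G" using one_end_obtain[OF wf y] .
  have noF: "y \<notin> ends G f" if "f \<in> ?F" for f using one_endD(4)[OF y, of f] that e by blast
  have only: "u = y" if u: "u \<in> verts G" "fv u = fv y" for u
  proof -
    have "reach G ?F y u" using contractionD(5)[OF C yV u(1)] u(2) by simp
    then have "u \<in> {y}" by (rule reach_closed) (use noF in auto)
    then show ?thesis by simp
  qed
  then have fib: "{u\<in>verts G. fv u = fv y} = {y}" using yV by blast
  have y': "fv y \<in> verts G'" using yV contractionD(1)[OF C] by blast
  have "{f\<in>?F. fv ` ends G f = {fv y}} = {}"
  proof -
    have False if f: "f \<in> ?F" "fv ` ends G f = {fv y}" for f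
    proof -
      obtain a b where ab: "ends G f = {a, b}" "a \<in> verts G" using wf_ends[OF wf, of f] f by blast
      then have "a = y" using only f(2) by auto
      then show False using noF[OF f(1)] ab by simp
    qed
    then show ?thesis by blast
  qed
  then have "card {f\<in>?F. fv ` ends G f = {fv y}} = 0" by (simp only: card.empty)
  then have w: "weight G' (fv y) = 0"
    using contractionD(6)[OF C y'] one_endD(5)[OF y] unfolding fib by (simp del: Diff_iff)
  have dg: "deg G' (fv y) = 1" using contractionD(7)[OF C y'] fib one_endD(7)[OF y] by simp
  have ends': "ends G' e = {fv y, fv q}" using contractionD(4)[OF C e] q by simp
  have ne: "fv q \<noteq> fv y" using only[OF q(3)] q(2) by blast
  have others: "f = e" if f: "f \<in> edges G'" "fv y \<in> ends G' f" for f
  proof -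
    have feE: "fe f \<in> edges G" using contractionD(3)[OF C] f by blast
    obtain a where a: "a \<in> ends G (fe f)" "fv a = fv y" using f contractionD(4)[OF C f(1)] by auto
    then have "a \<in> verts G" using wf_edge(1)[OF wf feE] by blast
    then have "y \<in> ends G (fe f)" using only a by blast
    then have "fe f = fe e" using one_endD(4)[OF y feE] by blast
    then show ?thesis using contractionD(2)[OF C] f e by (auto simp: inj_on_def)
  qed
  have "mark G' i \<noteq> fv y" if i: "i \<in> {1..n}" for i
  proof
    assume "mark G' i = fv y"
    then have "fv (mark G i) = fv y" using contractionD(8)[OF C i] by simp
    then show False using only[OF wf_mark[OF wf i]] one_endD(6)[OF y i] by blast
  qed
  then have "\<forall>i\<in>{1..n}. mark G' i \<noteq> fv y" by blast
  moreover have "\<forall>f\<in>edges G'. fv y \<in> ends G' f \<longrightarrow> f = e" using others by blast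
  moreover have "card (ends G' e) = 2" "fv y \<in> ends G' e" using ends' ne by auto
  ultimately show ?thesis unfolding one_end_def using e w dg by metis
qed

text \<open>
  Stability forces the fibre over a 1-end vertex to be a single vertex: the excess of a 1-end
  vertex is \<open>-1\<close>, vertices of degree zero contribute at least one each, and the vertex
  carrying the degree contributes at least \<open>-1\<close>.
\<close>

lemma one_end_fibre:
  assumes G: "G \<in> stable_graphs n d" and C: "contraction n G fv fe G'" and e: "one_end n G' e y'"
  obtains y where "one_end n G (fe e) y" "{u\<in>verts G. fv u = y'} = {y}"
proof -
  let ?F = "edges G - fe ` edges G'" and ?A = "{u\<in>verts G. fv u = y'}"
  have wf: "wf_wgraph n G" using stable_graphs_wf[OF G] .
  have wf': "wf_wgraph n G'" using contraction_wf[OF wf C] .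
  have fin: "finite (verts G)" "finite (edges G)" using wf_finite[OF wf] by auto
  have y': "y' \<in> verts G'" using one_end_verts[OF wf' e] .
  have eE: "e \<in> edges G'" using one_endD(1)[OF e] .
  then have feE: "fe e \<in> edges G" using contractionD(3)[OF C] by blast
  have ends': "ends G' e = fv ` ends G (fe e)" using contractionD(4)[OF C eE] .
  obtain a where a: "a \<in> ends G (fe e)" "fv a = y'" using one_endD(3)[OF e] ends' by auto
  have aV: "a \<in> verts G" using wf_edge(1)[OF wf feE] a by blast
  have dsum: "(\<Sum>u\<in>?A. deg G u) = 1" using contractionD(7)[OF C y'] one_endD(7)[OF e] by simp
  then have "(\<Sum>u\<in>?A. deg G u) > 0" by simp
  then obtain y where y: "y \<in> ?A" "deg G y > 0" by (rule sum_pos_obtain)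
  have "(\<Sum>u\<in>?A. deg G u) = deg G y + (\<Sum>u\<in>?A - {y}. deg G u)"
    using fin y by (intro sum.remove) auto
  then have dy: "deg G y = 1" and d0: "(\<Sum>u\<in>?A - {y}. deg G u) = 0" using dsum y by auto
  have "valence G y \<ge> 1"
  proof (cases "y = a")
    case True
    then show ?thesis using valence_pos[OF fin(2) feE] a by simp
  next
    case False
    have "reach G ?F a y" using contractionD(5)[OF C aV, of y] a y by simp
    then obtain f x where "f \<in> ?F" "ends G f = {x, y}" using reach_first_hit[of a y G ?F] False by metis
    then show ?thesis using valence_pos[OF fin(2), of f y] by simp
  qed
  then have exy: "vertex_excess n G y \<ge> - 1" by (simp add: vertex_excess_def)
  have ex1: "vertex_excess n G u \<ge> 1" if "u \<in> ?A - {y}" for u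
  proof -
    have "deg G u = 0" using d0 fin that by simp
    then have "vertex_excess n G u > 0" using G that by (auto simp: stable_graphs_def stable_iff)
    then show ?thesis by simp
  qed
  have ey': "vertex_excess n G' y' = - 1"
  proof -
    have "{f\<in>edges G'. y' \<in> ends G' f} = {e}" using one_endD(1,3,4)[OF e] by blast
    moreover have "ends G' f \<noteq> {y'}" if f: "f \<in> edges G'" for f
    proof
      assume l: "ends G' f = {y'}"
      then have "f = e" using one_endD(4)[OF e f] by blast
      then show False using l one_endD(2)[OF e] by simp
    qed
    then have "{f\<in>edges G'. ends G' f = {y'}} = {}" by blast
    moreover have "{i\<in>{1..n}. mark G' i = y'} = {}" using one_endD(6)[OF e] by blast
    ultimately show ?thesis
      unfolding vertex_excess_def valence_def using one_endD(5)[OF e] by (simp only: card.empty) simp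
  qed
  have "(\<Sum>u\<in>?A. vertex_excess n G u) = vertex_excess n G y + (\<Sum>u\<in>?A - {y}. vertex_excess n G u)"
    using fin y(1) by (intro sum.remove) auto
  then have "(\<Sum>u\<in>?A - {y}. vertex_excess n G u) \<le> 0"
    using contraction_excess[OF wf C y'] ey' exy by simp
  moreover have "(\<Sum>u\<in>?A - {y}. 1) \<le> (\<Sum>u\<in>?A - {y}. vertex_excess n G u)" using ex1 by (intro sum_mono) blast
  ultimately have "card (?A - {y}) = 0" by simp
  then have "?A - {y} = {}" using fin by simp
  then have fib: "?A = {y}" using y(1) by blast
  have ay: "a = y" using a aV fib by blast
  have "weight G' y' + card ?A = (\<Sum>u\<in>?A. weight G u) + card {f\<in>?F. fv ` ends G f = {y'}} + 1"
    using contractionD(6)[OF C y'] .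
  then have w: "weight G y = 0" and F0: "card {f\<in>?F. fv ` ends G f = {y'}} = 0"
    unfolding fib using one_endD(5)[OF e] by auto
  have noF: "y \<notin> ends G f" if f: "f \<in> ?F" for f
  proof
    assume yf: "y \<in> ends G f"
    obtain p q where pq: "ends G f = {p, q}" using wf_ends[OF wf, of f] f by blast
    then have "fv ` ends G f = {y'}" using contracted_edge_const[OF wf C f pq] yf y(1) by auto
    then have "f \<in> {f\<in>?F. fv ` ends G f = {y'}}" using f by blast
    moreover have "finite {f\<in>?F. fv ` ends G f = {y'}}" using fin by simp
    ultimately show False using F0 by (metis card_eq_0_iff empty_iff)
  qed
  have others: "f = fe e" if f: "f \<in> edges G" "y \<in> ends G f" for f
  proof -
    obtain f' where f': "f' \<in> edges G'" "f = fe f'" using noF f by blast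
    then have "y' \<in> ends G' f'" using contractionD(4)[OF C f'(1)] f(2) y(1) by auto
    then show ?thesis using one_endD(4)[OF e f'(1)] f'(2) by simp
  qed
  have c2: "card (ends G (fe e)) = 2"
  proof -
    have "card (ends G (fe e)) \<noteq> 1"
    proof
      assume "card (ends G (fe e)) = 1"
      then have "card (ends G' e) = 1" unfolding ends' by (auto simp: card_1_singleton_iff)
      then show False using one_endD(2)[OF e] by simp
    qed
    then show ?thesis using wf_edge(2)[OF wf feE] by blast
  qed
  have "mark G i \<noteq> y" if i: "i \<in> {1..n}" for i
    using contractionD(8)[OF C i] one_endD(6)[OF e i] y(1) by auto
  then have "one_end n G (fe e) y"
    unfolding one_end_def using feE c2 a ay others w dy by blast
  then show ?thesis using that fib by blast
qed

text \<open>
  Sprouting is functorial. A tip of the sprouting projects to the vertex whose degree it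
  carries, so over each vertex of \<open>G'\<close> there are as many tips of the one sprouting as of
  the other, and a matching of the tips over \<open>G'\<close> extends to a contraction. Tips are never
  contracted: if a contraction swallows a 1-end of \<open>G\<close>, that edge becomes a new sprout.
\<close>

lemma sprout_contraction:
  assumes G: "G \<in> stable_graphs n d" and C: "contraction n G fv fe G'"
  obtains sv se where "contraction n (sprout n G) sv se (sprout n G')"
    "\<And>e. e \<in> edges G' \<Longrightarrow> se e = fe e"
    "\<And>e. e \<in> edges (sprout n G') \<Longrightarrow>
       one_end_edge n (sprout n G') e \<longleftrightarrow> one_end_edge n (sprout n G) (se e)"
    "\<And>e. e \<in> edges (sprout n G) - se ` edges (sprout n G') \<Longrightarrow>
       e \<in> edges G \<and> \<not> one_end_edge n (sprout n G) e"
proof -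
  let ?F = "edges G - fe ` edges G'" and ?S = "sprout n G" and ?S' = "sprout n G'"
  let ?L = "sprout_labels n G" and ?L' = "sprout_labels n G'"
  let ?T = "tips n G" and ?T' = "tips n G'"
  let ?p = "sprout_proj n G" and ?p' = "sprout_proj n G'"
  let ?te = "tip_edge n G"
  have wf: "wf_wgraph n G" using stable_graphs_wf[OF G] .
  have G': "G' \<in> stable_graphs n d" using contraction_stable_graphs[OF G C] .
  have wf': "wf_wgraph n G'" using stable_graphs_wf[OF G'] .
  have V': "verts G' = fv ` verts G" using contractionD(1)[OF C] by simp
  have fin: "finite (verts G)" "finite (edges G)" using wf_finite[OF wf] by auto
  have finT: "finite ?T" "finite ?T'" using finite_tips wf wf' by auto
  have pT: "?p x \<in> verts G" if "x \<in> ?T" for x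
    using that sprout_anchor(1) by (auto simp: tips_def sprout_proj_def)
  have pT': "?p' x \<in> verts G'" if "x \<in> ?T'" for x
    using that sprout_anchor(1) by (auto simp: tips_def sprout_proj_def)
  have pV: "?p v = v" if "v \<in> verts G" for v
    using that sprout_labels_fresh(1)[OF wf] by (auto simp: sprout_proj_def)
  have pV': "?p' v = v" if "v \<in> verts G'" for v
    using that sprout_labels_fresh(1)[OF wf'] by (auto simp: sprout_proj_def)
  have count: "card {x\<in>?T. fv (?p x) = v} = card {x\<in>?T'. ?p' x = v}" for v
  proof (cases "v \<in> verts G'")
    case True
    have "{x\<in>?T. fv (?p x) = v} = {x\<in>?T. ?p x \<in> {u\<in>verts G. fv u = v}}" using pT by blast
    then have "card {x\<in>?T. fv (?p x) = v} = (\<Sum>u | u \<in> verts G \<and> fv u = v. card {x\<in>?T. ?p x = u})"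
      using card_fibres[OF finT(1), of "{u\<in>verts G. fv u = v}" ?p] fin by simp
    also have "\<dots> = (\<Sum>u | u \<in> verts G \<and> fv u = v. deg G u)"
      using sprout_proj_tips[OF wf] by (intro sum.cong) auto
    also have "\<dots> = deg G' v" using contractionD(7)[OF C True] by simp
    also have "\<dots> = card {x\<in>?T'. ?p' x = v}" using sprout_proj_tips[OF wf' True] by simp
    finally show ?thesis .
  next
    case False
    then have "{x\<in>?T. fv (?p x) = v} = {}" "{x\<in>?T'. ?p' x = v} = {}" using pT pT' V' by auto
    then show ?thesis by (simp only:)
  qed
  obtain \<gamma> where \<gamma>: "bij_betw \<gamma> ?T ?T'" "\<And>x. x \<in> ?T \<Longrightarrow> ?p' (\<gamma> x) = fv (?p x)"
    using fibres_bij[OF finT count] by blast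
  define \<beta> where "\<beta> = inv_into ?T \<gamma>"
  have \<gamma>T: "\<gamma> x \<in> ?T'" if "x \<in> ?T" for x using \<gamma>(1) that by (auto simp: bij_betw_def)
  have \<gamma>inj: "x = y" if "x \<in> ?T" "y \<in> ?T" "\<gamma> x = \<gamma> y" for x y
    using \<gamma>(1) that by (auto simp: bij_betw_def inj_on_def)
  have \<beta>: "\<beta> x \<in> ?T" "\<gamma> (\<beta> x) = x" if "x \<in> ?T'" for x
    using \<gamma>(1) that unfolding \<beta>_def by (auto simp: bij_betw_def intro: inv_into_into f_inv_into_f)
  have \<beta>\<gamma>: "\<beta> (\<gamma> x) = x" if "x \<in> ?T" for x using \<gamma>inj \<beta> \<gamma>T that by blast
  define End where "End = {v\<in>verts G. one_end_vert n G v}"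
  define End' where "End' = {v\<in>verts G'. one_end_vert n G' v}"
  define U where "U = verts G - End"
  define U' where "U' = verts G' - End'"
  have T: "?T = ?L \<union> End" and T': "?T' = ?L' \<union> End'" by (simp_all add: tips_def End_def End'_def)
  have EndV: "y \<in> End \<Longrightarrow> y \<in> verts G" for y by (simp add: End_def)
  have te: "one_end n G (?te y) y" if "y \<in> End" for y
    using that tip_edge_old[OF wf] unfolding End_def one_end_vert_def by fastforce
  have EndI: "y \<in> End" if "one_end n G e y" for e y
    using one_end_verts[OF wf that] that by (auto simp: End_def one_end_vert_def)
  have te_uniq: "x = y" if "y \<in> End" "one_end n G (?te y) x" for x y
    using one_end_unique[OF stable_graphs_genus[OF G]] te that by blast
  have lab: "x \<in> ?L \<Longrightarrow> x \<notin> End \<and> x \<notin> verts G \<and> x \<notin> edges G" for x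
    using sprout_labels_fresh[OF wf] EndV by blast
  have lab': "x \<in> ?L' \<Longrightarrow> x \<notin> End' \<and> x \<notin> verts G' \<and> x \<notin> edges G'" for x
    using sprout_labels_fresh[OF wf'] by (auto simp: End'_def)
  \<comment> \<open>a tip keeps its label if its edge survives, and becomes a new sprout otherwise\<close>
  have keep: "fv y \<in> End' \<and> \<gamma> y = fv y" if y: "y \<in> End" "?te y \<in> fe ` edges G'" for y
  proof -
    obtain e where e: "e \<in> edges G'" "?te y = fe e" using y by blast
    have "one_end n G' e (fv y)" using one_end_contraction[OF G C e(1)] te[OF y(1)] e(2) by simp
    then have E: "fv y \<in> End'" using one_end_verts[OF wf'] by (auto simp: End'_def one_end_vert_def)
    have p: "?p' (\<gamma> y) = fv y" using \<gamma>(2)[of y] y(1) T pV EndV by auto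
    have "\<gamma> y \<notin> ?L'"
    proof
      assume l: "\<gamma> y \<in> ?L'"
      then have "sprout_anchor G' (\<gamma> y) = fv y" using p by (simp add: sprout_proj_def)
      then show False using sprout_anchor(2)[OF l] E by (auto simp: End'_def)
    qed
    then have "?p' (\<gamma> y) = \<gamma> y" by (simp add: sprout_proj_def)
    then show ?thesis using p E by simp
  qed
  have moved: "\<gamma> x \<in> ?L'" if x: "x \<in> ?T" "\<not> (x \<in> End \<and> ?te x \<in> fe ` edges G')" for x
  proof (rule ccontr)
    assume "\<gamma> x \<notin> ?L'"
    then have E: "\<gamma> x \<in> End'" using \<gamma>T[OF x(1)] T' by blast
    then obtain e where e: "one_end n G' e (\<gamma> x)" by (auto simp: End'_def one_end_vert_def)
    obtain y where y: "one_end n G (fe e) y" "{u\<in>verts G. fv u = \<gamma> x} = {y}"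
      using one_end_fibre[OF G C e] by blast
    have "\<gamma> x = fv (?p x)" using \<gamma>(2)[OF x(1)] pV' E by (simp add: End'_def)
    then have "?p x = y" using y(2) pT[OF x(1)] by (metis (mono_tags, lifting) mem_Collect_eq singletonD)
    show False
    proof (cases "x \<in> ?L")
      case True
      then show False using \<open>?p x = y\<close> sprout_anchor(2)[OF True] y(1) by (auto simp: sprout_proj_def one_end_vert_def)
    next
      case False
      then have "x \<in> End" "x = y" using x(1) T \<open>?p x = y\<close> by (auto simp: sprout_proj_def)
      then show False using x(2) tip_edge_old[OF wf y(1)] one_endD(1)[OF e] by auto
    qed
  qed
  have fvU: "fv u \<in> U'" if u: "u \<in> U" for u
  proof -
    have uV: "u \<in> verts G" "u \<notin> End" using u by (auto simp: U_def)
    have "fv u \<notin> End'"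
    proof
      assume "fv u \<in> End'"
      then obtain e where e: "one_end n G' e (fv u)" by (auto simp: End'_def one_end_vert_def)
      obtain y where y: "one_end n G (fe e) y" "{w\<in>verts G. fv w = fv u} = {y}"
        using one_end_fibre[OF G C e] by blast
      have "u \<in> {w\<in>verts G. fv w = fv u}" using uV by simp
      then have "u = y" unfolding y(2) by simp
      then show False using uV EndI[OF y(1)] by blast
    qed
    then show ?thesis using uV V' by (auto simp: U'_def)
  qed
  have nb: "\<exists>q\<in>U. ends G (?te y) = {y, q}" if y: "y \<in> End" for y
  proof -
    obtain q where q: "ends G (?te y) = {y, q}" "q \<noteq> y" "q \<in> verts G" using one_end_obtain[OF wf te[OF y]] .
    have "q \<notin> End"
    proof
      assume "q \<in> End"
      then have "?te y = ?te q"
        using one_endD(4)[OF te[of q], of "?te y"] one_endD(1)[OF te[OF y]] q(1) by auto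
      then have "one_end n G (?te y) q" using te[OF \<open>q \<in> End\<close>] by simp
      then show False using te_uniq[OF y] q(2) by blast
    qed
    then show ?thesis using q by (auto simp: U_def)
  qed
  then obtain q where q: "\<And>y. y \<in> End \<Longrightarrow> q y \<in> U \<and> ends G (?te y) = {y, q y}" by metis
  have qc: "fv (q y) = fv y" if "y \<in> End" "?te y \<in> ?F" for y
    using contracted_edge_const[OF wf C that(2), of y "q y"] q[OF that(1)] by simp
  have Ufib: "\<exists>u\<in>U. fv u = v'" if v': "v' \<in> U'" for v'
  proof -
    obtain v where v: "v \<in> verts G" "fv v = v'" using v' V' by (auto simp: U'_def)
    show ?thesis
    proof (cases "v \<in> End")
      case True
      then have "?te v \<in> ?F" using keep[OF True] v v' one_endD(1)[OF te[OF True]] by (auto simp: U'_def)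
      then show ?thesis using qc[OF True] q[OF True] v by auto
    qed (use v in \<open>auto simp: U_def\<close>)
  qed
  define K where "K = {e\<in>?F. \<not> one_end_edge n G e}"
  have KU: "a \<in> U \<and> b \<in> U" if "e \<in> edges G" "\<not> one_end_edge n G e" "ends G e = {a, b}" for e a b
  proof -
    have "x \<notin> End" if "x \<in> ends G e" for x
      using one_endD(4)[OF te[of x], of e] te[of x] that \<open>e \<in> edges G\<close> \<open>\<not> one_end_edge n G e\<close>
      unfolding one_end_edge_def by blast
    then show ?thesis using that wf_edge(1)[OF wf that(1)] by (auto simp: U_def)
  qed
  have end_edge: "\<exists>y\<in>End. e = ?te y" if "one_end_edge n G e" for e
    using that EndI tip_edge_old[OF wf] unfolding one_end_edge_def by metis
  define sv where "sv x = (if x \<in> ?T then \<gamma> x else fv x)" for x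
  define se where "se e = (if e \<in> edges G' then fe e else ?te (\<beta> e))" for e
  have VS: "verts ?S = ?T \<union> U" and VS': "verts ?S' = ?T' \<union> U'"
    by (auto simp: sprout_simps T T' U_def U'_def End_def End'_def)
  have TU: "x \<notin> ?T" if "x \<in> U" for x using that lab by (auto simp: T U_def)
  have TU': "x \<notin> ?T'" if "x \<in> U'" for x using that lab' by (auto simp: T' U'_def)
  have svU: "sv u = fv u" if "u \<in> U" for u using TU[OF that] by (simp add: sv_def)
  have svT: "sv x = \<gamma> x" if "x \<in> ?T" for x using that by (simp add: sv_def)
  have ES: "edges ?S = edges G \<union> ?L" and ES': "edges ?S' = edges G' \<union> ?L'" by (simp_all add: sprout_simps)
  have seE: "se e = fe e" if "e \<in> edges G'" for e using that by (simp add: se_def)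
  have seL: "se x = ?te (\<beta> x)" if "x \<in> ?L'" for x using that lab' by (simp add: se_def)
  have \<beta>L: "\<beta> x \<in> ?L \<or> (\<beta> x \<in> End \<and> ?te (\<beta> x) \<in> ?F)" if x: "x \<in> ?L'" for x
  proof -
    have xT: "x \<in> ?T'" using x T' by blast
    have "\<not> (\<beta> x \<in> End \<and> ?te (\<beta> x) \<in> fe ` edges G')"
      using keep[of "\<beta> x"] \<beta>(2)[OF xT] lab'[OF x] by auto
    then show ?thesis using \<beta>(1)[OF xT] T one_endD(1)[OF te[of "\<beta> x"]] by blast
  qed
  have seL_not: "se x \<notin> fe ` edges G'" if x: "x \<in> ?L'" for x
    using \<beta>L[OF x] tip_edge_label[OF wf, of "\<beta> x"] lab[of "\<beta> x"] seL[OF x] contractionD(3)[OF C] by auto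
  have imse: "edges ?S - se ` edges ?S' = K"
  proof (intro set_eqI iffI)
    fix e assume e: "e \<in> edges ?S - se ` edges ?S'"
    have nt: "e \<noteq> ?te x" if x: "x \<in> ?T" "\<not> (x \<in> End \<and> ?te x \<in> fe ` edges G')" for x
    proof
      assume ex: "e = ?te x"
      have l: "\<gamma> x \<in> ?L'" using moved[OF x] .
      then have "se (\<gamma> x) = e" using seL \<beta>\<gamma>[OF x(1)] ex by simp
      moreover have "\<gamma> x \<in> edges ?S'" using l ES' by simp
      ultimately show False using e by (metis DiffD2 imageI)
    qed
    have eL: "e \<notin> ?L"
    proof
      assume l: "e \<in> ?L"
      have "e \<in> ?T" "e \<notin> End" using l T lab[OF l] by auto
      then show False using nt[of e] tip_edge_label[OF wf l] by simp
    qed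
    have efe: "e \<notin> fe ` edges G'"
    proof
      assume "e \<in> fe ` edges G'"
      then obtain f where "f \<in> edges G'" "e = se f" using seE by auto
      then show False using e ES' by (metis DiffD2 UnI1 imageI)
    qed
    have "e \<in> edges G" using e ES eL by blast
    then have eF: "e \<in> ?F" using efe by simp
    have "\<not> one_end_edge n G e"
    proof
      assume "one_end_edge n G e"
      then obtain y where "y \<in> End" "e = ?te y" using end_edge by blast
      then show False using nt[of y] T eF by blast
    qed
    then show "e \<in> K" using eF by (simp add: K_def)
  next
    fix e assume e: "e \<in> K"
    have "e \<noteq> se x" if x: "x \<in> ?L'" for x
    proof
      assume "e = se x"
      then have "e = ?te (\<beta> x)" using seL[OF x] by simp
      then show False
        using \<beta>L[OF x] tip_edge_label[OF wf, of "\<beta> x"] lab[of "\<beta> x"] e te[of "\<beta> x"]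
        by (auto simp: K_def one_end_edge_def)
    qed
    then show "e \<in> edges ?S - se ` edges ?S'" using e seE by (auto simp: K_def ES ES')
  qed
  have KE: "e \<in> edges G" "e \<in> ?F" if "e \<in> K" for e using that by (auto simp: K_def)
  have endsK: "ends ?S e = ends G e" if "e \<in> K" for e using sprout_edge_old[OF wf KE(1)[OF that]] .
  have endsKU: "a \<in> U \<and> b \<in> U" if "e \<in> K" "ends G e = {a, b}" for e a b
    using KU[of e a b] that by (auto simp: K_def)
  have c1: "sv ` verts ?S = verts ?S'"
  proof -
    have "sv ` ?T = ?T'" using svT \<gamma>(1) by (auto simp: bij_betw_def)
    moreover have "sv ` U = U'" using svU fvU Ufib by force
    ultimately show ?thesis unfolding VS VS' by blast
  qed
  have c2: "inj_on se (edges ?S')"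
  proof -
    have i1: "inj_on se (edges G')" using contractionD(2)[OF C] seE by (auto simp: inj_on_def)
    have i2: "inj_on se ?L'"
    proof (rule inj_onI)
      fix x y assume xy: "x \<in> ?L'" "y \<in> ?L'" "se x = se y"
      then have "x \<in> ?T'" "y \<in> ?T'" using T' by auto
      moreover have "?te (\<beta> x) = ?te (\<beta> y)" using xy seL by simp
      ultimately have "\<beta> x = \<beta> y" using inj_on_tip_edge[OF G] \<beta>(1) by (auto simp: inj_on_def)
      then show "x = y" using \<beta>(2) \<open>x \<in> ?T'\<close> \<open>y \<in> ?T'\<close> by metis
    qed
    have i3: "se x \<noteq> se e" if "x \<in> ?L'" "e \<in> edges G'" for x e
      using seL_not[OF that(1)] seE[OF that(2)] that(2) by (metis imageI)
    show ?thesis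
    proof (rule inj_onI)
      fix x y assume xy: "x \<in> edges ?S'" "y \<in> edges ?S'" "se x = se y"
      consider "x \<in> edges G'" "y \<in> edges G'" | "x \<in> ?L'" "y \<in> ?L'"
        | "x \<in> ?L'" "y \<in> edges G'" | "x \<in> edges G'" "y \<in> ?L'"
        using xy(1,2) ES' by blast
      then show "x = y"
      proof cases
        case 1
        then show ?thesis using i1 xy(3) by (simp add: inj_on_def)
      next
        case 2
        then show ?thesis using i2 xy(3) by (simp add: inj_on_def)
      next
        case 3
        then show ?thesis using i3 xy(3) by blast
      next
        case 4
        then show ?thesis using i3[of y x] xy(3) by simp
      qed
    qed
  qed
  have c3: "se ` edges ?S' \<subseteq> edges ?S"
  proof -
    have "se x \<in> edges ?S" if x: "x \<in> ?L'" for x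
      using one_endD(1)[OF tip_edge_one_end[OF wf \<beta>(1)]] seL[OF x] x T' by auto
    then show ?thesis using seE contractionD(3)[OF C] by (auto simp: ES ES')
  qed
  have c4: "ends ?S' e = sv ` ends ?S (se e)" if e: "e \<in> edges ?S'" for e
  proof (cases "e \<in> ?L'")
    case True
    then have eT: "e \<in> ?T'" using T' by blast
    let ?x = "\<beta> e"
    have xT: "?x \<in> ?T" "\<gamma> ?x = e" using \<beta>[OF eT] by auto
    have an: "sprout_anchor G' e = fv (?p ?x)" using \<gamma>(2)[OF xT(1)] xT(2) True by (simp add: sprout_proj_def)
    consider "?x \<in> ?L" | "?x \<in> End" "?te ?x \<in> ?F" using \<beta>L[OF True] by blast
    then have "sv ` ends ?S (se e) = {sprout_anchor G' e, e}"
    proof cases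
      case 1
      have aU: "sprout_anchor G ?x \<in> U" using sprout_anchor[OF 1] by (auto simp: U_def End_def)
      have "ends ?S (se e) = {sprout_anchor G ?x, ?x}"
        using seL[OF True] tip_edge_label[OF wf 1] sprout_simps(4)[OF 1] by simp
      then show ?thesis using an svU[OF aU] svT[OF xT(1)] xT(2) 1 by (simp add: sprout_proj_def)
    next
      case 2
      have "ends ?S (se e) = {?x, q ?x}"
        using seL[OF True] sprout_edge_old[OF wf, of "?te ?x"] q[OF 2(1)] 2(2) by simp
      moreover have "sv (q ?x) = fv ?x" using svU q[OF 2(1)] qc[OF 2] by simp
      ultimately show ?thesis using an svT[OF xT(1)] xT(2) pV[OF EndV[OF 2(1)]] by auto
    qed
    then show ?thesis using sprout_simps(4)[OF True] by simp
  next
    case False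
    then have eE: "e \<in> edges G'" using e ES' by blast
    then have fE: "fe e \<in> edges G" using contractionD(3)[OF C] by blast
    have "sv z = fv z" if z: "z \<in> ends G (fe e)" for z
    proof (cases "z \<in> End")
      case True
      have "fe e = ?te z" using one_endD(4)[OF te[OF True] fE z] .
      then have "\<gamma> z = fv z" using keep[OF True] eE by (metis imageI)
      then show ?thesis using svT True T by auto
    next
      case zE: False
      then have "z \<in> U" using wf_edge(1)[OF wf fE] z by (auto simp: U_def)
      then show ?thesis using svU by blast
    qed
    then have "sv ` ends G (fe e) = fv ` ends G (fe e)" by (intro image_cong) auto
    then show ?thesis
      using sprout_edge_old[OF wf fE] sprout_edge_old[OF wf' eE] contractionD(4)[OF C eE] seE[OF eE] by simp
  qed
  have adjK: "reach ?S K u v \<longleftrightarrow> reach G K u v" for u v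
  proof -
    have "adj ?S K = adj G K" using endsK by (auto simp: adj_def)
    then show ?thesis by simp
  qed
  have c5: "sv u = sv v \<longleftrightarrow> reach ?S K u v" if uv: "u \<in> verts ?S" "v \<in> verts ?S" for u v
  proof
    assume "reach ?S K u v"
    then have "reach G K u v" using adjK by simp
    then have "v \<in> {z. sv u = sv z}"
    proof (rule reach_closed)
      fix e a b assume e: "e \<in> K" "ends G e = {a, b}" "a \<in> {z. sv u = sv z}"
      have "fv a = fv b" using contracted_edge_const[OF wf C KE(2)[OF e(1)] e(2)] .
      then show "b \<in> {z. sv u = sv z}" using e(3) svU endsKU[OF e(1,2)] by simp
    qed simp
    then show "sv u = sv v" by simp
  next
    assume eq: "sv u = sv v"
    show "reach ?S K u v"
    proof (cases "u \<in> ?T")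
      case True
      have "sv u \<in> ?T'" using svT[OF True] \<gamma>T[OF True] by simp
      then have "v \<in> ?T" using eq uv(2) svU fvU TU' unfolding VS by auto
      then have "u = v" using \<gamma>inj True eq svT by simp
      then show ?thesis by simp
    next
      case False
      then have uU: "u \<in> U" using uv(1) VS by blast
      have "sv u \<notin> ?T'" using svU[OF uU] fvU[OF uU] TU' by simp
      then have vU: "v \<in> U" using eq uv(2) svT \<gamma>T unfolding VS by auto
      have "fv u = fv v" using eq svU uU vU by simp
      then have r: "reach G ?F u v" using contractionD(5)[OF C, of u v] uU vU by (simp add: U_def)
      \<comment> \<open>a path between vertices that are not 1-ends can skip its excursions into 1-ends\<close>
      define \<pi> where "\<pi> z = (if z \<in> End then q z else z)" for z
      have "reach G K (\<pi> u) (\<pi> v)"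
      proof (rule reach_map[OF r])
        fix e a b assume e: "e \<in> ?F" "ends G e = {a, b}"
        show "reach G K (\<pi> a) (\<pi> b)"
        proof (cases "one_end_edge n G e")
          case True
          then obtain y where y: "y \<in> End" "e = ?te y" using end_edge by blast
          then have "{a, b} = {y, q y}" and "q y \<in> U" using e q by auto
          then have "\<pi> a = q y" "\<pi> b = q y" using y(1) by (auto simp: \<pi>_def U_def doubleton_eq_iff)
          then show ?thesis by simp
        next
          case False
          then have "e \<in> K" using e by (simp add: K_def)
          moreover have "\<pi> a = a" "\<pi> b = b" using endsKU[OF \<open>e \<in> K\<close> e(2)] by (auto simp: \<pi>_def U_def)
          ultimately show ?thesis using reach_edge[OF _ e(2)] by simp
        qed
      qed
      then show ?thesis using adjK uU vU by (simp add: \<pi>_def U_def)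
    qed
  qed
  have fibT: "{u\<in>verts ?S. sv u = v'} = {\<beta> v'}" if v': "v' \<in> ?T'" for v'
  proof (intro set_eqI iffI)
    fix u assume u: "u \<in> {u\<in>verts ?S. sv u = v'}"
    then have "u \<in> ?T" using svU fvU TU' v' unfolding VS by auto
    then show "u \<in> {\<beta> v'}" using u svT \<beta>\<gamma> by auto
  next
    fix u assume "u \<in> {\<beta> v'}"
    then show "u \<in> {u\<in>verts ?S. sv u = v'}" using \<beta>[OF v'] svT VS by auto
  qed
  have fibU: "{u\<in>verts ?S. sv u = v'} = {u\<in>U. fv u = v'}" if v': "v' \<in> U'" for v'
  proof -
    have "u \<in> U" if "u \<in> verts ?S" "sv u = v'" for u
      using that svT[of u] \<gamma>T[of u] TU'[OF v'] unfolding VS by auto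
    then have "u \<in> verts ?S \<and> sv u = v' \<longleftrightarrow> u \<in> U \<and> fv u = v'" for u
      using svU[of u] VS by (metis UnI2)
    then show ?thesis by simp
  qed
  have K_im: "sv ` ends ?S e = {v'} \<longleftrightarrow> fv ` ends G e = {v'}" if e: "e \<in> K" for e v'
  proof -
    obtain a b where ab: "ends G e = {a, b}" using wf_ends[OF wf KE(1)[OF e]] by blast
    then show ?thesis using endsK[OF e] svU endsKU[OF e ab] by simp
  qed
  have wS: "weight ?S x = 0" if "x \<in> ?T" for x
    using that sprout_simps(6) sprout_weight_old[OF wf EndV] one_endD(5)[OF te] unfolding T by auto
  have wS': "weight ?S' x = 0" if "x \<in> ?T'" for x
    using that sprout_simps(6) sprout_weight_old[OF wf'] one_endD(5) unfolding T' End'_def one_end_vert_def by auto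
  have c6: "weight ?S' v' + card {u\<in>verts ?S. sv u = v'} =
      (\<Sum>u | u \<in> verts ?S \<and> sv u = v'. weight ?S u) + card {e\<in>K. sv ` ends ?S e = {v'}} + 1"
    if v': "v' \<in> verts ?S'" for v'
  proof (cases "v' \<in> ?T'")
    case True
    have "sv ` ends ?S e \<noteq> {v'}" if e: "e \<in> K" for e
    proof -
      obtain a b where ab: "ends G e = {a, b}" using wf_ends[OF wf KE(1)[OF e]] by blast
      then have "fv a \<noteq> v'" using endsKU[OF e ab] fvU TU' True by blast
      then show ?thesis using K_im[OF e] ab by auto
    qed
    then have "{e\<in>K. sv ` ends ?S e = {v'}} = {}" by blast
    then show ?thesis unfolding fibT[OF True] using wS[OF \<beta>(1)[OF True]] wS'[OF True] by (simp only: card.empty) simp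
  next
    case False
    then have vU: "v' \<in> U'" using v' VS' by blast
    then have vV: "v' \<in> verts G'" by (simp add: U'_def)
    let ?A = "{u\<in>verts G. fv u = v'}" and ?AU = "{u\<in>U. fv u = v'}" and ?AE = "{u\<in>End. fv u = v'}"
    have A: "?A = ?AU \<union> ?AE" "?AU \<inter> ?AE = {}" by (auto simp: U_def End_def)
    have fA: "finite ?AU" "finite ?AE" using fin by (auto simp: U_def End_def)
    have cA: "card ?A = card ?AU + card ?AE" unfolding A(1) using fA A(2) by (rule card_Un_disjoint)
    have "(\<Sum>u\<in>?A. weight G u) = (\<Sum>u\<in>?AU. weight G u) + (\<Sum>u\<in>?AE. weight G u)"
      unfolding A(1) using fA A(2) by (rule sum.union_disjoint)
    moreover have "(\<Sum>u\<in>?AE. weight G u) = 0" using one_endD(5)[OF te] by (intro sum.neutral) blast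
    moreover have "(\<Sum>u\<in>?AU. weight G u) = (\<Sum>u\<in>?AU. weight ?S u)"
      using sprout_weight_old[OF wf] by (intro sum.cong) (auto simp: U_def)
    ultimately have sA: "(\<Sum>u\<in>?A. weight G u) = (\<Sum>u\<in>?AU. weight ?S u)" by simp
    have teF: "?te y \<in> ?F" if "y \<in> ?AE" for y
      using keep[of y] that vU one_endD(1)[OF te[of y]] by (auto simp: U'_def)
    have ed: "{e\<in>?F. fv ` ends G e = {v'}} = {e\<in>K. sv ` ends ?S e = {v'}} \<union> ?te ` ?AE"
    proof (intro set_eqI iffI)
      fix e assume e: "e \<in> {e\<in>?F. fv ` ends G e = {v'}}"
      show "e \<in> {e\<in>K. sv ` ends ?S e = {v'}} \<union> ?te ` ?AE"
      proof (cases "one_end_edge n G e")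
        case True
        then obtain y where y: "y \<in> End" "e = ?te y" using end_edge by blast
        then have "y \<in> ?AE" using e q[OF y(1)] by auto
        then show ?thesis using y by blast
      next
        case False
        then have "e \<in> K" using e by (simp add: K_def)
        then show ?thesis using K_im[of e v'] e by simp
      qed
    next
      fix e assume "e \<in> {e\<in>K. sv ` ends ?S e = {v'}} \<union> ?te ` ?AE"
      then show "e \<in> {e\<in>?F. fv ` ends G e = {v'}}"
      proof
        assume "e \<in> {e\<in>K. sv ` ends ?S e = {v'}}"
        then show ?thesis using K_im[of e v'] KE(2)[of e] by simp
      next
        assume "e \<in> ?te ` ?AE"
        then obtain y where y: "y \<in> End" "fv y = v'" "e = ?te y" "y \<in> ?AE" by blast
        have "fv ` ends G e = {v'}" using q[OF y(1)] qc[OF y(1) teF[OF y(4)]] y by auto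
        then show ?thesis using teF[OF y(4)] y(3) by simp
      qed
    qed
    have "{e\<in>K. sv ` ends ?S e = {v'}} \<inter> ?te ` ?AE = {}"
      using te by (auto simp: K_def one_end_edge_def)
    then have "card {e\<in>?F. fv ` ends G e = {v'}} = card {e\<in>K. sv ` ends ?S e = {v'}} + card (?te ` ?AE)"
      unfolding ed using fin fA by (intro card_Un_disjoint) (auto simp: K_def)
    moreover have "card (?te ` ?AE) = card ?AE"
      using inj_on_tip_edge[OF G] T by (intro card_image) (auto simp: inj_on_def)
    ultimately have cE: "card {e\<in>?F. fv ` ends G e = {v'}} = card {e\<in>K. sv ` ends ?S e = {v'}} + card ?AE" by simp
    show ?thesis
      using contractionD(6)[OF C vV] unfolding cA sA cE fibU[OF vU] sprout_weight_old[OF wf' vV] by linarith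
  qed
  have c7: "deg ?S' v' = (\<Sum>u | u \<in> verts ?S \<and> sv u = v'. deg ?S u)" if v': "v' \<in> verts ?S'" for v'
  proof (cases "v' \<in> ?T'")
    case True
    have "\<beta> v' \<in> verts ?S" using \<beta>(1)[OF True] VS by blast
    then show ?thesis
      unfolding fibT[OF True] using sprout_deg_tips[OF wf] sprout_deg_tips[OF wf' v'] \<beta>(1)[OF True] True by simp
  next
    case False
    then have vU: "v' \<in> U'" using v' VS' by blast
    have "(\<Sum>u | u \<in> U \<and> fv u = v'. deg ?S u) = 0"
      using sprout_deg_tips[OF wf] TU VS by (intro sum.neutral) auto
    then show ?thesis unfolding fibU[OF vU] using sprout_deg_tips[OF wf' v'] False by simp
  qed
  have c8: "mark ?S' i = sv (mark ?S i)" if i: "i \<in> {1..n}" for i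
  proof -
    have "mark G i \<notin> End" using one_endD(6)[OF te i] by blast
    then have "mark G i \<in> U" using wf_mark[OF wf i] by (simp add: U_def)
    then show ?thesis using contractionD(8)[OF C i] svU by (simp add: sprout_simps(3))
  qed
  have CS: "contraction n ?S sv se ?S'"
    unfolding contraction_def imse using c1 c2 c3 c4 c5 c6 c7 c8 by simp
  have ends_eq: "one_end_edge n ?S' e \<longleftrightarrow> one_end_edge n ?S (se e)" if e: "e \<in> edges ?S'" for e
  proof (cases "e \<in> ?L'")
    case True
    then have "e \<in> ?T'" using T' by blast
    have "one_end_edge n ?S' e"
      using one_end_edge_sprout[OF wf'] tip_edge_label[OF wf' True] \<open>e \<in> ?T'\<close> by (metis imageI)
    moreover have "one_end_edge n ?S (se e)"
      using one_end_edge_sprout[OF wf] \<beta>(1)[OF \<open>e \<in> ?T'\<close>] seL[OF True] by (metis imageI)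
    ultimately show ?thesis by simp
  next
    case False
    then have eE: "e \<in> edges G'" using e ES' by blast
    then have fE: "fe e \<in> edges G" using contractionD(3)[OF C] by blast
    have "one_end_edge n G' e \<longleftrightarrow> one_end_edge n G (fe e)"
    proof
      assume "one_end_edge n G' e"
      then obtain y' where "one_end n G' e y'" by (auto simp: one_end_edge_def)
      then show "one_end_edge n G (fe e)" using one_end_fibre[OF G C] unfolding one_end_edge_def by metis
    next
      assume "one_end_edge n G (fe e)"
      then show "one_end_edge n G' e" using one_end_contraction[OF G C eE] unfolding one_end_edge_def by blast
    qed
    then show ?thesis
      using one_end_edge_sprout_old[OF wf fE] one_end_edge_sprout_old[OF wf' eE] seE[OF eE] by simp
  qed
  have rest: "e \<in> edges G \<and> \<not> one_end_edge n ?S e" if e: "e \<in> edges ?S - se ` edges ?S'" for e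
    using e one_end_edge_sprout_old[OF wf] unfolding imse by (simp add: K_def)
  show ?thesis using that[OF CS seE ends_eq rest] .
qed

section \<open>The deformation retraction\<close>

lemma retract_lengths_old:
  "e \<in> edges G \<Longrightarrow> retract_lengths n d G l t e =
    (1 - t) * l e + (if one_end_edge n (sprout n G) e then t / real d else 0)"
  by (simp add: retract_lengths_def sprout_simps)

lemma retract_lengths_new:
  assumes "wf_wgraph n G" "e \<in> sprout_labels n G"
  shows "retract_lengths n d G l t e = t / real d"
proof -
  have "one_end_edge n (sprout n G) e"
    using one_end_sprout[OF assms(1)] assms(2) by (auto simp: one_end_edge_def)
  moreover have "e \<notin> edges G" using sprout_labels_fresh(2)[OF assms] .
  ultimately show ?thesis using assms(2) by (simp add: retract_lengths_def sprout_simps)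
qed

text \<open>
  The \<open>d\<close> tips have distinct edges, so the summands \<open>t / d\<close> add up to \<open>t\<close>.
\<close>

lemma retract_lengths_kappa:
  assumes G: "G \<in> stable_graphs n d" and d: "d > 0" and t: "t \<in> {0..1}"
    and l: "\<forall>e\<in>edges G. 0 \<le> (1 - t) * l e" "(1 - t) * (\<Sum>e\<in>edges G. l e) = 1 - t"
  shows "retract_lengths n d G l t \<in> topspace (kappa (sprout n G))"
proof -
  let ?S = "sprout n G"
  have wf: "wf_wgraph n G" using stable_graphs_wf[OF G] .
  have fin: "finite (edges ?S)" using wf_finite(2)[OF wf_sprout[OF wf]] .
  have td: "0 \<le> t / real d" using t d by simp
  have "0 \<le> retract_lengths n d G l t e" if "e \<in> edges ?S" for e
    using that l(1) td by (auto simp: retract_lengths_def)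
  moreover have "(\<Sum>e\<in>edges ?S. retract_lengths n d G l t e) = 1"
  proof -
    have "(\<Sum>e\<in>edges ?S. retract_lengths n d G l t e) =
        (\<Sum>e\<in>edges ?S. (1 - t) * (if e \<in> edges G then l e else 0))
        + (\<Sum>e\<in>edges ?S. if one_end_edge n ?S e then t / real d else 0)"
      by (simp add: retract_lengths_def sum.distrib)
    also have "(\<Sum>e\<in>edges ?S. (1 - t) * (if e \<in> edges G then l e else 0)) = (\<Sum>e\<in>edges G. (1 - t) * l e)"
      using fin by (intro sum.mono_neutral_cong_right) (auto simp: sprout_simps)
    also have "\<dots> = 1 - t" using l(2) by (simp add: sum_distrib_left)
    also have "(\<Sum>e\<in>edges ?S. if one_end_edge n ?S e then t / real d else 0) =
        (\<Sum>e\<in>tip_edge n G ` tips n G. t / real d)"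
    proof (rule sum.mono_neutral_cong_right[OF fin])
      show "tip_edge n G ` tips n G \<subseteq> edges ?S" using one_endD(1)[OF tip_edge_one_end[OF wf]] by blast
    qed (auto simp: one_end_edge_sprout[OF wf])
    also have "\<dots> = real d * (t / real d)"
      using card_image[OF inj_on_tip_edge[OF G]] card_tips[OF G] by simp
    finally show ?thesis using d by simp
  qed
  ultimately show ?thesis unfolding topspace_kappa by (simp add: retract_lengths_def)
qed

definition H_rep :: "nat \<Rightarrow> nat \<Rightarrow> real \<Rightarrow> wgraph \<times> (nat \<Rightarrow> real) \<Rightarrow> (wgraph \<times> (nat \<Rightarrow> real)) set" where
  "H_rep n d t = (\<lambda>(G, l). vir_class n d (sprout n G, retract_lengths n d G l t))"

lemma kappa_retract:
  assumes "G \<in> stable_graphs n d" "d > 0" "t \<in> {0..1}" "l \<in> topspace (kappa G)"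
  shows "retract_lengths n d G l t \<in> topspace (kappa (sprout n G))"
  using assms by (intro retract_lengths_kappa) (auto simp: topspace_kappa)

text \<open>
  The hypotheses constrain only \<open>(1 - t) * l\<close>, so that for \<open>t = 1\<close> the lengths are
  arbitrary and \<open>G'\<close> may have no edges at all.
\<close>

lemma H_rep_contraction:
  assumes G: "G \<in> stable_graphs n d" and C: "contraction n G fv fe G'"
    and eq: "\<And>e. e \<in> edges G' \<Longrightarrow> (1 - t) * l (fe e) = (1 - t) * l' e"
    and zero: "\<And>e. e \<in> edges G - fe ` edges G' \<Longrightarrow> (1 - t) * l e = 0"
    and k: "retract_lengths n d G' l' t \<in> topspace (kappa (sprout n G'))"
  shows "H_rep n d t (G, l) = H_rep n d t (G', l')"
proof -
  let ?S = "sprout n G" and ?S' = "sprout n G'"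
  have wf: "wf_wgraph n G" using stable_graphs_wf[OF G] .
  have wf': "wf_wgraph n G'" using contraction_wf[OF wf C] .
  obtain sv se where s: "contraction n ?S sv se ?S'" "\<And>e. e \<in> edges G' \<Longrightarrow> se e = fe e"
    "\<And>e. e \<in> edges ?S' \<Longrightarrow> one_end_edge n ?S' e \<longleftrightarrow> one_end_edge n ?S (se e)"
    "\<And>e. e \<in> edges ?S - se ` edges ?S' \<Longrightarrow> e \<in> edges G \<and> \<not> one_end_edge n ?S e"
    using sprout_contraction[OF G C] by metis
  have "retract_lengths n d G l t (se e) = retract_lengths n d G' l' t e" if e: "e \<in> edges ?S'" for e
  proof (cases "e \<in> edges G'")
    case True
    have "fe e \<in> edges G" using contractionD(3)[OF C] True by blast
    then show ?thesis
      using retract_lengths_old[of "fe e" G] retract_lengths_old[OF True] eq[OF True] s(2)[OF True] s(3)[OF e] by simp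
  next
    case False
    then have L: "e \<in> sprout_labels n G'" using e by (simp add: sprout_simps(2))
    have oe: "one_end_edge n ?S (se e)"
      using s(3)[OF e] one_end_edge_sprout[OF wf'] tip_edge_label[OF wf' L] L by (metis UnI1 imageI tips_def)
    have seS: "se e \<in> edges ?S" using contractionD(3)[OF s(1)] e by blast
    have "se e \<notin> fe ` edges G'"
    proof
      assume "se e \<in> fe ` edges G'"
      then obtain f where f: "f \<in> edges G'" "se e = se f" using s(2) by auto
      then have "e = f" using contractionD(2)[OF s(1)] e by (auto simp: inj_on_def sprout_simps(2))
      then show False using f False by simp
    qed
    then have "retract_lengths n d G l t (se e) = t / real d"
      using seS oe zero[of "se e"] by (simp add: retract_lengths_def)
    then show ?thesis using retract_lengths_new[OF wf' L] by simp
  qed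
  moreover have "retract_lengths n d G l t e = 0" if e: "e \<in> edges ?S - se ` edges ?S'" for e
  proof -
    have "e \<notin> fe ` edges G'"
    proof
      assume "e \<in> fe ` edges G'"
      then obtain f where "f \<in> edges G'" "e = se f" using s(2) by auto
      then show False using e by (metis DiffD2 UnI1 imageI sprout_simps(2))
    qed
    then have "(1 - t) * l e = 0" using s(4)[OF e] zero by blast
    then show ?thesis using retract_lengths_old[of e G] s(4)[OF e] by simp
  qed
  moreover have "retract_lengths n d G l t \<in> extensional (edges ?S)" by (simp add: retract_lengths_def)
  ultimately show ?thesis
    unfolding H_rep_def case_prod_conv by (intro vir_class_contraction[OF stable_sprout[OF G] s(1) k])
qed

lemma H_rep_invariant:
  assumes d: "d > 0" and m: "graph_mor n d G f G'" and x: "x \<in> topspace (kappa G')" and t: "t \<in> {0..1}"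
  shows "H_rep n d t (G', x) = H_rep n d t (G, kappa_incl G f G' x)"
proof -
  have C: "contraction n G (fst f) (snd f) G'" using graph_mor_contraction[OF m] by simp
  note g = graph_mor_inj[OF m]
  have "H_rep n d t (G, kappa_incl G f G' x) = H_rep n d t (G', x)"
  proof (rule H_rep_contraction[OF g(1) C _ _ kappa_retract[OF g(2) d t x]])
    fix e assume "e \<in> edges G'"
    then have "kappa_incl G f G' x (snd f e) = x e"
      unfolding kappa_incl_def using g by (intro extend_zero_image) auto
    then show "(1 - t) * kappa_incl G f G' x (snd f e) = (1 - t) * x e" by simp
  next
    fix e assume "e \<in> edges G - snd f ` edges G'"
    then show "(1 - t) * kappa_incl G f G' x e = 0" by (simp add: kappa_incl_def extend_zero_other)
  qed
  then show ?thesis by simp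
qed

lemma retraction_H_class:
  assumes "d > 0" "t \<in> {0..1}" "G \<in> stable_graphs n d" "l \<in> topspace (kappa G)"
  shows "retraction_H n d (vir_class n d (G, l)) t = H_rep n d t (G, l)"
proof -
  have "retraction_H n d p t = descend (H_rep n d t) p" for p
    by (simp add: retraction_H_def H_rep_def)
  moreover have "descend (H_rep n d t) (vir_class n d (G, l)) = H_rep n d t (G, l)"
    unfolding vir_class_def using assms by (intro vir.descend_cls H_rep_invariant) auto
  ultimately show ?thesis by simp
qed

lemma vir_class_in_topspace:
  "G \<in> stable_graphs n d \<Longrightarrow> l \<in> topspace (kappa G) \<Longrightarrow> vir_class n d (G, l) \<in> topspace (Delta_vir n d)"
  unfolding Delta_vir_def vir.topspace_colimit vir_class_def by (intro imageI) simp

lemma topspace_Delta_vir: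
  "topspace (Delta_vir n d) = {vir_class n d (G, l) | G l. G \<in> stable_graphs n d \<and> l \<in> topspace (kappa G)}"
proof (intro set_eqI iffI)
  fix p assume "p \<in> topspace (Delta_vir n d)"
  then obtain G l where "p = vir_class n d (G, l)" "(G, l) \<in> topspace (sum_topology kappa (stable_graphs n d))"
    unfolding Delta_vir_def vir.topspace_colimit vir_class_def by (metis imageE surj_pair)
  then show "p \<in> {vir_class n d (G, l) | G l. G \<in> stable_graphs n d \<and> l \<in> topspace (kappa G)}"
    unfolding vir_points by blast
qed (use vir_class_in_topspace in blast)

lemma continuous_retraction_H:
  assumes d: "d > 0"
  shows "continuous_map (prod_topology (Delta_vir n d) (top_of_set {0..1})) (Delta_vir n d)
    (\<lambda>(p, t). retraction_H n d p t)"
proof -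
  let ?I = "top_of_set {0..1 :: real}"
  have "compact_space ?I" by (simp add: compact_space_subtopology)
  then have I: "locally_compact_space ?I" "Hausdorff_space ?I"
    by (auto simp: compact_imp_locally_compact_space Hausdorff_space_subtopology)
  have "continuous_map (prod_topology (Delta_vir n d) ?I) (Delta_vir n d) (\<lambda>(p, t). descend (H_rep n d t) p)"
    unfolding Delta_vir_def
  proof (rule vir.continuous_map_colimit_prod[OF I, where h = "H_rep n d"])
    fix G assume G: "G \<in> stable_graphs n d"
    let ?S = "sprout n G" and ?P = "prod_topology (kappa G) ?I"
    have r: "continuous_map ?P (kappa ?S) (\<lambda>(l, t). retract_lengths n d G l t)"
      unfolding kappa_def continuous_map_length_simplex
    proof (intro conjI ballI)
      show "(\<lambda>(l, t). retract_lengths n d G l t) \<in> topspace (prod_topology (length_simplex (edges G)) ?I)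
          \<rightarrow> topspace (length_simplex (edges ?S))"
        using kappa_retract[OF G d] by (auto simp: kappa_def)
      fix e assume e: "e \<in> edges ?S"
      let ?Q = "prod_topology (length_simplex (edges G)) ?I"
      have cf: "continuous_map ?Q euclideanreal (\<lambda>x. fst x e)" if "e \<in> edges G"
        using continuous_map_compose[OF continuous_map_fst continuous_map_length_simplex_coordinate[OF that]]
        by (simp add: comp_def)
      have cs: "continuous_map ?Q euclideanreal snd"
        using continuous_map_snd[of _ ?I] continuous_map_in_subtopology by blast
      have "continuous_map ?Q euclideanreal (\<lambda>x. (1 - snd x) * (if e \<in> edges G then fst x e else 0)
          + (if one_end_edge n ?S e then snd x * (1 / real d) else 0))"
      proof (intro continuous_map_add continuous_map_real_mult continuous_map_diff)
        show "continuous_map ?Q euclideanreal (\<lambda>x. if e \<in> edges G then fst x e else 0)"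
          using cf by (cases "e \<in> edges G") simp_all
        show "continuous_map ?Q euclideanreal (\<lambda>x. if one_end_edge n ?S e then snd x * (1 / real d) else 0)"
          using continuous_map_real_mult_right[OF cs, of "1 / real d"]
          by (cases "one_end_edge n ?S e") simp_all
      qed (use cs in simp_all)
      then show "continuous_map ?Q euclideanreal (\<lambda>x. (case x of (l, t) \<Rightarrow> retract_lengths n d G l t) e)"
        using e by (simp add: retract_lengths_def case_prod_unfold cong: if_cong)
    qed
    have "continuous_map (kappa ?S) (colimit (stable_graphs n d) kappa (graph_mor n d) kappa_incl)
        (\<lambda>l. vir_class n d (?S, l))"
      unfolding vir_class_def by (rule vir.continuous_map_cls[OF stable_sprout[OF G]])
    from continuous_map_compose[OF r this]
    show "continuous_map ?P (colimit (stable_graphs n d) kappa (graph_mor n d) kappa_incl) (\<lambda>(x, t). H_rep n d t (G, x))"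
      by (simp add: comp_def case_prod_unfold H_rep_def)
  qed (use H_rep_invariant[OF d] in auto)
  then show ?thesis by (simp add: retraction_H_def H_rep_def)
qed

lemma one_vertex_contraction:
  assumes G: "G \<in> stable_graphs n d"
  shows "contraction n G (\<lambda>_. 0) id (one_vertex_graph d)"
proof -
  have g: "genus_one_graph n d G" and wf: "wf_wgraph n G" using stable_graphs_genus[OF G] stable_graphs_wf[OF G] by auto
  have ne: "verts G \<noteq> {}" using g by (simp add: genus_one_graph_def connected_wgraph_def)
  have "(\<lambda>_. 0) ` ends G e = {0 :: nat}" if "e \<in> edges G" for e
    using wf_ends[OF wf that] by auto
  then have E: "{e \<in> edges G. (\<lambda>_. 0) ` ends G e = {0 :: nat}} = edges G" by blast
  show ?thesis
    unfolding contraction_def one_vertex_graph_def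
    using ne connected_reach[OF g] g E unfolding genus_one_graph_iff
    by (auto simp: image_constant_conv)
qed

lemma one_vertex_stable:
  assumes "d > 0"
  shows "one_vertex_graph d \<in> stable_graphs n d"
  using assms by (auto simp: stable_graphs_def genus_one_graph_iff stable_def one_vertex_graph_def
      wf_wgraph_def connected_wgraph_def)

lemma star_lengths:
  assumes d: "d > 0"
  shows "retract_lengths n d (one_vertex_graph d) (\<lambda>_. 0) 1 =
    (\<lambda>e\<in>edges (sprout n (one_vertex_graph d)). 1 / real d)"
proof -
  let ?O = "one_vertex_graph d"
  have wf: "wf_wgraph n ?O" using stable_graphs_wf[OF one_vertex_stable[OF d]] .
  have E: "edges (sprout n ?O) = sprout_labels n ?O" by (simp add: sprout_simps(2) one_vertex_graph_def)
  show ?thesis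
  proof (rule extensionalityI[of _ "edges (sprout n ?O)"])
    show "retract_lengths n d ?O (\<lambda>_. 0) 1 \<in> extensional (edges (sprout n ?O))" by (simp add: retract_lengths_def)
    fix e assume e: "e \<in> edges (sprout n ?O)"
    then show "retract_lengths n d ?O (\<lambda>_. 0) 1 e = (\<lambda>e\<in>edges (sprout n ?O). 1 / real d) e"
      using retract_lengths_new[OF wf] E by simp
  qed simp
qed

lemma star:
  assumes d: "d > 0"
  shows "sprout n (one_vertex_graph d) \<in> stable_graphs n d"
    and "(\<lambda>e\<in>edges (sprout n (one_vertex_graph d)). 1 / real d) \<in> topspace (kappa (sprout n (one_vertex_graph d)))"
    and "H_end n d = H_rep n d 1 (one_vertex_graph d, \<lambda>_. 0)"
proof -
  note O = one_vertex_stable[OF d]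
  show "sprout n (one_vertex_graph d) \<in> stable_graphs n d" using stable_sprout[OF O] .
  have "retract_lengths n d (one_vertex_graph d) (\<lambda>_. 0) 1 \<in> topspace (kappa (sprout n (one_vertex_graph d)))"
    by (rule retract_lengths_kappa[OF O d]) auto
  then show "(\<lambda>e\<in>edges (sprout n (one_vertex_graph d)). 1 / real d) \<in> topspace (kappa (sprout n (one_vertex_graph d)))"
    unfolding star_lengths[OF d] .
  show "H_end n d = H_rep n d 1 (one_vertex_graph d, \<lambda>_. 0)"
    unfolding H_end_def H_rep_def Let_def case_prod_conv star_lengths[OF d] ..
qed

lemma H_rep_zero:
  assumes G: "G \<in> stable_graphs n d" and l: "l \<in> topspace (kappa G)"
  shows "H_rep n d 0 (G, l) = vir_class n d (G, l)"
  unfolding H_rep_def case_prod_conv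
proof (rule vir_class_contraction[OF stable_sprout[OF G] sprout_proj_contraction[OF stable_graphs_wf[OF G]] l])
  show "retract_lengths n d G l 0 \<in> extensional (edges (sprout n G))" by (simp add: retract_lengths_def)
  show "retract_lengths n d G l 0 (id e) = l e" if "e \<in> edges G" for e
    using that by (simp add: retract_lengths_old)
  show "retract_lengths n d G l 0 e = 0" if "e \<in> edges (sprout n G) - id ` edges G" for e
    using that by (simp add: retract_lengths_def)
qed

text \<open>
  At time one the lengths on \<open>G\<close> no longer enter, so all of \<open>G\<close> can be contracted to one
  vertex before sprouting.
\<close>

lemma H_rep_one:
  assumes d: "d > 0" and G: "G \<in> stable_graphs n d"
  shows "H_rep n d 1 (G, l) = H_end n d"
proof -
  have "retract_lengths n d (one_vertex_graph d) (\<lambda>_. 0) 1 \<in> topspace (kappa (sprout n (one_vertex_graph d)))"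
    by (rule retract_lengths_kappa[OF one_vertex_stable[OF d] d]) auto
  then have "H_rep n d 1 (G, l) = H_rep n d 1 (one_vertex_graph d, \<lambda>_. 0)"
    by (intro H_rep_contraction[OF G one_vertex_contraction[OF G]]) auto
  then show ?thesis using star(3)[OF d] by simp
qed

text \<open>
  Nothing sprouts from the star: its centre has degree zero and all other vertices are 1-end
  vertices, each on an edge whose length \<open>(1 - t) / d + t / d\<close> stays constant.
\<close>

lemma H_rep_star:
  assumes d: "d > 0" and t: "t \<in> {0..1}"
  shows "H_rep n d t (sprout n (one_vertex_graph d), \<lambda>e\<in>edges (sprout n (one_vertex_graph d)). 1 / real d) = H_end n d"
proof -
  let ?O = "one_vertex_graph d"
  let ?S = "sprout n ?O"
  let ?l = "\<lambda>e\<in>edges ?S. 1 / real d"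
  have wfO: "wf_wgraph n ?O" using stable_graphs_wf[OF one_vertex_stable[OF d]] .
  note S = star(1,2)[OF d, of n]
  have wf: "wf_wgraph n ?S" using stable_graphs_wf[OF S(1)] .
  have E: "edges ?S = sprout_labels n ?O" and V: "verts ?S = {0} \<union> sprout_labels n ?O"
    by (simp_all add: sprout_simps(1,2) one_vertex_graph_def)
  have ends: "one_end n ?S x x" if "x \<in> sprout_labels n ?O" for x
    using one_end_sprout[OF wfO] that by blast
  have "deg ?S 0 = 0"
  proof -
    have "0 \<notin> sprout_labels n ?O" using sprout_labels_fresh(1)[OF wfO, of 0] by (auto simp: one_vertex_graph_def)
    moreover have "\<not> one_end_vert n ?O 0" by (simp add: one_end_vert_def one_end_def one_vertex_graph_def)
    ultimately show ?thesis by (simp add: sprout_deg[OF wfO])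
  qed
  then have L: "sprout_labels n ?S = {}"
    using ends V by (auto simp: sprout_labels_def[of n ?S] one_end_vert_def)
  have "H_rep n d t (?S, ?l) = vir_class n d (?S, ?l)"
    unfolding H_rep_def case_prod_conv
  proof (rule vir_class_contraction[OF stable_sprout[OF S(1)] sprout_proj_contraction[OF wf] S(2)])
    show "retract_lengths n d ?S ?l t \<in> extensional (edges (sprout n ?S))" by (simp add: retract_lengths_def)
    show "retract_lengths n d ?S ?l t (id e) = ?l e" if e: "e \<in> edges ?S" for e
    proof -
      have "one_end_edge n (sprout n ?S) e"
        using one_end_sprout[OF wf] ends e E unfolding one_end_edge_def by blast
      then show ?thesis using e d by (simp add: retract_lengths_old field_simps)
    qed
    show "retract_lengths n d ?S ?l t e = 0" if "e \<in> edges (sprout n ?S) - id ` edges ?S" for e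
      using that L by (simp add: sprout_simps(2))
  qed
  then show ?thesis by (simp add: H_end_def Let_def)
qed

theorem deformation_retraction_Delta_vir:
  assumes d: "d > 0"
  shows "deformation_retraction_to_point (Delta_vir n d) (retraction_H n d) (H_end n d)"
  unfolding deformation_retraction_to_point_def
proof (intro conjI ballI continuous_retraction_H[OF d])
  have e: "H_end n d = vir_class n d (sprout n (one_vertex_graph d), \<lambda>e\<in>edges (sprout n (one_vertex_graph d)). 1 / real d)"
    by (simp add: H_end_def Let_def)
  show "H_end n d \<in> topspace (Delta_vir n d)" unfolding e using vir_class_in_topspace star(1,2)[OF d] by blast
  show "retraction_H n d (H_end n d) t = H_end n d" if t: "t \<in> {0..1}" for t
  proof -
    have "retraction_H n d (H_end n d) t = retraction_H n d (vir_class n d (sprout n (one_vertex_graph d),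
        \<lambda>e\<in>edges (sprout n (one_vertex_graph d)). 1 / real d)) t" by (simp only: e)
    also have "\<dots> = H_end n d"
      using retraction_H_class[OF d t star(1,2)[OF d, of n]] H_rep_star[OF d t, of n] by simp
    finally show ?thesis .
  qed
next
  fix p assume "p \<in> topspace (Delta_vir n d)"
  then obtain G l where p: "p = vir_class n d (G, l)" "G \<in> stable_graphs n d" "l \<in> topspace (kappa G)"
    unfolding topspace_Delta_vir by blast
  show "retraction_H n d p 0 = p"
    using retraction_H_class[OF d _ p(2,3), of 0] H_rep_zero[OF p(2,3)] p(1) by simp
  show "retraction_H n d p 1 = H_end n d"
    using retraction_H_class[OF d _ p(2,3), of 1] H_rep_one[OF d p(2)] p(1) by simp
qed

text \<open>
  In the sprouting all degree sits on tips, and at time \<open>t\<close> a tip over \<open>v\<close> is at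
  distance \<open>(1 - t) * r + t / d\<close> from the core if \<open>v\<close> was at distance \<open>r\<close>.
  This is a monotone function of \<open>r\<close>, so ties persist.
\<close>

lemma tied_sprout:
  assumes G: "G \<in> stable_graphs n d" and d: "d > 0" and t: "t \<in> {0..1}"
    and l0: "\<forall>e\<in>edges G. 0 \<le> l e" and tied: "tied G (dist_core G l)"
  shows "tied (sprout n G) (dist_core (sprout n G) (retract_lengths n d G l t))"
proof -
  let ?S = "sprout n G" and ?p = "sprout_proj n G" and ?L = "sprout_labels n G" and ?l = "retract_lengths n d G l t"
  have wf: "wf_wgraph n G" using stable_graphs_wf[OF G] .
  have S: "?S \<in> stable_graphs n d" using stable_sprout[OF G] .
  have wfS: "wf_wgraph n ?S" using stable_graphs_wf[OF S] .
  have C: "contraction n ?S ?p id G" using sprout_proj_contraction[OF wf] .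
  have gS: "genus_one_graph n d ?S" using stable_graphs_genus[OF S] .
  have gG: "genus_one_graph n d G" using stable_graphs_genus[OF G] .
  have lS: "\<forall>e\<in>edges ?S. 0 \<le> ?l e" using l0 t d by (auto simp: retract_lengths_def)
  have finS: "finite (verts ?S)" using wf_finite(1)[OF wfS] .
  define g where "g v = (1 - t) * dist_core G l (?p v) + (if v \<in> tips n G then t / real d else 0)" for v
  have tip_not_core: "x \<notin> core_verts ?S" if x: "x \<in> tips n G" for x
  proof
    assume c: "x \<in> core_verts ?S"
    have o: "one_end n ?S (tip_edge n G x) x" using tip_edge_one_end[OF wf x] .
    then have "\<exists>f\<in>cycle_edges ?S. x \<in> ends ?S f" using c one_endD(5)[OF o] unfolding core_eq(2)[OF gS] by auto
    then obtain f where f: "f \<in> cycle_edges ?S" "x \<in> ends ?S f" by blast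
    then have "f = tip_edge n G x" using one_endD(4)[OF o] by (auto simp: cycle_edges_def)
    then have fc: "tip_edge n G x \<in> cycle_edges ?S" using f by simp
    obtain y where y: "ends ?S (tip_edge n G x) = {x, y}" "y \<noteq> x" using one_end_obtain[OF wfS o] by metis
    have "x \<noteq> y" using y(2) by simp
    then obtain h where "h \<in> cycle_edges ?S" "h \<noteq> tip_edge n G x" "x \<in> ends ?S h"
      using cycle_edges_next[OF fc y(1)] by blast
    then show False using one_endD(4)[OF o] by (auto simp: cycle_edges_def)
  qed
  have dist: "dist_core ?S ?l v = g v" if v: "v \<in> verts ?S" for v
  proof (rule dist_core_unique[OF gS lS _ _ v])
    fix v assume c: "v \<in> core_verts ?S"
    then have "?p v \<in> core_verts G" using core_verts_contraction[OF S C] by blast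
    then show "g v = 0" using dist_core_core[OF gG l0] tip_not_core c by (auto simp: g_def)
  next
    fix e v w assume e: "directed ?S e v w"
    have vw: "v \<in> verts ?S" "w \<in> verts ?S" using directed_verts[OF wfS e] by auto
    have tail: "v \<notin> tips n G"
    proof
      assume vt: "v \<in> tips n G"
      have o: "one_end n ?S (tip_edge n G v) v" using tip_edge_one_end[OF wf vt] .
      have "e = tip_edge n G v" using one_endD(4)[OF o directedD(1)[OF e]] directedD(3)[OF e] by simp
      obtain u where u: "u \<in> core_verts ?S" "reach ?S (edges ?S - {e}) u v" using directedD(4)[OF e] by blast
      then have "u \<noteq> v" using tip_not_core[OF vt] by blast
      then obtain f y where "f \<in> edges ?S - {e}" "ends ?S f = {y, v}" using reach_first_hit[OF u(2)] by metis
      then show False using one_endD(4)[OF o, of f] \<open>e = tip_edge n G v\<close> by simp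
    qed
    have head: "w \<in> tips n G \<longleftrightarrow> one_end_edge n ?S e"
    proof
      assume wt: "w \<in> tips n G"
      have o: "one_end n ?S (tip_edge n G w) w" using tip_edge_one_end[OF wf wt] .
      have "e = tip_edge n G w" using one_endD(4)[OF o directedD(1)[OF e]] directedD(3)[OF e] by simp
      then show "one_end_edge n ?S e" using o by (auto simp: one_end_edge_def)
    next
      assume "one_end_edge n ?S e"
      then obtain x where x: "x \<in> tips n G" "e = tip_edge n G x" using one_end_edge_sprout[OF wf] by blast
      then have "x \<in> ends ?S e" using one_endD(3)[OF tip_edge_one_end[OF wf x(1)]] by simp
      then show "w \<in> tips n G" using directedD(3)[OF e] tail x by auto
    qed
    have len: "?l e = (1 - t) * (dist_core G l (?p w) - dist_core G l (?p v)) + (if one_end_edge n ?S e then t / real d else 0)"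
    proof (cases "e \<in> edges G")
      case True
      have "directed G e (?p v) (?p w)"
        using directed_contraction[OF S C True, of v w] directedD(3)[OF e] e by simp
      then have "dist_core G l (?p w) - dist_core G l (?p v) = l e" using dist_core_directed[OF gG l0] by simp
      then show ?thesis using retract_lengths_old[OF True] by simp
    next
      case False
      have eS: "e \<in> edges ?S" using directedD(1)[OF e] .
      have "?p v = ?p w"
        using contracted_edge_const[OF wfS C _ directedD(3)[OF e]] False eS by simp
      then show ?thesis using False eS by (simp add: retract_lengths_def)
    qed
    show "g w = g v + ?l e" unfolding len g_def using tail head by (simp add: algebra_simps)
  qed
  have "tied ?S (\<lambda>v. dist_core G l (?p v))" using tied_contraction[OF wfS C] tied by blast
  then have "tied ?S g"
  proof (rule tied_mono[OF finS])
    fix u v assume uv: "u \<in> verts ?S" "v \<in> verts ?S" "deg ?S u > 0" "deg ?S v > 0"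
      and le: "dist_core G l (?p u) \<le> dist_core G l (?p v)"
    have "u \<in> tips n G" "v \<in> tips n G" using uv sprout_deg_tips[OF wf] by auto
    then show "g u \<le> g v" using le t by (simp add: g_def mult_left_mono)
  qed
  then show ?thesis using tied_cong[OF finS, of g "dist_core ?S ?l"] dist by auto
qed

theorem retraction_H_preserves_Z:
  assumes d: "d > 0"
  shows "(\<lambda>(p, t). retraction_H n d p t) ` (Z_locus n d \<times> {0..1}) \<subseteq> Z_locus n d"
proof -
  have "retraction_H n d p t \<in> Z_locus n d" if p: "p \<in> Z_locus n d" and t: "t \<in> {0..1}" for p t
  proof -
    obtain G l where G: "p = vir_class n d (G, l)" "G \<in> stable_graphs n d" "l \<in> topspace (kappa G)"
      using p unfolding Z_locus_def by blast
    then have "tied G (dist_core G l)" using vir_class_in_Z_locus[OF G(2,3) d] p by simp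
    moreover have "\<forall>e\<in>edges G. 0 \<le> l e" using G(3) by (simp add: topspace_kappa)
    ultimately have "tied (sprout n G) (dist_core (sprout n G) (retract_lengths n d G l t))"
      using tied_sprout[OF G(2) d t] by blast
    then show ?thesis
      unfolding G(1) retraction_H_class[OF d t G(2,3)] H_rep_def case_prod_conv
      using vir_class_in_Z_locus[OF stable_sprout[OF G(2)] kappa_retract[OF G(2) d t G(3)] d] by simp
  qed
  then show ?thesis by auto
qed

text \<open>
  The centre alone is tied, since it carries the whole degree \<open>d > 1\<close>, and sprouting preserves
  ties.
\<close>

lemma H_end_in_Z_locus:
  assumes d: "d > 1"
  shows "H_end n d \<in> Z_locus n d"
proof -
  have d0: "d > 0" using d by simp
  let ?O = "one_vertex_graph d"
  let ?S = "sprout n ?O"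
  note S = star(1,2)[OF d0, of n]
  have "{v \<in> verts ?O. g v = g 0} = {0}" for g :: "nat \<Rightarrow> real" by (auto simp: one_vertex_graph_def)
  then have "tied ?O (dist_core ?O (\<lambda>_. 0))"
    unfolding tied_def using d
    by (intro exI[of _ "dist_core ?O (\<lambda>_. 0) 0"]) (simp add: one_vertex_graph_def)
  then have "tied ?S (dist_core ?S (retract_lengths n d ?O (\<lambda>_. 0) 1))"
    by (intro tied_sprout[OF one_vertex_stable[OF d0] d0]) simp_all
  then show ?thesis
    unfolding star_lengths[OF d0] using vir_class_in_Z_locus[OF S d0] by (simp add: H_end_def Let_def)
qed

section \<open>Radially aligned graphs\<close>

lemma Plus_mem_iff [simp]: "Inl a \<in> A <+> B \<longleftrightarrow> a \<in> A" "Inr b \<in> A <+> B \<longleftrightarrow> b \<in> B"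
  by auto

lemma radial_alignment_iff:
  assumes g: "genus_one_graph n d G"
  shows "radial_alignment G k \<rho> \<longleftrightarrow> \<rho> ` verts G = {0..k} \<and> {v\<in>verts G. \<rho> v = 0} = core_verts G \<and>
    (\<forall>e v w. directed G e v w \<longrightarrow> \<rho> v < \<rho> w)"
proof -
  have wf: "wf_wgraph n G" using genus_one_wf[OF g] .
  let ?R = "{(a, b). \<exists>e. directed G e a b}"
  have 1: "tree_less G v w" if "directed G e v w" for e v w
    using directed_verts[OF wf that] directed_head_not_core[OF that] that unfolding tree_less_def by blast
  have 2: "\<rho> v < \<rho> w"
    if z: "{v\<in>verts G. \<rho> v = 0} = core_verts G" and dir: "\<And>e v w. directed G e v w \<Longrightarrow> \<rho> v < \<rho> w"
      and t: "tree_less G v w" for v w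
  proof (cases "v \<in> core_verts G")
    case True
    then have "v \<in> {v\<in>verts G. \<rho> v = 0}" unfolding z .
    moreover have "w \<in> verts G" "w \<notin> {v\<in>verts G. \<rho> v = 0}" using t unfolding z tree_less_def by auto
    ultimately show ?thesis by simp
  next
    case False
    then have "(v, w) \<in> ?R\<^sup>+" using t unfolding tree_less_def by blast
    then show ?thesis
    proof (induction rule: trancl_induct)
      case (base y)
      then show ?case using dir by blast
    next
      case (step y z)
      then have "\<rho> y < \<rho> z" using dir by blast
      then show ?case using step.IH by simp
    qed
  qed
  show ?thesis unfolding radial_alignment_def using 1 2 by metis
qed

lemma aligned_graphs_iff:
  assumes d: "d > 0"
  shows "(G, k, \<rho>) \<in> aligned_graphs n d \<longleftrightarrow> G \<in> stable_graphs n d \<and> \<rho> ` verts G = {0..k} \<and>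
    {v\<in>verts G. \<rho> v = 0} = core_verts G \<and> (\<forall>e v w. directed G e v w \<longrightarrow> \<rho> v < \<rho> w) \<and> tied G \<rho>"
proof (cases "G \<in> stable_graphs n d")
  case True
  have "d_min G \<rho> > 1 \<longleftrightarrow> tied G \<rho>"
    using d_min_tied[of G \<rho>] stable_graphs_finite[OF True] stable_graphs_deg[OF True] d by simp
  then show ?thesis
    using True radial_alignment_iff[OF stable_graphs_genus[OF True]] by (simp add: aligned_graphs_def)
qed (simp add: aligned_graphs_def)

lemma aligned_graphsD:
  assumes "d > 0" "(G, k, \<rho>) \<in> aligned_graphs n d"
  shows "G \<in> stable_graphs n d" "\<rho> ` verts G = {0..k}" "{v\<in>verts G. \<rho> v = 0} = core_verts G"
    "\<And>e v w. directed G e v w \<Longrightarrow> \<rho> v < \<rho> w" "tied G \<rho>"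
    "v \<in> core_verts G \<Longrightarrow> \<rho> v = 0" "v \<in> verts G \<Longrightarrow> \<rho> v \<le> k"
proof -
  note a = assms(2)[unfolded aligned_graphs_iff[OF assms(1)]]
  show "G \<in> stable_graphs n d" "\<rho> ` verts G = {0..k}" "{v\<in>verts G. \<rho> v = 0} = core_verts G"
    "\<And>e v w. directed G e v w \<Longrightarrow> \<rho> v < \<rho> w" "tied G \<rho>" using a by auto
  show "v \<in> core_verts G \<Longrightarrow> \<rho> v = 0" using a by blast
  show "v \<in> verts G \<Longrightarrow> \<rho> v \<le> k" using a by (metis atLeastAtMost_iff imageI)
qed

lemma crosses_iff:
  assumes "directed G e v w"
  shows "crosses G \<rho> e i \<longleftrightarrow> \<rho> v < i \<and> i \<le> \<rho> w"
proof
  assume "crosses G \<rho> e i"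
  then obtain a b where ab: "directed G e a b" "\<rho> a < i" "i \<le> \<rho> b" by (auto simp: crosses_def)
  have "{a, b} = {v, w}" using directedD(3)[OF ab(1)] directedD(3)[OF assms] by simp
  then have "(a = v \<and> b = w) \<or> (a = w \<and> b = v)" by (auto simp: doubleton_eq_iff)
  then show "\<rho> v < i \<and> i \<le> \<rho> w" using ab directed_asym[OF assms] by blast
qed (use assms in \<open>auto simp: crosses_def\<close>)

lemma crosses_edge: "crosses G \<rho> e i \<Longrightarrow> e \<in> edges G - core_edges G"
  using directedD(1,2) unfolding crosses_def by blast

lemma crosses_level:
  assumes "d > 0" "(G, k, \<rho>) \<in> aligned_graphs n d" "crosses G \<rho> e i"
  shows "i \<in> {1..k}"
proof -
  obtain v w where vw: "directed G e v w" "\<rho> v < i" "i \<le> \<rho> w" using assms(3) by (auto simp: crosses_def)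
  have "w \<in> verts G"
    using directed_verts[OF stable_graphs_wf[OF aligned_graphsD(1)[OF assms(1,2)]] vw(1)] by simp
  then have "\<rho> w \<le> k" using aligned_graphsD(7)[OF assms(1,2)] by blast
  then show ?thesis using vw by simp
qed

lemma finite_crosses:
  assumes "d > 0" "(G, k, \<rho>) \<in> aligned_graphs n d"
  shows "finite {i. crosses G \<rho> e i}"
proof -
  have "{i. crosses G \<rho> e i} \<subseteq> {1..k}" using crosses_level[OF assms] by blast
  then show ?thesis using finite_subset by blast
qed

text \<open>
  Some vertex has level \<open>i\<close>, and the edge by which it hangs from the core side crosses that
  level.
\<close>

lemma mult_pos:
  assumes "d > 0" "(G, k, \<rho>) \<in> aligned_graphs n d" "i \<in> {1..k}"
  shows "mult G \<rho> i > 0"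
proof -
  note a = aligned_graphsD[OF assms(1,2)]
  have "i \<in> \<rho> ` verts G" using a(2) assms(3) by simp
  then obtain w where w: "w \<in> verts G" "\<rho> w = i" by blast
  then have "w \<notin> core_verts G" using a(6) assms(3) by force
  then obtain e v where e: "directed G e v w" using noncore_parent[OF stable_graphs_genus[OF a(1)] w(1)] by blast
  have "crosses G \<rho> e i" using crosses_iff[OF e] a(4)[OF e] w(2) by simp
  moreover have "finite {e. crosses G \<rho> e i}"
    using stable_graphs_finite[OF a(1)] crosses_edge by (metis (no_types, lifting) DiffD1 finite_subset mem_Collect_eq subsetI)
  ultimately show ?thesis unfolding mult_def by (auto simp: card_gt_0_iff)
qed

text \<open>The radius of a level: the distance to the core in the metric \<open>hat G \<rho> l\<close>.\<close>

definition radius :: "wgraph \<Rightarrow> (nat \<Rightarrow> nat) \<Rightarrow> (nat + nat \<Rightarrow> real) \<Rightarrow> nat \<Rightarrow> real" where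
  "radius G \<rho> l j = (\<Sum>i\<in>{1..j}. l (Inr i) / real (mult G \<rho> i))"

lemma hat_core: "e \<in> core_edges G \<Longrightarrow> e \<in> edges G \<Longrightarrow> hat G \<rho> l e = l (Inl e)"
  by (simp add: hat_def)

lemma hat_noncore:
  "e \<in> edges G - core_edges G \<Longrightarrow> hat G \<rho> l e = (\<Sum>i | crosses G \<rho> e i. l (Inr i) / real (mult G \<rho> i))"
  by (simp add: hat_def)

lemma hat_directed:
  assumes e: "directed G e v w" and le: "\<rho> v \<le> \<rho> w"
  shows "hat G \<rho> l e = radius G \<rho> l (\<rho> w) - radius G \<rho> l (\<rho> v)"
proof -
  have "{i. crosses G \<rho> e i} = {1..\<rho> w} - {1..\<rho> v}" using crosses_iff[OF e] by auto
  moreover have "e \<in> edges G - core_edges G" using directedD(1,2)[OF e] by blast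
  ultimately have "hat G \<rho> l e = (\<Sum>i\<in>{1..\<rho> w} - {1..\<rho> v}. l (Inr i) / real (mult G \<rho> i))"
    using hat_noncore by simp
  also have "\<dots> = radius G \<rho> l (\<rho> w) - radius G \<rho> l (\<rho> v)"
    unfolding radius_def using le by (intro sum_diff) auto
  finally show ?thesis .
qed

lemma finite_sigma_index:
  assumes "G \<in> stable_graphs n d"
  shows "finite (core_edges G)" "finite (sigma_index (G, k, \<rho>))"
proof -
  show "finite (core_edges G)"
    using core_subset(1)[OF stable_graphs_genus[OF assms]] stable_graphs_finite[OF assms] finite_subset by blast
  then show "finite (sigma_index (G, k, \<rho>))" by simp
qed

lemma topspace_sigma:
  "topspace (sigma A) = {l \<in> extensional (sigma_index A). (\<forall>s\<in>sigma_index A. 0 \<le> l s) \<and> (\<Sum>s\<in>sigma_index A. l s) = 1}"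
  by (simp add: sigma_def topspace_length_simplex)

text \<open>
  Level \<open>i\<close> contributes \<open>l(i) / m_i\<close> to each of the \<open>m_i\<close> edges crossing it.
\<close>

lemma sum_hat:
  assumes d: "d > 0" and A: "(G, k, \<rho>) \<in> aligned_graphs n d"
  shows "(\<Sum>e\<in>edges G. hat G \<rho> l e) = (\<Sum>s\<in>sigma_index (G, k, \<rho>). l s)"
proof -
  have G: "G \<in> stable_graphs n d" using aligned_graphsD(1)[OF d A] .
  have fin: "finite (edges G)" "finite (core_edges G)" using stable_graphs_finite[OF G] finite_sigma_index[OF G] by auto
  have sub: "core_edges G \<subseteq> edges G" using core_subset(1)[OF stable_graphs_genus[OF G]] .
  let ?N = "edges G - core_edges G"
  have "(\<Sum>e\<in>edges G. hat G \<rho> l e) = (\<Sum>e\<in>?N. hat G \<rho> l e) + (\<Sum>e\<in>core_edges G. hat G \<rho> l e)"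
    using fin sub by (intro sum.subset_diff) auto
  also have "(\<Sum>e\<in>core_edges G. hat G \<rho> l e) = (\<Sum>e\<in>core_edges G. l (Inl e))"
    using sub by (intro sum.cong) (auto simp: hat_core)
  also have "(\<Sum>e\<in>?N. hat G \<rho> l e) = (\<Sum>e\<in>?N. \<Sum>i\<in>{1..k}. if crosses G \<rho> e i then l (Inr i) / real (mult G \<rho> i) else 0)"
  proof (rule sum.cong)
    fix e assume e: "e \<in> ?N"
    have "{i. crosses G \<rho> e i} = {i\<in>{1..k}. crosses G \<rho> e i}" using crosses_level[OF d A] by blast
    then have "hat G \<rho> l e = (\<Sum>i\<in>{i\<in>{1..k}. crosses G \<rho> e i}. l (Inr i) / real (mult G \<rho> i))"
      using hat_noncore[OF e, of \<rho> l] by simp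
    also have "\<dots> = (\<Sum>i\<in>{1..k}. if crosses G \<rho> e i then l (Inr i) / real (mult G \<rho> i) else 0)"
      by (rule sum.inter_filter) simp
    finally show "hat G \<rho> l e = (\<Sum>i\<in>{1..k}. if crosses G \<rho> e i then l (Inr i) / real (mult G \<rho> i) else 0)" .
  qed simp
  also have "\<dots> = (\<Sum>i\<in>{1..k}. \<Sum>e\<in>?N. if crosses G \<rho> e i then l (Inr i) / real (mult G \<rho> i) else 0)"
    by (rule sum.swap)
  also have "\<dots> = (\<Sum>i\<in>{1..k}. l (Inr i))"
  proof (rule sum.cong)
    fix i assume i: "i \<in> {1..k}"
    have "(\<Sum>e\<in>?N. if crosses G \<rho> e i then l (Inr i) / real (mult G \<rho> i) else 0)
        = (\<Sum>e\<in>{e\<in>?N. crosses G \<rho> e i}. l (Inr i) / real (mult G \<rho> i))"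
      using fin by (intro sum.inter_filter[symmetric]) simp
    also have "{e\<in>?N. crosses G \<rho> e i} = {e. crosses G \<rho> e i}" using crosses_edge by blast
    also have "(\<Sum>e\<in>{e. crosses G \<rho> e i}. l (Inr i) / real (mult G \<rho> i)) = l (Inr i)"
      using mult_pos[OF d A i] by (simp add: mult_def)
    finally show "(\<Sum>e\<in>?N. if crosses G \<rho> e i then l (Inr i) / real (mult G \<rho> i) else 0) = l (Inr i)" .
  qed simp
  also have "(\<Sum>i\<in>{1..k}. l (Inr i)) + (\<Sum>e\<in>core_edges G. l (Inl e)) = (\<Sum>s\<in>sigma_index (G, k, \<rho>). l s)"
    using fin by (simp add: sum.Plus comp_def)
  finally show ?thesis .
qed

lemma hat_nonneg:
  assumes d: "d > 0" and A: "(G, k, \<rho>) \<in> aligned_graphs n d"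
    and l: "\<forall>s\<in>sigma_index (G, k, \<rho>). 0 \<le> l s" and e: "e \<in> edges G"
  shows "0 \<le> hat G \<rho> l e"
proof (cases "e \<in> core_edges G")
  case True
  then show ?thesis using l e by (simp add: hat_core)
next
  case False
  have "0 \<le> l (Inr i)" if "crosses G \<rho> e i" for i using crosses_level[OF d A that] l by auto
  then have "0 \<le> (\<Sum>i | crosses G \<rho> e i. l (Inr i) / real (mult G \<rho> i))" by (intro sum_nonneg) simp
  then show ?thesis using hat_noncore[of e G \<rho> l] e False by simp
qed

lemma hat_pos:
  assumes d: "d > 0" and A: "(G, k, \<rho>) \<in> aligned_graphs n d"
    and l: "\<forall>s\<in>sigma_index (G, k, \<rho>). 0 < l s" and e: "e \<in> edges G"
  shows "0 < hat G \<rho> l e"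
proof (cases "e \<in> core_edges G")
  case True
  then show ?thesis using l e by (simp add: hat_core)
next
  case False
  note a = aligned_graphsD[OF d A]
  obtain x y where "ends G e = {x, y}" using wf_ends[OF stable_graphs_wf[OF a(1)] e] by blast
  then obtain v w where vw: "directed G e v w" using noncore_directed[OF stable_graphs_genus[OF a(1)]] e False by blast
  have c: "crosses G \<rho> e (\<rho> w)" using crosses_iff[OF vw] a(4)[OF vw] by simp
  have pos: "0 < l (Inr i) / real (mult G \<rho> i)" if "crosses G \<rho> e i" for i
  proof -
    have i: "i \<in> {1..k}" using crosses_level[OF d A that] .
    then have "0 < l (Inr i)" using l by (metis Plus_mem_iff(2) sigma_index.simps)
    then show ?thesis using mult_pos[OF d A i] by simp
  qed
  note fc = finite_crosses[OF d A, of e]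
  have "0 < (\<Sum>i | crosses G \<rho> e i. l (Inr i) / real (mult G \<rho> i))" using fc pos c by (intro sum_pos) auto
  then show ?thesis using hat_noncore[of e G \<rho> l] e False by simp
qed

lemma hat_kappa:
  assumes d: "d > 0" and A: "(G, k, \<rho>) \<in> aligned_graphs n d" and l: "l \<in> topspace (sigma (G, k, \<rho>))"
  shows "hat G \<rho> l \<in> topspace (kappa G)"
proof -
  have "\<forall>s\<in>sigma_index (G, k, \<rho>). 0 \<le> l s" "(\<Sum>s\<in>sigma_index (G, k, \<rho>). l s) = 1"
    using l unfolding topspace_sigma by auto
  then show ?thesis
    unfolding topspace_kappa using hat_nonneg[OF d A] sum_hat[OF d A, of l] by (simp add: hat_def)
qed

lemma continuous_map_hat:
  assumes d: "d > 0" and A: "(G, k, \<rho>) \<in> aligned_graphs n d"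
  shows "continuous_map (sigma (G, k, \<rho>)) (kappa G) (hat G \<rho>)"
  unfolding kappa_def continuous_map_length_simplex
proof (intro conjI ballI)
  show "hat G \<rho> \<in> topspace (sigma (G, k, \<rho>)) \<rightarrow> topspace (length_simplex (edges G))"
    using hat_kappa[OF d A] by (auto simp: kappa_def)
  fix e assume e: "e \<in> edges G"
  have co: "continuous_map (sigma (G, k, \<rho>)) euclideanreal (\<lambda>l. l s)" if "s \<in> sigma_index (G, k, \<rho>)" for s
    unfolding sigma_def by (rule continuous_map_length_simplex_coordinate[OF that])
  show "continuous_map (sigma (G, k, \<rho>)) euclideanreal (\<lambda>l. hat G \<rho> l e)"
  proof (cases "e \<in> core_edges G")
    case True
    then show ?thesis using co[of "Inl e"] e by (simp add: hat_core)
  next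
    case False
    note fc = finite_crosses[OF d A, of e]
    have "continuous_map (sigma (G, k, \<rho>)) euclideanreal (\<lambda>l. l (Inr i) / real (mult G \<rho> i))"
      if "crosses G \<rho> e i" for i
    proof -
      have "continuous_map (sigma (G, k, \<rho>)) euclideanreal (\<lambda>l. l (Inr i))"
        using crosses_level[OF d A that] by (intro co) auto
      from continuous_map_real_mult_right[OF this, of "1 / real (mult G \<rho> i)"] show ?thesis by simp
    qed
    then have "continuous_map (sigma (G, k, \<rho>)) euclideanreal
        (\<lambda>l. \<Sum>i | crosses G \<rho> e i. l (Inr i) / real (mult G \<rho> i))"
      using fc by (intro continuous_map_sum) auto
    then show ?thesis using hat_noncore[of e G \<rho>] e False by simp
  qed
qed

lemma radius_mono:
  assumes "\<forall>i\<in>{1..k}. 0 \<le> l (Inr i)" "i \<le> j" "j \<le> k"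
  shows "radius G \<rho> l i \<le> radius G \<rho> l j"
  unfolding radius_def using assms by (intro sum_mono2) auto

lemma dist_core_hat:
  assumes d: "d > 0" and A: "(G, k, \<rho>) \<in> aligned_graphs n d"
    and l: "\<forall>s\<in>sigma_index (G, k, \<rho>). 0 \<le> l s" and v: "v \<in> verts G"
  shows "dist_core G (hat G \<rho> l) v = radius G \<rho> l (\<rho> v)"
proof (rule dist_core_unique[OF stable_graphs_genus[OF aligned_graphsD(1)[OF d A]] _ _ _ v,
      where g = "\<lambda>v. radius G \<rho> l (\<rho> v)"])
  show "\<forall>e\<in>edges G. 0 \<le> hat G \<rho> l e" using hat_nonneg[OF d A l] by blast
  show "radius G \<rho> l (\<rho> v) = 0" if "v \<in> core_verts G" for v
    using aligned_graphsD(6)[OF d A that] by (simp add: radius_def)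
  show "radius G \<rho> l (\<rho> w) = radius G \<rho> l (\<rho> v) + hat G \<rho> l e" if e: "directed G e v w" for e v w
    using hat_directed[OF e less_imp_le[OF aligned_graphsD(4)[OF d A e]]] by simp
qed

lemma hat_in_Z_locus:
  assumes d: "d > 0" and A: "(G, k, \<rho>) \<in> aligned_graphs n d" and l: "l \<in> topspace (sigma (G, k, \<rho>))"
  shows "vir_class n d (G, hat G \<rho> l) \<in> Z_locus n d"
proof -
  note a = aligned_graphsD[OF d A]
  have l0: "\<forall>s\<in>sigma_index (G, k, \<rho>). 0 \<le> l s" using l unfolding topspace_sigma by blast
  then have r0: "\<forall>i\<in>{1..k}. 0 \<le> l (Inr i)" by auto
  have "tied G (dist_core G (hat G \<rho> l))"
  proof (rule tied_mono[OF _ a(5)])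
    show "finite (verts G)" using stable_graphs_finite[OF a(1)] by blast
    fix u v assume "u \<in> verts G" "v \<in> verts G" "\<rho> u \<le> \<rho> v"
    then show "dist_core G (hat G \<rho> l) u \<le> dist_core G (hat G \<rho> l) v"
      using dist_core_hat[OF d A l0] radius_mono[OF r0 _ a(7)] by simp
  qed
  then show ?thesis using vir_class_in_Z_locus[OF a(1) hat_kappa[OF d A l] d] by simp
qed

subsection \<open>Morphisms of aligned graphs\<close>

text \<open>
  What the comparison map needs to know about a morphism: uncontracted edges cross
  corresponding levels, and contracted edges cross only levels that disappear.
\<close>

definition aligned_contraction ::
  "nat \<Rightarrow> aligned \<Rightarrow> (nat \<Rightarrow> nat) \<times> (nat \<Rightarrow> nat) \<times> (nat \<Rightarrow> nat) \<Rightarrow> aligned \<Rightarrow> bool" where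
  "aligned_contraction n = (\<lambda>(G, k, \<rho>) (fv, fe, fl) (G', k', \<rho>').
     contraction n G fv fe G' \<and> inj_on fl {1..k'} \<and> fl ` {1..k'} \<subseteq> {1..k} \<and>
     (\<forall>e\<in>edges G'. \<forall>j\<in>{1..k'}. crosses G' \<rho>' e j \<longleftrightarrow> crosses G \<rho> (fe e) (fl j)) \<and>
     (\<forall>e\<in>edges G - fe ` edges G'. \<forall>j\<in>{1..k'}. \<not> crosses G \<rho> e (fl j)))"

lemma aligned_contractionD:
  assumes "aligned_contraction n (G, k, \<rho>) (fv, fe, fl) (G', k', \<rho>')"
  shows "contraction n G fv fe G'" "inj_on fl {1..k'}" "fl ` {1..k'} \<subseteq> {1..k}"
    "e \<in> edges G' \<Longrightarrow> j \<in> {1..k'} \<Longrightarrow> crosses G' \<rho>' e j \<longleftrightarrow> crosses G \<rho> (fe e) (fl j)"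
    "e \<in> edges G - fe ` edges G' \<Longrightarrow> j \<in> {1..k'} \<Longrightarrow> \<not> crosses G \<rho> e (fl j)"
  using assms unfolding aligned_contraction_def case_prod_conv by blast+

lemma aligned_contraction_comp:
  assumes wf: "wf_wgraph n G"
    and 1: "aligned_contraction n (G, k, \<rho>) (fv, fe, fl) (G', k', \<rho>')"
    and 2: "aligned_contraction n (G', k', \<rho>') (gv, ge, gl) (G'', k'', \<rho>'')"
  shows "aligned_contraction n (G, k, \<rho>) (gv \<circ> fv, fe \<circ> ge, fl \<circ> gl) (G'', k'', \<rho>'')"
proof -
  note C = aligned_contractionD(1)[OF 1] aligned_contractionD(1)[OF 2]
  note il = aligned_contractionD(2,3)[OF 1] aligned_contractionD(2,3)[OF 2]
  note x1 = aligned_contractionD(4)[OF 1] and y1 = aligned_contractionD(5)[OF 1]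
  note x2 = aligned_contractionD(4)[OF 2] and y2 = aligned_contractionD(5)[OF 2]
  have gl: "gl j \<in> {1..k'}" if "j \<in> {1..k''}" for j using il(4) that by blast
  have "inj_on (fl \<circ> gl) {1..k''}" using il by (meson comp_inj_on inj_on_subset)
  moreover have "(fl \<circ> gl) ` {1..k''} \<subseteq> {1..k}" using il by (auto simp: image_subset_iff)
  moreover have "crosses G'' \<rho>'' e j \<longleftrightarrow> crosses G \<rho> ((fe \<circ> ge) e) ((fl \<circ> gl) j)"
    if e: "e \<in> edges G''" "j \<in> {1..k''}" for e j
  proof -
    have "ge e \<in> edges G'" using contractionD(3)[OF C(2)] e by blast
    then show ?thesis using x2[OF e] x1[OF _ gl[OF e(2)]] by simp
  qed
  moreover have "\<not> crosses G \<rho> e ((fl \<circ> gl) j)" if e: "e \<in> edges G - (fe \<circ> ge) ` edges G''" "j \<in> {1..k''}" for e j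
  proof (cases "e \<in> fe ` edges G'")
    case True
    then obtain e' where e': "e' \<in> edges G'" "e = fe e'" by blast
    then have "e' \<in> edges G' - ge ` edges G''" using e(1) by auto
    then show ?thesis using y2[OF _ e(2)] x1[OF e'(1) gl[OF e(2)]] e'(2) by simp
  next
    case False
    then show ?thesis using y1[OF _ gl[OF e(2)]] e(1) by simp
  qed
  ultimately show ?thesis
    using contraction_comp[OF wf C] unfolding aligned_contraction_def case_prod_conv by blast
qed

lemma crosses_contraction:
  assumes G: "G \<in> stable_graphs n d" and C: "contraction n G fv fe G'" and e: "e \<in> edges G'"
    and eq: "\<And>v w. directed G (fe e) v w \<Longrightarrow> \<rho>' (fv v) < j \<and> j \<le> \<rho>' (fv w) \<longleftrightarrow> \<rho> v < i \<and> i \<le> \<rho> w"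
  shows "crosses G' \<rho>' e j \<longleftrightarrow> crosses G \<rho> (fe e) i"
proof
  assume "crosses G' \<rho>' e j"
  then obtain v' w' where d': "directed G' e v' w'" "\<rho>' v' < j" "j \<le> \<rho>' w'" by (auto simp: crosses_def)
  obtain v w where "directed G (fe e) v w" "fv v = v'" "fv w = w'" using directed_lift[OF G C d'(1)] .
  then show "crosses G \<rho> (fe e) i" using eq[of v w] d' unfolding crosses_def by blast
next
  assume "crosses G \<rho> (fe e) i"
  then obtain v w where d': "directed G (fe e) v w" "\<rho> v < i" "i \<le> \<rho> w" by (auto simp: crosses_def)
  have "directed G' e (fv v) (fv w)" using directed_contraction[OF G C e directedD(3)[OF d'(1)]] d'(1) by blast
  then show "crosses G' \<rho>' e j" using eq[OF d'(1)] d' unfolding crosses_def by blast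
qed

lemma contract_list_contraction:
  assumes "wf_wgraph n G" "distinct es" "set es \<subseteq> edges G"
  shows "contraction n G (contract_list_vert G es) id (contract_list G es) \<and>
    edges (contract_list G es) = edges G - set es"
  using assms
proof (induction es arbitrary: G)
  case Nil
  show ?case
    unfolding contract_list.simps contract_list_vert.simps
    by (intro conjI contraction_refl Nil(1)) simp
next
  case (Cons e es)
  let ?H = "contract_edge G e"
  have e: "e \<in> edges G" using Cons.prems by simp
  have C: "contraction n G (contract_vert G e) id ?H" using contract_edge_contraction[OF Cons.prems(1) e] .
  have EH: "edges ?H = edges G - {e}" by (simp add: contract_edge_def)
  have wfH: "wf_wgraph n ?H" using contraction_wf[OF Cons.prems(1) C] .
  have IH: "contraction n ?H (contract_list_vert ?H es) id (contract_list ?H es) \<and>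
      edges (contract_list ?H es) = edges ?H - set es"
    using Cons.prems EH by (intro Cons.IH[OF wfH]) auto
  have "contraction n G (contract_list_vert ?H es \<circ> contract_vert G e) (id \<circ> id) (contract_list ?H es)"
    using contraction_comp[OF Cons.prems(1) C] IH by blast
  then have "contraction n G (contract_list_vert ?H es \<circ> contract_vert G e) id (contract_list ?H es)"
    unfolding id_o .
  moreover have "edges (contract_list ?H es) = edges G - set (e # es)" using IH EH by auto
  ultimately show ?case unfolding contract_list.simps contract_list_vert.simps by blast
qed

lemma contract_vert_const:
  assumes "wf_wgraph n G" "e \<in> edges G" "\<And>a b. a \<in> ends G e \<Longrightarrow> b \<in> ends G e \<Longrightarrow> \<sigma> a = \<sigma> b"
  shows "\<sigma> (contract_vert G e v) = \<sigma> v"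
proof (cases "v \<in> ends G e")
  case True
  have "finite (ends G e)" using wf_edge(1)[OF assms(1,2)] wf_finite(1)[OF assms(1)] finite_subset by blast
  then have "Min (ends G e) \<in> ends G e" using True by (intro Min_in) auto
  then have "\<sigma> (Min (ends G e)) = \<sigma> v" using True by (rule assms(3))
  then show ?thesis using True by (simp add: contract_vert_def)
qed (simp add: contract_vert_def)

text \<open>
  A contraction keeps one of the labels it merges, so a function that does not distinguish merged
  labels does not notice the passage to representatives.
\<close>

lemma contract_list_const:
  assumes "wf_wgraph n G" "distinct es" "set es \<subseteq> edges G"
    "\<And>e a b. e \<in> set es \<Longrightarrow> a \<in> ends G e \<Longrightarrow> b \<in> ends G e \<Longrightarrow> \<sigma> a = \<sigma> b"
  shows "\<sigma> (contract_list_vert G es v) = \<sigma> v"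
  using assms
proof (induction es arbitrary: G v)
  case (Cons e es)
  let ?H = "contract_edge G e"
  have e: "e \<in> edges G" using Cons.prems by simp
  have C: "contraction n G (contract_vert G e) id ?H" using contract_edge_contraction[OF Cons.prems(1) e] .
  have wfH: "wf_wgraph n ?H" using contraction_wf[OF Cons.prems(1) C] .
  have c: "\<sigma> (contract_vert G e u) = \<sigma> u" for u
  proof (rule contract_vert_const[OF Cons.prems(1) e])
    fix a b assume "a \<in> ends G e" "b \<in> ends G e"
    then show "\<sigma> a = \<sigma> b" by (rule Cons.prems(4)[rotated]) simp
  qed
  have "\<sigma> (contract_list_vert ?H es (contract_vert G e v)) = \<sigma> (contract_vert G e v)"
  proof (rule Cons.IH[OF wfH])
    show "distinct es" "set es \<subseteq> edges ?H" using Cons.prems by (auto simp: contract_edge_def)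
    fix f a b assume f: "f \<in> set es" "a \<in> ends ?H f" "b \<in> ends ?H f"
    then obtain a0 b0 where "a0 \<in> ends G f" "a = contract_vert G e a0" "b0 \<in> ends G f" "b = contract_vert G e b0"
      by (auto simp: contract_edge_def)
    moreover have "\<sigma> a0 = \<sigma> b0" using Cons.prems(4)[of f a0 b0] f(1) calculation by simp
    ultimately show "\<sigma> a = \<sigma> b" using c by simp
  qed
  then show ?case using c by simp
qed simp

text \<open>
  The two level maps are adjoint, which is what identifies crossings before and after a merge.
\<close>

lemma merge_skip: "1 \<le> i \<Longrightarrow> j \<le> merge_level i b \<longleftrightarrow> skip_level i j \<le> b"
  by (auto simp: merge_level_def skip_level_def)

lemma merge_edges:
  assumes G: "G \<in> stable_graphs n d"
  shows "set (merge_edges G \<rho> i) = {e\<in>edges G. \<rho> ` ends G e = {i - 1, i}}" "distinct (merge_edges G \<rho> i)"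
  using stable_graphs_finite[OF G] by (simp_all add: merge_edges_def)

lemma merge_contraction:
  assumes G: "G \<in> stable_graphs n d" and i: "i \<ge> 1" and ed: "es = merge_edges G \<rho> i"
  shows "contraction n G (contract_list_vert G es) id (contract_list G es)"
    and "edges (contract_list G es) = edges G - {e\<in>edges G. \<rho> ` ends G e = {i - 1, i}}"
    and "merge_level i (\<rho> (contract_list_vert G es v)) = merge_level i (\<rho> v)"
proof -
  have wf: "wf_wgraph n G" using stable_graphs_wf[OF G] .
  have es: "set es = {e\<in>edges G. \<rho> ` ends G e = {i - 1, i}}" "distinct es" "set es \<subseteq> edges G"
    using merge_edges[OF G, of \<rho> i] unfolding ed by auto
  show "contraction n G (contract_list_vert G es) id (contract_list G es)"
    "edges (contract_list G es) = edges G - {e\<in>edges G. \<rho> ` ends G e = {i - 1, i}}"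
    using contract_list_contraction[OF wf es(2,3)] unfolding es(1) by auto
  show "merge_level i (\<rho> (contract_list_vert G es v)) = merge_level i (\<rho> v)"
  proof (rule contract_list_const[OF wf es(2,3), where \<sigma> = "\<lambda>v. merge_level i (\<rho> v)"])
    fix e a b assume "e \<in> set es" "a \<in> ends G e" "b \<in> ends G e"
    then have "\<rho> a \<in> {i - 1, i}" "\<rho> b \<in> {i - 1, i}" unfolding es(1) by blast+
    then show "merge_level i (\<rho> a) = merge_level i (\<rho> b)" using i by (auto simp: merge_level_def)
  qed
qed

lemma core_contract_level:
  assumes d: "d > 0" and A: "(G, k, \<rho>) \<in> aligned_graphs n d" and e: "e \<in> core_edges G"
  shows "contraction n G (contract_vert G e) id (contract_edge G e)"
    and "\<rho> (contract_vert G e v) = \<rho> v"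
proof -
  have G: "G \<in> stable_graphs n d" using aligned_graphsD(1)[OF d A] .
  have eE: "e \<in> edges G" using core_subset(1)[OF stable_graphs_genus[OF G]] e by blast
  show "contraction n G (contract_vert G e) id (contract_edge G e)"
    using contract_edge_contraction[OF stable_graphs_wf[OF G] eE] .
  have "\<rho> a = 0" if "a \<in> ends G e" for a
    using aligned_graphsD(6)[OF d A] core_subset(3)[OF stable_graphs_genus[OF G] e] that by blast
  then show "\<rho> (contract_vert G e v) = \<rho> v"
    using contract_vert_const[OF stable_graphs_wf[OF G] eE, of \<rho>] by simp
qed

lemma aligned_mor_contraction:
  assumes d: "d > 0" and m: "aligned_mor n d A f A'"
  shows "A \<in> aligned_graphs n d \<and> A' \<in> aligned_graphs n d \<and> aligned_contraction n A f A'"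
  using m
proof (induction rule: aligned_mor.induct)
  case (iso G k \<rho> G' \<rho>' fv fe)
  have G: "G \<in> stable_graphs n d" using aligned_graphsD(1)[OF d iso(1)] .
  have C: "contraction n G fv fe G'" using graph_iso_contraction[OF stable_graphs_wf[OF G] iso(3)] .
  have F: "edges G - fe ` edges G' = {}" using iso(3) by (auto simp: graph_iso_def bij_betw_def)
  have "crosses G' \<rho>' e j \<longleftrightarrow> crosses G \<rho> (fe e) j" if e: "e \<in> edges G'" for e j
  proof (rule crosses_contraction[OF G C e])
    fix v w assume "directed G (fe e) v w"
    then have "v \<in> verts G" "w \<in> verts G" using directed_verts[OF stable_graphs_wf[OF G]] by auto
    then show "\<rho>' (fv v) < j \<and> j \<le> \<rho>' (fv w) \<longleftrightarrow> \<rho> v < j \<and> j \<le> \<rho> w" using iso(4) by simp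
  qed
  then show ?case using iso C by (simp add: aligned_contraction_def F)
next
  case (core_contract G k \<rho> e)
  have G: "G \<in> stable_graphs n d" using aligned_graphsD(1)[OF d core_contract(1)] .
  note c = core_contract_level[OF d core_contract(1,3)]
  have eE: "e \<in> edges G" using core_subset(1)[OF stable_graphs_genus[OF G]] core_contract(3) by blast
  have F: "edges G - id ` edges (contract_edge G e) = {e}" using eE by (auto simp: contract_edge_def)
  have "crosses (contract_edge G e) \<rho> f j \<longleftrightarrow> crosses G \<rho> (id f) j" if f: "f \<in> edges (contract_edge G e)" for f j
    by (rule crosses_contraction[OF G c(1) f]) (simp add: c(2))
  moreover have "\<not> crosses G \<rho> e j" for j using crosses_edge[of G \<rho> e j] core_contract(3) by blast
  ultimately show ?case unfolding aligned_contraction_def case_prod_conv F using core_contract c(1) by simp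
next
  case (merge G k \<rho> i es)
  have G: "G \<in> stable_graphs n d" using aligned_graphsD(1)[OF d merge(1)] .
  have i: "1 \<le> i" "i \<le> k" using merge(2) by auto
  let ?fv = "contract_list_vert G es" and ?G' = "contract_list G es" and ?\<rho>' = "merge_level i \<circ> \<rho>"
  note c = merge_contraction[OF G i(1) merge(3)]
  have x: "crosses ?G' ?\<rho>' e j \<longleftrightarrow> crosses G \<rho> (id e) (skip_level i j)" if e: "e \<in> edges ?G'" for e j
  proof (rule crosses_contraction[OF G c(1) e])
    fix v w
    show "?\<rho>' (?fv v) < j \<and> j \<le> ?\<rho>' (?fv w) \<longleftrightarrow> \<rho> v < skip_level i j \<and> skip_level i j \<le> \<rho> w"
      using merge_skip[OF i(1), of j "\<rho> v"] merge_skip[OF i(1), of j "\<rho> w"] c(3) by (simp add: not_le[symmetric])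
  qed
  have y: "\<not> crosses G \<rho> e (skip_level i j)" if e: "e \<in> edges G - id ` edges ?G'" for e j
  proof
    assume "crosses G \<rho> e (skip_level i j)"
    then obtain v w where vw: "directed G e v w" "\<rho> v < skip_level i j" "skip_level i j \<le> \<rho> w" by (auto simp: crosses_def)
    have "\<rho> ` ends G e = {i - 1, i}" using e c(2) by simp
    then have "\<rho> v \<in> {i - 1, i}" "\<rho> w \<in> {i - 1, i}" using directedD(3)[OF vw(1)] by auto
    then have "skip_level i j = i" using vw(2,3) by auto
    then show False by (auto simp: skip_level_def split: if_splits)
  qed
  have l: "inj_on (skip_level i) {1..k - 1}" "skip_level i ` {1..k - 1} \<subseteq> {1..k}"
    using i by (auto simp: inj_on_def skip_level_def)
  show ?case
    unfolding aligned_contraction_def case_prod_conv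
    by (intro conjI ballI merge(1) merge(4) c(1) l x y)
next
  case (comp A fv fe fl A' gv ge gl A'')
  obtain G k \<rho> where a: "A = (G, k, \<rho>)" by (cases A) auto
  obtain G' k' \<rho>' where a': "A' = (G', k', \<rho>')" by (cases A') auto
  obtain G'' k'' \<rho>'' where a'': "A'' = (G'', k'', \<rho>'')" by (cases A'') auto
  have "wf_wgraph n G" using stable_graphs_wf[OF aligned_graphsD(1)[OF d]] comp.IH a by blast
  then show ?case using aligned_contraction_comp comp.IH unfolding a a' a'' by blast
qed

lemma inj_on_map_sum_Plus:
  assumes "inj_on f A" "inj_on g B"
  shows "inj_on (map_sum f g) (A <+> B)"
proof (rule inj_onI)
  fix x y assume "x \<in> A <+> B" "y \<in> A <+> B" "map_sum f g x = map_sum f g y"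
  then show "x = y" using assms by (cases x; cases y) (auto dest: inj_onD)
qed

lemma map_sum_image_Plus:
  assumes "f ` A \<subseteq> A'" "g ` B \<subseteq> B'"
  shows "map_sum f g ` (A <+> B) \<subseteq> A' <+> B'"
proof (rule image_subsetI)
  fix x assume "x \<in> A <+> B"
  then show "map_sum f g x \<in> A' <+> B'" using assms by (cases x) (auto simp: image_subset_iff)
qed

lemma aligned_contraction_index:
  assumes d: "d > 0" and A: "(G, k, \<rho>) \<in> aligned_graphs n d"
    and C: "aligned_contraction n (G, k, \<rho>) (fv, fe, fl) (G', k', \<rho>')"
  shows "inj_on (map_sum fe fl) (sigma_index (G', k', \<rho>'))"
    "map_sum fe fl ` sigma_index (G', k', \<rho>') \<subseteq> sigma_index (G, k, \<rho>)"
proof -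
  note C' = aligned_contractionD(1)[OF C] and l = aligned_contractionD(2,3)[OF C]
  have G: "G \<in> stable_graphs n d" using aligned_graphsD(1)[OF d A] .
  have G': "G' \<in> stable_graphs n d" using contraction_stable_graphs[OF G C'] .
  have sub: "core_edges G' \<subseteq> edges G'" using core_subset(1)[OF stable_graphs_genus[OF G']] .
  have "inj_on fe (core_edges G')" using contractionD(2)[OF C'] sub inj_on_subset by blast
  then show "inj_on (map_sum fe fl) (sigma_index (G', k', \<rho>'))" 
    using l(1) by (simp only: sigma_index.simps inj_on_map_sum_Plus)
  have "fe e \<in> core_edges G" if "e \<in> core_edges G'" for e
    using core_edges_contraction[OF stable_graphs_genus[OF G] C'] that sub by blast
  then have "fe ` core_edges G' \<subseteq> core_edges G" by blast
  then show "map_sum fe fl ` sigma_index (G', k', \<rho>') \<subseteq> sigma_index (G, k, \<rho>)"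
    using l(2) by (simp only: sigma_index.simps map_sum_image_Plus)
qed

lemma mult_aligned_contraction:
  assumes C: "aligned_contraction n (G, k, \<rho>) (fv, fe, fl) (G', k', \<rho>')" and j: "j \<in> {1..k'}"
  shows "mult G \<rho> (fl j) = mult G' \<rho>' j"
proof -
  note C' = aligned_contractionD(1)[OF C] and x = aligned_contractionD(4)[OF C _ j]
    and y = aligned_contractionD(5)[OF C _ j]
  have "{e. crosses G \<rho> e (fl j)} = fe ` {e. crosses G' \<rho>' e j}"
  proof (intro set_eqI iffI)
    fix e assume "e \<in> {e. crosses G \<rho> e (fl j)}"
    then have e: "crosses G \<rho> e (fl j)" by simp
    then have "e \<in> fe ` edges G'" using y[of e] crosses_edge[OF e] by blast
    then obtain e' where "e' \<in> edges G'" "e = fe e'" by blast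
    then show "e \<in> fe ` {e. crosses G' \<rho>' e j}" using x e by blast
  next
    fix e assume "e \<in> fe ` {e. crosses G' \<rho>' e j}"
    then obtain e' where e': "crosses G' \<rho>' e' j" "e = fe e'" by blast
    then have "e' \<in> edges G'" using crosses_edge by blast
    then show "e \<in> {e. crosses G \<rho> e (fl j)}" using x e' by simp
  qed
  moreover have "inj_on fe {e. crosses G' \<rho>' e j}"
    using contractionD(2)[OF C'] by (rule inj_on_subset) (use crosses_edge in blast)
  ultimately show ?thesis unfolding mult_def by (simp add: card_image)
qed

text \<open>
  A surviving level is crossed by the images of the same edges as before, so multiplicities agree,
  and a level that disappears has length zero.
\<close>

lemma hat_aligned_contraction:
  assumes d: "d > 0" and A: "(G, k, \<rho>) \<in> aligned_graphs n d" and A': "(G', k', \<rho>') \<in> aligned_graphs n d"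
    and C: "aligned_contraction n (G, k, \<rho>) (fv, fe, fl) (G', k', \<rho>')"
    and eq: "\<And>s. s \<in> sigma_index (G', k', \<rho>') \<Longrightarrow> l (map_sum fe fl s) = l' s"
    and zero: "\<And>s. s \<in> sigma_index (G, k, \<rho>) - map_sum fe fl ` sigma_index (G', k', \<rho>') \<Longrightarrow> l s = 0"
  shows "e \<in> edges G' \<Longrightarrow> hat G \<rho> l (fe e) = hat G' \<rho>' l' e"
    and "e \<in> edges G - fe ` edges G' \<Longrightarrow> hat G \<rho> l e = 0"
proof -
  note C' = aligned_contractionD(1)[OF C] and il = aligned_contractionD(2,3)[OF C]
  have G: "G \<in> stable_graphs n d" using aligned_graphsD(1)[OF d A] .
  note ce = core_edges_contraction[OF stable_graphs_genus[OF G] C']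
  have eqr: "l (Inr (fl j)) = l' (Inr j)" if "j \<in> {1..k'}" for j using eq[of "Inr j"] that by simp
  have eql: "l (Inl (fe e)) = l' (Inl e)" if "e \<in> core_edges G'" for e using eq[of "Inl e"] that by simp
  have zr: "l (Inr i) = 0" if "i \<in> {1..k}" "i \<notin> fl ` {1..k'}" for i
  proof (rule zero)
    show "Inr i \<in> sigma_index (G, k, \<rho>) - map_sum fe fl ` sigma_index (G', k', \<rho>')" using that by auto
  qed
  have zl: "l (Inl e) = 0" if "e \<in> core_edges G" "e \<notin> fe ` core_edges G'" for e
  proof (rule zero)
    show "Inl e \<in> sigma_index (G, k, \<rho>) - map_sum fe fl ` sigma_index (G', k', \<rho>')" using that by auto
  qed
  show "hat G \<rho> l (fe e) = hat G' \<rho>' l' e" if e: "e \<in> edges G'"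
  proof -
    have fe: "fe e \<in> edges G" using contractionD(3)[OF C'] e by blast
    show ?thesis
    proof (cases "e \<in> core_edges G'")
      case True
      then show ?thesis using hat_core[OF _ fe] hat_core[OF _ e] ce[OF e] eql by simp
    next
      case False
      then have nc: "fe e \<in> edges G - core_edges G" using ce[OF e] fe by simp
      have x: "crosses G' \<rho>' e j \<longleftrightarrow> crosses G \<rho> (fe e) (fl j)" if "j \<in> {1..k'}" for j
        using aligned_contractionD(4)[OF C e that] .
      let ?J = "{j. crosses G' \<rho>' e j}" and ?I = "{i. crosses G \<rho> (fe e) i}"
      have J: "?J \<subseteq> {1..k'}" and I: "?I \<subseteq> {1..k}" using crosses_level[OF d A'] crosses_level[OF d A] by auto
      have "(\<Sum>i\<in>?I. l (Inr i) / real (mult G \<rho> i)) = (\<Sum>i\<in>fl ` ?J. l (Inr i) / real (mult G \<rho> i))"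
      proof (rule sum.mono_neutral_right)
        show "finite ?I" using I finite_subset by blast
        show "fl ` ?J \<subseteq> ?I" using J x by auto
        show "\<forall>i\<in>?I - fl ` ?J. l (Inr i) / real (mult G \<rho> i) = 0"
        proof
          fix i assume i: "i \<in> ?I - fl ` ?J"
          have "i \<notin> fl ` {1..k'}"
          proof
            assume "i \<in> fl ` {1..k'}"
            then obtain j where "j \<in> {1..k'}" "i = fl j" by blast
            then show False using i x by blast
          qed
          then show "l (Inr i) / real (mult G \<rho> i) = 0" using zr i I by auto
        qed
      qed
      also have "\<dots> = (\<Sum>j\<in>?J. l (Inr (fl j)) / real (mult G \<rho> (fl j)))"
        using inj_on_subset[OF il(1) J] by (simp add: sum.reindex)
      also have "\<dots> = (\<Sum>j\<in>?J. l' (Inr j) / real (mult G' \<rho>' j))"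
        using J eqr mult_aligned_contraction[OF C] by (intro sum.cong) auto
      finally show ?thesis using hat_noncore[OF nc] hat_noncore[of e G'] e False by simp
    qed
  qed
  show "hat G \<rho> l e = 0" if e: "e \<in> edges G - fe ` edges G'"
  proof (cases "e \<in> core_edges G")
    case True
    have "e \<notin> fe ` core_edges G'"
      using e core_subset(1)[OF stable_graphs_genus[OF contraction_stable_graphs[OF G C']]] by blast
    then show ?thesis using hat_core[OF True] e zl[OF True] by simp
  next
    case False
    have "l (Inr i) = 0" if "crosses G \<rho> e i" for i
    proof (rule zr[OF crosses_level[OF d A that]])
      show "i \<notin> fl ` {1..k'}" using aligned_contractionD(5)[OF C e] that by blast
    qed
    then show ?thesis using hat_noncore[of e G \<rho> l] e False by simp
  qed
qed

section \<open>The comparison map\<close>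

lemma space_diagram_aligned:
  assumes d: "d > 0"
  shows "space_diagram (aligned_graphs n d) sigma (aligned_mor n d) sigma_incl"
proof
  fix A f A' assume m: "aligned_mor n d A f A'"
  note a = aligned_mor_contraction[OF d m]
  show "A \<in> aligned_graphs n d" "A' \<in> aligned_graphs n d" using a by auto
  obtain G k \<rho> where A: "A = (G, k, \<rho>)" by (cases A) auto
  obtain G' k' \<rho>' where A': "A' = (G', k', \<rho>')" by (cases A') auto
  obtain fv fe fl where f: "f = (fv, fe, fl)" by (cases f) auto
  have A1: "(G, k, \<rho>) \<in> aligned_graphs n d" using a A by simp
  have fin: "finite (sigma_index (G, k, \<rho>))" using finite_sigma_index(2)[OF aligned_graphsD(1)[OF d A1]] .
  have C: "aligned_contraction n (G, k, \<rho>) (fv, fe, fl) (G', k', \<rho>')" using a A A' f by simp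
  show "x \<in> topspace (sigma A') \<Longrightarrow> sigma_incl A f A' x \<in> topspace (sigma A)" for x
    unfolding sigma_def sigma_incl_def A A' f fst_conv snd_conv
    using extend_zero_simplex[OF aligned_contraction_index[OF d A1 C] fin] .
qed

abbreviation aligned_class :: "nat \<Rightarrow> nat \<Rightarrow> aligned \<times> (nat + nat \<Rightarrow> real) \<Rightarrow> (aligned \<times> (nat + nat \<Rightarrow> real)) set" where
  "aligned_class n d \<equiv> colim_class (aligned_graphs n d) sigma (aligned_mor n d) sigma_incl"

definition comparison_rep ::
  "nat \<Rightarrow> nat \<Rightarrow> aligned \<times> (nat + nat \<Rightarrow> real) \<Rightarrow> (wgraph \<times> (nat \<Rightarrow> real)) set" where
  "comparison_rep n d = (\<lambda>((G, k, \<rho>), l). vir_class n d (G, hat G \<rho> l))"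

lemma comparison_rep_invariant:
  assumes d: "d > 0" and m: "aligned_mor n d A f A'" and x: "x \<in> topspace (sigma A')"
  shows "comparison_rep n d (A', x) = comparison_rep n d (A, sigma_incl A f A' x)"
proof -
  obtain G k \<rho> where A: "A = (G, k, \<rho>)" by (cases A) auto
  obtain G' k' \<rho>' where A': "A' = (G', k', \<rho>')" by (cases A') auto
  obtain fv fe fl where f: "f = (fv, fe, fl)" by (cases f) auto
  note a = aligned_mor_contraction[OF d m]
  have A1: "(G, k, \<rho>) \<in> aligned_graphs n d" and A2: "(G', k', \<rho>') \<in> aligned_graphs n d" using a A A' by auto
  have C: "aligned_contraction n (G, k, \<rho>) (fv, fe, fl) (G', k', \<rho>')" using a A A' f by simp
  note idx = aligned_contraction_index[OF d A1 C]
  define l where "l = sigma_incl A f A' x"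
  have l: "l = extend_zero (map_sum fe fl) (sigma_index (G', k', \<rho>')) (sigma_index (G, k, \<rho>)) x"
    unfolding l_def sigma_incl_def A A' f by simp
  have eq: "l (map_sum fe fl s) = x s" if "s \<in> sigma_index (G', k', \<rho>')" for s
    unfolding l using idx(2) that by (intro extend_zero_image[OF idx(1) that]) blast
  have zero: "l s = 0" if "s \<in> sigma_index (G, k, \<rho>) - map_sum fe fl ` sigma_index (G', k', \<rho>')" for s
    unfolding l using that by (intro extend_zero_other) auto
  note h = hat_aligned_contraction[OF d A1 A2 C, of l x, OF eq zero]
  have "vir_class n d (G, hat G \<rho> l) = vir_class n d (G', hat G' \<rho>' x)"
  proof (rule vir_class_contraction[OF aligned_graphsD(1)[OF d A1] aligned_contractionD(1)[OF C]])
    show "hat G' \<rho>' x \<in> topspace (kappa G')" using hat_kappa[OF d A2] x A' by simp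
    show "hat G \<rho> l \<in> extensional (edges G)" by (simp add: hat_def)
  qed (use h in auto)
  then show ?thesis unfolding comparison_rep_def A A' using l_def A A' by simp
qed

lemma comparison_class:
  assumes d: "d > 0" and A: "(G, k, \<rho>) \<in> aligned_graphs n d" and l: "l \<in> topspace (sigma (G, k, \<rho>))"
  shows "comparison n d (aligned_class n d ((G, k, \<rho>), l)) = vir_class n d (G, hat G \<rho> l)"
proof -
  have "descend (comparison_rep n d) (aligned_class n d ((G, k, \<rho>), l)) = comparison_rep n d ((G, k, \<rho>), l)"
    using A l by (intro space_diagram.descend_cls[OF space_diagram_aligned[OF d]] comparison_rep_invariant[OF d]) auto
  moreover have "comparison n d = descend (comparison_rep n d)" by (simp add: comparison_def comparison_rep_def)
  ultimately show ?thesis by (simp add: comparison_rep_def)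
qed

lemma topspace_Delta:
  assumes "d > 0"
  shows "topspace (Delta n d) = aligned_class n d ` topspace (sum_topology sigma (aligned_graphs n d))"
  unfolding Delta_def by (rule space_diagram.topspace_colimit[OF space_diagram_aligned[OF assms]])

lemma topspace_Delta_obtain:
  assumes "d > 0" "p \<in> topspace (Delta n d)"
  obtains G k \<rho> l where "p = aligned_class n d ((G, k, \<rho>), l)" "(G, k, \<rho>) \<in> aligned_graphs n d"
    "l \<in> topspace (sigma (G, k, \<rho>))"
proof -
  obtain q where q: "p = aligned_class n d q" "q \<in> topspace (sum_topology sigma (aligned_graphs n d))"
    using assms(2) unfolding topspace_Delta[OF assms(1)] by blast
  obtain G k \<rho> l where "q = ((G, k, \<rho>), l)" by (metis surj_pair)
  then show ?thesis using that q by simp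
qed

lemma aligned_class_in_topspace:
  assumes "d > 0" "A \<in> aligned_graphs n d" "l \<in> topspace (sigma A)"
  shows "aligned_class n d (A, l) \<in> topspace (Delta n d)"
  unfolding topspace_Delta[OF assms(1)] using assms(2,3) by (intro imageI) simp

subsection \<open>Positive representatives\<close>

text \<open>
  The common part of core contractions and radial merges: \<open>\<sigma>\<close> is the identity for the former
  and identifies two adjacent levels for the latter.
\<close>

lemma aligned_contract:
  assumes d: "d > 0" and A: "(G, k, \<rho>) \<in> aligned_graphs n d" and C: "contraction n G fv fe G'"
    and level: "\<And>v. v \<in> verts G \<Longrightarrow> \<rho>' (fv v) = \<sigma> (\<rho> v)" and onto: "\<sigma> ` {0..k} = {0..k'}"
    and mono: "mono \<sigma>" and zero: "\<sigma> 0 = 0"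
    and core: "\<And>v. v \<in> verts G \<Longrightarrow> \<sigma> (\<rho> v) = 0 \<Longrightarrow> fv v \<in> core_verts G'"
    and strict: "\<And>e v w. e \<in> edges G' \<Longrightarrow> directed G (fe e) v w \<Longrightarrow> \<sigma> (\<rho> v) < \<sigma> (\<rho> w)"
  shows "(G', k', \<rho>') \<in> aligned_graphs n d"
proof -
  note a = aligned_graphsD[OF d A]
  have G: "G \<in> stable_graphs n d" using a(1) .
  have wf: "wf_wgraph n G" using stable_graphs_wf[OF G] .
  have G': "G' \<in> stable_graphs n d" using contraction_stable_graphs[OF G C] .
  have V': "verts G' = fv ` verts G" using contractionD(1)[OF C] by simp
  have cV: "core_verts G' = fv ` core_verts G" using core_verts_contraction[OF G C] .
  have sub: "core_verts G \<subseteq> verts G" using core_subset(2)[OF stable_graphs_genus[OF G]] .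
  have "\<rho>' ` verts G' = \<sigma> ` \<rho> ` verts G" unfolding V' image_image using level by (intro image_cong) auto
  then have 1: "\<rho>' ` verts G' = {0..k'}" unfolding a(2) onto .
  have 2: "{v\<in>verts G'. \<rho>' v = 0} = core_verts G'"
  proof (intro set_eqI iffI)
    fix x assume "x \<in> {v\<in>verts G'. \<rho>' v = 0}"
    then obtain v where v: "v \<in> verts G" "x = fv v" "\<rho>' x = 0" unfolding V' by blast
    then show "x \<in> core_verts G'" using core[OF v(1)] level[OF v(1)] by simp
  next
    fix x assume "x \<in> core_verts G'"
    then obtain v where v: "v \<in> core_verts G" "x = fv v" unfolding cV by blast
    then have vV: "v \<in> verts G" using sub by blast
    have "\<rho>' x = 0" using level[OF vV] a(6)[OF v(1)] zero v(2) by simp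
    then show "x \<in> {v\<in>verts G'. \<rho>' v = 0}" using vV v(2) V' by blast
  qed
  have 3: "\<rho>' v' < \<rho>' w'" if e: "directed G' e v' w'" for e v' w'
  proof -
    obtain v w where vw: "directed G (fe e) v w" "fv v = v'" "fv w = w'" using directed_lift[OF G C e] .
    have "v \<in> verts G" "w \<in> verts G" using directed_verts[OF wf vw(1)] by auto
    then show ?thesis using strict[OF directedD(1)[OF e] vw(1)] level vw by auto
  qed
  have fin: "finite (verts G)" using wf_finite(1)[OF wf] .
  have "tied G (\<lambda>v. \<sigma> (\<rho> v))" by (rule tied_mono[OF fin a(5)]) (use mono in \<open>auto dest: monoD\<close>)
  then have "tied G (\<lambda>v. \<rho>' (fv v))" using tied_cong[OF fin, of "\<lambda>v. \<sigma> (\<rho> v)" "\<lambda>v. \<rho>' (fv v)"] level by simp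
  then have 4: "tied G' \<rho>'" using tied_contraction[OF wf C] by blast
  show ?thesis unfolding aligned_graphs_iff[OF d] using G' 1 2 3 4 by blast
qed

lemma aligned_core_contract:
  assumes d: "d > 0" and A: "(G, k, \<rho>) \<in> aligned_graphs n d" and e: "e \<in> core_edges G"
  shows "(contract_edge G e, k, \<rho>) \<in> aligned_graphs n d"
proof (rule aligned_contract[OF d A core_contract_level(1)[OF d A e], where \<sigma> = id])
  note a = aligned_graphsD[OF d A]
  have cV: "core_verts (contract_edge G e) = contract_vert G e ` core_verts G"
    using core_verts_contraction[OF a(1) core_contract_level(1)[OF d A e]] .
  show "\<rho> (contract_vert G e v) = id (\<rho> v)" for v using core_contract_level(2)[OF d A e] by simp
  show "contract_vert G e v \<in> core_verts (contract_edge G e)" if "v \<in> verts G" "id (\<rho> v) = 0" for v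
  proof -
    have "v \<in> {v\<in>verts G. \<rho> v = 0}" using that by simp
    then show ?thesis unfolding cV a(3) by blast
  qed
  show "id (\<rho> v) < id (\<rho> w)" if "directed G (id f) v w" for f v w using a(4) that by simp
qed (auto simp: mono_def)

lemma aligned_merge:
  assumes d: "d > 0" and A: "(G, k, \<rho>) \<in> aligned_graphs n d" and i: "i \<in> {1..k}"
    and es: "es = merge_edges G \<rho> i"
  shows "(contract_list G es, k - 1, merge_level i \<circ> \<rho>) \<in> aligned_graphs n d"
proof -
  note a = aligned_graphsD[OF d A]
  have i1: "1 \<le> i" using i by simp
  note c = merge_contraction[OF a(1) i1 es]
  have g: "genus_one_graph n d G" using stable_graphs_genus[OF a(1)] .
  let ?fv = "contract_list_vert G es"
  have cV: "core_verts (contract_list G es) = ?fv ` core_verts G" using core_verts_contraction[OF a(1) c(1)] .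
  show ?thesis
  proof (rule aligned_contract[OF d A c(1), where \<sigma> = "merge_level i"])
    show "(merge_level i \<circ> \<rho>) (?fv v) = merge_level i (\<rho> v)" for v using c(3) by simp
    show "merge_level i ` {0..k} = {0..k - 1}"
    proof (intro set_eqI iffI)
      fix x assume "x \<in> {0..k - 1}"
      then show "x \<in> merge_level i ` {0..k}"
        using i by (intro image_eqI[of _ _ "skip_level i x"]) (auto simp: merge_level_def skip_level_def)
    qed (use i in \<open>auto simp: merge_level_def\<close>)
    show "mono (merge_level i)" by (auto simp: mono_def merge_level_def)
    show "merge_level i 0 = 0" by (simp add: merge_level_def)
    show "?fv v \<in> core_verts (contract_list G es)" if v: "v \<in> verts G" "merge_level i (\<rho> v) = 0" for v
    proof (cases "\<rho> v = 0")
      case True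
      then have "v \<in> {v\<in>verts G. \<rho> v = 0}" using v by simp
      then show ?thesis unfolding cV a(3) by blast
    next
      case False
      then have r1: "\<rho> v = 1" "i = 1" using v(2) i1 by (auto simp: merge_level_def split: if_splits)
      \<comment> \<open>merging level one into the core contracts the edge that attaches \<open>v\<close> to the core\<close>
      then have "v \<notin> core_verts G" using a(6) by force
      then obtain e u where e: "directed G e u v" using noncore_parent[OF g v(1)] by blast
      have uV: "u \<in> verts G" using directed_verts[OF stable_graphs_wf[OF a(1)] e] by simp
      have u0: "\<rho> u = 0" using a(4)[OF e] r1 by simp
      then have uc: "u \<in> core_verts G" using uV a(3) by blast
      have "\<rho> ` ends G e = {i - 1, i}" using directedD(3)[OF e] r1 u0 by simp
      then have "e \<in> edges G - id ` edges (contract_list G es)" using directedD(1)[OF e] c(2) by simp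
      then have "?fv u = ?fv v"
        using contracted_edge_const[OF stable_graphs_wf[OF a(1)] c(1) _ directedD(3)[OF e]] by blast
      then show ?thesis unfolding cV using uc by (metis imageI)
    qed
    show "merge_level i (\<rho> v) < merge_level i (\<rho> w)"
      if e: "e \<in> edges (contract_list G es)" "directed G (id e) v w" for e v w
    proof -
      have lt: "\<rho> v < \<rho> w" using a(4)[OF e(2)] .
      have "\<not> (\<rho> v = i - 1 \<and> \<rho> w = i)"
      proof
        assume "\<rho> v = i - 1 \<and> \<rho> w = i"
        then have "\<rho> ` ends G e = {i - 1, i}" using directedD(3)[OF e(2)] by simp
        then show False using e(1) c(2) by blast
      qed
      then show ?thesis using lt i1 by (auto simp: merge_level_def)
    qed
  qed
qed

lemma aligned_class_mor:
  assumes d: "d > 0" and m: "aligned_mor n d (G, k, \<rho>) (fv, fe, fl) (G', k', \<rho>')"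
    and l: "l \<in> topspace (sigma (G, k, \<rho>))"
    and eq: "\<And>s. s \<in> sigma_index (G', k', \<rho>') \<Longrightarrow> l (map_sum fe fl s) = l' s"
    and zero: "\<And>s. s \<in> sigma_index (G, k, \<rho>) - map_sum fe fl ` sigma_index (G', k', \<rho>') \<Longrightarrow> l s = 0"
    and ext: "l' \<in> extensional (sigma_index (G', k', \<rho>'))"
  shows "l' \<in> topspace (sigma (G', k', \<rho>'))"
    and "aligned_class n d ((G, k, \<rho>), l) = aligned_class n d ((G', k', \<rho>'), l')"
proof -
  note a = aligned_mor_contraction[OF d m]
  have A: "(G, k, \<rho>) \<in> aligned_graphs n d" using a by blast
  have fin: "finite (sigma_index (G, k, \<rho>))" using finite_sigma_index(2)[OF aligned_graphsD(1)[OF d A]] .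
  note idx = aligned_contraction_index[OF d A conjunct2[OF conjunct2[OF a]]]
  have l1: "l \<in> extensional (sigma_index (G, k, \<rho>))" "\<forall>s\<in>sigma_index (G, k, \<rho>). 0 \<le> l s"
    "(\<Sum>s\<in>sigma_index (G, k, \<rho>). l s) = 1" using l unfolding topspace_sigma by blast+
  have s: "(\<Sum>s\<in>sigma_index (G, k, \<rho>). l s) = (\<Sum>s\<in>sigma_index (G', k', \<rho>'). l' s)"
  proof (rule extend_zero_sum[OF idx fin])
    show "\<And>s. s \<in> sigma_index (G', k', \<rho>') \<Longrightarrow> l (map_sum fe fl s) = l' s" by (rule eq)
    show "\<And>s. s \<in> sigma_index (G, k, \<rho>) \<Longrightarrow> s \<notin> map_sum fe fl ` sigma_index (G', k', \<rho>') \<Longrightarrow> l s = 0"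
      by (rule zero) (rule DiffI)
  qed
  have "0 \<le> l' s" if s: "s \<in> sigma_index (G', k', \<rho>')" for s
  proof -
    have "map_sum fe fl s \<in> sigma_index (G, k, \<rho>)" using idx(2) s by (metis image_subset_iff)
    then have "0 \<le> l (map_sum fe fl s)" using l1(2) by (metis)
    then show ?thesis using eq[OF s] by (simp only:)
  qed
  moreover have "(\<Sum>s\<in>sigma_index (G', k', \<rho>'). l' s) = 1" using s l1(3) by (simp only:)
  ultimately show l': "l' \<in> topspace (sigma (G', k', \<rho>'))" using ext unfolding topspace_sigma by blast
  have "l = sigma_incl (G, k, \<rho>) (fv, fe, fl) (G', k', \<rho>') l'"
    unfolding sigma_incl_def fst_conv snd_conv
  proof (rule extend_zero_eqI[OF idx l1(1)])
    show "\<And>s. s \<in> sigma_index (G', k', \<rho>') \<Longrightarrow> l (map_sum fe fl s) = l' s" by (rule eq)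
    show "\<And>s. s \<in> sigma_index (G, k, \<rho>) \<Longrightarrow> s \<notin> map_sum fe fl ` sigma_index (G', k', \<rho>') \<Longrightarrow> l s = 0"
      by (rule zero) (rule DiffI)
  qed
  then show "aligned_class n d ((G, k, \<rho>), l) = aligned_class n d ((G', k', \<rho>'), l')"
    using space_diagram.cls_act[OF space_diagram_aligned[OF d] m l'] by simp
qed

text \<open>
  Contract core edges of length zero and merge levels of length zero, one at a time. Both keep the
  graph in the category, because coarsening the levels cannot break a tie.
\<close>

lemma aligned_positive_exists:
  assumes d: "d > 0" and A: "(G, k, \<rho>) \<in> aligned_graphs n d" and l: "l \<in> topspace (sigma (G, k, \<rho>))"
  shows "\<exists>G' k' \<rho>' l'. (G', k', \<rho>') \<in> aligned_graphs n d \<and> l' \<in> topspace (sigma (G', k', \<rho>')) \<and>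
    (\<forall>s\<in>sigma_index (G', k', \<rho>'). 0 < l' s) \<and>
    aligned_class n d ((G, k, \<rho>), l) = aligned_class n d ((G', k', \<rho>'), l')"
  using A l
proof (induction "card (edges G) + k" arbitrary: G k \<rho> l rule: less_induct)
  case less
  note a = aligned_graphsD[OF d less.prems(1)]
  have nn: "\<forall>s\<in>sigma_index (G, k, \<rho>). 0 \<le> l s" using less.prems(2) unfolding topspace_sigma by blast
  have g: "genus_one_graph n d G" using stable_graphs_genus[OF a(1)] .
  have finE: "finite (edges G)" using stable_graphs_finite[OF a(1)] by blast
  show ?case
  proof (cases "\<forall>s\<in>sigma_index (G, k, \<rho>). 0 < l s")
    case True
    then show ?thesis using less.prems by blast
  next
    case False
    then obtain s where s: "s \<in> sigma_index (G, k, \<rho>)" "l s = 0"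
      using nn by (metis order.order_iff_strict)
    show ?thesis
    proof (cases s)
      case (Inl e)
      then have e: "e \<in> core_edges G" using s(1) by simp
      then have eE: "e \<in> edges G" using core_subset(1)[OF g] by blast
      let ?G = "contract_edge G e"
      have A': "(?G, k, \<rho>) \<in> aligned_graphs n d" using aligned_core_contract[OF d less.prems(1) e] .
      have m: "aligned_mor n d (G, k, \<rho>) (contract_vert G e, id, id) (?G, k, \<rho>)"
        using aligned_mor.core_contract[OF less.prems(1) A' e] .
      have EG: "edges ?G = edges G - {e}" by (simp add: contract_edge_def)
      have cE: "f \<in> core_edges ?G \<longleftrightarrow> f \<in> core_edges G" if "f \<in> edges ?G" for f
        using core_edges_contraction[OF g core_contract_level(1)[OF d less.prems(1) e] that] by simp
      have "core_edges ?G \<subseteq> edges ?G"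
        using core_subset(1)[OF stable_graphs_genus[OF aligned_graphsD(1)[OF d A']]] .
      then have core: "core_edges ?G = core_edges G - {e}" using cE EG core_subset(1)[OF g] by blast
      define l' where "l' = restrict l (sigma_index (?G, k, \<rho>))"
      have ms: "map_sum id id t = t" for t :: "nat + nat" by (cases t) simp_all
      have eq: "l (map_sum id id t) = l' t" if "t \<in> sigma_index (?G, k, \<rho>)" for t
        using that unfolding l'_def ms by (simp only: restrict_apply')
      have zero: "l t = 0" if t: "t \<in> sigma_index (G, k, \<rho>) - map_sum id id ` sigma_index (?G, k, \<rho>)" for t
      proof -
        have "t \<in> sigma_index (G, k, \<rho>)" "t \<notin> sigma_index (?G, k, \<rho>)" using t unfolding ms by simp_all
        then have "t = Inl e" unfolding sigma_index.simps core by (cases t) simp_all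
        then show ?thesis using s(2) Inl by simp
      qed
      have ext: "l' \<in> extensional (sigma_index (?G, k, \<rho>))" unfolding l'_def by (rule restrict_extensional)
      have l': "l' \<in> topspace (sigma (?G, k, \<rho>))"
        by (rule aligned_class_mor(1)[OF d m less.prems(2)]) (erule eq, erule zero, rule ext)
      have cl: "aligned_class n d ((G, k, \<rho>), l) = aligned_class n d ((?G, k, \<rho>), l')"
        by (rule aligned_class_mor(2)[OF d m less.prems(2)]) (erule eq, erule zero, rule ext)
      have "card (edges ?G) + k < card (edges G) + k" using card_Diff1_less[OF finE eE] EG by simp
      from less.hyps[OF this A' l'] show ?thesis unfolding cl .
    next
      case (Inr i)
      then have i: "i \<in> {1..k}" using s(1) by simp
      define es where "es = merge_edges G \<rho> i"
      let ?G = "contract_list G es" and ?\<rho> = "merge_level i \<circ> \<rho>"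
      have i1: "1 \<le> i" using i by simp
      note c = merge_contraction[OF a(1) i1 es_def]
      have A': "(?G, k - 1, ?\<rho>) \<in> aligned_graphs n d" using aligned_merge[OF d less.prems(1) i es_def] .
      have m: "aligned_mor n d (G, k, \<rho>) (contract_list_vert G es, id, skip_level i) (?G, k - 1, ?\<rho>)"
        using aligned_mor.merge[OF less.prems(1) i es_def A'] .
      have sub: "edges ?G \<subseteq> edges G" using c(2) by blast
      have cE: "f \<in> core_edges ?G \<longleftrightarrow> f \<in> core_edges G" if "f \<in> edges ?G" for f
        using core_edges_contraction[OF g c(1) that] by simp
      have cG: "core_edges G \<subseteq> edges ?G"
      proof
        fix f assume f: "f \<in> core_edges G"
        then have fE: "f \<in> edges G" using core_subset(1)[OF g] by blast
        have r0: "\<rho> x = 0" if "x \<in> ends G f" for x using a(6) core_subset(3)[OF g f] that by (metis subsetD)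
        have "\<rho> ` ends G f \<noteq> {i - 1, i}"
        proof
          assume "\<rho> ` ends G f = {i - 1, i}"
          then have "i \<in> \<rho> ` ends G f" by simp
          then obtain x where "x \<in> ends G f" "i = \<rho> x" by blast
          then show False using r0 i1 by simp
        qed
        then show "f \<in> edges ?G" using c(2) fE by simp
      qed
      have core: "core_edges ?G = core_edges G"
        using cE cG core_subset(1)[OF stable_graphs_genus[OF aligned_graphsD(1)[OF d A']]] by blast
      define l' where "l' = restrict (\<lambda>t. l (map_sum id (skip_level i) t)) (sigma_index (?G, k - 1, ?\<rho>))"
      have eq: "l (map_sum id (skip_level i) t) = l' t" if "t \<in> sigma_index (?G, k - 1, ?\<rho>)" for t
        using that unfolding l'_def by (simp only: restrict_apply')
      have zero: "l t = 0" if t: "t \<in> sigma_index (G, k, \<rho>) - map_sum id (skip_level i) ` sigma_index (?G, k - 1, ?\<rho>)" for t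
      proof (cases t)
        case (Inl f)
        then have "Inl f \<in> sigma_index (?G, k - 1, ?\<rho>)" using t core by simp
        moreover have "map_sum id (skip_level i) (Inl f) = t" using Inl by simp
        ultimately show ?thesis using t by (metis DiffD2 imageI)
      next
        case (Inr j)
        have jk: "j \<in> {1..k}" using t Inr by simp
        show ?thesis
        proof (cases "j = i")
          case True
          then show ?thesis using s(2) Inr \<open>s = Inr i\<close> by simp
        next
          case False
          have "merge_level i j \<in> {1..k - 1}" "skip_level i (merge_level i j) = j"
            using False jk i by (auto simp: merge_level_def skip_level_def)
          then have "Inr (merge_level i j) \<in> sigma_index (?G, k - 1, ?\<rho>)"
            "map_sum id (skip_level i) (Inr (merge_level i j)) = t" using Inr by simp_all
          then show ?thesis using t by (metis DiffD2 imageI)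
        qed
      qed
      have ext: "l' \<in> extensional (sigma_index (?G, k - 1, ?\<rho>))" unfolding l'_def by (rule restrict_extensional)
      have l': "l' \<in> topspace (sigma (?G, k - 1, ?\<rho>))"
        by (rule aligned_class_mor(1)[OF d m less.prems(2)]) (erule eq, erule zero, rule ext)
      have cl: "aligned_class n d ((G, k, \<rho>), l) = aligned_class n d ((?G, k - 1, ?\<rho>), l')"
        by (rule aligned_class_mor(2)[OF d m less.prems(2)]) (erule eq, erule zero, rule ext)
      have "card (edges ?G) + (k - 1) < card (edges G) + k"
      proof -
        have "k - 1 < k" using i by simp
        with card_mono[OF finE sub] show ?thesis by (rule add_le_less_mono)
      qed
      from less.hyps[OF this A' l'] show ?thesis unfolding cl .
    qed
  qed
qed

text \<open>
  Counting the smaller elements enumerates a finite set of reals.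
\<close>

lemma card_less_image:
  fixes D :: "real set"
  assumes "finite D"
  shows "(\<lambda>x. card (D \<inter> {..<x})) ` D = {..<card D}"
proof (rule card_subset_eq)
  have lt: "card (D \<inter> {..<x}) < card (D \<inter> {..<y})" if "x \<in> D" "x < y" for x y
    using that assms by (intro psubset_card_mono) auto
  have "inj_on (\<lambda>x. card (D \<inter> {..<x})) D"
  proof (rule linorder_inj_onI)
    fix x y assume "x < y" "x \<in> D" "y \<in> D"
    then show "card (D \<inter> {..<x}) \<noteq> card (D \<inter> {..<y})" using lt[of x y] by simp
  qed (rule linear)
  then show "card ((\<lambda>x. card (D \<inter> {..<x})) ` D) = card {..<card D}" by (simp add: card_image)
  have "card (D \<inter> {..<x}) < card D" if "x \<in> D" for x
    using that assms by (intro psubset_card_mono) auto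
  then show "(\<lambda>x. card (D \<inter> {..<x})) ` D \<subseteq> {..<card D}" by auto
qed simp

lemma radius_strict_mono:
  assumes d: "d > 0" and A: "(G, k, \<rho>) \<in> aligned_graphs n d"
    and l: "\<forall>s\<in>sigma_index (G, k, \<rho>). 0 < l s" and ij: "i < j" "j \<le> k"
  shows "radius G \<rho> l i < radius G \<rho> l j"
proof -
  have pos: "0 < l (Inr m) / real (mult G \<rho> m)" if m: "m \<in> {1..k}" for m
  proof -
    have "0 < l (Inr m)" using l m by (metis Plus_mem_iff(2) sigma_index.simps)
    then show ?thesis using mult_pos[OF d A m] by simp
  qed
  have "{1..j} = {1..i} \<union> {i<..j}" using ij by auto
  then have "radius G \<rho> l j = radius G \<rho> l i + (\<Sum>m\<in>{i<..j}. l (Inr m) / real (mult G \<rho> m))"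
    unfolding radius_def by (simp only:) (rule sum.union_disjoint, auto)
  moreover have "(\<Sum>m\<in>{i<..j}. l (Inr m) / real (mult G \<rho> m)) > 0"
    using ij by (intro sum_pos pos) auto
  ultimately show ?thesis by simp
qed

text \<open>
  If all level lengths are positive, radii increase strictly with the level, so the number of smaller
  distances is the level.
\<close>

lemma canonical_alignment_hat:
  assumes d: "d > 0" and A: "(G, k, \<rho>) \<in> aligned_graphs n d"
    and l: "\<forall>s\<in>sigma_index (G, k, \<rho>). 0 < l s" and v: "v \<in> verts G"
  shows "canonical_alignment G (hat G \<rho> l) v = \<rho> v"
proof -
  note a = aligned_graphsD[OF d A]
  have l0: "\<forall>s\<in>sigma_index (G, k, \<rho>). 0 \<le> l s" using l by (metis less_imp_le)
  let ?r = "radius G \<rho> l"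
  note dist = dist_core_hat[OF d A l0]
  note strict = radius_strict_mono[OF d A l]
  have iff: "?r i < ?r j \<longleftrightarrow> i < j" if "i \<le> k" "j \<le> k" for i j
    using strict[of i j] strict[of j i] that by (metis less_asym linorder_neqE_nat less_irrefl)
  have D: "dist_core G (hat G \<rho> l) ` verts G = ?r ` {0..k}"
    unfolding a(2)[symmetric] image_image using dist by (intro image_cong) auto
  have vk: "\<rho> v \<le> k" using a(7)[OF v] .
  have "?r ` {0..k} \<inter> {..<?r (\<rho> v)} = ?r ` {0..<\<rho> v}"
  proof (intro set_eqI iffI)
    fix x assume "x \<in> ?r ` {0..k} \<inter> {..<?r (\<rho> v)}"
    then obtain j where j: "j \<le> k" "x = ?r j" "?r j < ?r (\<rho> v)" by auto
    then have "j < \<rho> v" using iff[OF j(1) vk] by simp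
    then show "x \<in> ?r ` {0..<\<rho> v}" using j by simp
  next
    fix x assume "x \<in> ?r ` {0..<\<rho> v}"
    then obtain j where j: "j < \<rho> v" "x = ?r j" by auto
    then show "x \<in> ?r ` {0..k} \<inter> {..<?r (\<rho> v)}" using iff[of j "\<rho> v"] vk by simp
  qed
  moreover have "inj_on ?r {0..<\<rho> v}"
  proof (rule linorder_inj_onI)
    fix x y assume "x < y" "x \<in> {0..<\<rho> v}" "y \<in> {0..<\<rho> v}"
    then show "?r x \<noteq> ?r y" using iff[of x y] vk by simp
  qed (rule linear)
  ultimately show ?thesis unfolding canonical_alignment_def D dist[OF v] by (simp add: card_image)
qed

text \<open>
  An isometry of the underlying graphs preserves distances to the core, hence the canonical
  alignments. The level lengths are then recovered as the gaps between consecutive radii times the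
  multiplicities.
\<close>

lemma comparison_injective_positive:
  assumes d: "d > 0"
    and A: "(G, k, \<rho>) \<in> aligned_graphs n d" "l \<in> topspace (sigma (G, k, \<rho>))" "\<forall>s\<in>sigma_index (G, k, \<rho>). 0 < l s"
    and A': "(G', k', \<rho>') \<in> aligned_graphs n d" "l' \<in> topspace (sigma (G', k', \<rho>'))" "\<forall>s\<in>sigma_index (G', k', \<rho>'). 0 < l' s"
    and eq: "vir_class n d (G, hat G \<rho> l) = vir_class n d (G', hat G' \<rho>' l')"
  shows "aligned_class n d ((G, k, \<rho>), l) = aligned_class n d ((G', k', \<rho>'), l')"
proof -
  note a = aligned_graphsD[OF d A(1)] and a' = aligned_graphsD[OF d A'(1)]
  have l0: "\<forall>s\<in>sigma_index (G, k, \<rho>). 0 \<le> l s" using A(3) by (metis less_imp_le)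
  have l0': "\<forall>s\<in>sigma_index (G', k', \<rho>'). 0 \<le> l' s" using A'(3) by (metis less_imp_le)
  have h: "\<forall>e\<in>edges G. 0 < hat G \<rho> l e" "\<forall>e\<in>edges G'. 0 < hat G' \<rho>' l' e"
    using hat_pos[OF d A(1,3)] hat_pos[OF d A'(1,3)] by auto
  obtain fv fe where I: "graph_iso n G fv fe G'" and len: "\<And>e. e \<in> edges G' \<Longrightarrow> hat G \<rho> l (fe e) = hat G' \<rho>' l' e"
    using positive_unique[OF a(1) hat_kappa[OF d A(1,2)] h(1) a'(1) hat_kappa[OF d A'(1,2)] h(2) eq] by metis
  have wf: "wf_wgraph n G" using stable_graphs_wf[OF a(1)] .
  have C: "contraction n G fv fe G'" using graph_iso_contraction[OF wf I] .
  have full: "fe ` edges G' = edges G" and V: "fv ` verts G = verts G'" using I by (auto simp: graph_iso_def bij_betw_def)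
  have dist: "dist_core G (hat G \<rho> l) v = dist_core G' (hat G' \<rho>' l') (fv v)" if "v \<in> verts G" for v
  proof (rule dist_core_contraction[OF a(1) C _ _ _ that])
    show "\<forall>e\<in>edges G'. 0 \<le> hat G' \<rho>' l' e" using h(2) by (metis less_imp_le)
  qed (use len full in auto)
  have D: "dist_core G (hat G \<rho> l) ` verts G = dist_core G' (hat G' \<rho>' l') ` verts G'"
    unfolding V[symmetric] image_image using dist by (intro image_cong) auto
  have lev: "\<rho>' (fv v) = \<rho> v" if v: "v \<in> verts G" for v
  proof -
    have v': "fv v \<in> verts G'" using v V by blast
    have "canonical_alignment G (hat G \<rho> l) v = canonical_alignment G' (hat G' \<rho>' l') (fv v)"
      unfolding canonical_alignment_def D dist[OF v] ..
    then show ?thesis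
      using canonical_alignment_hat[OF d A(1,3) v] canonical_alignment_hat[OF d A'(1,3) v'] by simp
  qed
  have "\<rho> ` verts G = \<rho>' ` verts G'" unfolding V[symmetric] image_image using lev by (intro image_cong) auto
  then have "{0..k} = {0..k'}" using a(2) a'(2) by simp
  then have k: "k' = k" by simp
  have m: "aligned_mor n d (G, k, \<rho>) (fv, fe, id) (G', k, \<rho>')"
    using aligned_mor.iso[OF A(1) A'(1)[unfolded k] I] lev by blast
  have AC: "aligned_contraction n (G, k, \<rho>) (fv, fe, id) (G', k, \<rho>')"
    using aligned_mor_contraction[OF d m] by blast
  have rad: "radius G \<rho> l j = radius G' \<rho>' l' j" if j: "j \<le> k" for j
  proof -
    have "j \<in> \<rho> ` verts G" using a(2) j by simp
    then obtain v where v: "v \<in> verts G" "\<rho> v = j" by blast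
    have v': "fv v \<in> verts G'" using v V by blast
    show ?thesis
      using dist[OF v(1)] dist_core_hat[OF d A(1) l0 v(1)] dist_core_hat[OF d A'(1) l0' v'] lev[OF v(1)] v(2) by simp
  qed
  have inr: "l (Inr i) = l' (Inr i)" if i: "i \<in> {1..k}" for i
  proof -
    have step: "radius H \<tau> c i = radius H \<tau> c (i - 1) + c (Inr i) / real (mult H \<tau> i)" for H \<tau> c
    proof -
      have "{1..i} = insert i {1..i - 1}" using i by auto
      moreover have "i \<notin> {1..i - 1}" using i by auto
      ultimately show ?thesis unfolding radius_def by simp
    qed
    have "l (Inr i) / real (mult G \<rho> i) = l' (Inr i) / real (mult G' \<rho>' i)"
    proof -
      have "i \<le> k" using i by simp
      moreover from this have "i - 1 \<le> k" by linarith
      ultimately show ?thesis using rad[of i] rad[of "i - 1"] step[of G \<rho> l] step[of G' \<rho>' l'] by simp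
    qed
    moreover have "mult G \<rho> i = mult G' \<rho>' i" using mult_aligned_contraction[OF AC i] by simp
    moreover have "mult G \<rho> i > 0" using mult_pos[OF d A(1) i] .
    ultimately show ?thesis by simp
  qed
  have cmem: "fe e \<in> core_edges G" "e \<in> edges G'" if "e \<in> core_edges G'" for e
  proof -
    show e: "e \<in> edges G'" using core_subset(1)[OF stable_graphs_genus[OF a'(1)]] that by blast
    show "fe e \<in> core_edges G" using core_edges_contraction[OF stable_graphs_genus[OF a(1)] C e] that by simp
  qed
  have inl: "l (Inl (fe e)) = l' (Inl e)" if e: "e \<in> core_edges G'" for e
  proof -
    have "fe e \<in> edges G" using full cmem(2)[OF e] by blast
    then show ?thesis
      using len[OF cmem(2)[OF e]] hat_core[OF cmem(1)[OF e]] hat_core[OF e cmem(2)[OF e]] by simp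
  qed
  have meq: "l (map_sum fe id s) = l' s" if s: "s \<in> sigma_index (G', k, \<rho>')" for s
    using s inl inr by (cases s) simp_all
  have mzero: "l s = 0" if s: "s \<in> sigma_index (G, k, \<rho>) - map_sum fe id ` sigma_index (G', k, \<rho>')" for s
  proof -
    have "s \<in> map_sum fe id ` sigma_index (G', k, \<rho>')"
    proof (cases s)
      case (Inl e)
      then have e: "e \<in> core_edges G" using s by simp
      then have "e \<in> edges G" using core_subset(1)[OF stable_graphs_genus[OF a(1)]] by blast
      then obtain e' where e': "e' \<in> edges G'" "e = fe e'" using full by blast
      then have "e' \<in> core_edges G'" using core_edges_contraction[OF stable_graphs_genus[OF a(1)] C e'(1)] e by simp
      then show ?thesis using Inl e' by (intro image_eqI[of _ _ "Inl e'"]) simp_all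
    next
      case (Inr i)
      then have "i \<in> {1..k}" using s by simp
      then show ?thesis using Inr by (intro image_eqI[of _ _ "Inr i"]) simp_all
    qed
    then show ?thesis using s by blast
  qed
  have ext: "l' \<in> extensional (sigma_index (G', k, \<rho>'))" using A'(2) unfolding k topspace_sigma by blast
  show ?thesis
    unfolding k by (rule aligned_class_mor(2)[OF d m A(2)]) (erule meq, erule mzero, rule ext)
qed

lemma comparison_injective:
  assumes d: "d > 0"
  shows "inj_on (comparison n d) (topspace (Delta n d))"
proof (rule inj_onI)
  fix p q assume p: "p \<in> topspace (Delta n d)" and q: "q \<in> topspace (Delta n d)"
    and eq: "comparison n d p = comparison n d q"
  have pos: "\<exists>G k \<rho> l. x = aligned_class n d ((G, k, \<rho>), l) \<and> (G, k, \<rho>) \<in> aligned_graphs n d \<and>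
      l \<in> topspace (sigma (G, k, \<rho>)) \<and> (\<forall>s\<in>sigma_index (G, k, \<rho>). 0 < l s)"
    if xT: "x \<in> topspace (Delta n d)" for x
  proof -
    obtain G k \<rho> l where x: "x = aligned_class n d ((G, k, \<rho>), l)" "(G, k, \<rho>) \<in> aligned_graphs n d"
      "l \<in> topspace (sigma (G, k, \<rho>))" using topspace_Delta_obtain[OF d xT] by metis
    show ?thesis using aligned_positive_exists[OF d x(2,3)] unfolding x(1) by metis
  qed
  obtain G k \<rho> l where P: "p = aligned_class n d ((G, k, \<rho>), l)" "(G, k, \<rho>) \<in> aligned_graphs n d"
      "l \<in> topspace (sigma (G, k, \<rho>))" "\<forall>s\<in>sigma_index (G, k, \<rho>). 0 < l s" using pos[OF p] by metis
  obtain G' k' \<rho>' l' where Q: "q = aligned_class n d ((G', k', \<rho>'), l')" "(G', k', \<rho>') \<in> aligned_graphs n d"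
      "l' \<in> topspace (sigma (G', k', \<rho>'))" "\<forall>s\<in>sigma_index (G', k', \<rho>'). 0 < l' s" using pos[OF q] by metis
  have "vir_class n d (G, hat G \<rho> l) = vir_class n d (G', hat G' \<rho>' l')"
    using eq comparison_class[OF d P(2,3)] comparison_class[OF d Q(2,3)] P(1) Q(1) by simp
  then show "p = q" unfolding P(1) Q(1) by (rule comparison_injective_positive[OF d P(2-4) Q(2-4)])
qed

text \<open>
  A level gets as its length the gap between consecutive distances, times the number of edges crossing
  it. Then the radius of each level is the distance of its vertices, and an edge has as its length the
  difference of the radii at its ends.
\<close>

lemma canonical_lift:
  assumes d: "d > 0" and G: "G \<in> stable_graphs n d" and l: "l \<in> topspace (kappa G)"
    and pos: "\<forall>e\<in>edges G. 0 < l e" and tied: "tied G (dist_core G l)"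
  shows "\<exists>k \<rho> c. k \<le> card (verts G) \<and> \<rho> \<in> extensional (verts G) \<and> (G, k, \<rho>) \<in> aligned_graphs n d \<and>
    c \<in> topspace (sigma (G, k, \<rho>)) \<and> hat G \<rho> c = l"
proof -
  have g: "genus_one_graph n d G" using stable_graphs_genus[OF G] .
  have wf: "wf_wgraph n G" using stable_graphs_wf[OF G] .
  have fin: "finite (verts G)" "finite (edges G)" using wf_finite[OF wf] by auto
  have l0: "\<forall>e\<in>edges G. 0 \<le> l e" using pos by (metis less_imp_le)
  let ?d = "dist_core G l"
  let ?D = "?d ` verts G"
  define \<rho> where "\<rho> = restrict (canonical_alignment G l) (verts G)"
  define k where "k = card ?D - 1"
  have \<rho>: "\<rho> v = card (?D \<inter> {..<?d v})" if "v \<in> verts G" for v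
    using that by (simp add: \<rho>_def canonical_alignment_def)
  have V0: "verts G \<noteq> {}" using g by (simp add: genus_one_graph_def connected_wgraph_def)
  then have cD: "card ?D > 0" using fin by (simp add: card_gt_0_iff)
  have im: "\<rho> ` verts G = {0..k}"
  proof -
    have "\<rho> ` verts G = (\<lambda>x. card (?D \<inter> {..<x})) ` ?D" unfolding image_image using \<rho> by (intro image_cong) auto
    also have "\<dots> = {..<card ?D}" using fin by (intro card_less_image) simp
    also have "\<dots> = {0..k}" using cD by (auto simp: k_def)
    finally show ?thesis .
  qed
  have le: "\<rho> u \<le> \<rho> v \<longleftrightarrow> ?d u \<le> ?d v" if "u \<in> verts G" "v \<in> verts G" for u v
    using canonical_alignment_le[OF fin(1) that, of l] that by (simp add: \<rho>_def)
  have less: "\<rho> u < \<rho> v \<longleftrightarrow> ?d u < ?d v" if "u \<in> verts G" "v \<in> verts G" for u v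
    using canonical_alignment_less[OF fin(1) that, of l] that by (simp add: \<rho>_def)
  have same: "?d u = ?d v" if "u \<in> verts G" "v \<in> verts G" "\<rho> u = \<rho> v" for u v
    using le[OF that(1,2)] le[OF that(2,1)] that(3) by simp
  have nn: "0 \<le> ?d v" if "v \<in> verts G" for v
    using dist_core_ge[OF g that, of 0 l] walk_length_nonneg[OF l0] by blast
  have d0: "?d v = 0" if "v \<in> core_verts G" for v using dist_core_core[OF g l0 that] .
  have dpos: "0 < ?d v" if v: "v \<in> verts G" "v \<notin> core_verts G" for v
  proof -
    obtain e u where e: "directed G e u v" using noncore_parent[OF g v] by blast
    have "u \<in> verts G" using directed_verts[OF wf e] by simp
    then show ?thesis using dist_core_directed[OF g l0 e] nn[of u] pos directedD(1)[OF e] by fastforce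
  qed
  obtain u0 where u0: "u0 \<in> core_verts G" using core_verts_nonempty[OF g] by blast
  have u0V: "u0 \<in> verts G" using u0 core_subset(2)[OF g] by blast
  have rho_u0: "\<rho> u0 = 0"
  proof -
    have "?D \<inter> {..<?d u0} = {}" using nn d0[OF u0] by force
    then show ?thesis using \<rho>[OF u0V] by simp
  qed
  have zero: "{v\<in>verts G. \<rho> v = 0} = core_verts G"
  proof (intro set_eqI iffI)
    fix v assume v: "v \<in> {v\<in>verts G. \<rho> v = 0}"
    then have "?d v = 0" using same[OF _ u0V] rho_u0 d0[OF u0] by simp
    then show "v \<in> core_verts G" using dpos[of v] v by force
  next
    fix v assume v: "v \<in> core_verts G"
    then have vV: "v \<in> verts G" using core_subset(2)[OF g] by blast
    have "\<rho> v \<le> \<rho> u0" using le[OF vV u0V] d0[OF v] d0[OF u0] by simp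
    then show "v \<in> {v\<in>verts G. \<rho> v = 0}" using vV rho_u0 by simp
  qed
  have strict: "\<rho> v < \<rho> w" if e: "directed G e v w" for e v w
  proof -
    have "v \<in> verts G" "w \<in> verts G" using directed_verts[OF wf e] by auto
    moreover have "0 < l e" using pos directedD(1)[OF e] by blast
    ultimately show ?thesis using less dist_core_directed[OF g l0 e] by simp
  qed
  have "tied G \<rho>" by (rule tied_mono[OF fin(1) tied]) (simp add: le)
  then have A: "(G, k, \<rho>) \<in> aligned_graphs n d"
    unfolding aligned_graphs_iff[OF d] using G im zero strict by blast
  \<comment> \<open>the distance of the vertices of level \<open>j\<close>\<close>
  define r where "r j = ?d (SOME v. v \<in> verts G \<and> \<rho> v = j)" for j
  have r: "r (\<rho> v) = ?d v" if v: "v \<in> verts G" for v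
  proof -
    have "(SOME u. u \<in> verts G \<and> \<rho> u = \<rho> v) \<in> verts G \<and> \<rho> (SOME u. u \<in> verts G \<and> \<rho> u = \<rho> v) = \<rho> v"
      using v by (intro someI[of "\<lambda>u. u \<in> verts G \<and> \<rho> u = \<rho> v" v]) simp
    then show ?thesis unfolding r_def using same v by metis
  qed
  have r_step: "r (i - 1) \<le> r i" if i: "i \<in> {1..k}" for i
  proof -
    have "i \<in> \<rho> ` verts G" "i - 1 \<in> \<rho> ` verts G" unfolding im using i by auto
    then obtain u v where uv: "u \<in> verts G" "\<rho> u = i - 1" "v \<in> verts G" "\<rho> v = i" by (metis imageE)
    then have "?d u \<le> ?d v" using le[OF uv(1,3)] by simp
    then show ?thesis using r[OF uv(1)] r[OF uv(3)] uv by simp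
  qed
  define c where "c = (\<lambda>s\<in>sigma_index (G, k, \<rho>). case s of Inl e \<Rightarrow> l e | Inr i \<Rightarrow> real (mult G \<rho> i) * (r i - r (i - 1)))"
  have cl: "c (Inl e) = l e" if "e \<in> core_edges G" for e using that by (simp add: c_def)
  have cr: "c (Inr i) = real (mult G \<rho> i) * (r i - r (i - 1))" if "i \<in> {1..k}" for i using that by (simp add: c_def)
  have rad: "radius G \<rho> c j = r j - r 0" if "j \<le> k" for j
    using that
  proof (induction j)
    case (Suc j)
    have "Suc j \<in> {1..k}" using Suc.prems by simp
    then have "c (Inr (Suc j)) / real (mult G \<rho> (Suc j)) = r (Suc j) - r j"
      using cr[of "Suc j"] mult_pos[OF d A, of "Suc j"] by simp
    then show ?case using Suc by (simp add: radius_def)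
  qed (simp add: radius_def)
  have hat: "hat G \<rho> c = l"
  proof (rule extensionalityI[of _ "edges G"])
    show "hat G \<rho> c \<in> extensional (edges G)" by (simp add: hat_def)
    show "l \<in> extensional (edges G)" using l by (simp add: topspace_kappa)
    fix e assume e: "e \<in> edges G"
    show "hat G \<rho> c e = l e"
    proof (cases "e \<in> core_edges G")
      case True
      then show ?thesis using hat_core[OF True e] cl by simp
    next
      case False
      obtain x y where "ends G e = {x, y}" using wf_ends[OF wf e] by blast
      then obtain v w where vw: "directed G e v w" using noncore_directed[OF g] e False by blast
      have V: "v \<in> verts G" "w \<in> verts G" using directed_verts[OF wf vw] by auto
      have "\<rho> v \<le> k" "\<rho> w \<le> k" using im V by (metis atLeastAtMost_iff imageI)+
      then show ?thesis
        using hat_directed[OF vw less_imp_le[OF strict[OF vw]], of c] rad r[OF V(1)] r[OF V(2)]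
          dist_core_directed[OF g l0 vw] by simp
    qed
  qed
  have "0 \<le> c s" if s: "s \<in> sigma_index (G, k, \<rho>)" for s
  proof (cases s)
    case (Inl e)
    then have e: "e \<in> core_edges G" using s by simp
    then have "e \<in> edges G" using core_subset(1)[OF g] by blast
    then show ?thesis using cl[OF e] Inl l0 by simp
  next
    case (Inr i)
    then have "i \<in> {1..k}" using s by simp
    then show ?thesis using cr r_step Inr by simp
  qed
  moreover have "(\<Sum>s\<in>sigma_index (G, k, \<rho>). c s) = 1"
    using sum_hat[OF d A, of c] hat l by (simp add: topspace_kappa)
  moreover have "c \<in> extensional (sigma_index (G, k, \<rho>))" unfolding c_def by (rule restrict_extensional)
  ultimately have c: "c \<in> topspace (sigma (G, k, \<rho>))" unfolding topspace_sigma by blast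
  have "k \<le> card (verts G)" using card_image_le[OF fin(1), of ?d] by (simp add: k_def)
  moreover have "\<rho> \<in> extensional (verts G)" by (simp add: \<rho>_def)
  ultimately show ?thesis using A c hat by blast
qed

lemma comparison_image:
  assumes d: "d > 0"
  shows "comparison n d ` topspace (Delta n d) = Z_locus n d"
proof (intro set_eqI iffI)
  fix p assume "p \<in> comparison n d ` topspace (Delta n d)"
  then obtain q where q: "q \<in> topspace (Delta n d)" "p = comparison n d q" by blast
  obtain G k \<rho> l where Q: "q = aligned_class n d ((G, k, \<rho>), l)" "(G, k, \<rho>) \<in> aligned_graphs n d"
      "l \<in> topspace (sigma (G, k, \<rho>))" using topspace_Delta_obtain[OF d q(1)] by metis
  show "p \<in> Z_locus n d" unfolding q(2) Q(1) comparison_class[OF d Q(2,3)] by (rule hat_in_Z_locus[OF d Q(2,3)])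
next
  fix p assume p: "p \<in> Z_locus n d"
  then obtain G l where G: "p = vir_class n d (G, l)" "G \<in> stable_graphs n d" "l \<in> topspace (kappa G)"
      "\<forall>e\<in>edges G. l e > 0" unfolding Z_locus_def by blast
  have "tied G (dist_core G l)" using vir_class_in_Z_locus[OF G(2,3) d] p G(1) by simp
  then obtain k \<rho> c where c: "(G, k, \<rho>) \<in> aligned_graphs n d" "c \<in> topspace (sigma (G, k, \<rho>))" "hat G \<rho> c = l"
    using canonical_lift[OF d G(2,3,4)] by blast
  have "comparison n d (aligned_class n d ((G, k, \<rho>), c)) = p"
    using comparison_class[OF d c(1,2)] c(3) G(1) by simp
  then show "p \<in> comparison n d ` topspace (Delta n d)" using aligned_class_in_topspace[OF d c(1,2)] by blast
qed

lemma continuous_comparison: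
  assumes d: "d > 0"
  shows "continuous_map (Delta n d) (Delta_vir n d) (comparison n d)"
proof -
  have "continuous_map (colimit (aligned_graphs n d) sigma (aligned_mor n d) sigma_incl) (Delta_vir n d)
      (descend (comparison_rep n d))"
  proof (rule space_diagram.continuous_map_colimit[OF space_diagram_aligned[OF d]])
    fix A assume A: "A \<in> aligned_graphs n d"
    obtain G k \<rho> where a: "A = (G, k, \<rho>)" by (cases A) auto
    have A1: "(G, k, \<rho>) \<in> aligned_graphs n d" using A a by simp
    have "continuous_map (kappa G) (Delta_vir n d) (\<lambda>l. vir_class n d (G, l))"
      unfolding Delta_vir_def vir_class_def by (rule vir.continuous_map_cls[OF aligned_graphsD(1)[OF d A1]])
    from continuous_map_compose[OF continuous_map_hat[OF d A1] this]
    show "continuous_map (sigma A) (Delta_vir n d) (\<lambda>l. comparison_rep n d (A, l))"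
      unfolding a by (simp add: comp_def comparison_rep_def)
  qed (rule comparison_rep_invariant[OF d])
  moreover have "comparison n d = descend (comparison_rep n d)" by (simp add: comparison_def comparison_rep_def)
  ultimately show ?thesis by (simp add: Delta_def)
qed

text \<open>
  The preimage in a cell of the image of a closed set is a finite union of compact sets: over
  each face of the cell, the canonical lift shows which alignments contribute.
\<close>

lemma closed_comparison:
  assumes d: "d > 0"
  shows "closed_map (Delta n d) (Delta_vir n d) (comparison n d)"
  unfolding closed_map_def
proof (intro allI impI)
  fix C assume C: "closedin (Delta n d) C"
  have Csub: "C \<subseteq> topspace (Delta n d)" using closedin_subset[OF C] .
  let ?K = "comparison n d ` C"
  have KZ: "?K \<subseteq> Z_locus n d" using comparison_image[OF d, of n] Csub by blast
  have Ksub: "?K \<subseteq> topspace (Delta_vir n d)"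
    using continuous_map_image_subset_topspace[OF continuous_comparison[OF d]] Csub by blast
  show "closedin (Delta_vir n d) ?K"
    unfolding Delta_vir_def
  proof (rule vir.closedin_colimit)
    show "?K \<subseteq> topspace (colimit (stable_graphs n d) kappa (graph_mor n d) kappa_incl)"
      using Ksub unfolding Delta_vir_def .
    fix G assume G: "G \<in> stable_graphs n d"
    have fin: "finite (edges G)" using stable_graphs_finite[OF G] by blast
    have "\<forall>F\<in>Pow (edges G). \<exists>N fv. graph_mor n d G (fv, id) N \<and> edges N = edges G - F"
      using contract_edges_exists[OF G] by blast
    then obtain N where N: "\<And>F. F \<subseteq> edges G \<Longrightarrow> \<exists>fv. graph_mor n d G (fv, id) (N F) \<and> edges (N F) = edges G - F"
      by (metis PowI)
    have NE: "edges (N F) = edges G - F" and Nst: "N F \<in> stable_graphs n d" if "F \<subseteq> edges G" for F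
      using N[OF that] graph_mor_contraction by blast+
    define I where "I = {(F, k, \<rho>). F \<subseteq> edges G \<and> k \<le> card (verts (N F)) \<and>
      \<rho> \<in> extensional (verts (N F)) \<and> (N F, k, \<rho>) \<in> aligned_graphs n d}"
    define T where "T = (\<lambda>(F, k, \<rho>). {c \<in> topspace (sigma (N F, k, \<rho>)). aligned_class n d ((N F, k, \<rho>), c) \<in> C})"
    define \<phi> where "\<phi> = (\<lambda>(F, k :: nat, \<rho>) c. extend_zero id (edges (N F)) (edges G) (hat (N F) \<rho> c))"
    have finI: "finite I"
    proof -
      let ?J = "SIGMA F:Pow (edges G). {0..card (verts (N F))} \<times> (verts (N F) \<rightarrow>\<^sub>E {0..card (verts (N F))})"
      have "finite ?J"
      proof (rule finite_SigmaI)
        fix F assume "F \<in> Pow (edges G)"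
        then have "finite (verts (N F))" using stable_graphs_finite[OF Nst] by blast
        then show "finite ({0..card (verts (N F))} \<times> (verts (N F) \<rightarrow>\<^sub>E {0..card (verts (N F))}))"
          by (intro finite_cartesian_product finite_PiE) simp_all
      qed (use fin in simp)
      moreover have "I \<subseteq> ?J"
      proof
        fix x assume x: "x \<in> I"
        obtain F k \<rho> where xx: "x = (F, k, \<rho>)" by (cases x) auto
        have h: "F \<subseteq> edges G" "k \<le> card (verts (N F))" "\<rho> \<in> extensional (verts (N F))" "(N F, k, \<rho>) \<in> aligned_graphs n d"
          using x by (auto simp: I_def xx)
        have "\<rho> v \<in> {0..card (verts (N F))}" if "v \<in> verts (N F)" for v
          using aligned_graphsD(7)[OF d h(4) that] h(2) by simp
        then have "\<rho> \<in> verts (N F) \<rightarrow>\<^sub>E {0..card (verts (N F))}" using h(3) by (intro PiE_I) (auto simp: extensional_def)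
        then show "x \<in> ?J" using h xx by auto
      qed
      ultimately show ?thesis using finite_subset by blast
    qed
    have \<phi>cont: "continuous_map (sigma (N F, k, \<rho>)) (kappa G) (\<phi> (F, k, \<rho>))" if i: "(F, k, \<rho>) \<in> I" for F k \<rho>
    proof -
      have h: "F \<subseteq> edges G" "(N F, k, \<rho>) \<in> aligned_graphs n d" using i by (auto simp: I_def)
      have "continuous_map (kappa (N F)) (kappa G) (extend_zero id (edges (N F)) (edges G))"
        unfolding kappa_def using NE[OF h(1)] fin by (intro continuous_map_extend_zero) auto
      from continuous_map_compose[OF continuous_map_hat[OF d h(2)] this] show ?thesis by (simp add: \<phi>_def comp_def)
    qed
    have closed: "closedin (kappa G) (\<phi> i ` T i)" if i: "i \<in> I" for i
    proof -
      obtain F k \<rho> where ii: "i = (F, k, \<rho>)" by (cases i) auto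
      have h: "F \<subseteq> edges G" "(N F, k, \<rho>) \<in> aligned_graphs n d" using i by (auto simp: I_def ii)
      have "continuous_map (sigma (N F, k, \<rho>)) (Delta n d) (\<lambda>c. aligned_class n d ((N F, k, \<rho>), c))"
        unfolding Delta_def by (rule space_diagram.continuous_map_cls[OF space_diagram_aligned[OF d] h(2)])
      then have "closedin (sigma (N F, k, \<rho>)) (T i)"
        unfolding T_def ii case_prod_conv using closedin_continuous_map_preimage C by blast
      moreover have "compact_space (sigma (N F, k, \<rho>))"
        unfolding sigma_def by (rule compact_length_simplex[OF finite_sigma_index(2)[OF Nst[OF h(1)]]])
      ultimately have "compactin (sigma (N F, k, \<rho>)) (T i)" using closedin_compact_space by blast
      then have "compactin (kappa G) (\<phi> i ` T i)" using image_compactin \<phi>cont i ii by blast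
      then show ?thesis
        using compactin_imp_closedin Hausdorff_length_simplex unfolding kappa_def by blast
    qed
    have "{l \<in> topspace (kappa G). vir.cls n d (G, l) \<in> ?K} = (\<Union>i\<in>I. \<phi> i ` T i)"
    proof (intro set_eqI iffI)
      fix l assume "l \<in> {l \<in> topspace (kappa G). vir.cls n d (G, l) \<in> ?K}"
      then have l: "l \<in> topspace (kappa G)" "vir_class n d (G, l) \<in> ?K" by (auto simp: vir_class_def)
      then obtain q where q: "q \<in> C" "vir_class n d (G, l) = comparison n d q" by blast
      define F where "F = {e\<in>edges G. \<not> l e > 0}"
      have F: "F \<subseteq> edges G" by (auto simp: F_def)
      obtain fv where fv: "graph_mor n d G (fv, id) (N F)" using N[OF F] by blast
      have EN: "edges (N F) = {e\<in>edges G. l e > 0}" using NE[OF F] by (auto simp: F_def)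
      note P = positive_exists[OF G l(1) fv EN]
      let ?l = "restrict l (edges (N F))"
      have "vir_class n d (N F, ?l) \<in> Z_locus n d" using l(2) KZ P(5) by auto
      then have "tied (N F) (dist_core (N F) ?l)" using vir_class_in_Z_locus[OF P(1,3) d] by simp
      then obtain k \<rho> c where c: "k \<le> card (verts (N F))" "\<rho> \<in> extensional (verts (N F))"
          "(N F, k, \<rho>) \<in> aligned_graphs n d" "c \<in> topspace (sigma (N F, k, \<rho>))" "hat (N F) \<rho> c = ?l"
        using canonical_lift[OF d P(1,3,4)] by blast
      have "comparison n d (aligned_class n d ((N F, k, \<rho>), c)) = comparison n d q"
        using comparison_class[OF d c(3,4)] c(5) P(5) q(2) by simp
      then have "aligned_class n d ((N F, k, \<rho>), c) = q"
        using comparison_injective[OF d] aligned_class_in_topspace[OF d c(3,4)] q(1) Csub by (auto dest: inj_onD)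
      then have "c \<in> T (F, k, \<rho>)" using c(4) q(1) by (simp add: T_def)
      moreover have "(F, k, \<rho>) \<in> I" using F c(1-3) by (simp add: I_def)
      moreover have "l = \<phi> (F, k, \<rho>) c"
        unfolding \<phi>_def case_prod_conv c(5)
      proof (rule extend_zero_eqI)
        show "l \<in> extensional (edges G)" using l(1) by (simp add: topspace_kappa)
        show "l s = 0" if "s \<in> edges G" "s \<notin> id ` edges (N F)" for s
          using l(1) that EN by (auto simp: topspace_kappa not_less intro: antisym)
      qed (use EN in auto)
      ultimately show "l \<in> (\<Union>i\<in>I. \<phi> i ` T i)" by blast
    next
      fix l assume "l \<in> (\<Union>i\<in>I. \<phi> i ` T i)"
      then obtain i c where ic: "i \<in> I" "c \<in> T i" "l = \<phi> i c" by blast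
      obtain F k \<rho> where ii: "i = (F, k, \<rho>)" by (cases i) auto
      have h: "F \<subseteq> edges G" "(N F, k, \<rho>) \<in> aligned_graphs n d" using ic(1) by (auto simp: I_def ii)
      have c: "c \<in> topspace (sigma (N F, k, \<rho>))" "aligned_class n d ((N F, k, \<rho>), c) \<in> C"
        using ic(2) by (auto simp: T_def ii)
      obtain fv where fv: "graph_mor n d G (fv, id) (N F)" using N[OF h(1)] by blast
      have l: "l = kappa_incl G (fv, id) (N F) (hat (N F) \<rho> c)"
        using ic(3) by (simp add: ii \<phi>_def kappa_incl_def)
      have "vir_class n d (G, l) = vir_class n d (N F, hat (N F) \<rho> c)"
        unfolding l vir_class_def using vir.cls_act[OF fv hat_kappa[OF d h(2) c(1)]] by simp
      also have "\<dots> = comparison n d (aligned_class n d ((N F, k, \<rho>), c))" using comparison_class[OF d h(2) c(1)] by simp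
      finally have "vir_class n d (G, l) \<in> ?K" using c(2) by blast
      moreover have "l \<in> topspace (kappa G)" unfolding l by (rule vir.act_in[OF fv hat_kappa[OF d h(2) c(1)]])
      ultimately show "l \<in> {l \<in> topspace (kappa G). vir.cls n d (G, l) \<in> ?K}" by (simp add: vir_class_def)
    qed
    moreover have "closedin (kappa G) (\<Union>i\<in>I. \<phi> i ` T i)"
    proof (rule closedin_Union)
      fix X assume "X \<in> (\<lambda>i. \<phi> i ` T i) ` I"
      then obtain i where "i \<in> I" "X = \<phi> i ` T i" by (rule imageE)
      then show "closedin (kappa G) X" using closed[of i] by simp
    qed (use finI in simp)
    ultimately show "closedin (kappa G) {l \<in> topspace (kappa G). vir.cls n d (G, l) \<in> ?K}" by (simp only:)
  qed
qed

theorem proposition5p10: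
  fixes n d :: nat
  assumes "d > 1"
  shows "homeomorphic_map (Delta n d) (subtopology (Delta_vir n d) (Z_locus n d)) (comparison n d)
    \<and> Z_locus n d \<subseteq> topspace (Delta_vir n d)
    \<and> deformation_retraction_to_point (Delta_vir n d) (retraction_H n d) (H_end n d)
    \<and> (\<lambda>(p, t). retraction_H n d p t) ` (Z_locus n d \<times> {0..1}) \<subseteq> Z_locus n d
    \<and> topspace (Delta n d) \<noteq> {} \<and> contractible_space (Delta n d)"
proof -
  have d: "d > 0" using assms by simp
  let ?Z = "subtopology (Delta_vir n d) (Z_locus n d)" and ?I = "top_of_set {0..1 :: real}"
  have "embedding_map (Delta n d) (Delta_vir n d) (comparison n d)"
    by (rule injective_closed_imp_embedding_map[OF continuous_comparison[OF d] closed_comparison[OF d] comparison_injective[OF d]])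
  then have hom: "homeomorphic_map (Delta n d) ?Z (comparison n d)"
    unfolding embedding_map_def comparison_image[OF d] .
  have Zsub: "Z_locus n d \<subseteq> topspace (Delta_vir n d)"
    unfolding comparison_image[OF d, symmetric]
    by (rule continuous_map_image_subset_topspace[OF continuous_comparison[OF d]])
  note H = deformation_retraction_Delta_vir[OF d, of n]
  note HZ = retraction_H_preserves_Z[OF d, of n]
  have ne: "topspace (Delta n d) \<noteq> {}" using comparison_image[OF d, of n] H_end_in_Z_locus[OF assms, of n] by blast
  have "homotopic_with (\<lambda>_. True) ?Z ?Z id (\<lambda>_. H_end n d)"
  proof (subst homotopic_with, simp, intro exI[of _ "\<lambda>(t, p). retraction_H n d p t"] conjI ballI)
    have "continuous_map (prod_topology ?I ?Z) (prod_topology (Delta_vir n d) ?I) (\<lambda>(t, p). (p, t))"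
    proof -
      have "continuous_map (prod_topology ?I ?Z) (Delta_vir n d) snd"
        using continuous_map_snd[of ?I ?Z] continuous_map_into_fulltopology by blast
      then show ?thesis by (simp add: continuous_map_pairwise comp_def case_prod_unfold continuous_map_fst)
    qed
    moreover have "continuous_map (prod_topology (Delta_vir n d) ?I) (Delta_vir n d) (\<lambda>(p, t). retraction_H n d p t)"
      using H by (simp add: deformation_retraction_to_point_def)
    ultimately have "continuous_map (prod_topology ?I ?Z) (Delta_vir n d)
        ((\<lambda>(p, t). retraction_H n d p t) \<circ> (\<lambda>(t, p). (p, t)))"
      by (rule continuous_map_compose)
    then have "continuous_map (prod_topology ?I ?Z) (Delta_vir n d) (\<lambda>(t, p). retraction_H n d p t)"
      by (simp add: comp_def case_prod_unfold)
    then show "continuous_map (prod_topology ?I ?Z) ?Z (\<lambda>(t, p). retraction_H n d p t)"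
      unfolding continuous_map_in_subtopology using HZ by auto
  next
    fix p assume "p \<in> topspace ?Z"
    then have "p \<in> topspace (Delta_vir n d)" by simp
    then show "(case (0, p) of (t, p) \<Rightarrow> retraction_H n d p t) = id p"
      and "(case (1, p) of (t, p) \<Rightarrow> retraction_H n d p t) = H_end n d"
      using H by (auto simp: deformation_retraction_to_point_def)
  qed auto
  then have "contractible_space ?Z" unfolding contractible_space_def by blast
  then have "contractible_space (Delta n d)"
    using homeomorphic_space_contractibility homeomorphic_map_imp_homeomorphic_space[OF hom] by blast
  then show ?thesis using hom Zsub H HZ ne by blast
qed

end
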